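(* For every $\alpha\in(0,2)$ there exists a constant $C>0$ depending only on $\alpha$ such that the following holds. If a Beltrami coefficient $\mu\in M(\mathbb D^* )$ satisfies $$\|\mu\|_{(\alpha)}:=\operatorname*{ess\,sup}_{|z|>1}\ \max\{(|z|-1)^{-\alpha},1\}\,|\mu(z)|<\infty,$$ then for the quasiconformal self-homeomorphism $F_\mu$ of $\widehat{\mathbb C}$ with complex dilatation $\mu$ on $\mathbb D^*$ and $0$ on $\mathbb D$, the Schwarzian derivative of $F_\mu|_{\mathbb D}$ satisfies $$(1-|\zeta|)^{2-\alpha}\,|S_{F_\mu|_{\mathbb D}}(\zeta)|\le C\,\|\mu\|_{(\alpha)}$$ for every $\zeta\in\mathbb D$.
   Context: $\mathbb D$ is the unit disk, $\mathbb D^*=\{z\mid|z|>1\}\cup\{\infty\}$, $\widehat{\mathbb C}$ the Riemann sphere, and $M(\mathbb D^* )=\{\mu\in L_\infty(\mathbb D^* )\mid\|\mu\|_\infty<1\}$. The map $F_\mu$ is normalized by $F_\mu(0)=0$, $F_\mu'(0)=1$, $F_\mu(\infty)=\infty$. The Schwarzian derivative of a locally univalent holomorphic $F$ is $S_F=(N_F)'-\tfrac12(N_F)^2$, where $N_F=(\log F')'=F''/F'$. *)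

theory Defs
  imports "HOL-Complex_Analysis.Complex_Analysis" "HOL-Probability.Essential_Supremum"
begin

text \<open>The Riemann sphere: \<^term>\<open>Some z\<close> is the finite point \<^term>\<open>z\<close>, \<^term>\<open>None\<close> is infinity.\<close>

definition riemann_sphere :: "complex option topology"
  where "riemann_sphere = Alexandroff_compactification euclidean"

definition finite_part :: "(complex option \<Rightarrow> complex option) \<Rightarrow> complex \<Rightarrow> complex"
  where "finite_part F z = the (F (Some z))"

definition finite_domain :: "(complex option \<Rightarrow> complex option) \<Rightarrow> complex set"
  where "finite_domain F = {z. F (Some z) \<noteq> None}"

text \<open>The point at infinity of the exterior disk is null and is left out, as only
  almost-everywhere classes matter.\<close>

definition exterior_disk :: "complex set"
  where "exterior_disk = {z. 1 < norm z}"

definition beltrami_on :: "complex set \<Rightarrow> (complex \<Rightarrow> complex) set"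
  where "beltrami_on S = {\<mu>. \<mu> \<in> borel_measurable (lebesgue_on S) \<and>
           esssup (lebesgue_on S) (\<lambda>z. ereal (norm (\<mu> z))) < 1}"

definition weighted_norm :: "real \<Rightarrow> (complex \<Rightarrow> complex) \<Rightarrow> ereal"
  where "weighted_norm \<alpha> \<mu> = esssup (lebesgue_on exterior_disk)
           (\<lambda>z. ereal (max ((norm z - 1) powr (- \<alpha>)) 1 * norm (\<mu> z)))"

definition extend_by_zero :: "(complex \<Rightarrow> complex) \<Rightarrow> complex \<Rightarrow> complex"
  where "extend_by_zero \<mu> z = (if z \<in> exterior_disk then \<mu> z else 0)"

text \<open>Weak derivatives are tested against continuously differentiable functions with compact
  support; by mollification this is the same as testing against smooth ones.\<close>

definition test_functions :: "complex set \<Rightarrow> (complex \<Rightarrow> real) set"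
  where "test_functions U = {\<phi>. (\<forall>z. \<phi> differentiable (at z)) \<and>
           (\<forall>v. continuous_on UNIV (\<lambda>z. frechet_derivative \<phi> (at z) v)) \<and>
           compact (closure {z. \<phi> z \<noteq> 0}) \<and> closure {z. \<phi> z \<noteq> 0} \<subseteq> U}"

text \<open>\<^term>\<open>g\<close> is the weak derivative of \<^term>\<open>f\<close> on \<^term>\<open>U\<close> in the direction \<^term>\<open>v\<close>;
  \<^term>\<open>v = 1\<close> and \<^term>\<open>v = \<i>\<close> are the directions of the real coordinates.\<close>

definition weak_derivative ::
  "complex set \<Rightarrow> complex \<Rightarrow> (complex \<Rightarrow> complex) \<Rightarrow> (complex \<Rightarrow> complex) \<Rightarrow> bool"
  where "weak_derivative U v f g \<longleftrightarrow> (\<forall>\<phi>\<in>test_functions U.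
           (LINT z|lebesgue_on U. frechet_derivative \<phi> (at z) v *\<^sub>R f z) =
           - (LINT z|lebesgue_on U. \<phi> z *\<^sub>R g z))"

definition locally_square_integrable :: "complex set \<Rightarrow> (complex \<Rightarrow> complex) \<Rightarrow> bool"
  where "locally_square_integrable U g \<longleftrightarrow> g \<in> borel_measurable (lebesgue_on U) \<and>
           (\<forall>K. compact K \<and> K \<subseteq> U \<longrightarrow> integrable (lebesgue_on K) (\<lambda>z. (norm (g z))\<^sup>2))"

text \<open>Analytic definition of quasiconformality: a homeomorphism of the sphere that lies in the
  local Sobolev space of exponent two and satisfies the Beltrami equation with coefficient
  \<^term>\<open>\<nu>\<close>. Here \<^term>\<open>p\<close> and \<^term>\<open>q\<close> are the partial derivatives of the finite part, so that
  \<^term>\<open>(p - \<i> * q) / 2\<close> and \<^term>\<open>(p + \<i> * q) / 2\<close> are its derivatives with respect to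
  \<^term>\<open>z\<close> and the conjugate of \<^term>\<open>z\<close>. As usual, infinity and the preimage of infinity are
  exempt from the regularity condition (isolated points are removable for quasiconformal
  homeomorphisms). Preservation of orientation follows from the Beltrami equation, the essential
  supremum of \<^term>\<open>\<nu>\<close> being less than one.\<close>

definition quasiconformal_with_dilatation ::
  "(complex \<Rightarrow> complex) \<Rightarrow> (complex option \<Rightarrow> complex option) \<Rightarrow> bool"
  where "quasiconformal_with_dilatation \<nu> F \<longleftrightarrow>
           \<nu> \<in> beltrami_on UNIV \<and>
           homeomorphic_map riemann_sphere riemann_sphere F \<and>
           (\<exists>p q. locally_square_integrable (finite_domain F) p \<and>
                  locally_square_integrable (finite_domain F) q \<and>
                  weak_derivative (finite_domain F) 1 (finite_part F) p \<and>
                  weak_derivative (finite_domain F) \<i> (finite_part F) q \<and>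
                  (AE z in lebesgue_on (finite_domain F).
                     (p z + \<i> * q z) / 2 = \<nu> z * ((p z - \<i> * q z) / 2)))"

text \<open>The normalized solution is unique, so a statement about \<^term>\<open>F\<^sub>\<mu>\<close> is
  a statement about every \<^term>\<open>F\<close> with this property.\<close>

definition normalized_qc_extension ::
  "(complex \<Rightarrow> complex) \<Rightarrow> (complex option \<Rightarrow> complex option) \<Rightarrow> bool"
  where "normalized_qc_extension \<mu> F \<longleftrightarrow>
           quasiconformal_with_dilatation (extend_by_zero \<mu>) F \<and>
           F (Some 0) = Some 0 \<and> F None = None \<and>
           (finite_part F has_field_derivative 1) (at 0)"

definition pre_schwarzian :: "(complex \<Rightarrow> complex) \<Rightarrow> complex \<Rightarrow> complex"
  where "pre_schwarzian f z = deriv (deriv f) z / deriv f z"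

definition schwarzian :: "(complex \<Rightarrow> complex) \<Rightarrow> complex \<Rightarrow> complex"
  where "schwarzian f z = deriv (pre_schwarzian f) z - (pre_schwarzian f z)\<^sup>2 / 2"

end

theory Submission
  imports Defs
begin

text \<open>
  Let \<open>f\<close> be the finite part of the quasiconformal map, fix \<open>\<zeta>\<close> in the unit disk, put
  \<open>d = 1 - |\<zeta>|\<close> and \<open>M\<close> for the weighted norm of the Beltrami coefficient. The rescaled map
  \<open>F u = (f (\<zeta> + d u) - f \<zeta>) / (d f' \<zeta>)\<close> is univalent in the unit disk, and its reciprocal
  has there an expansion \<open>g u = 1/u + c0 + u kk u\<close> with \<open>-6 kk 0 = d^2 S_f(\<zeta>)\<close>
  (\<open>Schwarzian_of_inverse\<close>). Since \<open>|\<zeta> + d u| - 1 \<le> d |u|\<close>, the dilatation of \<open>g\<close> is at most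
  \<open>L |u|^\<alpha>\<close> with \<open>L = M d^\<alpha>\<close>, and it vanishes for \<open>|u| < 1\<close>. So the theorem says that
  \<open>|kk 0| \<le> C L\<close> for every such \<open>g\<close>; these functions are collected in the locale
  \<open>exterior_qc\<close>.

  The coefficient \<open>kk 0\<close> is computed by integrating the derivative of \<open>g\<close> with respect to the conjugate
  variable against \<open>1/z^2\<close>, with a cutoff at a radius \<open>T\<close> (\<open>coefficient_identity\<close>). As this derivative is at
  most \<open>L |z|^\<alpha> |\<partial>g|\<close>, the inequality of the arithmetic and geometric means bounds the integral by \<open>L\<close> times the sum
  of the integrals of \<open>|z|^(\<alpha> - 4)\<close>, which converges at infinity because \<open>\<alpha> < 2\<close>, and of
  \<open>|z|^\<alpha> |\<partial>g|^2\<close>. The second one is comparable to the area integral of the Jacobian \<open>J\<close> of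
  \<open>g\<close> with weight \<open>|z|^\<alpha>\<close>, so everything depends on a bound for this weighted area which does not
  depend on \<open>g\<close>. The cutoff at \<open>T\<close> costs a term of order \<open>T^(-\<alpha>)\<close>.

  Green's formula writes the area integral with a radial weight \<open>\<phi>\<close> as an integral over circles of
  \<open>\<phi>'\<close> times the area enclosed by the image circle, and the isoperimetric inequality bounds this area by the squared
  angular derivative, hence by \<open>(1 + \<kappa>) / (1 - \<kappa>) r^2 J\<close> where the dilatation is at most
  \<open>\<kappa>\<close>. For \<open>\<phi> = r^\<alpha>\<close> the result is the weighted area itself with the factor
  \<open>(1 + \<kappa>) / (1 - \<kappa>) \<cdot> \<alpha> / 2\<close>, plus a term controlled by the unweighted area away from the pole, which the
  classical area theorem bounds (\<open>base_energy\<close>). Because \<open>\<alpha> < 2\<close>, some \<open>\<kappa> > 0\<close> makes the factor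
  less than one, and the weighted area is absorbed (\<open>weighted_energy\<close>). The radius \<open>T\<close> is the one at which
  \<open>L T^\<alpha> = \<kappa>\<close>: up to there the dilatation is at most \<open>\<kappa>\<close>, and the cost
  \<open>T^(-\<alpha>) = L / \<kappa>\<close> of the cutoff is again of order \<open>L\<close>.

  All identities are proved for twice continuously differentiable functions and carried over to Sobolev
  maps by mollification (\<open>smooth_approx\<close>). Mollification also yields Weyl's lemma: the map is holomorphic in the disk and
  its weak derivatives are the classical ones there.
\<close>

section \<open>Continuously differentiable functions of a complex variable\<close>

text \<open>The gradient is carried along as a pair of functions, so that partial derivatives of products,
  quotients and convolutions can be named explicitly.\<close>

definition c1_on :: "complex set \<Rightarrow> (complex \<Rightarrow> complex) \<Rightarrow> (complex \<Rightarrow> complex) \<Rightarrow> (complex \<Rightarrow> complex) \<Rightarrow> bool"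
  where "c1_on V G Gx Gy \<longleftrightarrow>
    (\<forall>z\<in>V. (G has_derivative (\<lambda>h. of_real (Re h) * Gx z + of_real (Im h) * Gy z)) (at z)) \<and>
    continuous_on V Gx \<and> continuous_on V Gy"

lemma c1_onD:
  assumes "c1_on V G Gx Gy"
  shows "z \<in> V \<Longrightarrow> (G has_derivative (\<lambda>h. of_real (Re h) * Gx z + of_real (Im h) * Gy z)) (at z)"
    and "continuous_on V Gx" "continuous_on V Gy"
  using assms by (auto simp: c1_on_def)

lemma c1_on_continuous: "c1_on V G Gx Gy \<Longrightarrow> continuous_on V G"
  by (meson c1_onD(1) continuous_at_imp_continuous_on has_derivative_continuous)

lemma c1_on_subset: "c1_on V G Gx Gy \<Longrightarrow> W \<subseteq> V \<Longrightarrow> c1_on W G Gx Gy"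
  by (auto simp: c1_on_def intro: continuous_on_subset)

lemma c1_on_const: "c1_on V (\<lambda>_. c) (\<lambda>_. 0) (\<lambda>_. 0)"
  by (auto simp: c1_on_def)

lemma c1_on_ident: "c1_on V (\<lambda>z. z) (\<lambda>_. 1) (\<lambda>_. \<i>)"
proof -
  have "(\<lambda>h. of_real (Re h) * 1 + of_real (Im h) * \<i>) = (\<lambda>h::complex. h)"
    by (auto simp: complex_eq_iff)
  then show ?thesis
    by (auto simp: c1_on_def)
qed

lemma c1_on_Re: "c1_on V (\<lambda>z. of_real (Re z)) (\<lambda>_. 1) (\<lambda>_. 0)"
  unfolding c1_on_def by (auto intro!: derivative_eq_intros)

lemma c1_on_Im: "c1_on V (\<lambda>z. of_real (Im z)) (\<lambda>_. 0) (\<lambda>_. 1)"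
  unfolding c1_on_def by (auto intro!: derivative_eq_intros)

lemma c1_on_add:
  assumes "c1_on V G Gx Gy" "c1_on V H Hx Hy"
  shows "c1_on V (\<lambda>z. G z + H z) (\<lambda>z. Gx z + Hx z) (\<lambda>z. Gy z + Hy z)"
  using assms unfolding c1_on_def
  by (auto intro!: derivative_eq_intros continuous_intros simp: algebra_simps)

lemma c1_on_mult:
  assumes "c1_on V G Gx Gy" "c1_on V H Hx Hy"
  shows "c1_on V (\<lambda>z. G z * H z) (\<lambda>z. Gx z * H z + G z * Hx z) (\<lambda>z. Gy z * H z + G z * Hy z)"
  using assms c1_on_continuous[OF assms(1)] c1_on_continuous[OF assms(2)] unfolding c1_on_def
  by (auto intro!: derivative_eq_intros continuous_intros simp: algebra_simps)

lemma c1_on_cmult: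
  assumes "c1_on V G Gx Gy"
  shows "c1_on V (\<lambda>z. c * G z) (\<lambda>z. c * Gx z) (\<lambda>z. c * Gy z)"
  using c1_on_mult[OF c1_on_const[of V c] assms] by simp

lemma c1_on_cnj:
  assumes "c1_on V G Gx Gy"
  shows "c1_on V (\<lambda>z. cnj (G z)) (\<lambda>z. cnj (Gx z)) (\<lambda>z. cnj (Gy z))"
  using assms unfolding c1_on_def
  by (auto intro!: derivative_eq_intros continuous_intros)

lemma c1_on_cong:
  assumes "c1_on V G Gx Gy" "\<And>z. z \<in> V \<Longrightarrow> G z = G' z" "\<And>z. z \<in> V \<Longrightarrow> Gx z = Gx' z"
    "\<And>z. z \<in> V \<Longrightarrow> Gy z = Gy' z" "open V"
  shows "c1_on V G' Gx' Gy'"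
  unfolding c1_on_def
proof (intro conjI ballI)
  fix z assume z: "z \<in> V"
  have "(G has_derivative (\<lambda>h. of_real (Re h) * Gx' z + of_real (Im h) * Gy' z)) (at z)"
    using c1_onD(1)[OF assms(1) z] assms(3,4)[OF z] by simp
  then show "(G' has_derivative (\<lambda>h. of_real (Re h) * Gx' z + of_real (Im h) * Gy' z)) (at z)"
    by (rule has_derivative_transform_within_open[OF _ assms(5) z]) (use assms(2) in auto)
qed (use assms c1_onD(2,3)[OF assms(1)] in \<open>auto cong: continuous_on_cong\<close>)

lemma c1_on_inverse:
  assumes "c1_on V G Gx Gy" "\<And>z. z \<in> V \<Longrightarrow> G z \<noteq> 0"
  shows "c1_on V (\<lambda>z. inverse (G z)) (\<lambda>z. - Gx z / (G z)\<^sup>2) (\<lambda>z. - Gy z / (G z)\<^sup>2)"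
  unfolding c1_on_def
proof (intro conjI ballI)
  fix z assume z: "z \<in> V"
  have "((\<lambda>z. inverse (G z)) has_derivative
      (\<lambda>h. - (inverse (G z) * (of_real (Re h) * Gx z + of_real (Im h) * Gy z) * inverse (G z)))) (at z)"
    by (rule Deriv.has_derivative_inverse[OF assms(2)[OF z] c1_onD(1)[OF assms(1) z]])
  then show "((\<lambda>z. inverse (G z)) has_derivative
      (\<lambda>h. of_real (Re h) * (- Gx z / (G z)\<^sup>2) + of_real (Im h) * (- Gy z / (G z)\<^sup>2))) (at z)"
    by (rule has_derivative_eq_rhs) (simp add: fun_eq_iff divide_simps power2_eq_square assms(2)[OF z] algebra_simps)
qed (use assms c1_onD(2,3)[OF assms(1)] c1_on_continuous[OF assms(1)] in \<open>auto intro!: continuous_intros\<close>)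

lemma c1_on_holomorphic:
  assumes "open V" "f holomorphic_on V"
  shows "c1_on V f (deriv f) (\<lambda>z. \<i> * deriv f z)"
  unfolding c1_on_def
proof (intro conjI ballI)
  fix z assume z: "z \<in> V"
  have "(f has_field_derivative deriv f z) (at z)"
    using assms z holomorphic_derivI by blast
  then have "(f has_derivative (\<lambda>h. deriv f z * h)) (at z)"
    by (simp add: has_field_derivative_def)
  then show "(f has_derivative (\<lambda>h. of_real (Re h) * deriv f z + of_real (Im h) * (\<i> * deriv f z))) (at z)"
    by (rule has_derivative_eq_rhs) (simp add: fun_eq_iff complex_eq_iff algebra_simps)
qed (use assms holomorphic_deriv holomorphic_on_imp_continuous_on in \<open>auto intro!: continuous_intros\<close>)

lemma c1_on_partials_unique:
  assumes "c1_on V G Gx Gy" "c1_on V G Hx Hy" "z \<in> V"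
  shows "Gx z = Hx z" "Gy z = Hy z"
proof -
  have "(\<lambda>h. of_real (Re h) * Gx z + of_real (Im h) * Gy z) = (\<lambda>h. of_real (Re h) * Hx z + of_real (Im h) * Hy z)"
    using has_derivative_unique[OF c1_onD(1)[OF assms(1,3)] c1_onD(1)[OF assms(2,3)]] .
  from fun_cong[OF this, of 1] fun_cong[OF this, of \<i>] show "Gx z = Hx z" "Gy z = Hy z"
    by simp_all
qed

lemma c1_on_vanish:
  assumes "c1_on V G Gx Gy" "open W" "W \<subseteq> V" "\<And>z. z \<in> W \<Longrightarrow> G z = 0" "z \<in> W"
  shows "Gx z = 0" "Gy z = 0"
proof -
  have 1: "c1_on W G Gx Gy" using assms c1_on_subset by blast
  have 2: "c1_on W G (\<lambda>_. 0) (\<lambda>_. 0)"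
    by (rule c1_on_cong[OF c1_on_const[of W 0]]) (use assms in auto)
  show "Gx z = 0" "Gy z = 0"
    using c1_on_partials_unique[OF 1 2 assms(5)] by auto
qed

lemma c1_on_Un:
  assumes "c1_on V G Gx Gy" "c1_on W G Gx Gy" "open V" "open W"
  shows "c1_on (V \<union> W) G Gx Gy"
  using assms unfolding c1_on_def by (auto intro!: continuous_on_open_Un)

lemma c1_on_mult_cutoff:
  assumes A: "c1_on V A Ax Ay" and w: "c1_on UNIV w wx wy" and "open V" "closed K" "K \<subseteq> V"
    and supp: "\<And>z. z \<notin> K \<Longrightarrow> w z = 0"
  shows "c1_on UNIV (\<lambda>z. w z * A z) (\<lambda>z. wx z * A z + w z * Ax z) (\<lambda>z. wy z * A z + w z * Ay z)"
proof -
  have 1: "c1_on V (\<lambda>z. w z * A z) (\<lambda>z. wx z * A z + w z * Ax z) (\<lambda>z. wy z * A z + w z * Ay z)"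
    by (rule c1_on_mult[OF c1_on_subset[OF w] A]) auto
  have z: "w z = 0 \<and> wx z = 0 \<and> wy z = 0" if "z \<in> - K" for z
    using c1_on_vanish[OF w, of "- K"] supp that assms(4) by auto
  have 2: "c1_on (- K) (\<lambda>z. w z * A z) (\<lambda>z. wx z * A z + w z * Ax z) (\<lambda>z. wy z * A z + w z * Ay z)"
    by (rule c1_on_cong[OF c1_on_const[of _ 0]]) (use assms z in auto)
  have "V \<union> - K = UNIV" using assms by auto
  then show ?thesis using c1_on_Un[OF 1 2] assms by auto
qed

lemma integrable_continuous_support:
  fixes F :: "complex \<Rightarrow> 'b::{banach, second_countable_topology}"
  assumes "continuous_on UNIV F" "\<And>z. norm z > R \<Longrightarrow> F z = 0"
  shows "integrable lborel F"
proof -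
  have "integrable lborel (\<lambda>x. indicator (cball 0 R) x *\<^sub>R F x)"
    by (rule borel_integrable_compact) (auto intro: continuous_on_subset[OF assms(1)])
  also have "(\<lambda>x. indicator (cball 0 R) x *\<^sub>R F x) = F"
    using assms(2) by (auto simp: fun_eq_iff indicator_def)
  finally show ?thesis .
qed

lemma lborel_integral_translate:
  fixes F :: "complex \<Rightarrow> 'b::{banach, second_countable_topology}"
  assumes [measurable]: "F \<in> borel_measurable borel"
  shows "(\<integral>z. F (c + z) \<partial>lborel) = (\<integral>z. F z \<partial>lborel)"
proof -
  have "(\<integral>z. F z \<partial>distr lborel borel ((+) c)) = (\<integral>z. F (c + z) \<partial>lborel)"
    by (rule integral_distr) auto
  then show ?thesis by (simp add: lborel_distr_plus)
qed

lemma integral_cbox_eq_lborel: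
  fixes F :: "complex \<Rightarrow> complex"
  assumes "continuous_on UNIV F" "\<And>z. z \<notin> cbox a b \<Longrightarrow> F z = 0"
  shows "integral (cbox a b) F = (\<integral>z. F z \<partial>lborel)"
proof -
  have "integrable lborel (\<lambda>x. indicator (cbox a b) x *\<^sub>R F x)"
    by (rule borel_integrable_compact) (auto intro: continuous_on_subset[OF assms(1)])
  then have "set_integrable lborel (cbox a b) F" by (simp add: set_integrable_def)
  from set_borel_integral_eq_integral(2)[OF this]
  have "integral (cbox a b) F = (\<integral>z. indicator (cbox a b) z *\<^sub>R F z \<partial>lborel)"
    by (simp add: set_lebesgue_integral_def)
  also have "(\<lambda>x. indicator (cbox a b) x *\<^sub>R F x) = F"
    using assms(2) by (auto simp: fun_eq_iff indicator_def)
  finally show ?thesis .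
qed

text \<open>The integral of \<open>\<phi>(z + t v)\<close> does not depend on \<open>t\<close>; differentiation under the integral
  at \<open>t = 0\<close> gives the claim.\<close>

lemma integral_directional_derivative_eq_0:
  assumes c: "c1_on UNIV \<phi> \<phi>x \<phi>y" and supp: "\<And>z. norm z > R \<Longrightarrow> \<phi> z = 0"
  shows "(\<integral>z. of_real (Re v) * \<phi>x z + of_real (Im v) * \<phi>y z \<partial>lborel) = 0"
proof -
  define D where "D z = of_real (Re v) * \<phi>x z + of_real (Im v) * \<phi>y z" for z
  have contD: "continuous_on UNIV D"
    unfolding D_def using c1_onD(2,3)[OF c] by (intro continuous_intros)
  have cont: "continuous_on UNIV \<phi>" using c1_on_continuous[OF c] .
  obtain a b where ab: "cball (0::complex) (\<bar>R\<bar> + norm v + 1) \<subseteq> cbox a b"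
    using bounded_subset_cbox_symmetric[OF bounded_cball] by blast
  have out: "norm z > \<bar>R\<bar> + norm v" if "z \<notin> cbox a b" for z
    using ab that by (force simp: subset_iff)
  have 0: "\<phi> (of_real s * v + z) = 0" if "z \<notin> cbox a b" "\<bar>s\<bar> \<le> 1" for s z
  proof (rule supp)
    have "norm (of_real s * v) \<le> norm v" using that by (simp add: norm_mult mult_left_le_one_le)
    moreover have "norm z \<le> norm (of_real s * v + z) + norm (of_real s * v)"
      by (metis add_diff_cancel_left' norm_triangle_ineq4)
    ultimately show "R < norm (of_real s * v + z)" using out[OF that(1)] by linarith
  qed
  have eq: "integral (cbox a b) (\<lambda>z. \<phi> (of_real s * v + z)) = (\<integral>z. \<phi> z \<partial>lborel)" if "\<bar>s\<bar> \<le> 1" for s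
  proof -
    have "continuous_on UNIV (\<lambda>z. \<phi> (of_real s * v + z))"
      by (rule continuous_on_compose2[OF cont]) (auto intro!: continuous_intros)
    then show ?thesis
      using integral_cbox_eq_lborel[of "\<lambda>z. \<phi> (of_real s * v + z)" a b] 0 that
        lborel_integral_translate[of \<phi> "of_real s * v"] borel_measurable_continuous_onI[OF cont]
      by auto
  qed
  have cD: "continuous_on ({-1..1} \<times> cbox a b) (\<lambda>(s::real, z). D (of_real s * v + z))"
    unfolding split_beta by (rule continuous_on_compose2[OF contD]) (auto intro!: continuous_intros)
  have "((\<lambda>s. integral (cbox a b) (\<lambda>z. \<phi> (of_real s * v + z))) has_vector_derivative
      integral (cbox a b) (\<lambda>z. D (of_real 0 * v + z))) (at 0 within {-1..1})"
  proof (rule leibniz_rule_vector_derivative[OF _ _ cD])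
    fix s :: real and z assume "s \<in> {-1..1}" "z \<in> cbox a b"
    have "((\<lambda>s. \<phi> (of_real s * v + z)) has_derivative
        (\<lambda>h. of_real (Re (of_real h * v)) * \<phi>x (of_real s * v + z) + of_real (Im (of_real h * v)) * \<phi>y (of_real s * v + z)))
       (at s within {-1..1})"
      by (rule has_derivative_compose[OF _ c1_onD(1)[OF c], simplified])
         (auto intro!: derivative_eq_intros)
    then show "((\<lambda>s. \<phi> (of_real s * v + z)) has_vector_derivative D (of_real s * v + z)) (at s within {-1..1})"
      unfolding has_vector_derivative_def
      by (rule has_derivative_eq_rhs) (simp add: D_def fun_eq_iff algebra_simps scaleR_conv_of_real)
  next
    fix s :: real assume "s \<in> {-1..1}"
    show "(\<lambda>z. \<phi> (of_real s * v + z)) integrable_on cbox a b"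
      by (intro integrable_continuous continuous_on_compose2[OF cont] continuous_intros) auto
  qed auto
  moreover have "((\<lambda>s. integral (cbox a b) (\<lambda>z. \<phi> (of_real s * v + z))) has_vector_derivative 0) (at 0 within {-1..1::real})"
    by (rule has_vector_derivative_transform[OF _ _ has_vector_derivative_const[of "\<integral>z. \<phi> z \<partial>lborel"]]) (use eq in auto)
  ultimately have "integral (cbox a b) D = 0"
    using vector_derivative_unique_within_closed_interval[of "-1::real" 1 0] by (simp add: cbox_interval)
  moreover have "D z = 0" if "z \<notin> cbox a b" for z
  proof -
    have "norm z > \<bar>R\<bar>" using out[OF that] norm_ge_zero[of v] by linarith
    then have "\<phi>x z = 0" "\<phi>y z = 0"
      using c1_on_vanish[OF c, of "- cball 0 \<bar>R\<bar>" z] supp by auto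
    then show ?thesis by (simp add: D_def)
  qed
  ultimately show ?thesis
    using integral_cbox_eq_lborel[OF contD, of a b] by (simp add: D_def)
qed

lemma integral_partial_x_eq_0:
  assumes "c1_on UNIV \<phi> \<phi>x \<phi>y" "\<And>z. norm z > R \<Longrightarrow> \<phi> z = 0"
  shows "(\<integral>z. \<phi>x z \<partial>lborel) = 0"
  using integral_directional_derivative_eq_0[OF assms, where v=1] by simp

lemma integral_partial_y_eq_0:
  assumes "c1_on UNIV \<phi> \<phi>x \<phi>y" "\<And>z. norm z > R \<Longrightarrow> \<phi> z = 0"
  shows "(\<integral>z. \<phi>y z \<partial>lborel) = 0"
  using integral_directional_derivative_eq_0[OF assms, where v=\<i>] by simp

lemma c1_on_support_integrable:
  assumes "c1_on UNIV \<phi> \<phi>x \<phi>y" "\<And>z. norm z > R \<Longrightarrow> \<phi> z = 0"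
  shows "integrable lborel \<phi>x" "integrable lborel \<phi>y"
proof -
  have "\<phi>x z = 0 \<and> \<phi>y z = 0" if "norm z > R" for z
    using c1_on_vanish[OF assms(1), of "- cball 0 R" z] assms(2) that by auto
  then show "integrable lborel \<phi>x" "integrable lborel \<phi>y"
    using c1_onD(2,3)[OF assms(1)] by (auto intro: integrable_continuous_support)
qed

text \<open>Integration by parts in both directions; the mixed second derivatives of \<open>g\<close> cancel.\<close>

lemma green_identity:
  assumes g: "c1_on V g gx gy" and gx: "c1_on V gx gxx gxy" and gy: "c1_on V gy gxy gyy"
    and w: "c1_on UNIV w wx wy" and V: "open V" "compact K" "K \<subseteq> V"
    and supp: "\<And>z. z \<notin> K \<Longrightarrow> w z = 0"
  shows "(\<integral>z. w z * (cnj (gx z) * gy z - cnj (gy z) * gx z) \<partial>lborel) =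
         - (\<integral>z. cnj (g z) * (wx z * gy z - wy z * gx z) \<partial>lborel)"
proof -
  obtain R where R: "K \<subseteq> cball 0 R"
    using compact_imp_bounded[OF V(2)] unfolding bounded_iff by (metis mem_cball_0 subsetI)
  have s: "w z = 0" if "norm z > R" for z
  proof (rule supp)
    show "z \<notin> K" using R that by (meson linorder_not_less mem_cball_0 subsetD)
  qed
  note cl = compact_imp_closed[OF V(2)]
  note A = c1_on_mult_cutoff[OF c1_on_mult[OF c1_on_cnj[OF g] gy] w V(1) cl V(3) supp]
  note B = c1_on_mult_cutoff[OF c1_on_mult[OF c1_on_cnj[OF g] gx] w V(1) cl V(3) supp]
  note iA = integral_partial_x_eq_0[OF A, of R] c1_on_support_integrable(1)[OF A, of R]
  note iB = integral_partial_y_eq_0[OF B, of R] c1_on_support_integrable(2)[OF B, of R]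
  note iA = iA[simplified s mult_zero_left, simplified]
  note iB = iB[simplified s mult_zero_left, simplified]
  let ?L = "\<lambda>z. w z * (cnj (gx z) * gy z - cnj (gy z) * gx z)"
  let ?R = "\<lambda>z. cnj (g z) * (wx z * gy z - wy z * gx z)"
  have c: "continuous_on UNIV (\<lambda>z. w z * (cnj (gx z) * gy z - cnj (gy z) * gx z))"
  proof -
    have 1: "continuous_on V ?L"
      using c1_on_continuous[OF w] c1_on_continuous[OF gx] c1_on_continuous[OF gy]
      by (auto intro!: continuous_intros intro: continuous_on_subset)
    have 2: "continuous_on (-K) ?L"
      by (rule continuous_on_eq[OF continuous_on_const[of _ 0]]) (simp add: supp)
    have "continuous_on (V \<union> - K) ?L"
      by (rule continuous_on_open_Un) (use V cl 1 2 in auto)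
    moreover have "V \<union> - K = UNIV" using V by auto
    ultimately show ?thesis by simp
  qed
  have iL: "integrable lborel ?L"
    by (rule integrable_continuous_support[OF c, of R]) (simp add: s)
  have sum: "?L z + ?R z = (wx z * (cnj (g z) * gy z) + w z * (cnj (gx z) * gy z + cnj (g z) * gxy z))
     - (wy z * (cnj (g z) * gx z) + w z * (cnj (gy z) * gx z + cnj (g z) * gxy z))" for z
    by (simp add: algebra_simps)
  have i: "integrable lborel (\<lambda>z. ?L z + ?R z)"
    unfolding sum using iA iB by (intro Bochner_Integration.integrable_diff) auto
  have "integrable lborel (\<lambda>z. (?L z + ?R z) - ?L z)"
    by (rule Bochner_Integration.integrable_diff[OF i iL])
  then have iR: "integrable lborel ?R" by simp
  have "(\<integral>z. ?L z + ?R z \<partial>lborel) = 0"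
    unfolding sum using iA iB by (subst Bochner_Integration.integral_diff) auto
  then show ?thesis
    using Bochner_Integration.integral_add[OF iL iR] by (simp add: add_eq_0_iff2)
qed

section \<open>Square integrable functions and convergence in mean square\<close>

definition sq_integrable :: "'a measure \<Rightarrow> ('a \<Rightarrow> complex) \<Rightarrow> bool"
  where "sq_integrable M u \<longleftrightarrow> u \<in> borel_measurable M \<and> integrable M (\<lambda>x. (norm (u x))\<^sup>2)"

definition L2_tendsto :: "'a measure \<Rightarrow> (nat \<Rightarrow> 'a \<Rightarrow> complex) \<Rightarrow> ('a \<Rightarrow> complex) \<Rightarrow> bool"
  where "L2_tendsto M U u \<longleftrightarrow> sq_integrable M u \<and> (\<forall>n. sq_integrable M (U n)) \<and>
           (\<lambda>n. \<integral>x. (norm (U n x - u x))\<^sup>2 \<partial>M) \<longlonglongrightarrow> 0"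

lemma sq_integrable_measurable: "sq_integrable M u \<Longrightarrow> u \<in> borel_measurable M"
  by (simp add: sq_integrable_def)

lemma norm_mult_le_sum_squares: "norm (a * b :: complex) \<le> (norm a)\<^sup>2 + (norm b)\<^sup>2"
proof -
  have "0 \<le> (norm a - norm b)\<^sup>2" "0 \<le> norm a * norm b" by simp_all
  then show ?thesis unfolding norm_mult power2_diff by linarith
qed

lemma norm_add_square_le: "(norm (a + b :: complex))\<^sup>2 \<le> 2 * (norm a)\<^sup>2 + 2 * (norm b)\<^sup>2"
proof -
  have "(norm (a + b))\<^sup>2 \<le> (norm a + norm b)\<^sup>2"
    by (intro power_mono norm_triangle_ineq) auto
  also have "\<dots> \<le> 2 * (norm a)\<^sup>2 + 2 * (norm b)\<^sup>2"
    using zero_le_power2[of "norm a - norm b"] by (simp add: power2_sum power2_diff)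
  finally show ?thesis .
qed

lemma sq_integrable_mult_integrable:
  assumes "sq_integrable M u" "sq_integrable M v"
  shows "integrable M (\<lambda>x. u x * v x)"
proof (rule Bochner_Integration.integrable_bound)
  show "integrable M (\<lambda>x. (norm (u x))\<^sup>2 + (norm (v x))\<^sup>2)"
    using assms by (auto simp: sq_integrable_def)
  show "(\<lambda>x. u x * v x) \<in> borel_measurable M"
    using assms by (auto simp: sq_integrable_def)
  show "AE x in M. norm (u x * v x) \<le> norm ((norm (u x))\<^sup>2 + (norm (v x))\<^sup>2)"
    using norm_mult_le_sum_squares by (intro AE_I2) auto
qed

lemma sq_integrable_add:
  assumes "sq_integrable M u" "sq_integrable M v"
  shows "sq_integrable M (\<lambda>x. u x + v x)"
  unfolding sq_integrable_def
proof
  show m: "(\<lambda>x. u x + v x) \<in> borel_measurable M"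
    using assms by (auto simp: sq_integrable_def)
  show "integrable M (\<lambda>x. (norm (u x + v x))\<^sup>2)"
  proof (rule Bochner_Integration.integrable_bound)
    show "integrable M (\<lambda>x. 2 * (norm (u x))\<^sup>2 + 2 * (norm (v x))\<^sup>2)"
      using assms by (auto simp: sq_integrable_def)
    show "(\<lambda>x. (norm (u x + v x))\<^sup>2) \<in> borel_measurable M" using m by measurable
    show "AE x in M. norm ((norm (u x + v x))\<^sup>2) \<le> norm (2 * (norm (u x))\<^sup>2 + 2 * (norm (v x))\<^sup>2)"
      using norm_add_square_le by (intro AE_I2) auto
  qed
qed

lemma sq_integrable_bounded_mult:
  assumes "sq_integrable M u" and [measurable]: "b \<in> borel_measurable M"
    and B: "\<And>x. x \<in> space M \<Longrightarrow> norm (b x) \<le> B"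
  shows "sq_integrable M (\<lambda>x. b x * u x)"
  unfolding sq_integrable_def
proof
  have [measurable]: "u \<in> borel_measurable M" using assms by (simp add: sq_integrable_def)
  show "(\<lambda>x. b x * u x) \<in> borel_measurable M" by measurable
  show "integrable M (\<lambda>x. (norm (b x * u x))\<^sup>2)"
  proof (rule Bochner_Integration.integrable_bound)
    show "integrable M (\<lambda>x. B\<^sup>2 * (norm (u x))\<^sup>2)"
      using assms by (auto simp: sq_integrable_def)
    show "(\<lambda>x. (norm (b x * u x))\<^sup>2) \<in> borel_measurable M" by measurable
    show "AE x in M. norm ((norm (b x * u x))\<^sup>2) \<le> norm (B\<^sup>2 * (norm (u x))\<^sup>2)"
      using B by (intro AE_I2) (auto simp: norm_mult power_mult_distrib intro!: mult_right_mono power_mono)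
  qed
qed

lemma sq_integrable_cmult: "sq_integrable M u \<Longrightarrow> sq_integrable M (\<lambda>x. c * u x)"
  by (rule sq_integrable_bounded_mult[where B="norm c"]) auto

lemma sq_integrable_diff:
  assumes "sq_integrable M u" "sq_integrable M v"
  shows "sq_integrable M (\<lambda>x. u x - v x)"
  using sq_integrable_add[OF assms(1) sq_integrable_cmult[OF assms(2), of "-1"]] by simp

lemma sq_integrable_cnj: "sq_integrable M u \<Longrightarrow> sq_integrable M (\<lambda>x. cnj (u x))"
  by (auto simp: sq_integrable_def
      intro!: measurable_compose[where g=cnj, OF _ borel_measurable_continuous_onI] continuous_intros)

lemma sq_integrable_bounded:
  assumes "finite_measure M" "u \<in> borel_measurable M" "\<And>x. x \<in> space M \<Longrightarrow> norm (u x) \<le> B"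
  shows "sq_integrable M u"
proof -
  interpret finite_measure M by fact
  have "sq_integrable M (\<lambda>x. 1)" by (simp add: sq_integrable_def)
  from sq_integrable_bounded_mult[OF this assms(2,3)] show ?thesis by simp
qed

lemma Cauchy_Schwarz_sq_integrable:
  assumes "sq_integrable M u" "sq_integrable M v"
  shows "(\<integral>x. norm (u x * v x) \<partial>M) \<le> sqrt (\<integral>x. (norm (u x))\<^sup>2 \<partial>M) * sqrt (\<integral>x. (norm (v x))\<^sup>2 \<partial>M)"
proof -
  have [measurable]: "u \<in> borel_measurable M" "v \<in> borel_measurable M"
    using assms by (auto simp: sq_integrable_def)
  have i: "integrable M (\<lambda>x. norm (u x * v x))" "integrable M (\<lambda>x. (norm (u x))\<^sup>2)" "integrable M (\<lambda>x. (norm (v x))\<^sup>2)"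
    using sq_integrable_mult_integrable[OF assms] assms by (auto simp: sq_integrable_def)
  have e: "(\<integral>\<^sup>+x. ennreal (norm (u x)) * ennreal (norm (v x)) \<partial>M) = ennreal (\<integral>x. norm (u x * v x) \<partial>M)"
    using nn_integral_eq_integral[OF i(1)] by (simp add: norm_mult ennreal_mult)
  have eu: "(\<integral>\<^sup>+x. ennreal (norm (u x)) ^ 2 \<partial>M) = ennreal (\<integral>x. (norm (u x))\<^sup>2 \<partial>M)"
    using nn_integral_eq_integral[OF i(2)] by (simp add: ennreal_power)
  have ev: "(\<integral>\<^sup>+x. ennreal (norm (v x)) ^ 2 \<partial>M) = ennreal (\<integral>x. (norm (v x))\<^sup>2 \<partial>M)"
    using nn_integral_eq_integral[OF i(3)] by (simp add: ennreal_power)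
  have "(\<integral>\<^sup>+x. ennreal (norm (u x)) * ennreal (norm (v x)) \<partial>M)\<^sup>2
     \<le> (\<integral>\<^sup>+x. ennreal (norm (u x)) ^ 2 \<partial>M) * (\<integral>\<^sup>+x. ennreal (norm (v x)) ^ 2 \<partial>M)"
    by (rule Cauchy_Schwarz_nn_integral) auto
  then have "(\<integral>x. norm (u x * v x) \<partial>M)\<^sup>2 \<le> (\<integral>x. (norm (u x))\<^sup>2 \<partial>M) * (\<integral>x. (norm (v x))\<^sup>2 \<partial>M)"
    unfolding e eu ev by (simp add: ennreal_power flip: ennreal_mult)
  then show ?thesis
    by (metis real_le_rsqrt real_sqrt_mult)
qed

lemma L2_tendsto_integral_mult:
  assumes "L2_tendsto M U u" "L2_tendsto M V v"
  shows "(\<lambda>n. \<integral>x. U n x * V n x \<partial>M) \<longlonglongrightarrow> (\<integral>x. u x * v x \<partial>M)"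
proof -
  define N where "N w = sqrt (\<integral>x. (norm (w x))\<^sup>2 \<partial>M)" for w :: "'a \<Rightarrow> complex"
  have s: "sq_integrable M u" "sq_integrable M v" "\<And>n. sq_integrable M (U n)" "\<And>n. sq_integrable M (V n)"
    using assms by (auto simp: L2_tendsto_def)
  have lim: "(\<lambda>n. N (\<lambda>x. U n x - u x)) \<longlonglongrightarrow> 0" "(\<lambda>n. N (\<lambda>x. V n x - v x)) \<longlonglongrightarrow> 0"
    unfolding N_def using assms by (auto simp: L2_tendsto_def intro!: tendsto_eq_intros)
  have bound: "norm ((\<integral>x. U n x * V n x \<partial>M) - (\<integral>x. u x * v x \<partial>M)) \<le>
     N (\<lambda>x. U n x - u x) * N (\<lambda>x. V n x - v x) + N (\<lambda>x. U n x - u x) * N v + N u * N (\<lambda>x. V n x - v x)" for n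
  proof -
    note d = sq_integrable_diff[OF s(3)[of n] s(1)] sq_integrable_diff[OF s(4)[of n] s(2)]
    note i = sq_integrable_mult_integrable[OF d] sq_integrable_mult_integrable[OF d(1) s(2)]
      sq_integrable_mult_integrable[OF s(1) d(2)]
    have "(\<integral>x. U n x * V n x \<partial>M) - (\<integral>x. u x * v x \<partial>M) = (\<integral>x. U n x * V n x - u x * v x \<partial>M)"
      using s by (intro Bochner_Integration.integral_diff[symmetric] sq_integrable_mult_integrable) auto
    also have "norm \<dots> \<le> (\<integral>x. norm (U n x * V n x - u x * v x) \<partial>M)"
      by (rule integral_norm_bound)
    also have "\<dots> \<le> (\<integral>x. norm ((U n x - u x) * (V n x - v x)) + norm ((U n x - u x) * v x) + norm (u x * (V n x - v x)) \<partial>M)"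
    proof (rule integral_mono)
      show "integrable M (\<lambda>x. norm (U n x * V n x - u x * v x))"
        using s by (intro integrable_norm Bochner_Integration.integrable_diff sq_integrable_mult_integrable) auto
      show "integrable M (\<lambda>x. norm ((U n x - u x) * (V n x - v x)) + norm ((U n x - u x) * v x) + norm (u x * (V n x - v x)))"
        using i by (intro Bochner_Integration.integrable_add integrable_norm)
      fix x
      have "U n x * V n x - u x * v x = (U n x - u x) * (V n x - v x) + (U n x - u x) * v x + u x * (V n x - v x)"
        by (simp add: algebra_simps)
      then show "norm (U n x * V n x - u x * v x) \<le> norm ((U n x - u x) * (V n x - v x)) + norm ((U n x - u x) * v x) + norm (u x * (V n x - v x))"
        by (metis (no_types, lifting) norm_add_rule_thm order_refl)
    qed
    also have "\<dots> = (\<integral>x. norm ((U n x - u x) * (V n x - v x)) \<partial>M) + (\<integral>x. norm ((U n x - u x) * v x) \<partial>M) + (\<integral>x. norm (u x * (V n x - v x)) \<partial>M)"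
      using i by (subst Bochner_Integration.integral_add; (intro Bochner_Integration.integrable_add integrable_norm)?; simp)+
    also have "\<dots> \<le> N (\<lambda>x. U n x - u x) * N (\<lambda>x. V n x - v x) + N (\<lambda>x. U n x - u x) * N v + N u * N (\<lambda>x. V n x - v x)"
      unfolding N_def using d s by (intro add_mono Cauchy_Schwarz_sq_integrable) auto
    finally show ?thesis .
  qed
  have "(\<lambda>n. (\<integral>x. U n x * V n x \<partial>M) - (\<integral>x. u x * v x \<partial>M)) \<longlonglongrightarrow> 0"
  proof (rule Lim_null_comparison[OF always_eventually])
    show "\<forall>n. norm ((\<integral>x. U n x * V n x \<partial>M) - (\<integral>x. u x * v x \<partial>M)) \<le>
     N (\<lambda>x. U n x - u x) * N (\<lambda>x. V n x - v x) + N (\<lambda>x. U n x - u x) * N v + N u * N (\<lambda>x. V n x - v x)"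
      using bound by blast
    show "(\<lambda>n. N (\<lambda>x. U n x - u x) * N (\<lambda>x. V n x - v x) + N (\<lambda>x. U n x - u x) * N v + N u * N (\<lambda>x. V n x - v x)) \<longlonglongrightarrow> 0"
      using lim by (auto intro!: tendsto_eq_intros)
  qed
  then show ?thesis by (simp add: LIM_zero_iff)
qed

lemma L2_tendsto_const: "sq_integrable M u \<Longrightarrow> L2_tendsto M (\<lambda>n. u) u"
  by (auto simp: L2_tendsto_def)

lemma L2_tendsto_cnj: "L2_tendsto M U u \<Longrightarrow> L2_tendsto M (\<lambda>n x. cnj (U n x)) (\<lambda>x. cnj (u x))"
  by (auto simp: L2_tendsto_def sq_integrable_cnj simp flip: complex_cnj_diff)

lemma L2_tendsto_squeeze:
  assumes "sq_integrable M u" "\<And>n. sq_integrable M (U n)"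
    and b: "\<And>n x. x \<in> space M \<Longrightarrow> (norm (U n x - u x))\<^sup>2 \<le> h n x" "\<And>n. integrable M (h n)"
    and lim: "(\<lambda>n. \<integral>x. h n x \<partial>M) \<longlonglongrightarrow> 0"
  shows "L2_tendsto M U u"
  unfolding L2_tendsto_def
proof (intro conjI allI)
  show "(\<lambda>n. \<integral>x. (norm (U n x - u x))\<^sup>2 \<partial>M) \<longlonglongrightarrow> 0"
  proof (rule tendsto_sandwich[OF always_eventually always_eventually tendsto_const lim])
    show "\<forall>n. 0 \<le> (\<integral>x. (norm (U n x - u x))\<^sup>2 \<partial>M)" by simp
    show "\<forall>n. (\<integral>x. (norm (U n x - u x))\<^sup>2 \<partial>M) \<le> (\<integral>x. h n x \<partial>M)"
      using b sq_integrable_diff[OF assms(2,1)] by (auto simp: sq_integrable_def intro!: integral_mono)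
  qed
qed (use assms in auto)

lemma L2_tendsto_add:
  assumes "L2_tendsto M U u" "L2_tendsto M V v"
  shows "L2_tendsto M (\<lambda>n x. U n x + V n x) (\<lambda>x. u x + v x)"
proof (rule L2_tendsto_squeeze)
  have s: "sq_integrable M u" "sq_integrable M v" "\<And>n. sq_integrable M (U n)" "\<And>n. sq_integrable M (V n)"
    using assms by (auto simp: L2_tendsto_def)
  then show "sq_integrable M (\<lambda>x. u x + v x)" "sq_integrable M (\<lambda>x. U n x + V n x)" for n
    by (auto intro: sq_integrable_add)
  show "(norm (U n x + V n x - (u x + v x)))\<^sup>2 \<le> 2 * (norm (U n x - u x))\<^sup>2 + 2 * (norm (V n x - v x))\<^sup>2" for n x
    using norm_add_square_le[of "U n x - u x" "V n x - v x"] by (simp add: algebra_simps)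
  have i: "integrable M (\<lambda>x. (norm (U n x - u x))\<^sup>2)" "integrable M (\<lambda>x. (norm (V n x - v x))\<^sup>2)" for n
    using sq_integrable_diff[OF s(3) s(1)] sq_integrable_diff[OF s(4) s(2)] by (auto simp: sq_integrable_def)
  then show "integrable M (\<lambda>x. 2 * (norm (U n x - u x))\<^sup>2 + 2 * (norm (V n x - v x))\<^sup>2)" for n
    by auto
  have "(\<lambda>n. 2 * (\<integral>x. (norm (U n x - u x))\<^sup>2 \<partial>M) + 2 * (\<integral>x. (norm (V n x - v x))\<^sup>2 \<partial>M)) \<longlonglongrightarrow> 0"
    using assms by (auto simp: L2_tendsto_def intro!: tendsto_eq_intros)
  then show "(\<lambda>n. \<integral>x. 2 * (norm (U n x - u x))\<^sup>2 + 2 * (norm (V n x - v x))\<^sup>2 \<partial>M) \<longlonglongrightarrow> 0"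
    using i by simp
qed

lemma L2_tendsto_uniform_mult:
  assumes U: "L2_tendsto M U u"
    and B: "uniform_limit (space M) B b sequentially" and Bm: "\<And>n. B n \<in> borel_measurable M"
    and bm: "b \<in> borel_measurable M"
    and bnd: "\<And>n x. x \<in> space M \<Longrightarrow> norm (B n x) \<le> C"  "\<And>x. x \<in> space M \<Longrightarrow> norm (b x) \<le> C"
  shows "L2_tendsto M (\<lambda>n x. B n x * U n x) (\<lambda>x. b x * u x)"
proof -
  have s: "sq_integrable M u" "\<And>n. sq_integrable M (U n)"
    using U by (auto simp: L2_tendsto_def)
  have 1: "L2_tendsto M (\<lambda>n x. B n x * (U n x - u x)) (\<lambda>x. 0)"
  proof (rule L2_tendsto_squeeze)
    show "sq_integrable M (\<lambda>x. 0)" by (simp add: sq_integrable_def)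
    show "sq_integrable M (\<lambda>x. B n x * (U n x - u x))" for n
      by (rule sq_integrable_bounded_mult[OF sq_integrable_diff[OF s(2,1)] Bm bnd(1)])
    show "(norm (B n x * (U n x - u x) - 0))\<^sup>2 \<le> C\<^sup>2 * (norm (U n x - u x))\<^sup>2" if "x \<in> space M" for n x
      using bnd(1)[OF that] by (auto simp: norm_mult power_mult_distrib intro!: mult_right_mono power_mono)
    show "integrable M (\<lambda>x. C\<^sup>2 * (norm (U n x - u x))\<^sup>2)" for n
      using sq_integrable_diff[OF s(2,1)] by (auto simp: sq_integrable_def)
    show "(\<lambda>n. \<integral>x. C\<^sup>2 * (norm (U n x - u x))\<^sup>2 \<partial>M) \<longlonglongrightarrow> 0"
      using U by (auto simp: L2_tendsto_def intro!: tendsto_eq_intros)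
  qed
  have 2: "L2_tendsto M (\<lambda>n x. B n x * u x) (\<lambda>x. b x * u x)"
    unfolding L2_tendsto_def
  proof (intro conjI allI)
    show bu: "sq_integrable M (\<lambda>x. b x * u x)"
      by (rule sq_integrable_bounded_mult[OF s(1) bm bnd(2)])
    show Bu: "sq_integrable M (\<lambda>x. B n x * u x)" for n
      by (rule sq_integrable_bounded_mult[OF s(1) Bm bnd(1)])
    define I where "I = (\<integral>x. (norm (u x))\<^sup>2 \<partial>M)"
    show "(\<lambda>n. \<integral>x. (norm (B n x * u x - b x * u x))\<^sup>2 \<partial>M) \<longlonglongrightarrow> 0"
    proof (rule LIMSEQ_I)
      fix r :: real assume r: "r > 0"
      define e where "e = sqrt (r / (I + 1))"
      have I0: "I \<ge> 0" by (simp add: I_def)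
      have e: "e > 0" "e\<^sup>2 = r / (I + 1)" using r I0 by (auto simp: e_def)
      from uniform_limitD[OF B e(1)] obtain N where N: "\<And>n x. n \<ge> N \<Longrightarrow> x \<in> space M \<Longrightarrow> dist (B n x) (b x) < e"
        by (auto simp: eventually_sequentially)
      show "\<exists>no. \<forall>n\<ge>no. norm ((\<integral>x. (norm (B n x * u x - b x * u x))\<^sup>2 \<partial>M) - 0) < r"
      proof (intro exI allI impI)
        fix n assume n: "n \<ge> N"
        have "(\<integral>x. (norm (B n x * u x - b x * u x))\<^sup>2 \<partial>M) \<le> (\<integral>x. e\<^sup>2 * (norm (u x))\<^sup>2 \<partial>M)"
        proof (rule integral_mono)
          show "integrable M (\<lambda>x. (norm (B n x * u x - b x * u x))\<^sup>2)"
            using sq_integrable_diff[OF Bu bu] by (auto simp: sq_integrable_def)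
          show "integrable M (\<lambda>x. e\<^sup>2 * (norm (u x))\<^sup>2)" using s by (auto simp: sq_integrable_def)
          fix x assume "x \<in> space M"
          then have "norm (B n x - b x) \<le> e" using N[OF n] by (auto simp: dist_norm intro: less_imp_le)
          then show "(norm (B n x * u x - b x * u x))\<^sup>2 \<le> e\<^sup>2 * (norm (u x))\<^sup>2"
            by (simp add: norm_mult power_mult_distrib mult_right_mono power_mono flip: left_diff_distrib)
        qed
        also have "\<dots> = r * I / (I + 1)" by (simp add: I_def e(2))
        also have "\<dots> < r" using r I0 by (simp add: field_simps)
        finally show "norm ((\<integral>x. (norm (B n x * u x - b x * u x))\<^sup>2 \<partial>M) - 0) < r" by simp
      qed
    qed
  qed
  from L2_tendsto_add[OF 1 2] show ?thesis by (simp add: algebra_simps)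
qed

lemma L2_tendsto_bounded_mult:
  assumes "L2_tendsto M U u" "b \<in> borel_measurable M" "\<And>x. x \<in> space M \<Longrightarrow> norm (b x) \<le> C"
  shows "L2_tendsto M (\<lambda>n x. b x * U n x) (\<lambda>x. b x * u x)"
  by (rule L2_tendsto_uniform_mult[OF assms(1) uniform_limit_const]) (use assms in auto)

lemma L2_tendsto_cong:
  assumes "L2_tendsto M U u" "\<And>n x. x \<in> space M \<Longrightarrow> U n x = V n x" "\<And>x. x \<in> space M \<Longrightarrow> u x = v x"
  shows "L2_tendsto M V v"
proof -
  have "sq_integrable M (U n) \<longleftrightarrow> sq_integrable M (V n)" "sq_integrable M u \<longleftrightarrow> sq_integrable M v" for n
    unfolding sq_integrable_def using assms(2,3)
    by (auto cong: measurable_cong Bochner_Integration.integrable_cong)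
  moreover have "(\<integral>x. (norm (U n x - u x))\<^sup>2 \<partial>M) = (\<integral>x. (norm (V n x - v x))\<^sup>2 \<partial>M)" for n
    using assms(2,3) by (intro Bochner_Integration.integral_cong) auto
  ultimately show ?thesis using assms(1) by (auto simp: L2_tendsto_def)
qed

lemma L2_tendsto_uniform:
  assumes "finite_measure M" "uniform_limit (space M) B b sequentially" "\<And>n. B n \<in> borel_measurable M"
    "b \<in> borel_measurable M" "\<And>n x. x \<in> space M \<Longrightarrow> norm (B n x) \<le> C" "\<And>x. x \<in> space M \<Longrightarrow> norm (b x) \<le> C"
  shows "L2_tendsto M B b"
proof -
  interpret finite_measure M by fact
  have "L2_tendsto M (\<lambda>n x. 1) (\<lambda>x. 1)" by (rule L2_tendsto_const) (simp add: sq_integrable_def)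
  from L2_tendsto_uniform_mult[OF this assms(2-6)] show ?thesis by simp
qed

abbreviation "lborel_on K \<equiv> restrict_space lborel (K :: complex set)"

lemma finite_measure_lborel_on: "compact K \<Longrightarrow> finite_measure (lborel_on K)"
  by (rule finite_measureI)
     (auto simp: emeasure_restrict_space space_restrict_space compact_imp_closed less_top[symmetric]
       dest!: compact_imp_bounded emeasure_bounded_finite)

lemma integral_lborel_on:
  fixes F :: "complex \<Rightarrow> 'b::{banach, second_countable_topology}"
  assumes "closed K" "\<And>z. z \<notin> K \<Longrightarrow> F z = 0"
  shows "(\<integral>z. F z \<partial>lborel_on K) = (\<integral>z. F z \<partial>lborel)"
    "integrable (lborel_on K) F \<longleftrightarrow> integrable lborel F"
proof -
  have "(\<lambda>x. indicator K x *\<^sub>R F x) = F"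
    using assms(2) by (auto simp: fun_eq_iff indicator_def)
  then show "(\<integral>z. F z \<partial>lborel_on K) = (\<integral>z. F z \<partial>lborel)"
    "integrable (lborel_on K) F \<longleftrightarrow> integrable lborel F"
    using assms(1) by (simp_all add: integral_restrict_space integrable_restrict_space)
qed

lemma sq_integrable_continuous_on:
  assumes "compact K" "continuous_on K u"
  shows "sq_integrable (lborel_on K) u"
proof -
  obtain B where "\<And>x. x \<in> K \<Longrightarrow> norm (u x) \<le> B"
    using compact_imp_bounded[OF compact_continuous_image[OF assms(2,1)]] by (auto simp: bounded_iff)
  moreover have "u \<in> borel_measurable (lborel_on K)"
    using borel_measurable_continuous_on_restrict[OF assms(2)]
    by (metis measurable_lborel1 measurable_restrict_space1 sets_lborel sets_restrict_space_cong measurable_cong_sets)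
  ultimately show ?thesis
    using sq_integrable_bounded[OF finite_measure_lborel_on[OF assms(1)]]
    by (auto simp: space_restrict_space)
qed

section \<open>Density of continuous functions\<close>

text \<open>A measurable function is an almost everywhere limit of continuous functions; truncation of these at the
  bound \<open>B\<close> allows dominated convergence.\<close>

lemma L2_density_bounded:
  assumes K: "compact K" and u: "sq_integrable (lborel_on K) u" and B: "B > 0" "\<And>z. z \<in> K \<Longrightarrow> norm (u z) \<le> B"
  shows "\<exists>H. (\<forall>n. continuous_on UNIV (H n)) \<and> L2_tendsto (lborel_on K) H u"
proof -
  have cl: "closed K" using K compact_imp_closed by blast
  interpret finite_measure "lborel_on K" by (rule finite_measure_lborel_on[OF K])
  define u' where "u' z = (if z \<in> K then u z else 0)" for z
  have mu: "u \<in> borel_measurable (lborel_on K)" using u sq_integrable_measurable by blast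
  have "(\<lambda>z. indicator K z *\<^sub>R u z) \<in> borel_measurable lborel"
    using mu cl by (subst (asm) borel_measurable_restrict_space_iff) auto
  also have "(\<lambda>z. indicator K z *\<^sub>R u z) = u'" by (auto simp: u'_def indicator_def)
  finally have "u' \<in> borel_measurable lebesgue" by (rule measurable_completion)
  then have "u' measurable_on UNIV"
    by (intro lebesgue_measurable_imp_measurable_on) auto
  then obtain N g where N: "negligible N" and g: "\<And>n::nat. continuous_on UNIV (g n)"
    and lim: "\<And>z. z \<notin> N \<Longrightarrow> (\<lambda>n. g n z) \<longlonglongrightarrow> u' z"
    by (auto simp: measurable_on_def)
  define c where "c z = (B / max B (norm z)) *\<^sub>R z" for z :: complex
  have cc: "continuous_on UNIV c"
    unfolding c_def using B by (auto intro!: continuous_intros)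
  have cb: "norm (c z) \<le> B" for z
    using B by (auto simp: c_def field_simps max_def)
  have cid: "c z = z" if "norm z \<le> B" for z
    using that B by (auto simp: c_def max_def)
  define H where "H n z = c (g n z)" for n z
  have Hc: "continuous_on UNIV (H n)" for n
    unfolding H_def by (rule continuous_on_compose2[OF cc g]) auto
  have Hs: "sq_integrable (lborel_on K) (H n)" for n
    by (rule sq_integrable_continuous_on[OF K continuous_on_subset[OF Hc]]) auto
  have "AE z in lborel. z \<notin> N"
    using N by (metis AE_completion_iff AE_not_in negligible_iff_null_sets)
  then have "AE z in lborel_on K. z \<notin> N"
    using cl by (auto simp: AE_restrict_space_iff)
  then have "AE z in lborel_on K. (\<lambda>n. (norm (H n z - u z))\<^sup>2) \<longlonglongrightarrow> 0"
  proof (rule AE_mp[OF _ AE_I2[OF impI]])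
    fix z assume z: "z \<in> space (lborel_on K)" "z \<notin> N"
    then have zK: "z \<in> K" by (auto simp: space_restrict_space)
    have "isCont c (u' z)" using cc continuous_on_eq_continuous_at by blast
    then have "(\<lambda>n. H n z) \<longlonglongrightarrow> c (u' z)"
      unfolding H_def using lim[OF z(2)] by (rule isCont_tendsto_compose)
    also have "c (u' z) = u z" using cid[OF B(2)[OF zK]] zK by (simp add: u'_def)
    finally show "(\<lambda>n. (norm (H n z - u z))\<^sup>2) \<longlonglongrightarrow> 0"
      by (auto intro!: tendsto_eq_intros)
  qed
  then have "(\<lambda>n. \<integral>z. (norm (H n z - u z))\<^sup>2 \<partial>lborel_on K) \<longlonglongrightarrow> (\<integral>z. 0 \<partial>lborel_on K)"
  proof (rule integral_dominated_convergence[rotated 3])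
    show "integrable (lborel_on K) (\<lambda>z. (2 * B)\<^sup>2)" by simp
    show "(\<lambda>z. (norm (H n z - u z))\<^sup>2) \<in> borel_measurable (lborel_on K)" for n
      using sq_integrable_diff[OF Hs u] by (auto simp: sq_integrable_def)
    show "AE z in lborel_on K. norm ((norm (H n z - u z))\<^sup>2) \<le> (2 * B)\<^sup>2" for n
    proof (rule AE_I2)
      fix z assume "z \<in> space (lborel_on K)"
      then have "norm (u z) \<le> B" using B(2) by (auto simp: space_restrict_space)
      then have "norm (H n z - u z) \<le> 2 * B"
        using cb[of "g n z"] norm_triangle_ineq4[of "H n z" "u z"] by (simp add: H_def)
      then have "(norm (H n z - u z))\<^sup>2 \<le> (2 * B)\<^sup>2"
        by (intro power_mono) auto
      then show "norm ((norm (H n z - u z))\<^sup>2) \<le> (2 * B)\<^sup>2"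
        by simp
    qed
  qed auto
  then have "L2_tendsto (lborel_on K) H u"
    using u Hs by (simp add: L2_tendsto_def)
  then show ?thesis using Hc by blast
qed

text \<open>Truncation at a high level reduces the claim to bounded functions.\<close>

lemma L2_density:
  assumes K: "compact K" and u: "sq_integrable (lborel_on K) u" and e: "e > 0"
  obtains h where "continuous_on UNIV h" "(\<integral>z. (norm (h z - u z))\<^sup>2 \<partial>lborel_on K) < e"
proof -
  interpret finite_measure "lborel_on K" by (rule finite_measure_lborel_on[OF K])
  define c where "c k z = (real (Suc k) / max (real (Suc k)) (norm z)) *\<^sub>R z" for k and z :: complex
  have cc: "continuous_on UNIV (c k)" for k
    unfolding c_def by (auto intro!: continuous_intros)
  have cb: "norm (c k z) \<le> real (Suc k)" for k z
  proof -
    have "norm z / max (real (Suc k)) (norm z) \<le> 1" by (simp add: divide_simps)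
    then have "real (Suc k) * (norm z / max (real (Suc k)) (norm z)) \<le> real (Suc k) * 1"
      by (intro mult_left_mono) auto
    then show ?thesis by (simp add: c_def)
  qed
  have cd: "norm (c k z - z) \<le> norm z" for k z
  proof -
    define t where "t = real (Suc k) / max (real (Suc k)) (norm z)"
    have t: "0 \<le> t" "t \<le> 1" by (auto simp: t_def divide_simps)
    have "norm (c k z - z) = norm ((t - 1) *\<^sub>R z)" by (simp add: c_def t_def algebra_simps)
    also have "\<dots> \<le> norm z" using t by (simp add: mult_left_le_one_le)
    finally show ?thesis .
  qed
  have clim: "(\<lambda>k. c k z) \<longlonglongrightarrow> z" for z
  proof (rule tendsto_eventually)
    have "eventually (\<lambda>k. k \<ge> nat \<lceil>norm z\<rceil>) sequentially" by (rule eventually_ge_at_top)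
    then show "eventually (\<lambda>k. c k z = z) sequentially"
    proof eventually_elim
      case (elim k)
      then have "norm z \<le> real (Suc k)" by linarith
      then show ?case by (simp add: c_def max_def)
    qed
  qed
  have mu[measurable]: "u \<in> borel_measurable (lborel_on K)" using u sq_integrable_measurable by blast
  have cm: "(\<lambda>z. c k (u z)) \<in> borel_measurable (lborel_on K)" for k
    by (rule measurable_compose[OF mu borel_measurable_continuous_onI[OF cc]])
  have cu: "sq_integrable (lborel_on K) (\<lambda>z. c k (u z))" for k
    by (rule sq_integrable_bounded[OF finite_measure_axioms cm]) (use cb in auto)
  have "(\<lambda>k. \<integral>z. (norm (c k (u z) - u z))\<^sup>2 \<partial>lborel_on K) \<longlonglongrightarrow> (\<integral>z. 0 \<partial>lborel_on K)"
  proof (rule integral_dominated_convergence)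
    show "integrable (lborel_on K) (\<lambda>z. (norm (u z))\<^sup>2)" using u by (simp add: sq_integrable_def)
    show "(\<lambda>z. (norm (c k (u z) - u z))\<^sup>2) \<in> borel_measurable (lborel_on K)" for k
      using sq_integrable_diff[OF cu u] by (auto simp: sq_integrable_def)
    show "AE z in lborel_on K. (\<lambda>k. (norm (c k (u z) - u z))\<^sup>2) \<longlonglongrightarrow> 0"
    proof (rule AE_I2)
      fix z
      have "(\<lambda>k. (norm (c k (u z) - u z))\<^sup>2) \<longlonglongrightarrow> (norm (u z - u z))\<^sup>2"
        by (intro tendsto_intros clim)
      then show "(\<lambda>k. (norm (c k (u z) - u z))\<^sup>2) \<longlonglongrightarrow> 0" by simp
    qed
    show "AE z in lborel_on K. norm ((norm (c k (u z) - u z))\<^sup>2) \<le> (norm (u z))\<^sup>2" for k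
      using cd by (auto intro!: power_mono)
  qed auto
  then have "eventually (\<lambda>k. (\<integral>z. (norm (c k (u z) - u z))\<^sup>2 \<partial>lborel_on K) < e / 4) sequentially"
    using e by (intro order_tendstoD(2)[where a="e/4"]) auto
  then obtain k where k: "(\<integral>z. (norm (c k (u z) - u z))\<^sup>2 \<partial>lborel_on K) < e / 4"
    by (auto simp: eventually_sequentially)
  obtain H where H: "\<And>n. continuous_on UNIV (H n)" "L2_tendsto (lborel_on K) H (\<lambda>z. c k (u z))"
    using L2_density_bounded[OF K cu[of k], of "real (Suc k)"] cb by (meson of_nat_0_less_iff zero_less_Suc)
  have "eventually (\<lambda>n. (\<integral>z. (norm (H n z - c k (u z)))\<^sup>2 \<partial>lborel_on K) < e / 4) sequentially"
    using e H(2) by (intro order_tendstoD(2)[where a="e/4"]) (auto simp: L2_tendsto_def)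
  then obtain n where n: "(\<integral>z. (norm (H n z - c k (u z)))\<^sup>2 \<partial>lborel_on K) < e / 4"
    by (auto simp: eventually_sequentially)
  have Hs: "sq_integrable (lborel_on K) (H n)" using H(2) by (simp add: L2_tendsto_def)
  have i: "integrable (lborel_on K) (\<lambda>z. (norm (H n z - c k (u z)))\<^sup>2)"
    "integrable (lborel_on K) (\<lambda>z. (norm (c k (u z) - u z))\<^sup>2)"
    "integrable (lborel_on K) (\<lambda>z. (norm (H n z - u z))\<^sup>2)"
    using sq_integrable_diff[OF Hs cu] sq_integrable_diff[OF cu u] sq_integrable_diff[OF Hs u]
    by (auto simp: sq_integrable_def)
  have "(\<integral>z. (norm (H n z - u z))\<^sup>2 \<partial>lborel_on K)
     \<le> (\<integral>z. 2 * (norm (H n z - c k (u z)))\<^sup>2 + 2 * (norm (c k (u z) - u z))\<^sup>2 \<partial>lborel_on K)"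
    using i norm_add_square_le[of "H n z - c k (u z)" "c k (u z) - u z" for z]
    by (intro integral_mono) auto
  also have "\<dots> = 2 * (\<integral>z. (norm (H n z - c k (u z)))\<^sup>2 \<partial>lborel_on K) + 2 * (\<integral>z. (norm (c k (u z) - u z))\<^sup>2 \<partial>lborel_on K)"
    using i by simp
  also have "\<dots> < e" using k n by simp
  finally show ?thesis using that H(1) by blast
qed

section \<open>Mollifiers and convolution\<close>

lemma max_power_has_derivative:
  assumes "n \<ge> 2"
  shows "((\<lambda>t::real. max 0 t ^ n) has_real_derivative real n * max 0 t ^ (n - 1)) (at t)"
proof -
  consider "t < 0" | "t > 0" | "t = 0" by linarith
  then show ?thesis
  proof cases
    case 1
    have "((\<lambda>t::real. 0) has_real_derivative 0) (at t)" by simp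
    then have "((\<lambda>t::real. max 0 t ^ n) has_real_derivative 0) (at t)"
      by (rule has_field_derivative_transform_within_open[where S="{..<0}"]) (use 1 assms in auto)
    then show ?thesis using 1 assms by (simp add: power_0_left)
  next
    case 2
    have "((\<lambda>t::real. t ^ n) has_real_derivative real n * t ^ (n - 1)) (at t)"
      by (auto intro!: derivative_eq_intros)
    then have "((\<lambda>t::real. max 0 t ^ n) has_real_derivative real n * t ^ (n - 1)) (at t)"
      by (rule has_field_derivative_transform_within_open[where S="{0<..}"]) (use 2 in auto)
    then show ?thesis using 2 by simp
  next
    case 3
    have "\<exists>g. (\<forall>z. max 0 z ^ n - max 0 0 ^ n = g z * (z - 0)) \<and> isCont g 0 \<and> g 0 = (0::real)"
    proof (intro exI[of _ "\<lambda>z. max 0 z ^ (n - 1)"] conjI allI)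
      show "max 0 z ^ n - max 0 0 ^ n = max 0 z ^ (n - 1) * (z - 0)" for z :: real
        using assms by (cases "z > 0") (auto simp: power_eq_if[of z n] max_def power_0_left)
      show "isCont (\<lambda>z::real. max 0 z ^ (n - 1)) 0" by (intro continuous_intros)
    qed (use assms in auto)
    then have "((\<lambda>t::real. max 0 t ^ n) has_real_derivative 0) (at 0)"
      by (subst DERIV_caratheodory_within)
    then show ?thesis using 3 assms by (simp add: power_0_left)
  qed
qed

text \<open>Raised to the third power this becomes twice continuously differentiable while remaining a
  polynomial on its support, so its derivatives can be written down.\<close>

definition bump :: "real \<Rightarrow> complex \<Rightarrow> real"
  where "bump e z = max 0 (e\<^sup>2 - (norm z)\<^sup>2)"

lemma bump_nonneg: "bump e z \<ge> 0" by (simp add: bump_def)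

lemma bump_eq_0: "e \<ge> 0 \<Longrightarrow> norm z \<ge> e \<Longrightarrow> bump e z = 0"
  by (simp add: bump_def power_mono)

lemma continuous_bump: "continuous_on UNIV (bump e)"
  unfolding bump_def by (intro continuous_intros)

lemma c1_bump_power:
  assumes "n \<ge> 2"
  shows "c1_on UNIV (\<lambda>z. of_real (bump e z ^ n)) (\<lambda>z. of_real (- 2 * real n * Re z * bump e z ^ (n - 1)))
     (\<lambda>z. of_real (- 2 * real n * Im z * bump e z ^ (n - 1)))"
  unfolding c1_on_def
proof (intro conjI ballI)
  fix z :: complex
  have 1: "((\<lambda>z. e\<^sup>2 - (norm z)\<^sup>2) has_derivative (\<lambda>h. - (2 * (Re z * Re h + Im z * Im h)))) (at z)"
    unfolding cmod_power2 by (auto intro!: derivative_eq_intros)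
  have 2: "((\<lambda>t. max 0 t ^ n) has_derivative (\<lambda>h. h * (real n * max 0 (e\<^sup>2 - (norm z)\<^sup>2) ^ (n - 1)))) (at (e\<^sup>2 - (norm z)\<^sup>2))"
    using max_power_has_derivative[OF assms] by (simp add: has_field_derivative_def mult.commute[of _ "real n * _"])
  have "((\<lambda>z. bump e z ^ n) has_derivative (\<lambda>h. - (2 * (Re z * Re h + Im z * Im h)) * (real n * bump e z ^ (n - 1)))) (at z)"
    using has_derivative_compose[OF 1 2] by (simp add: bump_def)
  from has_derivative_of_real[OF this]
  show "((\<lambda>z. of_real (bump e z ^ n)) has_derivative (\<lambda>h. of_real (Re h) * of_real (- 2 * real n * Re z * bump e z ^ (n - 1)) + of_real (Im h) * of_real (- 2 * real n * Im z * bump e z ^ (n - 1)))) (at z)"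
    by (rule has_derivative_eq_rhs) (simp add: fun_eq_iff algebra_simps)
qed (intro continuous_intros continuous_on_subset[OF continuous_bump] subset_UNIV)+


definition bump_mass :: "real \<Rightarrow> real"
  where "bump_mass e = (\<integral>z. bump e z ^ 3 \<partial>lborel)"

lemma bump_mass_pos:
  assumes "e > 0"
  shows "bump_mass e > 0" "integrable lborel (\<lambda>z. bump e z ^ 3)"
proof -
  show i: "integrable lborel (\<lambda>z. bump e z ^ 3)"
    by (rule integrable_continuous_support[of _ e])
       (use assms bump_eq_0[of e] in \<open>auto intro!: continuous_intros continuous_on_subset[OF continuous_bump]\<close>)
  have "bump_mass e \<noteq> 0"
  proof
    assume "bump_mass e = 0"
    then have "AE z in lborel. bump e z ^ 3 = 0"
      unfolding bump_mass_def using integral_nonneg_eq_0_iff_AE[OF i] bump_nonneg by auto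
    then have "AE z in lborel. z \<notin> ball (0::complex) e"
    proof eventually_elim
      case (elim z)
      then have "e\<^sup>2 \<le> (norm z)\<^sup>2" by (auto simp: bump_def max_def split: if_splits)
      then show ?case using assms by (simp add: power2_le_iff_abs_le)
    qed
    then have "emeasure lborel (ball (0::complex) e) = 0"
      by (subst (asm) AE_iff_measurable[where N="ball 0 e"]) auto
    then have "\<not> (open (ball (0::complex) e) \<and> ball (0::complex) e \<noteq> {})"
      by (metis open_not_negligible negligible_iff_null_sets null_setsI null_sets_completionI sets_lborel borel_open)
    then show False using assms by simp
  qed
  moreover have "bump_mass e \<ge> 0" unfolding bump_mass_def by (intro integral_nonneg_AE) (auto simp: bump_nonneg)
  ultimately show "bump_mass e > 0" by simp
qed

definition mollifier :: "real \<Rightarrow> complex \<Rightarrow> complex"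
  where "mollifier e z = of_real (bump e z ^ 3 / bump_mass e)"

definition mollifier_x :: "real \<Rightarrow> complex \<Rightarrow> complex"
  where "mollifier_x e z = of_real (- 6 * Re z * bump e z ^ 2 / bump_mass e)"

definition mollifier_y :: "real \<Rightarrow> complex \<Rightarrow> complex"
  where "mollifier_y e z = of_real (- 6 * Im z * bump e z ^ 2 / bump_mass e)"

lemma c1_mollifier: "c1_on UNIV (mollifier e) (mollifier_x e) (mollifier_y e)"
  by (rule c1_on_cong[OF c1_on_cmult[OF c1_bump_power[of 3 e], of "of_real (1 / bump_mass e)"]])
     (auto simp: mollifier_def mollifier_x_def mollifier_y_def)

lemma c2_mollifier:
  obtains kxx kxy kyy where "c1_on UNIV (mollifier_x e) kxx kxy" "c1_on UNIV (mollifier_y e) kxy kyy"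
    "continuous_on UNIV kxx" "continuous_on UNIV kxy" "continuous_on UNIV kyy"
proof -
  let ?c = "of_real (- 6 / bump_mass e) :: complex"
  note b = c1_bump_power[of 2 e, simplified]
  note X = c1_on_cmult[OF c1_on_mult[OF c1_on_Re b], of ?c]
  note Y = c1_on_cmult[OF c1_on_mult[OF c1_on_Im b], of ?c]
  have x: "c1_on UNIV (mollifier_x e) (\<lambda>z. ?c * (1 * (of_real (bump e z))\<^sup>2 + of_real (Re z) * - (4 * of_real (Re z) * of_real (bump e z))))
     (\<lambda>z. ?c * (- 4 * of_real (Re z) * of_real (Im z) * of_real (bump e z)))"
    by (rule c1_on_cong[OF X]) (auto simp: mollifier_x_def algebra_simps)
  have y: "c1_on UNIV (mollifier_y e) (\<lambda>z. ?c * (- 4 * of_real (Re z) * of_real (Im z) * of_real (bump e z)))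
     (\<lambda>z. ?c * (1 * (of_real (bump e z))\<^sup>2 + of_real (Im z) * - (4 * of_real (Im z) * of_real (bump e z))))"
    by (rule c1_on_cong[OF Y]) (auto simp: mollifier_y_def algebra_simps)
  show ?thesis using that[OF x y] c1_onD(2,3)[OF x] c1_onD(3)[OF y] by blast
qed

lemma mollifier_eq_0: "e \<ge> 0 \<Longrightarrow> norm z \<ge> e \<Longrightarrow> mollifier e z = 0"
  by (simp add: mollifier_def bump_eq_0)

definition convolve :: "(complex \<Rightarrow> complex) \<Rightarrow> (complex \<Rightarrow> complex) \<Rightarrow> complex \<Rightarrow> complex"
  where "convolve k u z = (\<integral>v. k (z - v) * u v \<partial>lborel)"

text \<open>For \<open>z\<close> near a given point the kernel confines the integral to one bounded box, where the Leibniz rule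
  applies.\<close>

lemma c1_convolve:
  assumes k: "c1_on UNIV k kx ky" and supp: "\<And>z. norm z > r \<Longrightarrow> k z = 0"
    and f: "continuous_on UNIV f"
  shows "c1_on UNIV (convolve k f) (convolve kx f) (convolve ky f)"
proof -
  define BR where "BR = Blinfun (\<lambda>h. of_real (Re h) :: complex)"
  define BI where "BI = Blinfun (\<lambda>h. of_real (Im h) :: complex)"
  have BR: "blinfun_apply BR = (\<lambda>h. of_real (Re h))"
    unfolding BR_def by (rule bounded_linear_Blinfun_apply)
      (intro bounded_linear_compose[OF bounded_linear_of_real] bounded_linear_Re)
  have BI: "blinfun_apply BI = (\<lambda>h. of_real (Im h))"
    unfolding BI_def by (rule bounded_linear_Blinfun_apply)
      (intro bounded_linear_compose[OF bounded_linear_of_real] bounded_linear_Im)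
  define fx where "fx z v = (blinfun_mult_left (kx (z - v) * f v) o\<^sub>L BR) + (blinfun_mult_left (ky (z - v) * f v) o\<^sub>L BI)" for z v
  have fx: "blinfun_apply (fx z v) h = of_real (Re h) * (kx (z - v) * f v) + of_real (Im h) * (ky (z - v) * f v)" for z v h
    by (simp add: fx_def blinfun.add_left BR BI)
  note ck = c1_on_continuous[OF k] c1_onD(2,3)[OF k]
  have k0: "k z = 0 \<and> kx z = 0 \<and> ky z = 0" if "norm z > r" for z
    using c1_on_vanish[OF k, of "- cball 0 r" z] supp that by auto
  have main: "(convolve k f has_derivative (\<lambda>h. of_real (Re h) * convolve kx f z0 + of_real (Im h) * convolve ky f z0)) (at z0) \<and>
     continuous_on (cball z0 1) (convolve kx f) \<and> continuous_on (cball z0 1) (convolve ky f)" for z0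
  proof -
    obtain a b where ab: "cball (0::complex) (norm z0 + 1 + \<bar>r\<bar>) \<subseteq> cbox a b"
      using bounded_subset_cbox_symmetric[OF bounded_cball] by blast
    have out: "norm (z - v) > r" if "v \<notin> cbox a b" "z \<in> cball z0 1" for z v
    proof -
      have "norm v > norm z0 + 1 + \<bar>r\<bar>" using ab that by (meson linorder_not_less mem_cball_0 subsetD)
      moreover have "norm v \<le> norm z + norm (z - v)" by (metis norm_triangle_sub norm_minus_commute)
      moreover have "norm z \<le> norm z0 + 1" using that(2) norm_triangle_sub[of z z0] by (simp add: dist_norm norm_minus_commute)
      ultimately show ?thesis by linarith
    qed
    have cont: "continuous_on UNIV (\<lambda>v. q (z - v) * f v)" if "continuous_on UNIV q" for q z
      by (intro continuous_intros f continuous_on_compose2[OF that]) auto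
    have conv: "convolve q f z = integral (cbox a b) (\<lambda>v. q (z - v) * f v)"
      if "z \<in> cball z0 1" "continuous_on UNIV q" "\<And>z. norm z > r \<Longrightarrow> q z = 0" for q z
      unfolding convolve_def
      by (rule integral_cbox_eq_lborel[symmetric]) (use that out cont in auto)
    have cont2: "continuous_on (U \<times> cbox a b) (\<lambda>(z, v). q (z - v) * f v)" if "continuous_on UNIV q" for q U
      unfolding split_beta by (intro continuous_intros continuous_on_compose2[OF that] continuous_on_compose2[OF f]) auto
    have "((\<lambda>z. integral (cbox a b) (\<lambda>v. k (z - v) * f v)) has_derivative integral (cbox a b) (fx z0)) (at z0 within cball z0 1)"
    proof (rule leibniz_rule)
      fix z v assume "z \<in> cball z0 1" "v \<in> cbox a b"
      have "((\<lambda>z. k (z - v)) has_derivative (\<lambda>h. of_real (Re h) * kx (z - v) + of_real (Im h) * ky (z - v))) (at z within cball z0 1)"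
        by (rule has_derivative_compose[OF _ c1_onD(1)[OF k]]) (auto intro!: derivative_eq_intros)
      from has_derivative_mult_left[OF this, of "f v"]
      show "((\<lambda>z. k (z - v) * f v) has_derivative blinfun_apply (fx z v)) (at z within cball z0 1)"
        by (rule has_derivative_eq_rhs) (simp add: fun_eq_iff fx algebra_simps)
    next
      fix z show "(\<lambda>v. k (z - v) * f v) integrable_on cbox a b"
        by (rule integrable_continuous[OF continuous_on_subset[OF cont[OF ck(1)]]]) auto
    next
      show "continuous_on (cball z0 1 \<times> cbox a b) (\<lambda>(z, v). fx z v)"
        unfolding fx_def split_beta
        by (intro continuous_intros bounded_bilinear.continuous_on[OF bounded_bilinear_blinfun_compose]
            bounded_linear.continuous_on[OF bounded_linear_blinfun_mult_left]
            continuous_on_compose2[OF ck(2)] continuous_on_compose2[OF ck(3)] continuous_on_compose2[OF f]) auto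
    qed auto
    then have "((\<lambda>z. integral (cbox a b) (\<lambda>v. k (z - v) * f v)) has_derivative integral (cbox a b) (fx z0)) (at z0)"
      using at_within_interior[of z0 "cball z0 1"] by simp
    then have "(convolve k f has_derivative integral (cbox a b) (fx z0)) (at z0)"
      by (rule has_derivative_transform_within_open[where s="ball z0 1"])
         (use conv[OF _ ck(1)] k0 in auto)
    moreover have "blinfun_apply (integral (cbox a b) (fx z0)) h = of_real (Re h) * convolve kx f z0 + of_real (Im h) * convolve ky f z0" for h
    proof -
      have "fx z0 integrable_on cbox a b"
        unfolding fx_def
        by (intro integrable_continuous continuous_intros bounded_bilinear.continuous_on[OF bounded_bilinear_blinfun_compose]
            bounded_linear.continuous_on[OF bounded_linear_blinfun_mult_left] continuous_on_subset[OF cont[OF ck(2)]] continuous_on_subset[OF cont[OF ck(3)]]) auto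
      then have "blinfun_apply (integral (cbox a b) (fx z0)) h = integral (cbox a b) (\<lambda>v. blinfun_apply (fx z0 v) h)"
        using integral_linear[OF _ blinfun.bounded_linear_left[of h], of "fx z0" "cbox a b"] by (simp add: o_def)
      also have "\<dots> = integral (cbox a b) (\<lambda>v. of_real (Re h) * (kx (z0 - v) * f v)) + integral (cbox a b) (\<lambda>v. of_real (Im h) * (ky (z0 - v) * f v))"
        unfolding fx
        by (intro Henstock_Kurzweil_Integration.integral_add integrable_continuous continuous_intros continuous_on_subset[OF cont[OF ck(2)]] continuous_on_subset[OF cont[OF ck(3)]]) auto
      finally show ?thesis using conv[OF _ ck(2), of z0] conv[OF _ ck(3), of z0] k0 by simp
    qed
    moreover have "continuous_on (cball z0 1) (convolve q f)" if "continuous_on UNIV q" "\<And>z. norm z > r \<Longrightarrow> q z = 0" for q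
    proof -
      have "continuous_on (cball z0 1) (\<lambda>z. integral (cbox a b) (\<lambda>v. q (z - v) * f v))"
        by (rule integral_continuous_on_param[OF cont2[OF that(1)]])
      then show ?thesis by (rule continuous_on_eq) (use conv that in auto)
    qed
    ultimately show ?thesis using ck k0 by (auto simp flip: fun_eq_iff elim!: has_derivative_eq_rhs)
  qed
  have "isCont (convolve kx f) z0" "isCont (convolve ky f) z0" for z0
    using main[of z0] by (auto intro: continuous_on_interior)
  then show ?thesis using main by (auto simp: c1_on_def intro: continuous_at_imp_continuous_on)
qed

section \<open>Convergence of mollifications\<close>

abbreviation mollify :: "real \<Rightarrow> (complex \<Rightarrow> complex) \<Rightarrow> complex \<Rightarrow> complex"
  where "mollify e \<equiv> convolve (mollifier e)"

text \<open>Borel measurability, rather than measurability for the completed measure, keeps products and convolutions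
  measurable on product spaces.\<close>

definition locally_sq_integrable :: "(complex \<Rightarrow> complex) \<Rightarrow> bool"
  where "locally_sq_integrable u \<longleftrightarrow> u \<in> borel_measurable borel \<and> (\<forall>R. sq_integrable (lborel_on (cball 0 R)) u)"

lemma locally_sq_integrable_continuous: "continuous_on UNIV u \<Longrightarrow> locally_sq_integrable u"
  unfolding locally_sq_integrable_def
  by (auto intro!: borel_measurable_continuous_onI sq_integrable_continuous_on intro: continuous_on_subset)

lemma locally_sq_integrable_diff:
  "locally_sq_integrable u \<Longrightarrow> locally_sq_integrable v \<Longrightarrow> locally_sq_integrable (\<lambda>z. u z - v z)"
  unfolding locally_sq_integrable_def by (auto intro: sq_integrable_diff)

lemma continuous_mollifier: "continuous_on UNIV (mollifier e)"
  using c1_on_continuous[OF c1_mollifier] .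

lemma mollifier_measurable [measurable]: "mollifier e \<in> borel_measurable borel"
  using continuous_mollifier by (rule borel_measurable_continuous_onI)

lemma norm_mollifier: "e > 0 \<Longrightarrow> norm (mollifier e z) = bump e z ^ 3 / bump_mass e"
  using bump_mass_pos(1)[of e] by (simp add: mollifier_def bump_nonneg norm_divide norm_power)

lemma nn_integral_mollifier:
  assumes "e > 0"
  shows "(\<integral>\<^sup>+z. ennreal (norm (mollifier e (z - v))) \<partial>lborel) = 1"
    "(\<integral>\<^sup>+v. ennreal (norm (mollifier e (z - v))) \<partial>lborel) = 1"
    "(\<integral>v. mollifier e (z - v) \<partial>lborel) = 1"
    "integrable lborel (\<lambda>v. mollifier e (z - v))"
    "(\<integral>v. norm (mollifier e (z - v)) \<partial>lborel) = 1"
proof -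
  have sym: "mollifier e (- z) = mollifier e z" for z by (simp add: mollifier_def bump_def)
  have i: "integrable lborel (mollifier e)" and I: "(\<integral>z. mollifier e z \<partial>lborel) = 1"
    using bump_mass_pos[OF assms] unfolding mollifier_def
    by (auto simp: bump_mass_def of_real_divide[symmetric] simp del: of_real_divide)
  have N: "(\<integral>\<^sup>+z. ennreal (norm (mollifier e z)) \<partial>lborel) = 1"
  proof -
    have "(\<integral>z. norm (mollifier e z) \<partial>lborel) = 1"
      using bump_mass_pos[OF assms] by (simp add: norm_mollifier[OF assms] bump_mass_def)
    then show ?thesis using nn_integral_eq_integral[OF integrable_norm[OF i]] by simp
  qed
  have T: "(\<integral>\<^sup>+z. F (c + z) \<partial>lborel) = (\<integral>\<^sup>+z. F z \<partial>lborel)"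
    if [measurable]: "F \<in> borel_measurable borel" for F :: "complex \<Rightarrow> ennreal" and c
    using nn_integral_distr[of "(+) c" lborel borel F] by (simp add: lborel_distr_plus)
  show 1: "(\<integral>\<^sup>+z. ennreal (norm (mollifier e (z - v))) \<partial>lborel) = 1" for v
    using T[of "\<lambda>z. ennreal (norm (mollifier e z))" "- v"] N by simp
  have s: "mollifier e (z - v) = mollifier e (- z + v)" for v z
    using sym[of "z - v"] by simp
  show 2: "(\<integral>\<^sup>+v. ennreal (norm (mollifier e (z - v))) \<partial>lborel) = 1"
    unfolding s using T[of "\<lambda>z. ennreal (norm (mollifier e z))" "- z"] N by simp
  show "(\<integral>v. mollifier e (z - v) \<partial>lborel) = 1"
    unfolding s using lborel_integral_translate[of "mollifier e" "- z"] I by simp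
  show i2: "integrable lborel (\<lambda>v. mollifier e (z - v))"
  proof (rule integrable_continuous_support[of _ "norm z + e"])
    show "continuous_on UNIV (\<lambda>v. mollifier e (z - v))"
      by (auto intro!: continuous_on_compose2[OF continuous_mollifier] continuous_intros)
    fix v :: complex assume "norm z + e < norm v"
    then show "mollifier e (z - v) = 0"
      using norm_triangle_ineq2[of v z] assms by (intro mollifier_eq_0) (auto simp: norm_minus_commute)
  qed
  have "(\<integral>v. norm (mollifier e (z - v)) \<partial>lborel) = enn2real (\<integral>\<^sup>+v. ennreal (norm (mollifier e (z - v))) \<partial>lborel)"
    by (rule integral_eq_nn_integral) auto
  then show "(\<integral>v. norm (mollifier e (z - v)) \<partial>lborel) = 1"
    unfolding 2 by simp
qed

lemma mollify_integrable:
  assumes "locally_sq_integrable u" "e > 0"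
  shows "integrable lborel (\<lambda>v. mollifier e (z - v) * u v)"
proof -
  define R where "R = norm z + e"
  have s: "sq_integrable (lborel_on (cball 0 R)) u" using assms by (simp add: locally_sq_integrable_def)
  have "sq_integrable (lborel_on (cball 0 R)) (\<lambda>v. mollifier e (z - v))"
    by (rule sq_integrable_continuous_on) (auto intro!: continuous_on_compose2[OF continuous_mollifier] continuous_intros)
  from sq_integrable_mult_integrable[OF this s]
  have "integrable (lborel_on (cball 0 R)) (\<lambda>v. mollifier e (z - v) * u v)" .
  moreover have "mollifier e (z - v) * u v = 0" if "v \<notin> cball 0 R" for v
  proof -
    have "norm v \<le> norm z + norm (z - v)" by (metis norm_triangle_sub norm_minus_commute)
    then show ?thesis using that mollifier_eq_0[of e "z - v"] assms(2) by (auto simp: R_def)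
  qed
  ultimately show ?thesis using integral_lborel_on(2)[of "cball 0 R" "\<lambda>v. mollifier e (z - v) * u v"] by auto
qed

lemma mollify_diff:
  assumes "locally_sq_integrable u" "locally_sq_integrable v" "e > 0"
  shows "mollify e (\<lambda>z. u z - v z) z = mollify e u z - mollify e v z"
  unfolding convolve_def using mollify_integrable[OF assms(1,3), of z] mollify_integrable[OF assms(2,3), of z]
  by (simp add: right_diff_distrib)

lemma mollify_measurable:
  assumes [measurable]: "u \<in> borel_measurable borel"
  shows "mollify e u \<in> borel_measurable borel"
proof -
  have "(\<lambda>z. \<integral>v. mollifier e (z - v) * u v \<partial>lborel) \<in> borel_measurable borel"
    by measurable
  then show ?thesis by (simp add: convolve_def[abs_def])
qed

text \<open>The Cauchy-Schwarz inequality for the probability density \<open>mollifier e (z - v)\<close>, followed by Tonelli's theorem.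
  The radius grows by one because the kernel has support in the unit disk.\<close>

lemma mollify_L2_bound:
  assumes u: "locally_sq_integrable u" and e: "0 < e" "e \<le> 1"
  shows "sq_integrable (lborel_on (cball 0 R)) (mollify e u)"
    "(\<integral>z. (norm (mollify e u z))\<^sup>2 \<partial>lborel_on (cball 0 R)) \<le> (\<integral>z. (norm (u z))\<^sup>2 \<partial>lborel_on (cball 0 (R + 1)))"
proof -
  have um[measurable]: "u \<in> borel_measurable borel" using u by (simp add: locally_sq_integrable_def)
  note mm[measurable] = mollify_measurable[OF um, of e]
  let ?k = "\<lambda>z v. norm (mollifier e (z - v))"
  have pt: "ennreal ((norm (mollify e u z))\<^sup>2) * indicator (cball 0 R) z
     \<le> (\<integral>\<^sup>+v. ennreal (?k z v) * (ennreal ((norm (u v))\<^sup>2) * indicator (cball 0 (R + 1)) v) \<partial>lborel)" for z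
  proof (cases "z \<in> cball 0 R")
    case True
    have "ennreal (norm (mollify e u z)) \<le> (\<integral>\<^sup>+v. ennreal (norm (mollifier e (z - v) * u v)) \<partial>lborel)"
      unfolding convolve_def by (rule integral_norm_bound_ennreal[OF mollify_integrable[OF u e(1)]])
    also have "\<dots> = (\<integral>\<^sup>+v. ennreal (sqrt (?k z v)) * ennreal (sqrt (?k z v) * norm (u v)) \<partial>lborel)"
      by (intro nn_integral_cong) (simp add: norm_mult flip: ennreal_mult mult.assoc)
    finally have "ennreal (norm (mollify e u z)) ^ 2 \<le> (\<integral>\<^sup>+v. ennreal (sqrt (?k z v)) * ennreal (sqrt (?k z v) * norm (u v)) \<partial>lborel)\<^sup>2"
      by (rule power_mono) auto
    also have "\<dots> \<le> (\<integral>\<^sup>+v. ennreal (sqrt (?k z v)) ^ 2 \<partial>lborel) * (\<integral>\<^sup>+v. ennreal (sqrt (?k z v) * norm (u v)) ^ 2 \<partial>lborel)"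
      by (rule Cauchy_Schwarz_nn_integral) auto
    also have "(\<integral>\<^sup>+v. ennreal (sqrt (?k z v)) ^ 2 \<partial>lborel) = 1"
      using nn_integral_mollifier(2)[OF e(1), of z] by (simp add: ennreal_power)
    also have "(\<integral>\<^sup>+v. ennreal (sqrt (?k z v) * norm (u v)) ^ 2 \<partial>lborel) =
       (\<integral>\<^sup>+v. ennreal (?k z v) * (ennreal ((norm (u v))\<^sup>2) * indicator (cball 0 (R + 1)) v) \<partial>lborel)"
    proof (intro nn_integral_cong)
      fix v :: complex
      show "ennreal (sqrt (?k z v) * norm (u v)) ^ 2 = ennreal (?k z v) * (ennreal ((norm (u v))\<^sup>2) * indicator (cball 0 (R + 1)) v)"
      proof (cases "v \<in> cball 0 (R + 1)")
        case True
        then show ?thesis by (simp add: ennreal_power power_mult_distrib flip: ennreal_mult)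
      next
        case False
        have "norm v \<le> norm z + norm (z - v)" by (metis norm_triangle_sub norm_minus_commute)
        then have "mollifier e (z - v) = 0" using False \<open>z \<in> cball 0 R\<close> e by (intro mollifier_eq_0) auto
        then show ?thesis by simp
      qed
    qed
    finally show ?thesis using True by (simp add: ennreal_power)
  qed simp
  have "(\<integral>\<^sup>+z. ennreal ((norm (mollify e u z))\<^sup>2) * indicator (cball 0 R) z \<partial>lborel)
     \<le> (\<integral>\<^sup>+z. \<integral>\<^sup>+v. ennreal (?k z v) * (ennreal ((norm (u v))\<^sup>2) * indicator (cball 0 (R + 1)) v) \<partial>lborel \<partial>lborel)"
    by (rule nn_integral_mono) (rule pt)
  also have "\<dots> = (\<integral>\<^sup>+v. \<integral>\<^sup>+z. ennreal (?k z v) * (ennreal ((norm (u v))\<^sup>2) * indicator (cball 0 (R + 1)) v) \<partial>lborel \<partial>lborel)"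
  proof (rule lborel_pair.Fubini'[symmetric])
    have [measurable]: "cball (0::complex) (R + 1) \<in> sets borel" by (intro borel_closed) auto
    define w where "w v = ennreal ((norm (u v))\<^sup>2) * indicator (cball 0 (R + 1)) v" for v
    have [measurable]: "w \<in> borel_measurable borel"
      unfolding w_def by measurable
    have "(\<lambda>(z, v). ennreal (?k z v) * w v) \<in> borel_measurable (lborel \<Otimes>\<^sub>M lborel)"
      by measurable
    then show "(\<lambda>(z, v). ennreal (?k z v) * (ennreal ((norm (u v))\<^sup>2) * indicator (cball 0 (R + 1)) v)) \<in> borel_measurable (lborel \<Otimes>\<^sub>M lborel)"
      by (simp add: w_def)
  qed
  also have "\<dots> = (\<integral>\<^sup>+v. ennreal ((norm (u v))\<^sup>2) * indicator (cball 0 (R + 1)) v \<partial>lborel)"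
    by (intro nn_integral_cong) (simp add: nn_integral_multc nn_integral_mollifier(1)[OF e(1)])
  finally have main: "(\<integral>\<^sup>+z. ennreal ((norm (mollify e u z))\<^sup>2) \<partial>lborel_on (cball 0 R))
     \<le> (\<integral>\<^sup>+v. ennreal ((norm (u v))\<^sup>2) \<partial>lborel_on (cball 0 (R + 1)))"
    by (simp add: nn_integral_restrict_space)
  have iu: "integrable (lborel_on (cball 0 (R + 1))) (\<lambda>v. (norm (u v))\<^sup>2)"
    using u by (simp add: locally_sq_integrable_def sq_integrable_def)
  note eu = nn_integral_eq_integral[OF iu, simplified]
  have mr: "mollify e u \<in> borel_measurable (lborel_on (cball 0 R))"
    by (intro measurable_restrict_space1) simp
  have i: "integrable (lborel_on (cball 0 R)) (\<lambda>z. (norm (mollify e u z))\<^sup>2)"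
  proof (rule integrableI_bounded)
    show "(\<lambda>z. (norm (mollify e u z))\<^sup>2) \<in> borel_measurable (lborel_on (cball 0 R))" using mr by measurable
    show "(\<integral>\<^sup>+z. ennreal (norm ((norm (mollify e u z))\<^sup>2)) \<partial>lborel_on (cball 0 R)) < \<infinity>"
      using le_less_trans[OF main] eu by simp
  qed
  then show "sq_integrable (lborel_on (cball 0 R)) (mollify e u)"
    using mr by (simp add: sq_integrable_def)
  show "(\<integral>z. (norm (mollify e u z))\<^sup>2 \<partial>lborel_on (cball 0 R)) \<le> (\<integral>z. (norm (u z))\<^sup>2 \<partial>lborel_on (cball 0 (R + 1)))"
    using main unfolding eu nn_integral_eq_integral[OF i, simplified] by simp
qed

lemma mollify_uniform_limit:
  assumes f: "continuous_on UNIV f"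
  shows "uniform_limit (cball 0 R) (\<lambda>n. mollify (1 / real (Suc n)) f) f sequentially"
proof (rule uniform_limitI)
  fix r :: real assume r: "r > 0"
  have "uniformly_continuous_on (cball 0 (R + 1)) f"
    by (rule compact_uniformly_continuous) (auto intro: continuous_on_subset[OF f])
  then obtain d where d: "d > 0" "\<And>x y. x \<in> cball 0 (R + 1) \<Longrightarrow> y \<in> cball 0 (R + 1) \<Longrightarrow> dist y x < d \<Longrightarrow> dist (f y) (f x) < r / 2"
    using r unfolding uniformly_continuous_on_def by (metis half_gt_zero)
  obtain N where N: "1 / real (Suc N) < d" using d(1) nat_approx_posE by blast
  show "\<forall>\<^sub>F n in sequentially. \<forall>z\<in>cball 0 R. dist (mollify (1 / real (Suc n)) f z) (f z) < r"
    unfolding eventually_sequentially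
  proof (intro exI allI impI ballI)
    fix n and z :: complex assume n: "n \<ge> N" and z: "z \<in> cball 0 R"
    define e where "e = 1 / real (Suc n)"
    have e: "0 < e" "e \<le> 1" "e < d"
    proof -
      have "e \<le> 1 / real (Suc N)" unfolding e_def using n by (intro frac_le) auto
      then show "e < d" using N by simp
    qed (auto simp: e_def)
    have "mollify e f z - f z = (\<integral>v. mollifier e (z - v) * f v \<partial>lborel) - (\<integral>v. mollifier e (z - v) * f z \<partial>lborel)"
      using nn_integral_mollifier(3,4)[OF e(1), of z] by (simp add: convolve_def)
    also have "\<dots> = (\<integral>v. mollifier e (z - v) * (f v - f z) \<partial>lborel)"
      using mollify_integrable[OF locally_sq_integrable_continuous[OF f] e(1), of z] nn_integral_mollifier(4)[OF e(1), of z]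
      by (subst Bochner_Integration.integral_diff[symmetric]) (auto simp: algebra_simps)
    also have "norm \<dots> \<le> (\<integral>v. norm (mollifier e (z - v)) * (r / 2) \<partial>lborel)"
    proof (rule Bochner_Integration.integral_norm_bound_integral)
      show "integrable lborel (\<lambda>v. mollifier e (z - v) * (f v - f z))"
        using Bochner_Integration.integrable_diff[OF mollify_integrable[OF locally_sq_integrable_continuous[OF f] e(1), of z]
            integrable_mult_left[OF nn_integral_mollifier(4)[OF e(1), of z], of "f z"]] by (simp add: algebra_simps)
      show "integrable lborel (\<lambda>v. norm (mollifier e (z - v)) * (r / 2))"
        using nn_integral_mollifier(4)[OF e(1), of z] by (intro integrable_mult_left integrable_norm)
      fix v :: complex
      show "norm (mollifier e (z - v) * (f v - f z)) \<le> norm (mollifier e (z - v)) * (r / 2)"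
      proof (cases "norm (z - v) \<ge> e")
        case True
        then show ?thesis using mollifier_eq_0[of e "z - v"] e by simp
      next
        case False
        have "norm v \<le> norm z + norm (z - v)" by (metis norm_triangle_sub norm_minus_commute)
        then have "dist (f v) (f z) < r / 2"
          using False z e by (intro d(2)) (auto simp: dist_norm norm_minus_commute)
        then show ?thesis
          using mult_left_mono[of "norm (f v - f z)" "r / 2" "norm (mollifier e (z - v))"] by (simp add: norm_mult dist_norm)
      qed
    qed
    also have "\<dots> = r / 2"
      using nn_integral_mollifier(5)[OF e(1), of z] by simp
    finally show "dist (mollify (1 / real (Suc n)) f z) (f z) < r"
      using r by (simp add: dist_norm e_def)
  qed
qed

text \<open>For continuous functions the convergence is locally uniform; the general case follows by density, as
  mollification is a contraction in mean square.\<close>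

lemma mollify_L2_tendsto:
  assumes u: "locally_sq_integrable u"
  shows "L2_tendsto (lborel_on (cball 0 R)) (\<lambda>n. mollify (1 / real (Suc n)) u) u"
proof -
  let ?M = "lborel_on (cball 0 R)" and ?e = "\<lambda>n. 1 / real (Suc n)"
  have e: "0 < ?e n" "?e n \<le> 1" for n by auto
  have su: "sq_integrable ?M u" using u by (simp add: locally_sq_integrable_def)
  have sm: "sq_integrable ?M (mollify (?e n) u)" for n
    by (rule mollify_L2_bound(1)[OF u e])
  have fm: "finite_measure ?M" by (rule finite_measure_lborel_on) simp
  interpret finite_measure ?M by (rule fm)
  have "(\<lambda>n. \<integral>z. (norm (mollify (?e n) u z - u z))\<^sup>2 \<partial>?M) \<longlonglongrightarrow> 0"
  proof (rule LIMSEQ_I)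
    fix r :: real assume r: "r > 0"
    obtain h where h: "continuous_on UNIV h" "(\<integral>z. (norm (h z - u z))\<^sup>2 \<partial>lborel_on (cball 0 (R + 1))) < r / 16"
      using L2_density[of "cball 0 (R + 1)" u "r / 16"] u r by (auto simp: locally_sq_integrable_def)
    note lh = locally_sq_integrable_continuous[OF h(1)]
    note sh = lh[unfolded locally_sq_integrable_def, THEN conjunct2, rule_format, of R]
    note ld = locally_sq_integrable_diff[OF lh u]
    have "L2_tendsto ?M (\<lambda>n. mollify (?e n) h) h"
    proof -
      have c: "continuous_on UNIV (mollify (?e n) h)" for n
        using c1_on_continuous[OF c1_convolve[OF c1_mollifier _ h(1), of "?e n" "?e n"]] mollifier_eq_0[of "?e n"] by auto
      have "bounded (h ` cball 0 (R + 1))"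
        by (rule compact_imp_bounded[OF compact_continuous_image]) (auto intro: continuous_on_subset[OF h(1)])
      then obtain C where C: "\<And>z. z \<in> cball 0 (R + 1) \<Longrightarrow> norm (h z) \<le> C"
        unfolding bounded_iff by (metis imageI)
      have Cb: "norm (mollify (?e n) h z) \<le> C" if z: "z \<in> cball 0 R" for n z
      proof -
        have C0: "C \<ge> 0" using order_trans[OF norm_ge_zero C[of z]] z by auto
        have "norm (mollify (?e n) h z) \<le> (\<integral>v. norm (mollifier (?e n) (z - v)) * C \<partial>lborel)"
          unfolding convolve_def
        proof (rule Bochner_Integration.integral_norm_bound_integral)
          show "integrable lborel (\<lambda>v. mollifier (?e n) (z - v) * h v)" by (rule mollify_integrable[OF lh e(1)])
          show "integrable lborel (\<lambda>v. norm (mollifier (?e n) (z - v)) * C)"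
            using nn_integral_mollifier(4)[OF e(1), of n z] by (intro integrable_mult_left integrable_norm)
          fix v :: complex
          show "norm (mollifier (?e n) (z - v) * h v) \<le> norm (mollifier (?e n) (z - v)) * C"
          proof (cases "norm (z - v) \<ge> ?e n")
            case True
            then have "mollifier (?e n) (z - v) = 0" by (intro mollifier_eq_0) auto
            then show ?thesis by simp
          next
            case False
            have "norm v \<le> norm z + norm (z - v)" by (metis norm_triangle_sub norm_minus_commute)
            moreover have "norm z \<le> R" using z by simp
            ultimately have "norm v \<le> R + 1" using False e(2)[of n] by linarith
            then show ?thesis using C[of v] by (auto simp: norm_mult intro!: mult_left_mono)
          qed
        qed
        also have "\<dots> = C" using nn_integral_mollifier(5)[OF e(1), of n z] by simp
        finally show ?thesis .
      qed
      show ?thesis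
      proof (rule L2_tendsto_uniform[OF fm, where C=C])
        show "mollify (?e n) h \<in> borel_measurable ?M" for n
          using borel_measurable_continuous_onI[OF c[of n]] by (simp add: measurable_restrict_space1)
        show "h \<in> borel_measurable ?M"
          using borel_measurable_continuous_onI[OF h(1)] by (simp add: measurable_restrict_space1)
        show "uniform_limit (space ?M) (\<lambda>n. mollify (?e n) h) h sequentially"
          using mollify_uniform_limit[OF h(1), of R] by (simp add: space_restrict_space)
        show "norm (mollify (?e n) h z) \<le> C" if "z \<in> space ?M" for n z
          by (rule Cb) (use that in \<open>simp add: space_restrict_space\<close>)
        show "norm (h z) \<le> C" if "z \<in> space ?M" for z
          using C[of z] that by (simp add: space_restrict_space)
      qed
    qed
    then have "eventually (\<lambda>n. (\<integral>z. (norm (mollify (?e n) h z - h z))\<^sup>2 \<partial>?M) < r / 16) sequentially"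
      using r by (intro order_tendstoD(2)[where a="r / 16"]) (auto simp: L2_tendsto_def)
    then obtain N where N: "\<And>n. n \<ge> N \<Longrightarrow> (\<integral>z. (norm (mollify (?e n) h z - h z))\<^sup>2 \<partial>?M) < r / 16"
      by (auto simp: eventually_sequentially)
    show "\<exists>no. \<forall>n\<ge>no. norm ((\<integral>z. (norm (mollify (?e n) u z - u z))\<^sup>2 \<partial>?M) - 0) < r"
    proof (intro exI allI impI)
      fix n assume n: "n \<ge> N"
      let ?T = "mollify (?e n)"
      have sTh: "sq_integrable ?M (?T h)" by (rule mollify_L2_bound(1)[OF lh e])
      have b1: "(\<integral>z. (norm (?T h z - ?T u z))\<^sup>2 \<partial>?M) < r / 16"
        using mollify_L2_bound(2)[OF ld e, of R n] h(2) unfolding mollify_diff[OF lh u e(1)] by linarith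
      have "(\<integral>z. (norm (h z - u z))\<^sup>2 \<partial>?M) \<le> (\<integral>z. (norm (h z - u z))\<^sup>2 \<partial>lborel_on (cball 0 (R + 1)))"
      proof -
        have i: "integrable (lborel_on (cball 0 (R + 1))) (\<lambda>z. (norm (h z - u z))\<^sup>2)" "integrable ?M (\<lambda>z. (norm (h z - u z))\<^sup>2)"
          using ld by (auto simp: locally_sq_integrable_def sq_integrable_def)
        then show ?thesis
          by (simp add: integral_restrict_space integrable_restrict_space)
             (intro integral_mono, auto simp: indicator_def)
      qed
      then have b2: "(\<integral>z. (norm (h z - u z))\<^sup>2 \<partial>?M) < r / 16" using h(2) by simp
      note sd = sq_integrable_diff[OF sTh sm[of n]] sq_integrable_diff[OF sTh sh] sq_integrable_diff[OF sh su] sq_integrable_diff[OF sm[of n] su]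
      have "(\<integral>z. (norm (?T u z - u z))\<^sup>2 \<partial>?M) \<le>
         (\<integral>z. 4 * (norm (?T h z - ?T u z))\<^sup>2 + 4 * (norm (?T h z - h z))\<^sup>2 + 2 * (norm (h z - u z))\<^sup>2 \<partial>?M)"
      proof (rule integral_mono)
        fix z
        have "(norm (?T u z - u z))\<^sup>2 \<le> 2 * (norm (?T u z - h z))\<^sup>2 + 2 * (norm (h z - u z))\<^sup>2"
          using norm_add_square_le[of "?T u z - h z" "h z - u z"] by simp
        moreover have "(norm (?T u z - h z))\<^sup>2 \<le> 2 * (norm (?T h z - ?T u z))\<^sup>2 + 2 * (norm (?T h z - h z))\<^sup>2"
          using norm_add_square_le[of "?T u z - ?T h z" "?T h z - h z"] by (simp add: norm_minus_commute)
        ultimately show "(norm (?T u z - u z))\<^sup>2 \<le> 4 * (norm (?T h z - ?T u z))\<^sup>2 + 4 * (norm (?T h z - h z))\<^sup>2 + 2 * (norm (h z - u z))\<^sup>2"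
          by linarith
      qed (use sd in \<open>auto simp: sq_integrable_def\<close>)
      also have "\<dots> = 4 * (\<integral>z. (norm (?T h z - ?T u z))\<^sup>2 \<partial>?M) + 4 * (\<integral>z. (norm (?T h z - h z))\<^sup>2 \<partial>?M) + 2 * (\<integral>z. (norm (h z - u z))\<^sup>2 \<partial>?M)"
        using sd by (simp add: sq_integrable_def)
      also have "\<dots> < r" using b1 b2 N[OF n] r by linarith
      finally show "norm ((\<integral>z. (norm (?T u z - u z))\<^sup>2 \<partial>?M) - 0) < r" by simp
    qed
  qed
  then show ?thesis using su sm by (simp add: L2_tendsto_def)
qed

section \<open>The isoperimetric inequality for closed curves\<close>

text \<open>The function \<open>q x = l tan (l (pi/2 - x))\<close> solves the Riccati equation
  \<open>q' = - l^2 - q^2\<close> without poles on the interval when \<open>l < 1\<close>. Hence \<open>F'^2 - l^2 F^2\<close> is the square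
  \<open>(F' - q F)^2\<close> plus the derivative of \<open>q F^2\<close>, and the latter integrates to zero.\<close>

lemma tan_Riccati_Wirtinger:
  fixes F F' :: "real \<Rightarrow> real"
  assumes F: "\<And>x. (F has_real_derivative F' x) (at x)" and F': "continuous_on UNIV F'"
    and ends: "F 0 = 0" "F pi = 0" and l: "0 < l" "l < 1"
  shows "integral {0..pi} (\<lambda>x. (F' x)\<^sup>2 - l\<^sup>2 * (F x)\<^sup>2) \<ge> 0"
proof -
  define q where "q x = l * tan (l * (pi / 2 - x))" for x
  have cosp: "cos (l * (pi / 2 - x)) > 0" if "x \<in> {0..pi}" for x
  proof (rule cos_gt_zero_pi)
    have "l * (pi / 2 - x) \<le> l * (pi / 2)" using that l by (intro mult_left_mono) auto
    also have "\<dots> < pi / 2" using l by simp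
    finally show "l * (pi / 2 - x) < pi / 2" .
    have "l * (x - pi / 2) \<le> l * (pi / 2)" using that l by (intro mult_left_mono) auto
    also have "\<dots> < pi / 2" using l by simp
    finally show "- (pi / 2) < l * (pi / 2 - x)" by (simp add: algebra_simps)
  qed
  have q': "(q has_real_derivative - (l\<^sup>2 + (q x)\<^sup>2)) (at x)" if "x \<in> {0..pi}" for x
  proof -
    define y where "y = l * (pi / 2 - x)"
    have y: "cos y \<noteq> 0" using cosp[OF that] by (simp add: y_def)
    have "((\<lambda>x. l * (pi / 2 - x)) has_real_derivative - l) (at x)"
      by (auto intro!: derivative_eq_intros)
    from DERIV_chain2[OF DERIV_tan[OF y, unfolded y_def] this]
    have "(q has_real_derivative l * (inverse ((cos y)\<^sup>2) * - l)) (at x)"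
      unfolding q_def y_def by (rule DERIV_cmult)
    also have "l * (inverse ((cos y)\<^sup>2) * - l) = - (l\<^sup>2 + (q x)\<^sup>2)"
    proof -
      have "q x = l * tan y" by (simp only: q_def y_def)
      moreover have "inverse ((cos y)\<^sup>2) = 1 + (tan y)\<^sup>2" using tan_sec[OF y] by (simp add: power_inverse)
      ultimately show ?thesis by (simp add: power2_eq_square algebra_simps)
    qed
    finally show ?thesis .
  qed
  have contF: "continuous_on A F" for A
    using F by (meson DERIV_continuous_on has_field_derivative_at_within)
  have contq: "continuous_on {0..pi} q"
    using q' by (meson DERIV_continuous_on has_field_derivative_at_within)
  have cF': "continuous_on {0..pi} F'" using F' continuous_on_subset by blast
  have "((\<lambda>x. 2 * F x * F' x * q x - (F x)\<^sup>2 * (l\<^sup>2 + (q x)\<^sup>2)) has_integral ((F pi)\<^sup>2 * q pi - (F 0)\<^sup>2 * q 0)) {0..pi}"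
  proof (rule fundamental_theorem_of_calculus)
    fix x assume x: "x \<in> {0..pi}"
    have "((\<lambda>x. (F x)\<^sup>2 * q x) has_real_derivative 2 * F x * F' x * q x - (F x)\<^sup>2 * (l\<^sup>2 + (q x)\<^sup>2)) (at x)"
      by (rule derivative_eq_intros F q'[OF x] refl)+ (simp add: algebra_simps)
    then show "((\<lambda>x. (F x)\<^sup>2 * q x) has_vector_derivative 2 * F x * F' x * q x - (F x)\<^sup>2 * (l\<^sup>2 + (q x)\<^sup>2)) (at x within {0..pi})"
      using has_real_derivative_iff_has_vector_derivative has_vector_derivative_at_within by blast
  qed simp
  then have a: "integral {0..pi} (\<lambda>x. 2 * F x * F' x * q x - (F x)\<^sup>2 * (l\<^sup>2 + (q x)\<^sup>2)) = 0"
    using ends by (simp add: integral_unique)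
  have b: "integral {0..pi} (\<lambda>x. (F' x - F x * q x)\<^sup>2) \<ge> 0"
    by (rule Henstock_Kurzweil_Integration.integral_nonneg)
      (auto intro!: integrable_continuous_interval continuous_intros contF contq cF')
  have "integral {0..pi} (\<lambda>x. (F' x)\<^sup>2 - l\<^sup>2 * (F x)\<^sup>2) =
     integral {0..pi} (\<lambda>x. (F' x - F x * q x)\<^sup>2 + (2 * F x * F' x * q x - (F x)\<^sup>2 * (l\<^sup>2 + (q x)\<^sup>2)))"
    by (rule Henstock_Kurzweil_Integration.integral_cong) (simp add: power2_eq_square algebra_simps)
  also have "\<dots> = integral {0..pi} (\<lambda>x. (F' x - F x * q x)\<^sup>2) + integral {0..pi} (\<lambda>x. 2 * F x * F' x * q x - (F x)\<^sup>2 * (l\<^sup>2 + (q x)\<^sup>2))"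
    by (rule Henstock_Kurzweil_Integration.integral_add)
      (auto intro!: integrable_continuous_interval continuous_intros contF contq cF')
  finally show ?thesis using a b by simp
qed

text \<open>The limit \<open>l \<rightarrow> 1\<close> of the preceding inequality.\<close>

lemma Wirtinger_half_period:
  fixes F F' :: "real \<Rightarrow> real"
  assumes F: "\<And>x. (F has_real_derivative F' x) (at x)" and F': "continuous_on UNIV F'"
    and ends: "F p = c" "F (p + pi) = c"
  shows "integral {p..p + pi} (\<lambda>x. (F x - c)\<^sup>2) \<le> integral {p..p + pi} (\<lambda>x. (F' x)\<^sup>2)"
proof -
  define H where "H x = F (x + p) - c" for x
  have H: "(H has_real_derivative F' (x + p)) (at x)" for x
    unfolding H_def using DERIV_shift[of F "F' (x + p)" x p] F by (auto intro!: derivative_eq_intros)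
  have cH': "continuous_on UNIV (\<lambda>x. F' (x + p))"
    by (rule continuous_on_compose2[OF F']) (auto intro!: continuous_intros)
  have cH: "continuous_on A H" for A
    using H by (meson DERIV_continuous_on has_field_derivative_at_within)
  define I where "I = integral {0..pi} (\<lambda>x. (F' (x + p))\<^sup>2)"
  define J where "J = integral {0..pi} (\<lambda>x. (H x)\<^sup>2)"
  have "I - l\<^sup>2 * J \<ge> 0" if "0 < l" "l < 1" for l
  proof -
    have "integral {0..pi} (\<lambda>x. (F' (x + p))\<^sup>2 - l\<^sup>2 * (H x)\<^sup>2) \<ge> 0"
      by (rule tan_Riccati_Wirtinger[OF H cH' _ _ that]) (use ends in \<open>auto simp: H_def add.commute\<close>)
    moreover have "integral {0..pi} (\<lambda>x. (F' (x + p))\<^sup>2 - l\<^sup>2 * (H x)\<^sup>2) = I - l\<^sup>2 * J"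
      unfolding I_def J_def
      by (subst Henstock_Kurzweil_Integration.integral_diff)
         (auto intro!: integrable_continuous_interval continuous_intros cH continuous_on_subset[OF cH'])
    ultimately show ?thesis by simp
  qed
  moreover have "((\<lambda>l. I - l\<^sup>2 * J) \<longlongrightarrow> I - 1\<^sup>2 * J) (at_left 1)"
    by (intro tendsto_intros)
  moreover have "eventually (\<lambda>l::real. 0 < l \<and> l < 1) (at_left 1)"
    using eventually_at_left_real[of 0 1] by (auto elim: eventually_mono)
  ultimately have "I - 1\<^sup>2 * J \<ge> 0"
    by (intro tendsto_lowerbound[of "\<lambda>l. I - l\<^sup>2 * J" _ "at_left 1"]) (auto elim: eventually_mono)
  moreover have "I = integral {p..p + pi} (\<lambda>x. (F' x)\<^sup>2)"
    unfolding I_def using integral_shift_Icc_real[of 0 pi "\<lambda>x. (F' x)\<^sup>2" p]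
    by (simp add: o_def add.commute)
  moreover have "J = integral {p..p + pi} (\<lambda>x. (F x - c)\<^sup>2)"
    unfolding J_def H_def using integral_shift_Icc_real[of 0 pi "\<lambda>x. (F x - c)\<^sup>2" p]
    by (simp add: o_def add.commute)
  ultimately show ?thesis by simp
qed

lemma integral_period_shift:
  fixes h :: "real \<Rightarrow> real"
  assumes h: "continuous_on UNIV h" "\<And>x. h (x + 2 * pi) = h x" and a: "0 \<le> a"
  shows "integral {a..a + 2 * pi} h = integral {0..2 * pi} h"
proof -
  have i: "h integrable_on {x..y}" for x y
    by (rule integrable_continuous_interval) (use h(1) continuous_on_subset in blast)
  have 1: "integral {0..a} h + integral {a..a + 2 * pi} h = integral {0..a + 2 * pi} h"
    by (rule Henstock_Kurzweil_Integration.integral_combine) (use a i in auto)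
  have 2: "integral {0..2 * pi} h + integral {2 * pi..a + 2 * pi} h = integral {0..a + 2 * pi} h"
    by (rule Henstock_Kurzweil_Integration.integral_combine) (use a i in auto)
  have "integral {2 * pi..a + 2 * pi} h = integral {0..a} h"
    using integral_shift_Icc_real[of 0 a h "2 * pi"] h(2) by (simp add: o_def add.commute)
  then show ?thesis using 1 2 by simp
qed

text \<open>By the intermediate value theorem a periodic function takes the same value \<open>c\<close> at two points half a period
  apart. Subtracting it gives functions that vanish at the ends of both half periods.\<close>

lemma Wirtinger_inequality:
  fixes F F' :: "real \<Rightarrow> real"
  assumes F: "\<And>x. (F has_real_derivative F' x) (at x)" and F': "continuous_on UNIV F'"
    and per: "\<And>x. F (x + 2 * pi) = F x" "\<And>x. F' (x + 2 * pi) = F' x"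
  obtains c where "integral {0..2 * pi} (\<lambda>x. (F x - c)\<^sup>2) \<le> integral {0..2 * pi} (\<lambda>x. (F' x)\<^sup>2)"
proof -
  have contF: "continuous_on A F" for A
    using F by (meson DERIV_continuous_on has_field_derivative_at_within)
  have "\<exists>a\<ge>0. F (a + pi) - F a = 0"
  proof -
    define \<phi> where "\<phi> x = F (x + pi) - F x" for x
    have c: "continuous_on {0..pi} \<phi>" unfolding \<phi>_def
      by (intro continuous_intros contF continuous_on_compose2[OF contF[of UNIV]]) auto
    have s: "\<phi> pi = - \<phi> 0" using per(1)[of 0] by (simp add: \<phi>_def)
    have "\<exists>x. 0 \<le> x \<and> x \<le> pi \<and> \<phi> x = 0"
    proof (cases "\<phi> 0 \<le> 0")
      case True then show ?thesis using s by (intro IVT'[OF _ _ _ c]) auto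
    next
      case False then show ?thesis using s by (intro IVT2'[OF _ _ _ c]) auto
    qed
    then show ?thesis by (auto simp: \<phi>_def)
  qed
  then obtain a where a: "a \<ge> 0" "F (a + pi) = F a" by auto
  define c where "c = F a"
  have two: "F (a + pi + pi) = c" using per(1)[of a] by (simp add: c_def add.assoc)
  have 1: "integral {a..a + pi} (\<lambda>x. (F x - c)\<^sup>2) \<le> integral {a..a + pi} (\<lambda>x. (F' x)\<^sup>2)"
    by (rule Wirtinger_half_period[OF F F']) (use a in \<open>auto simp: c_def\<close>)
  have 2: "integral {a + pi..a + pi + pi} (\<lambda>x. (F x - c)\<^sup>2) \<le> integral {a + pi..a + pi + pi} (\<lambda>x. (F' x)\<^sup>2)"
    by (rule Wirtinger_half_period[OF F F']) (use a two in \<open>auto simp: c_def\<close>)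
  have comb: "integral {a..a + pi} h + integral {a + pi..a + pi + pi} h = integral {0..2 * pi} h"
    if "continuous_on UNIV h" "\<And>x. h (x + 2 * pi) = h x" for h :: "real \<Rightarrow> real"
  proof -
    have "integral {a..a + pi} h + integral {a + pi..a + pi + pi} h = integral {a..a + pi + pi} h"
      by (rule Henstock_Kurzweil_Integration.integral_combine)
        (use that(1) in \<open>auto intro: integrable_continuous_interval continuous_on_subset\<close>)
    then show ?thesis using integral_period_shift[OF that a(1)] by (simp add: add.assoc)
  qed
  have "integral {0..2 * pi} (\<lambda>x. (F x - c)\<^sup>2) \<le> integral {0..2 * pi} (\<lambda>x. (F' x)\<^sup>2)"
  proof -
    have "integral {a..a + pi} (\<lambda>x. (F x - c)\<^sup>2) + integral {a + pi..a + pi + pi} (\<lambda>x. (F x - c)\<^sup>2) = integral {0..2 * pi} (\<lambda>x. (F x - c)\<^sup>2)"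
      by (rule comb) (use per in \<open>auto intro!: continuous_intros contF\<close>)
    moreover have "integral {a..a + pi} (\<lambda>x. (F' x)\<^sup>2) + integral {a + pi..a + pi + pi} (\<lambda>x. (F' x)\<^sup>2) = integral {0..2 * pi} (\<lambda>x. (F' x)\<^sup>2)"
      by (rule comb) (use per F' in \<open>auto intro!: continuous_intros\<close>)
    ultimately show ?thesis using 1 2 by linarith
  qed
  then show ?thesis using that by blast
qed

text \<open>The second term is twice the signed area enclosed by the curve. Writing it in terms of the real and imaginary parts
  reduces the claim to Wirtinger's inequality for one of them and a complete square.\<close>

lemma isoperimetric_circle:
  fixes G G' :: "real \<Rightarrow> complex"
  assumes G: "\<And>x. (G has_vector_derivative G' x) (at x)" and G': "continuous_on UNIV G'"
    and per: "\<And>x. G (x + 2 * pi) = G x" "\<And>x. G' (x + 2 * pi) = G' x"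
  shows "integral {0..2 * pi} (\<lambda>x. (norm (G' x))\<^sup>2 + Im (cnj (G x) * G' x)) \<ge> 0"
proof -
  have dR: "((\<lambda>x. Re (G x)) has_real_derivative Re (G' x)) (at x)" and dI: "((\<lambda>x. Im (G x)) has_real_derivative Im (G' x)) (at x)" for x
    using bounded_linear.has_vector_derivative[OF bounded_linear_Re G[of x]] bounded_linear.has_vector_derivative[OF bounded_linear_Im G[of x]]
    by (auto simp: has_real_derivative_iff_has_vector_derivative)
  have cG: "continuous_on A G" for A
    using G by (meson continuous_at_imp_continuous_on continuous_on_subset has_vector_derivative_continuous)
  have cG': "continuous_on A G'" for A using G' continuous_on_subset by blast
  note c = continuous_intros cG cG'
  obtain a where a: "integral {0..2 * pi} (\<lambda>x. (Re (G x) - a)\<^sup>2) \<le> integral {0..2 * pi} (\<lambda>x. (Re (G' x))\<^sup>2)"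
    by (rule Wirtinger_inequality[OF dR]) (use per in \<open>auto intro!: c\<close>)
  have ibp: "integral {0..2 * pi} (\<lambda>x. Im (G x) * Re (G' x) + Im (G' x) * (Re (G x) - a)) = 0"
  proof -
    have "((\<lambda>x. Im (G x) * Re (G' x) + Im (G' x) * (Re (G x) - a)) has_integral
       (Im (G (2 * pi)) * (Re (G (2 * pi)) - a) - Im (G 0) * (Re (G 0) - a))) {0..2 * pi}"
    proof (rule fundamental_theorem_of_calculus)
      fix x :: real
      have "((\<lambda>x. Im (G x) * (Re (G x) - a)) has_real_derivative Im (G x) * Re (G' x) + Im (G' x) * (Re (G x) - a)) (at x)"
        by (rule derivative_eq_intros dR dI refl)+ simp
      then show "((\<lambda>x. Im (G x) * (Re (G x) - a)) has_vector_derivative Im (G x) * Re (G' x) + Im (G' x) * (Re (G x) - a)) (at x within {0..2 * pi})"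
        using has_real_derivative_iff_has_vector_derivative has_vector_derivative_at_within by blast
    qed simp
    then show ?thesis using per(1)[of 0] by (simp add: integral_unique)
  qed
  have "0 \<le> integral {0..2 * pi} (\<lambda>x. (Im (G' x) + (Re (G x) - a))\<^sup>2)"
    by (rule Henstock_Kurzweil_Integration.integral_nonneg) (auto intro!: integrable_continuous_interval c)
  also have "\<dots> = integral {0..2 * pi} (\<lambda>x. ((norm (G' x))\<^sup>2 + Im (cnj (G x) * G' x)) +
      (((Re (G x) - a)\<^sup>2 - (Re (G' x))\<^sup>2) + (Im (G x) * Re (G' x) + Im (G' x) * (Re (G x) - a)) - a * Im (G' x)))"
    by (rule Henstock_Kurzweil_Integration.integral_cong, unfold cmod_power2) (simp add: power2_eq_square algebra_simps)
  also have "\<dots> = integral {0..2 * pi} (\<lambda>x. (norm (G' x))\<^sup>2 + Im (cnj (G x) * G' x)) +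
     ((integral {0..2 * pi} (\<lambda>x. (Re (G x) - a)\<^sup>2) - integral {0..2 * pi} (\<lambda>x. (Re (G' x))\<^sup>2)) +
      integral {0..2 * pi} (\<lambda>x. Im (G x) * Re (G' x) + Im (G' x) * (Re (G x) - a)) - a * integral {0..2 * pi} (\<lambda>x. Im (G' x)))"
    by (rule integral_unique, intro has_integral_add has_integral_diff has_integral_mult_right
        integrable_integral integrable_continuous_interval c)
  also have "integral {0..2 * pi} (\<lambda>x. Im (G' x)) = 0"
  proof -
    have "((\<lambda>x. Im (G' x)) has_integral (Im (G (2 * pi)) - Im (G 0))) {0..2 * pi}"
      by (rule fundamental_theorem_of_calculus)
        (use dI has_real_derivative_iff_has_vector_derivative has_vector_derivative_at_within in \<open>auto, blast\<close>)
    then show ?thesis using per(1)[of 0] by (simp add: integral_unique)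
  qed
  finally show ?thesis using a ibp by simp
qed

section \<open>Averages over circles\<close>

lemma integral_angular_derivative_eq_0:
  assumes c: "c1_on UNIV \<Psi> \<Psi>x \<Psi>y" and supp: "\<And>z. norm z > R \<Longrightarrow> \<Psi> z = 0"
  shows "(\<integral>u. of_real (Re u) * \<Psi>y u - of_real (Im u) * \<Psi>x u \<partial>lborel) = 0"
proof -
  note A = c1_on_mult[OF c1_on_Re c] and B = c1_on_mult[OF c1_on_Im c]
  have "(\<integral>u. of_real (Re u) * \<Psi>y u \<partial>lborel) = 0" "integrable lborel (\<lambda>u. of_real (Re u) * \<Psi>y u)"
    using integral_partial_y_eq_0[OF A, of R] c1_on_support_integrable(2)[OF A, of R] supp by auto
  moreover have "(\<integral>u. of_real (Im u) * \<Psi>x u \<partial>lborel) = 0" "integrable lborel (\<lambda>u. of_real (Im u) * \<Psi>x u)"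
    using integral_partial_x_eq_0[OF B, of R] c1_on_support_integrable(1)[OF B, of R] supp by auto
  ultimately show ?thesis by simp
qed

text \<open>The derivative in \<open>t\<close> of the integral is the integral of an angular derivative, which vanishes.\<close>

lemma lborel_integral_rotate_C1:
  assumes c: "c1_on UNIV \<Phi> \<Phi>x \<Phi>y" and supp: "\<And>z. norm z > R \<Longrightarrow> \<Phi> z = 0"
  shows "(\<integral>u. \<Phi> (cis t * u) \<partial>lborel) = (\<integral>u. \<Phi> u \<partial>lborel)"
proof -
  obtain a b where ab: "cball (0::complex) R \<subseteq> cbox a b"
    using bounded_subset_cbox_symmetric[OF bounded_cball] by blast
  define D where "D w = of_real (Re w) * \<Phi>y w - of_real (Im w) * \<Phi>x w" for w
  note cc = c1_on_continuous[OF c] c1_onD(2,3)[OF c]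
  have contD: "continuous_on UNIV D" unfolding D_def using cc by (intro continuous_intros)
  have z: "\<Phi> z = 0 \<and> D z = 0" if "norm z > R" for z
  proof -
    have "open (- cball (0::complex) R)" by (simp add: open_Compl)
    then have "\<Phi>x z = 0" "\<Phi>y z = 0"
      using c1_on_vanish[OF c, of "- cball 0 R" z] supp that by auto
    then show ?thesis using supp that by (simp add: D_def)
  qed
  have out: "norm (cis t * u) > R" if "u \<notin> cbox a b" for t u
    using that ab by (auto simp: norm_mult subset_iff not_le)
  have cont: "continuous_on UNIV (\<lambda>u. q (cis t * u))" if "continuous_on UNIV q" for q :: "complex \<Rightarrow> complex" and t
    by (rule continuous_on_compose2[OF that]) (auto intro!: continuous_intros)
  have eq: "integral (cbox a b) (\<lambda>u. q (cis t * u)) = (\<integral>u. q (cis t * u) \<partial>lborel)"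
    if "continuous_on UNIV q" "\<And>z. norm z > R \<Longrightarrow> q z = 0" for q :: "complex \<Rightarrow> complex" and t
    by (rule integral_cbox_eq_lborel[OF cont[OF that(1)]]) (use that(2) out in auto)
  have D0: "(\<integral>u. D (cis t * u) \<partial>lborel) = 0" for t
  proof -
    let ?c = "cis t"
    have m: "c1_on UNIV (\<lambda>u. \<Phi> (?c * u)) (\<lambda>u. of_real (Re ?c) * \<Phi>x (?c * u) + of_real (Im ?c) * \<Phi>y (?c * u))
       (\<lambda>u. of_real (- Im ?c) * \<Phi>x (?c * u) + of_real (Re ?c) * \<Phi>y (?c * u))"
      unfolding c1_on_def
    proof (intro conjI ballI)
      fix u
      have "((\<lambda>u. \<Phi> (?c * u)) has_derivative (\<lambda>h. of_real (Re (?c * h)) * \<Phi>x (?c * u) + of_real (Im (?c * h)) * \<Phi>y (?c * u))) (at u)"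
        by (rule has_derivative_compose[OF _ c1_onD(1)[OF c]]) (auto intro!: derivative_eq_intros)
      then show "((\<lambda>u. \<Phi> (?c * u)) has_derivative (\<lambda>h. of_real (Re h) * (of_real (Re ?c) * \<Phi>x (?c * u) + of_real (Im ?c) * \<Phi>y (?c * u))
        + of_real (Im h) * (of_real (- Im ?c) * \<Phi>x (?c * u) + of_real (Re ?c) * \<Phi>y (?c * u)))) (at u)"
        by (rule has_derivative_eq_rhs) (simp add: fun_eq_iff algebra_simps)
    qed (intro continuous_intros cont cc)+
    have "(\<integral>u. D (?c * u) \<partial>lborel) = (\<integral>u. of_real (Re u) * (of_real (- Im ?c) * \<Phi>x (?c * u) + of_real (Re ?c) * \<Phi>y (?c * u))
       - of_real (Im u) * (of_real (Re ?c) * \<Phi>x (?c * u) + of_real (Im ?c) * \<Phi>y (?c * u)) \<partial>lborel)"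
      by (rule Bochner_Integration.integral_cong) (auto simp: D_def algebra_simps)
    also have "\<dots> = 0"
      by (rule integral_angular_derivative_eq_0[OF m, of R]) (use supp in \<open>auto simp: norm_mult\<close>)
    finally show ?thesis .
  qed
  define I where "I t = integral (cbox a b) (\<lambda>u. \<Phi> (cis t * u))" for t
  have I': "(I has_vector_derivative 0) (at t within UNIV)" for t
  proof -
    have "((\<lambda>t. integral (cbox a b) (\<lambda>u. \<Phi> (cis t * u))) has_vector_derivative integral (cbox a b) (\<lambda>u. D (cis t * u))) (at t within UNIV)"
    proof (rule leibniz_rule_vector_derivative)
      fix t u
      have c': "(cis has_derivative (\<lambda>h. of_real h * (\<i> * cis t))) (at t)"
        using has_derivative_cis[OF has_derivative_ident, of t UNIV] by (simp add: scaleR_conv_of_real)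
      have "((\<lambda>t. \<Phi> (cis t * u)) has_derivative (\<lambda>h. of_real (Re (of_real h * (\<i> * cis t) * u)) * \<Phi>x (cis t * u) + of_real (Im (of_real h * (\<i> * cis t) * u)) * \<Phi>y (cis t * u))) (at t)"
        by (rule has_derivative_compose[OF has_derivative_mult_left[OF c'] c1_onD(1)[OF c]]) auto
      then show "((\<lambda>t. \<Phi> (cis t * u)) has_vector_derivative D (cis t * u)) (at t within UNIV)"
        unfolding has_vector_derivative_def
        by (rule has_derivative_eq_rhs) (simp add: D_def fun_eq_iff algebra_simps scaleR_conv_of_real)
    next
      fix t show "(\<lambda>u. \<Phi> (cis t * u)) integrable_on cbox a b"
        by (rule integrable_continuous[OF continuous_on_subset[OF cont[OF cc(1)]]]) auto
    next
      show "continuous_on (UNIV \<times> cbox a b) (\<lambda>(t, u). D (cis t * u))"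
        unfolding split_beta by (intro continuous_on_compose2[OF contD] continuous_intros) auto
    qed auto
    then show ?thesis using eq[OF contD] z D0 by (simp add: I_def[abs_def])
  qed
  have "I t = I 0"
    using has_vector_derivative_zero_constant[of UNIV I] I' by (metis UNIV_I convex_UNIV)
  then show ?thesis using eq[OF cc(1) supp, of t] eq[OF cc(1) supp, of 0] by (simp add: I_def)
qed

lemma tendsto_integral_uniform_support:
  fixes F :: "nat \<Rightarrow> complex \<Rightarrow> complex"
  assumes u: "uniform_limit (cball 0 R) F f sequentially" and c: "\<And>n. continuous_on UNIV (F n)" "continuous_on UNIV f"
    and s: "\<And>n z. norm z > R \<Longrightarrow> F n z = 0" "\<And>z. norm z > R \<Longrightarrow> f z = 0"
  shows "(\<lambda>n. \<integral>z. F n z \<partial>lborel) \<longlonglongrightarrow> (\<integral>z. f z \<partial>lborel)"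
proof -
  obtain a b where ab: "cball (0::complex) R \<subseteq> cbox a b"
    using bounded_subset_cbox_symmetric[OF bounded_cball] by blast
  have out: "norm z > R" if "z \<notin> cbox a b" for z using that ab by (auto simp: subset_iff not_le)
  have "uniform_limit (cbox a b) F f sequentially"
  proof (rule uniform_limitI)
    fix e :: real assume e: "e > 0"
    from uniform_limitD[OF u e] show "\<forall>\<^sub>F n in sequentially. \<forall>z\<in>cbox a b. dist (F n z) (f z) < e"
    proof eventually_elim
      case (elim n)
      show ?case
      proof
        fix z show "dist (F n z) (f z) < e"
          using elim s e by (cases "norm z \<le> R") (auto simp: not_le)
      qed
    qed
  qed
  then obtain I J where IJ: "\<And>n. (F n has_integral I n) (cbox a b)" "(f has_integral J) (cbox a b)" "I \<longlonglongrightarrow> J"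
    by (rule uniform_limit_integral_cbox) (auto intro: continuous_on_subset[OF c(1)])
  have "I n = (\<integral>z. F n z \<partial>lborel)" for n
    using integral_cbox_eq_lborel[OF c(1)[of n], of a b] s(1) out IJ(1)[of n] by (simp add: integral_unique)
  moreover have "J = (\<integral>z. f z \<partial>lborel)"
    using integral_cbox_eq_lborel[OF c(2), of a b] s(2) out IJ(2) by (simp add: integral_unique)
  moreover from calculation(1) have "I = (\<lambda>n. \<integral>z. F n z \<partial>lborel)" by (rule ext)
  ultimately show ?thesis using IJ(3) by simp
qed

lemma lborel_integral_rotate:
  fixes \<Phi> :: "complex \<Rightarrow> complex"
  assumes c: "continuous_on UNIV \<Phi>" and supp: "\<And>z. norm z > R \<Longrightarrow> \<Phi> z = 0"
  shows "(\<integral>u. \<Phi> (cis t * u) \<partial>lborel) = (\<integral>u. \<Phi> u \<partial>lborel)"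
proof -
  let ?e = "\<lambda>n. 1 / real (Suc n)"
  have c1: "c1_on UNIV (mollify (?e n) \<Phi>) (convolve (mollifier_x (?e n)) \<Phi>) (convolve (mollifier_y (?e n)) \<Phi>)" for n
    by (rule c1_convolve[OF c1_mollifier _ c, of "?e n"]) (auto intro: mollifier_eq_0)
  have s: "mollify (?e n) \<Phi> z = 0" if "norm z > R + 1" for n z
  proof -
    have zz: "mollifier (?e n) (z - v) * \<Phi> v = 0" for v
    proof (cases "norm v > R")
      case False
      have "?e n \<le> 1" by simp
      moreover have "norm z \<le> norm v + norm (z - v)" by (metis norm_triangle_sub)
      ultimately have "norm (z - v) \<ge> ?e n" using that False by linarith
      then show ?thesis by (simp add: mollifier_eq_0)
    qed (simp add: supp)
    show ?thesis unfolding convolve_def zz by simp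
  qed
  have cm: "continuous_on UNIV (mollify (?e n) \<Phi>)" for n by (rule c1_on_continuous[OF c1])
  have u: "uniform_limit (cball 0 (R + 1)) (\<lambda>n. mollify (?e n) \<Phi>) \<Phi> sequentially"
    by (rule mollify_uniform_limit[OF c])
  have 1: "(\<lambda>n. \<integral>u. mollify (?e n) \<Phi> u \<partial>lborel) \<longlonglongrightarrow> (\<integral>u. \<Phi> u \<partial>lborel)"
    by (rule tendsto_integral_uniform_support[OF u cm c s]) (use supp in auto)
  have 2: "(\<lambda>n. \<integral>u. mollify (?e n) \<Phi> (cis t * u) \<partial>lborel) \<longlonglongrightarrow> (\<integral>u. \<Phi> (cis t * u) \<partial>lborel)"
  proof (rule tendsto_integral_uniform_support[where R="R + 1"])
    show "uniform_limit (cball 0 (R + 1)) (\<lambda>n u. mollify (?e n) \<Phi> (cis t * u)) (\<lambda>u. \<Phi> (cis t * u)) sequentially"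
      by (rule uniform_limit_compose'[OF u]) (auto simp: norm_mult)
    show "continuous_on UNIV (\<lambda>u. mollify (?e n) \<Phi> (cis t * u))" for n
      by (rule continuous_on_compose2[OF cm]) (auto intro!: continuous_intros)
    show "continuous_on UNIV (\<lambda>u. \<Phi> (cis t * u))"
      by (rule continuous_on_compose2[OF c]) (auto intro!: continuous_intros)
  qed (use s supp in \<open>auto simp: norm_mult\<close>)
  have "(\<lambda>n. \<integral>u. mollify (?e n) \<Phi> (cis t * u) \<partial>lborel) = (\<lambda>n. \<integral>u. mollify (?e n) \<Phi> u \<partial>lborel)"
    using lborel_integral_rotate_C1[OF c1 s] by auto
  with 1 2 show ?thesis using LIMSEQ_unique by metis
qed

text \<open>Rotation invariance together with Fubini's theorem. The average over rotations takes the place of polar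
  coordinates.\<close>

lemma integral_circle_average:
  fixes \<Phi> :: "complex \<Rightarrow> complex"
  assumes c: "continuous_on UNIV \<Phi>" and supp: "\<And>z. norm z > R \<Longrightarrow> \<Phi> z = 0"
  shows "2 * of_real pi * (\<integral>u. \<Phi> u \<partial>lborel) = (\<integral>u. integral {0..2 * pi} (\<lambda>t. \<Phi> (cis t * u)) \<partial>lborel)"
    "integrable lborel (\<lambda>u. integral {0..2 * pi} (\<lambda>t. \<Phi> (cis t * u)))"
proof -
  define f where "f t u = indicator {0..2 * pi} t *\<^sub>R \<Phi> (cis t * u)" for t u
  have "integrable (lborel :: (real \<times> complex) measure) (\<lambda>x. indicator ({0..2 * pi} \<times> cball 0 R) x *\<^sub>R \<Phi> (cis (fst x) * snd x))"
    by (rule borel_integrable_compact)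
      (auto intro!: compact_Times continuous_on_compose2[OF c] continuous_intros)
  also have "(\<lambda>x. indicator ({0..2 * pi} \<times> cball 0 R) x *\<^sub>R \<Phi> (cis (fst x) * snd x)) = case_prod f"
  proof (rule ext, clarify)
    fix t :: real and u :: complex
    show "indicator ({0..2 * pi} \<times> cball 0 R) (t, u) *\<^sub>R \<Phi> (cis (fst (t, u)) * snd (t, u)) = f t u"
      using supp[of "cis t * u"] by (cases "norm u \<le> R") (auto simp: f_def indicator_def norm_mult)
  qed
  finally have i: "integrable (lborel \<Otimes>\<^sub>M lborel) (case_prod f)" by (simp add: lborel_prod)
  have inner: "(\<integral>t. f t u \<partial>lborel) = integral {0..2 * pi} (\<lambda>t. \<Phi> (cis t * u))" for u
  proof -
    have "set_integrable lborel {0..2 * pi} (\<lambda>t. \<Phi> (cis t * u))"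
      unfolding set_integrable_def
      by (rule borel_integrable_compact) (auto intro!: continuous_on_compose2[OF c] continuous_intros)
    from set_borel_integral_eq_integral(2)[OF this] show ?thesis by (simp add: f_def set_lebesgue_integral_def)
  qed
  have outer: "(\<integral>u. f t u \<partial>lborel) = indicator {0..2 * pi} t *\<^sub>R (\<integral>u. \<Phi> u \<partial>lborel)" for t
    using lborel_integral_rotate[OF c supp, where t=t] by (simp add: f_def)
  have "(\<integral>u. integral {0..2 * pi} (\<lambda>t. \<Phi> (cis t * u)) \<partial>lborel) = (\<integral>t. indicator {0..2 * pi} t *\<^sub>R (\<integral>u. \<Phi> u \<partial>lborel) \<partial>lborel)"
    using lborel_pair.Fubini_integral[OF i] by (simp add: inner outer)
  also have "\<dots> = 2 * of_real pi * (\<integral>u. \<Phi> u \<partial>lborel)"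
    by (simp add: scaleR_conv_of_real)
  finally show "2 * of_real pi * (\<integral>u. \<Phi> u \<partial>lborel) = (\<integral>u. integral {0..2 * pi} (\<lambda>t. \<Phi> (cis t * u)) \<partial>lborel)" by simp
  show "integrable lborel (\<lambda>u. integral {0..2 * pi} (\<lambda>t. \<Phi> (cis t * u)))"
    using lborel_pair.integrable_snd[OF i] by (simp add: inner)
qed

lemma integral_eq_0_circles:
  fixes \<Phi> :: "complex \<Rightarrow> complex"
  assumes "continuous_on UNIV \<Phi>" "\<And>z. norm z > R \<Longrightarrow> \<Phi> z = 0"
    and "\<And>u. integral {0..2 * pi} (\<lambda>t. \<Phi> (cis t * u)) = 0"
  shows "(\<integral>u. \<Phi> u \<partial>lborel) = 0"
  using integral_circle_average(1)[OF assms(1,2)] assms(3) by simp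

lemma integral_nonneg_circles:
  fixes \<Phi> :: "complex \<Rightarrow> real"
  assumes c: "continuous_on UNIV \<Phi>" and s: "\<And>z. norm z > R \<Longrightarrow> \<Phi> z = 0"
    and n: "\<And>u. integral {0..2 * pi} (\<lambda>t. \<Phi> (cis t * u)) \<ge> 0"
  shows "(\<integral>u. \<Phi> u \<partial>lborel) \<ge> 0"
proof -
  have cc: "continuous_on UNIV (\<lambda>z. complex_of_real (\<Phi> z))" using c by (intro continuous_intros)
  have i: "(\<lambda>t. \<Phi> (cis t * u)) integrable_on {0..2 * pi}" for u
    by (rule integrable_continuous_interval) (auto intro!: continuous_on_compose2[OF c] continuous_intros)
  have e: "integral {0..2 * pi} (\<lambda>t. complex_of_real (\<Phi> (cis t * u))) = of_real (integral {0..2 * pi} (\<lambda>t. \<Phi> (cis t * u)))" for u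
    using integral_linear[OF i bounded_linear_of_real] by (simp add: o_def)
  have "2 * of_real pi * (\<integral>u. complex_of_real (\<Phi> u) \<partial>lborel) = (\<integral>u. complex_of_real (integral {0..2 * pi} (\<lambda>t. \<Phi> (cis t * u))) \<partial>lborel)"
    using integral_circle_average(1)[OF cc, of R] s e by simp
  then have "complex_of_real (2 * pi * (\<integral>u. \<Phi> u \<partial>lborel)) = of_real (\<integral>u. integral {0..2 * pi} (\<lambda>t. \<Phi> (cis t * u)) \<partial>lborel)"
    by simp
  then have "2 * pi * (\<integral>u. \<Phi> u \<partial>lborel) = (\<integral>u. integral {0..2 * pi} (\<lambda>t. \<Phi> (cis t * u)) \<partial>lborel)"
    using of_real_eq_iff by blast
  also have "\<dots> \<ge> 0" using n by (intro integral_nonneg_AE) auto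
  finally show ?thesis using pi_gt_zero by (simp add: zero_le_mult_iff)
qed

text \<open>Mean value property, from Cauchy's formula.\<close>

lemma integral_circle_holomorphic:
  assumes "H holomorphic_on ball 0 r" "norm u < r"
  shows "integral {0..2 * pi} (\<lambda>t. H (cis t * u)) = 2 * of_real pi * H 0"
proof -
  have "(\<lambda>z. H (z * u)) holomorphic_on cball 0 1"
  proof (rule holomorphic_on_compose_gen[OF _ assms(1), unfolded o_def])
    show "(\<lambda>z. z * u) ` cball 0 1 \<subseteq> ball 0 r"
    proof safe
      fix z :: complex assume "z \<in> cball 0 1"
      then have "norm z * norm u \<le> norm u" by (intro mult_left_le_one_le) auto
      then show "z * u \<in> ball 0 r" using assms(2) by (simp add: norm_mult)
    qed
  qed (intro holomorphic_intros)
  from Cauchy_integral_circlepath_simple[OF this, of 0]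
  have "((\<lambda>z. H (z * u) / z) has_contour_integral (2 * of_real pi * \<i> * H 0)) (part_circlepath 0 1 0 (2 * pi))"
    by (simp add: circlepath_def)
  then have "((\<lambda>t. \<i> * H (cis t * u)) has_integral (2 * of_real pi * \<i> * H 0)) {0..2 * pi}"
    by (subst (asm) has_contour_integral_part_circlepath_iff) (auto simp: mult.commute)
  from has_integral_mult_right[OF this, of "- \<i>"]
  moreover have "- \<i> * (\<i> * h) = h" "- \<i> * (2 * of_real pi * \<i> * h) = 2 * of_real pi * h" for h
    by (simp_all add: complex_eq_iff)
  ultimately have "((\<lambda>t. H (cis t * u)) has_integral (2 * of_real pi * H 0)) {0..2 * pi}"
    by (simp only:)
  then show ?thesis by (rule integral_unique)
qed

section \<open>Sobolev functions as limits of smooth functions\<close>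

text \<open>The common function \<open>Gxy\<close> records the symmetry of the second derivatives.\<close>

definition c2_on :: "complex set \<Rightarrow> (complex \<Rightarrow> complex) \<Rightarrow> (complex \<Rightarrow> complex) \<Rightarrow> (complex \<Rightarrow> complex) \<Rightarrow> bool"
  where "c2_on V G Gx Gy \<longleftrightarrow> c1_on V G Gx Gy \<and>
    (\<exists>Gxx Gxy Gyy. c1_on V Gx Gxx Gxy \<and> c1_on V Gy Gxy Gyy)"

lemma c2_onD: "c2_on V G Gx Gy \<Longrightarrow> c1_on V G Gx Gy"
  by (simp add: c2_on_def)

lemma c2_on_subset: "c2_on V G Gx Gy \<Longrightarrow> W \<subseteq> V \<Longrightarrow> c2_on W G Gx Gy"
  unfolding c2_on_def by (meson c1_on_subset)

lemma c2_on_inverse: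
  assumes G: "c2_on V G Gx Gy" and nz: "\<And>z. z \<in> V \<Longrightarrow> G z \<noteq> 0" and V: "open V"
  shows "c2_on V (\<lambda>z. inverse (G z)) (\<lambda>z. - Gx z / (G z)\<^sup>2) (\<lambda>z. - Gy z / (G z)\<^sup>2)"
proof -
  obtain Gxx Gxy Gyy where c: "c1_on V G Gx Gy" "c1_on V Gx Gxx Gxy" "c1_on V Gy Gxy Gyy"
    using G by (auto simp: c2_on_def)
  note I = c1_on_inverse[OF c(1) nz]
  note I2 = c1_on_mult[OF I I]
  note X = c1_on_cmult[OF c1_on_mult[OF c(2) I2], of "-1"]
  note Y = c1_on_cmult[OF c1_on_mult[OF c(3) I2], of "-1"]
  have x: "c1_on V (\<lambda>z. - Gx z / (G z)\<^sup>2)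
     (\<lambda>z. - Gxx z / (G z)\<^sup>2 + 2 * Gx z * Gx z / (G z) ^ 3) (\<lambda>z. - Gxy z / (G z)\<^sup>2 + 2 * Gx z * Gy z / (G z) ^ 3)"
    by (rule c1_on_cong[OF X _ _ _ V]) (simp_all add: nz field_simps power2_eq_square power3_eq_cube)
  have y: "c1_on V (\<lambda>z. - Gy z / (G z)\<^sup>2)
     (\<lambda>z. - Gxy z / (G z)\<^sup>2 + 2 * Gx z * Gy z / (G z) ^ 3) (\<lambda>z. - Gyy z / (G z)\<^sup>2 + 2 * Gy z * Gy z / (G z) ^ 3)"
    by (rule c1_on_cong[OF Y _ _ _ V]) (simp_all add: nz field_simps power2_eq_square power3_eq_cube)
  show ?thesis unfolding c2_on_def using I x y by blast
qed

lemma c2_on_holomorphic: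
  assumes "open V" "f holomorphic_on V"
  shows "c2_on V f (deriv f) (\<lambda>z. \<i> * deriv f z)"
proof -
  have h: "deriv f holomorphic_on V" using assms holomorphic_deriv by blast
  show ?thesis unfolding c2_on_def
    using c1_on_holomorphic[OF assms] c1_on_holomorphic[OF assms(1) h] c1_on_cmult[OF c1_on_holomorphic[OF assms(1) h], of \<i>]
    by blast
qed

text \<open>Over a compact set, \<open>g\<close> is a uniform limit of functions of class \<open>C^2\<close> whose gradients converge
  in mean square to \<open>(gx, gy)\<close>. This is a working form of "continuous and in the Sobolev space of exponent two" which is
  visibly stable under composition with holomorphic functions such as the reciprocal.\<close>

definition smooth_approx :: "complex set \<Rightarrow> (complex \<Rightarrow> complex) \<Rightarrow> (complex \<Rightarrow> complex) \<Rightarrow> (complex \<Rightarrow> complex) \<Rightarrow> bool"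
  where "smooth_approx K g gx gy \<longleftrightarrow> (\<exists>V G Gx Gy.
    (\<forall>n. open (V n) \<and> K \<subseteq> V n \<and> c2_on (V n) (G n) (Gx n) (Gy n)) \<and>
    uniform_limit K G g sequentially \<and> L2_tendsto (lborel_on K) Gx gx \<and> L2_tendsto (lborel_on K) Gy gy)"

lemma L2_tendsto_shift: "L2_tendsto M U u \<Longrightarrow> L2_tendsto M (\<lambda>n. U (n + N)) u"
  unfolding L2_tendsto_def
  using LIMSEQ_ignore_initial_segment[of "\<lambda>n. \<integral>x. (norm (U n x - u x))\<^sup>2 \<partial>M" 0 N] by auto

lemma smooth_approxE:
  assumes "smooth_approx K g gx gy" "e > 0"
  obtains V G Gx Gy where "\<And>n. open (V n)" "\<And>n. K \<subseteq> V n" "\<And>n. c2_on (V n) (G n) (Gx n) (Gy n)"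
    "uniform_limit K G g sequentially" "L2_tendsto (lborel_on K) Gx gx" "L2_tendsto (lborel_on K) Gy gy"
    "\<And>(n::nat) z. z \<in> K \<Longrightarrow> dist (G n z) (g z) < e"
proof -
  obtain V G Gx Gy where a: "\<And>n. open (V n) \<and> K \<subseteq> V n \<and> c2_on (V n) (G n) (Gx n) (Gy n)"
    and u: "uniform_limit K G g sequentially" and L: "L2_tendsto (lborel_on K) Gx gx" "L2_tendsto (lborel_on K) Gy gy"
    using assms(1) unfolding smooth_approx_def by blast
  obtain N where N: "\<And>n z. n \<ge> N \<Longrightarrow> z \<in> K \<Longrightarrow> dist (G n z) (g z) < e"
    using uniform_limitD[OF u assms(2)] by (auto simp: eventually_sequentially)
  have "uniform_limit K (\<lambda>n. G (n + N)) g sequentially"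
  proof (rule uniform_limitI)
    fix r :: real assume "r > 0"
    from uniform_limitD[OF u this] obtain M where M: "\<And>n z. n \<ge> M \<Longrightarrow> z \<in> K \<Longrightarrow> dist (G n z) (g z) < r"
      by (auto simp: eventually_sequentially)
    show "\<forall>\<^sub>F n in sequentially. \<forall>z\<in>K. dist (G (n + N) z) (g z) < r"
      unfolding eventually_sequentially by (rule exI[of _ M]) (use M in auto)
  qed
  then show ?thesis
    using that[of "\<lambda>n. V (n + N)" "\<lambda>n. G (n + N)" "\<lambda>n. Gx (n + N)" "\<lambda>n. Gy (n + N)"]
      a L[THEN L2_tendsto_shift] N by auto
qed

lemma smooth_approx_continuous:
  assumes "smooth_approx K g gx gy"
  shows "continuous_on K g"
proof -
  obtain V G Gx Gy where a: "\<And>n. open (V n)" "\<And>n. K \<subseteq> V n" "\<And>n. c2_on (V n) (G n) (Gx n) (Gy n)"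
    "uniform_limit K G g sequentially"
    by (rule smooth_approxE[OF assms zero_less_one], rule that)
  show ?thesis
    by (rule uniform_limit_theorem[OF _ a(4)])
      (auto intro!: always_eventually continuous_on_subset[OF c1_on_continuous[OF c2_onD[OF a(3)]] a(2)])
qed

lemma smooth_approx_sq_integrable:
  assumes "smooth_approx K g gx gy"
  shows "sq_integrable (lborel_on K) gx" "sq_integrable (lborel_on K) gy"
  using assms by (auto simp: smooth_approx_def L2_tendsto_def)

lemma continuous_on_measurable_lborel_on:
  "closed K \<Longrightarrow> continuous_on K u \<Longrightarrow> u \<in> borel_measurable (lborel_on K)"
  using borel_measurable_continuous_on_restrict[of K u]
  by (metis measurable_lborel1 measurable_restrict_space1 sets_lborel sets_restrict_space_cong measurable_cong_sets)

lemma continuous_bounded_on_compact: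
  fixes u :: "complex \<Rightarrow> complex"
  assumes "compact K" "continuous_on K u"
  obtains C where "C \<ge> 0" "\<And>z. z \<in> K \<Longrightarrow> norm (u z) \<le> C"
proof -
  obtain C where "\<forall>z\<in>u ` K. norm z \<le> C"
    using compact_imp_bounded[OF compact_continuous_image[OF assms(2,1)]] unfolding bounded_iff by blast
  then show ?thesis using that[of "max 0 C"] by (auto simp: le_max_iff_disj)
qed

lemma smooth_approx_subset:
  assumes g: "smooth_approx K g gx gy" and "closed K" "K' \<subseteq> K" "closed K'"
  shows "smooth_approx K' g gx gy"
proof -
  have L: "L2_tendsto (lborel_on K') U u" if U: "L2_tendsto (lborel_on K) U u" for U u
  proof -
    have m: "borel_measurable (lborel_on K) \<subseteq> (borel_measurable (lborel_on K') :: (complex \<Rightarrow> complex) set)"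
    proof safe
      fix f :: "complex \<Rightarrow> complex" assume "f \<in> borel_measurable (lborel_on K)"
      then have "f \<in> borel_measurable (restrict_space (lborel_on K) K')"
        by (rule measurable_restrict_space1)
      then show "f \<in> borel_measurable (lborel_on K')"
        using assms by (simp add: restrict_restrict_space Int_absorb1)
    qed
    have r: "lborel_on K' = restrict_space (lborel_on K) K'"
      using assms by (simp add: restrict_restrict_space Int_absorb1)
    have i: "integrable (lborel_on K') h \<and> (\<integral>x. h x \<partial>lborel_on K') \<le> (\<integral>x. h x \<partial>lborel_on K)"
      if h: "integrable (lborel_on K) h" "\<And>x. h x \<ge> 0" for h :: "complex \<Rightarrow> real"
    proof -
      have K'm: "K' \<inter> space (lborel_on K) \<in> sets (lborel_on K)"
        using assms by (auto simp: sets_restrict_space space_restrict_space)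
      have a: "integrable (lborel_on K) (\<lambda>x. indicator K' x *\<^sub>R h x)"
      proof -
        have "K' \<inter> space (lborel_on K) = K'" using assms by (auto simp: space_restrict_space)
        then show ?thesis using integrable_mult_indicator[OF _ h(1), of K'] K'm by simp
      qed
      then have b: "integrable (lborel_on K') h"
        unfolding r using K'm by (subst integrable_restrict_space) auto
      have "(\<integral>x. h x \<partial>lborel_on K') = (\<integral>x. indicator K' x *\<^sub>R h x \<partial>lborel_on K)"
        unfolding r using K'm by (subst integral_restrict_space) auto
      also have "\<dots> \<le> (\<integral>x. h x \<partial>lborel_on K)"
        using a h by (intro integral_mono) (auto simp: indicator_def)
      finally show ?thesis using b by simp
    qed
    have s: "sq_integrable (lborel_on K') v" if "sq_integrable (lborel_on K) v" for v
      using that m i by (auto simp: sq_integrable_def)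
    show ?thesis unfolding L2_tendsto_def
    proof (intro conjI allI)
      show "sq_integrable (lborel_on K') u" "sq_integrable (lborel_on K') (U n)" for n
        using U s by (auto simp: L2_tendsto_def)
      have "(\<lambda>n. \<integral>x. (norm (U n x - u x))\<^sup>2 \<partial>lborel_on K) \<longlonglongrightarrow> 0" using U by (simp add: L2_tendsto_def)
      moreover have "(\<integral>x. (norm (U n x - u x))\<^sup>2 \<partial>lborel_on K') \<le> (\<integral>x. (norm (U n x - u x))\<^sup>2 \<partial>lborel_on K)" for n
      proof -
        have "sq_integrable (lborel_on K) (\<lambda>x. U n x - u x)"
          by (rule sq_integrable_diff) (use U in \<open>auto simp: L2_tendsto_def\<close>)
        then show ?thesis using i[of "\<lambda>x. (norm (U n x - u x))\<^sup>2"] by (simp add: sq_integrable_def)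
      qed
      ultimately show "(\<lambda>n. \<integral>x. (norm (U n x - u x))\<^sup>2 \<partial>lborel_on K') \<longlonglongrightarrow> 0"
        by (elim Lim_null_comparison[rotated]) simp
    qed
  qed
  obtain V G Gx Gy where a: "\<And>n. open (V n)" "\<And>n. K \<subseteq> V n" "\<And>n. c2_on (V n) (G n) (Gx n) (Gy n)"
    "uniform_limit K G g sequentially" "L2_tendsto (lborel_on K) Gx gx" "L2_tendsto (lborel_on K) Gy gy"
    by (rule smooth_approxE[OF g zero_less_one], rule that)
  show ?thesis unfolding smooth_approx_def
    by (rule exI[of _ V], rule exI[of _ G], rule exI[of _ Gx], rule exI[of _ Gy])
      (intro conjI allI a(1,3) order_trans[OF assms(3) a(2)] L[OF a(5)] L[OF a(6)] uniform_limit_on_subset[OF a(4) assms(3)])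
qed

text \<open>The approximations are eventually bounded away from zero on the compact set, so their reciprocals converge
  uniformly, and the factors \<open>- 1 / G^2\<close> of the gradients do too.\<close>

lemma smooth_approx_inverse:
  assumes g: "smooth_approx K g gx gy" and K: "compact K" and nz: "\<And>z. z \<in> K \<Longrightarrow> g z \<noteq> 0"
  shows "smooth_approx K (\<lambda>z. inverse (g z)) (\<lambda>z. - gx z / (g z)\<^sup>2) (\<lambda>z. - gy z / (g z)\<^sup>2)"
proof -
  note cg = smooth_approx_continuous[OF g] and cl = compact_imp_closed[OF K]
  obtain m where m: "m > 0" "\<And>z. z \<in> K \<Longrightarrow> 2 * m \<le> norm (g z)"
  proof (cases "K = {}")
    case True then show ?thesis using that[of 1] by auto
  next
    case False
    obtain z0 where z0: "z0 \<in> K" "\<And>z. z \<in> K \<Longrightarrow> norm (g z0) \<le> norm (g z)"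
      using continuous_attains_inf[OF K False, of "\<lambda>z. norm (g z)"] cg by (auto intro: continuous_intros)
    show ?thesis by (rule that[of "norm (g z0) / 2"]) (use z0 nz in auto)
  qed
  obtain V G Gx Gy where a: "\<And>n. open (V n)" "\<And>n. K \<subseteq> V n" "\<And>n. c2_on (V n) (G n) (Gx n) (Gy n)"
    "uniform_limit K G g sequentially" "L2_tendsto (lborel_on K) Gx gx" "L2_tendsto (lborel_on K) Gy gy"
    and d: "\<And>(n::nat) z. z \<in> K \<Longrightarrow> dist (G n z) (g z) < m"
    by (rule smooth_approxE[OF g m(1)], rule that)
  have Gm: "m \<le> norm (G n z)" if "z \<in> K" for n z
    using d[OF that, of n] m(2)[OF that] norm_triangle_ineq2[of "g z" "G n z"] by (simp add: dist_norm norm_minus_commute)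
  have gm: "m \<le> norm (g z)" if "z \<in> K" for z using m(2)[OF that] m(1) by simp
  note cG = c1_on_continuous[OF c2_onD[OF a(3)]]
  define W where "W n = {z \<in> V n. G n z \<noteq> 0}" for n
  have W: "open (W n)" "K \<subseteq> W n" for n
  proof -
    have "W n = V n \<inter> G n -` (- {0})" by (auto simp: W_def)
    then show "open (W n)" using continuous_open_preimage[OF cG[of n] a(1)[of n], of "- {0}"] by (simp add: open_Compl)
    show "K \<subseteq> W n"
    proof
      fix z assume z: "z \<in> K"
      then have "G n z \<noteq> 0" using Gm[OF z, of n] m(1) by auto
      then show "z \<in> W n" using z a(2) by (auto simp: W_def)
    qed
  qed
  have c2: "c2_on (W n) (\<lambda>z. inverse (G n z)) (\<lambda>z. - Gx n z / (G n z)\<^sup>2) (\<lambda>z. - Gy n z / (G n z)\<^sup>2)" for n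
    by (rule c2_on_inverse[OF c2_on_subset[OF a(3)]]) (use W in \<open>auto simp: W_def\<close>)
  have ui: "uniform_limit K (\<lambda>n z. inverse (G n z)) (\<lambda>z. inverse (g z)) sequentially"
    using uniform_lim_inverse[OF a(4), of m] gm m(1) by (simp add: o_def)
  have bnd: "norm (inverse (G n z)) \<le> inverse m" "norm (inverse (g z)) \<le> inverse m" if "z \<in> K" for n z
    using Gm[OF that, of n] gm[OF that] m(1) by (auto simp: norm_inverse intro!: le_imp_inverse_le)
  have u2: "uniform_limit K (\<lambda>n z. - (inverse (G n z) * inverse (G n z))) (\<lambda>z. - (inverse (g z) * inverse (g z))) sequentially"
  proof -
    have "bounded ((\<lambda>z. inverse (g z)) ` K)" using bnd(2) unfolding bounded_iff by blast
    note b = this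
    show ?thesis by (rule uniform_limit_uminus[OF uniform_lim_mult[OF ui ui b b]])
  qed
  have meas: "(\<lambda>z. - (inverse (G n z) * inverse (G n z))) \<in> borel_measurable (lborel_on K)"
    "(\<lambda>z. - (inverse (g z) * inverse (g z))) \<in> borel_measurable (lborel_on K)" for n
  proof -
    have n0: "G n z \<noteq> 0" "g z \<noteq> 0" if "z \<in> K" for n z
      using Gm[OF that, of n] gm[OF that] m(1) by auto
    show "(\<lambda>z. - (inverse (G n z) * inverse (G n z))) \<in> borel_measurable (lborel_on K)"
      by (intro continuous_on_measurable_lborel_on[OF cl] continuous_intros continuous_on_subset[OF cG a(2)]) (use n0 in auto)
    show "(\<lambda>z. - (inverse (g z) * inverse (g z))) \<in> borel_measurable (lborel_on K)"
      by (intro continuous_on_measurable_lborel_on[OF cl] continuous_intros cg) (use n0 in auto)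
  qed
  have LL: "L2_tendsto (lborel_on K) (\<lambda>n z. - U n z / (G n z)\<^sup>2) (\<lambda>z. - u z / (g z)\<^sup>2)"
    if "L2_tendsto (lborel_on K) U u" for U u
  proof -
    have b: "norm (- (x * x)) \<le> inverse m * inverse m" if "norm x \<le> inverse m" for x :: complex
      using mult_mono[OF that that] m(1) by (simp add: norm_mult)
    have "L2_tendsto (lborel_on K) (\<lambda>n z. - (inverse (G n z) * inverse (G n z)) * U n z) (\<lambda>z. - (inverse (g z) * inverse (g z)) * u z)"
      by (rule L2_tendsto_uniform_mult[OF that _ meas, where C="inverse m * inverse m"])
        (use u2 b bnd in \<open>auto simp: space_restrict_space\<close>)
    then show ?thesis
      by (rule L2_tendsto_cong) (simp_all add: divide_inverse power2_eq_square)
  qed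
  show ?thesis unfolding smooth_approx_def
    by (rule exI[of _ W], rule exI[of _ "\<lambda>n z. inverse (G n z)"], rule exI[of _ "\<lambda>n z. - Gx n z / (G n z)\<^sup>2"],
        rule exI[of _ "\<lambda>n z. - Gy n z / (G n z)\<^sup>2"])
      (intro conjI allI W c2 ui LL[OF a(5)] LL[OF a(6)])
qed

lemma L2_tendsto_integral_mult_diff:
  assumes "L2_tendsto M U u" "L2_tendsto M V v" "L2_tendsto M U' u'" "L2_tendsto M V' v'"
  shows "(\<lambda>n. \<integral>x. U n x * V n x - U' n x * V' n x \<partial>M) \<longlonglongrightarrow> (\<integral>x. u x * v x - u' x * v' x \<partial>M)"
proof -
  have i: "integrable M (\<lambda>x. U n x * V n x)" "integrable M (\<lambda>x. U' n x * V' n x)"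
    "integrable M (\<lambda>x. u x * v x)" "integrable M (\<lambda>x. u' x * v' x)" for n
    using assms by (auto simp: L2_tendsto_def intro!: sq_integrable_mult_integrable)
  show ?thesis
    unfolding Bochner_Integration.integral_diff[OF i(1,2)] Bochner_Integration.integral_diff[OF i(3,4)]
    by (intro tendsto_diff L2_tendsto_integral_mult assms)
qed

lemma c1_cutoff_vanish:
  assumes "c1_on UNIV w wx wy" "closed K" "\<And>z. z \<notin> K \<Longrightarrow> w z = 0" "z \<notin> K"
  shows "w z = 0" "wx z = 0" "wy z = 0"
  using c1_on_vanish[OF assms(1), of "- K" z] assms by auto

lemma L2_tendsto_continuous_mult:
  assumes "compact K" "continuous_on K b" "L2_tendsto (lborel_on K) U u"
  shows "L2_tendsto (lborel_on K) (\<lambda>n z. b z * U n z) (\<lambda>z. b z * u z)"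
proof -
  obtain C where C: "\<And>z. z \<in> K \<Longrightarrow> norm (b z) \<le> C"
    using continuous_bounded_on_compact[OF assms(1,2)] by metis
  show ?thesis
    by (rule L2_tendsto_bounded_mult[OF assms(3), where C=C])
      (use C assms in \<open>auto intro!: continuous_on_measurable_lborel_on compact_imp_closed simp: space_restrict_space\<close>)
qed

lemma smooth_approx_L2:
  assumes g: "smooth_approx K g gx gy" and K: "compact K"
  obtains V G Gx Gy where "\<And>n::nat. open (V n)" "\<And>n. K \<subseteq> V n" "\<And>n. c2_on (V n) (G n) (Gx n) (Gy n)"
    "L2_tendsto (lborel_on K) G g" "L2_tendsto (lborel_on K) Gx gx" "L2_tendsto (lborel_on K) Gy gy"
proof -
  obtain V G Gx Gy where a: "\<And>n. open (V n)" "\<And>n. K \<subseteq> V n" "\<And>n. c2_on (V n) (G n) (Gx n) (Gy n)"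
    "uniform_limit K G g sequentially" "L2_tendsto (lborel_on K) Gx gx" "L2_tendsto (lborel_on K) Gy gy"
    and d: "\<And>(n::nat) z. z \<in> K \<Longrightarrow> dist (G n z) (g z) < 1"
    by (rule smooth_approxE[OF g zero_less_one], rule that)
  note cg = smooth_approx_continuous[OF g]
  obtain C where C: "\<And>z. z \<in> K \<Longrightarrow> norm (g z) \<le> C"
    using continuous_bounded_on_compact[OF K cg] by metis
  have C': "norm (G n z) \<le> C + 1" if "z \<in> K" for n z
    using d[OF that, of n] C[OF that] norm_triangle_ineq2[of "G n z" "g z"] by (simp add: dist_norm)
  have "L2_tendsto (lborel_on K) G g"
  proof (rule L2_tendsto_uniform[OF finite_measure_lborel_on[OF K], where C="C + 1"])
    show "G n \<in> borel_measurable (lborel_on K)" for n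
      by (rule continuous_on_measurable_lborel_on[OF compact_imp_closed[OF K]
        continuous_on_subset[OF c1_on_continuous[OF c2_onD[OF a(3)]] a(2)]])
    show "g \<in> borel_measurable (lborel_on K)"
      by (rule continuous_on_measurable_lborel_on[OF compact_imp_closed[OF K] cg])
    show "norm (g z) \<le> C + 1" if "z \<in> space (lborel_on K)" for z
      using C[of z] that by (simp add: space_restrict_space)
  qed (use a(4) C' in \<open>auto simp: space_restrict_space\<close>)
  then show ?thesis using that a by blast
qed

text \<open>Each side is a sum of integrals of products of two functions, with a factor that does not depend on the index, and is
  therefore continuous under convergence in mean square.\<close>

lemma smooth_approx_Green:
  assumes g: "smooth_approx K g gx gy" and K: "compact K" and w: "c1_on UNIV w wx wy"
    and supp: "\<And>z. z \<notin> K \<Longrightarrow> w z = 0"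
  shows "(\<integral>z. w z * cnj (gx z) * gy z - w z * cnj (gy z) * gx z \<partial>lborel_on K) =
         - (\<integral>z. wx z * cnj (g z) * gy z - wy z * cnj (g z) * gx z \<partial>lborel_on K)"
proof -
  obtain V G Gx Gy where a: "\<And>n. open (V n)" "\<And>n. K \<subseteq> V n" "\<And>n::nat. c2_on (V n) (G n) (Gx n) (Gy n)"
    and L: "L2_tendsto (lborel_on K) G g" "L2_tendsto (lborel_on K) Gx gx" "L2_tendsto (lborel_on K) Gy gy"
    by (rule smooth_approx_L2[OF g K], rule that)
  note cl = compact_imp_closed[OF K]
  note v = c1_cutoff_vanish[OF w cl supp]
  note cw = continuous_on_subset[OF c1_on_continuous[OF w], of K, simplified]
    continuous_on_subset[OF c1_onD(2)[OF w], of K, simplified] continuous_on_subset[OF c1_onD(3)[OF w], of K, simplified]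
  have eq: "(\<integral>z. w z * cnj (Gx n z) * Gy n z - w z * cnj (Gy n z) * Gx n z \<partial>lborel_on K) =
         - (\<integral>z. wx z * cnj (G n z) * Gy n z - wy z * cnj (G n z) * Gx n z \<partial>lborel_on K)" for n
  proof -
    obtain Gxx Gxy Gyy where c: "c1_on (V n) (G n) (Gx n) (Gy n)" "c1_on (V n) (Gx n) Gxx Gxy" "c1_on (V n) (Gy n) Gxy Gyy"
      using a(3)[of n] by (auto simp: c2_on_def)
    have "(\<integral>z. w z * cnj (Gx n z) * Gy n z - w z * cnj (Gy n z) * Gx n z \<partial>lborel_on K)
      = (\<integral>z. w z * cnj (Gx n z) * Gy n z - w z * cnj (Gy n z) * Gx n z \<partial>lborel)"
      by (rule integral_lborel_on(1)[OF cl]) (simp add: v)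
    moreover have "(\<integral>z. wx z * cnj (G n z) * Gy n z - wy z * cnj (G n z) * Gx n z \<partial>lborel_on K)
      = (\<integral>z. wx z * cnj (G n z) * Gy n z - wy z * cnj (G n z) * Gx n z \<partial>lborel)"
      by (rule integral_lborel_on(1)[OF cl]) (simp add: v)
    ultimately show ?thesis
      using green_identity[OF c w a(1) K a(2) supp] by (simp add: algebra_simps)
  qed
  have l1: "(\<lambda>n. \<integral>z. w z * cnj (Gx n z) * Gy n z - w z * cnj (Gy n z) * Gx n z \<partial>lborel_on K)
     \<longlonglongrightarrow> (\<integral>z. w z * cnj (gx z) * gy z - w z * cnj (gy z) * gx z \<partial>lborel_on K)"
    by (intro L2_tendsto_integral_mult_diff L2_tendsto_continuous_mult K cw L2_tendsto_cnj L)
  have l2: "(\<lambda>n. \<integral>z. wx z * cnj (G n z) * Gy n z - wy z * cnj (G n z) * Gx n z \<partial>lborel_on K)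
     \<longlonglongrightarrow> (\<integral>z. wx z * cnj (g z) * gy z - wy z * cnj (g z) * gx z \<partial>lborel_on K)"
    by (intro L2_tendsto_integral_mult_diff L2_tendsto_continuous_mult K cw L2_tendsto_cnj L)
  show ?thesis
    by (rule LIMSEQ_unique[OF l1]) (unfold eq, rule tendsto_minus[OF l2])
qed

lemma smooth_approx_partials:
  assumes g: "smooth_approx K g gx gy" and K: "compact K" and w: "c1_on UNIV w wx wy"
    and supp: "\<And>z. z \<notin> K \<Longrightarrow> w z = 0"
  shows "(\<integral>z. w z * gx z \<partial>lborel_on K) = - (\<integral>z. wx z * g z \<partial>lborel_on K)"
    "(\<integral>z. w z * gy z \<partial>lborel_on K) = - (\<integral>z. wy z * g z \<partial>lborel_on K)"
proof -
  obtain V G Gx Gy where a: "\<And>n. open (V n)" "\<And>n. K \<subseteq> V n" "\<And>n::nat. c2_on (V n) (G n) (Gx n) (Gy n)"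
    and L: "L2_tendsto (lborel_on K) G g" "L2_tendsto (lborel_on K) Gx gx" "L2_tendsto (lborel_on K) Gy gy"
    by (rule smooth_approx_L2[OF g K], rule that)
  note cl = compact_imp_closed[OF K]
  note v = c1_cutoff_vanish[OF w cl supp]
  note cw = continuous_on_subset[OF c1_on_continuous[OF w], of K, simplified]
    continuous_on_subset[OF c1_onD(2)[OF w], of K, simplified] continuous_on_subset[OF c1_onD(3)[OF w], of K, simplified]
  obtain R where R: "K \<subseteq> cball 0 R"
    using compact_imp_bounded[OF K] unfolding bounded_iff by (metis mem_cball_0 subsetI)
  have out: "z \<notin> K" if "norm z > R" for z using R that by (meson linorder_not_less mem_cball_0 subsetD)
  have sq: "sq_integrable (lborel_on K) (\<lambda>z. b z)" if "continuous_on K b" for b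
    using sq_integrable_continuous_on[OF K that] .
  have eq: "(\<integral>z. w z * Gx n z \<partial>lborel_on K) = - (\<integral>z. wx z * G n z \<partial>lborel_on K)"
    "(\<integral>z. w z * Gy n z \<partial>lborel_on K) = - (\<integral>z. wy z * G n z \<partial>lborel_on K)" for n
  proof -
    note m = c1_on_mult_cutoff[OF c2_onD[OF a(3)[of n]] w a(1) cl a(2) supp]
    have w0: "w z * G n z = 0" if "norm z > R" for z using supp[OF out[OF that]] by simp
    have s: "sq_integrable (lborel_on K) (G n)" "sq_integrable (lborel_on K) (Gx n)" "sq_integrable (lborel_on K) (Gy n)"
      using L by (auto simp: L2_tendsto_def)
    have "(\<integral>z. wx z * G n z + w z * Gx n z \<partial>lborel_on K) = (\<integral>z. wx z * G n z + w z * Gx n z \<partial>lborel)"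
      by (rule integral_lborel_on(1)[OF cl]) (simp add: v)
    also have "\<dots> = 0" by (rule integral_partial_x_eq_0[OF m w0])
    finally show "(\<integral>z. w z * Gx n z \<partial>lborel_on K) = - (\<integral>z. wx z * G n z \<partial>lborel_on K)"
      using Bochner_Integration.integral_add[OF sq_integrable_mult_integrable[OF sq[OF cw(2)] s(1)]
          sq_integrable_mult_integrable[OF sq[OF cw(1)] s(2)]] by (simp add: eq_neg_iff_add_eq_0 add.commute)
    have "(\<integral>z. wy z * G n z + w z * Gy n z \<partial>lborel_on K) = (\<integral>z. wy z * G n z + w z * Gy n z \<partial>lborel)"
      by (rule integral_lborel_on(1)[OF cl]) (simp add: v)
    also have "\<dots> = 0" by (rule integral_partial_y_eq_0[OF m w0])
    finally show "(\<integral>z. w z * Gy n z \<partial>lborel_on K) = - (\<integral>z. wy z * G n z \<partial>lborel_on K)"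
      using Bochner_Integration.integral_add[OF sq_integrable_mult_integrable[OF sq[OF cw(3)] s(1)]
          sq_integrable_mult_integrable[OF sq[OF cw(1)] s(3)]] by (simp add: eq_neg_iff_add_eq_0 add.commute)
  qed
  have l: "(\<lambda>n. \<integral>z. b z * U n z \<partial>lborel_on K) \<longlonglongrightarrow> (\<integral>z. b z * u z \<partial>lborel_on K)"
    if "L2_tendsto (lborel_on K) U u" "continuous_on K b" for b U u
    by (rule L2_tendsto_integral_mult[OF L2_tendsto_const[OF sq[OF that(2)]] that(1)])
  show "(\<integral>z. w z * gx z \<partial>lborel_on K) = - (\<integral>z. wx z * g z \<partial>lborel_on K)"
    by (rule LIMSEQ_unique[OF l[OF L(2) cw(1)]]) (unfold eq, rule tendsto_minus[OF l[OF L(1) cw(2)]])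
  show "(\<integral>z. w z * gy z \<partial>lborel_on K) = - (\<integral>z. wy z * g z \<partial>lborel_on K)"
    by (rule LIMSEQ_unique[OF l[OF L(3) cw(1)]]) (unfold eq, rule tendsto_minus[OF l[OF L(1) cw(3)]])
qed

text \<open>The derivative with respect to the polar angle.\<close>

definition angular :: "(complex \<Rightarrow> complex) \<Rightarrow> (complex \<Rightarrow> complex) \<Rightarrow> complex \<Rightarrow> complex"
  where "angular gx gy z = of_real (Re z) * gy z - of_real (Im z) * gx z"

lemma L2_tendsto_angular:
  assumes "compact K" "L2_tendsto (lborel_on K) Gx gx" "L2_tendsto (lborel_on K) Gy gy"
  shows "L2_tendsto (lborel_on K) (\<lambda>n. angular (Gx n) (Gy n)) (angular gx gy)"
proof -
  have c: "continuous_on K (\<lambda>z. complex_of_real (Re z))" "continuous_on K (\<lambda>z. complex_of_real (- Im z))"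
    by (intro continuous_intros)+
  have "L2_tendsto (lborel_on K) (\<lambda>n z. of_real (Re z) * Gy n z) (\<lambda>z. of_real (Re z) * gy z)"
    by (rule L2_tendsto_continuous_mult[OF assms(1) c(1) assms(3)])
  moreover have "L2_tendsto (lborel_on K) (\<lambda>n z. of_real (- Im z) * Gx n z) (\<lambda>z. of_real (- Im z) * gx z)"
    by (rule L2_tendsto_continuous_mult[OF assms(1) c(2) assms(2)])
  ultimately show ?thesis
    by (rule L2_tendsto_cong[OF L2_tendsto_add]) (simp_all add: angular_def)
qed

abbreviation annulus :: "real \<Rightarrow> real \<Rightarrow> complex set"
  where "annulus a b \<equiv> {z. a \<le> norm z \<and> norm z \<le> b}"

lemma compact_annulus: "compact (annulus a b)"
proof -
  have "annulus a b = cball 0 b \<inter> (norm -` {a..})" by auto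
  moreover have "closed (norm -` {a..} :: complex set)" by (intro closed_vimage closed_atLeast continuous_intros)
  ultimately show ?thesis by (simp add: compact_Int_closed)
qed

text \<open>The isoperimetric inequality on every circle, averaged against a radial weight, and then passed to the limit.\<close>

lemma smooth_approx_isoperimetric:
  assumes g: "smooth_approx (annulus a b) g gx gy"
    and rho: "continuous_on UNIV \<rho>" "\<And>r. \<rho> r \<ge> 0" "\<And>r. r < a \<or> b < r \<Longrightarrow> \<rho> r = 0"
  shows "- (\<integral>z. \<rho> (norm z) * Im (cnj (g z) * angular gx gy z) \<partial>lborel_on (annulus a b))
     \<le> (\<integral>z. \<rho> (norm z) * (norm (angular gx gy z))\<^sup>2 \<partial>lborel_on (annulus a b))"
proof -
  let ?K = "annulus a b"
  note K = compact_annulus[of a b] and cl = compact_imp_closed[OF compact_annulus[of a b]]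
  obtain V G Gx Gy where a: "\<And>n. open (V n)" "\<And>n. ?K \<subseteq> V n" "\<And>n::nat. c2_on (V n) (G n) (Gx n) (Gy n)"
    and L: "L2_tendsto (lborel_on ?K) G g" "L2_tendsto (lborel_on ?K) Gx gx" "L2_tendsto (lborel_on ?K) Gy gy"
    by (rule smooth_approx_L2[OF g K], rule that)
  define R where "R z = complex_of_real (\<rho> (norm z))" for z :: complex
  have cR: "continuous_on A R" for A unfolding R_def
    by (intro continuous_intros continuous_on_compose2[OF rho(1)]) auto
  note LA = L2_tendsto_angular[OF K L(2,3)]
  note LR = L2_tendsto_continuous_mult[OF K cR]
  define I where "I h hx hy = Im (\<integral>z. R z * cnj (h z) * angular hx hy z \<partial>lborel_on ?K) + Re (\<integral>z. R z * cnj (angular hx hy z) * angular hx hy z \<partial>lborel_on ?K)"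
    for h hx hy
  have lim: "(\<lambda>n. I (G n) (Gx n) (Gy n)) \<longlonglongrightarrow> I g gx gy"
    unfolding I_def
    by (rule tendsto_add[OF tendsto_Im[OF L2_tendsto_integral_mult[OF LR[OF L2_tendsto_cnj[OF L(1)]] LA]]
          tendsto_Re[OF L2_tendsto_integral_mult[OF LR[OF L2_tendsto_cnj[OF LA]] LA]]])
  have I_eq: "I h hx hy = (\<integral>z. \<rho> (norm z) * Im (cnj (h z) * angular hx hy z) \<partial>lborel_on ?K) + (\<integral>z. \<rho> (norm z) * (norm (angular hx hy z))\<^sup>2 \<partial>lborel_on ?K)"
    and I_int: "integrable (lborel_on ?K) (\<lambda>z. \<rho> (norm z) * Im (cnj (h z) * angular hx hy z))"
       "integrable (lborel_on ?K) (\<lambda>z. \<rho> (norm z) * (norm (angular hx hy z))\<^sup>2)"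
    if h: "sq_integrable (lborel_on ?K) h" and A: "sq_integrable (lborel_on ?K) (angular hx hy)" for h hx hy
  proof -
    have m: "sq_integrable (lborel_on ?K) (\<lambda>z. R z * cnj (u z))" if "sq_integrable (lborel_on ?K) u" for u
      using LR[OF L2_tendsto_cnj[OF L2_tendsto_const[OF that]]] by (simp add: L2_tendsto_def)
    note i = sq_integrable_mult_integrable[OF m[OF h] A] sq_integrable_mult_integrable[OF m[OF A] A]
    have 1: "Im (R z * cnj (h z) * angular hx hy z) = \<rho> (norm z) * Im (cnj (h z) * angular hx hy z)" for z
      by (simp add: R_def algebra_simps)
    have 2: "Re (R z * cnj (angular hx hy z) * angular hx hy z) = \<rho> (norm z) * (norm (angular hx hy z))\<^sup>2" for z
    proof -
      have "R z * cnj (angular hx hy z) * angular hx hy z = of_real (\<rho> (norm z) * (norm (angular hx hy z))\<^sup>2)"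
        by (simp only: R_def of_real_mult complex_norm_square mult.assoc mult.commute[of "cnj _"])
      then show ?thesis by (simp only: Re_complex_of_real)
    qed
    show "I h hx hy = (\<integral>z. \<rho> (norm z) * Im (cnj (h z) * angular hx hy z) \<partial>lborel_on ?K) + (\<integral>z. \<rho> (norm z) * (norm (angular hx hy z))\<^sup>2 \<partial>lborel_on ?K)"
      unfolding I_def integral_Im[OF i(1), symmetric] integral_Re[OF i(2), symmetric] 1 2 by simp
    show "integrable (lborel_on ?K) (\<lambda>z. \<rho> (norm z) * Im (cnj (h z) * angular hx hy z))"
       "integrable (lborel_on ?K) (\<lambda>z. \<rho> (norm z) * (norm (angular hx hy z))\<^sup>2)"
      using integrable_Im[OF i(1)] integrable_Re[OF i(2)] by (simp_all only: 1 2)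
  qed
  have pos: "I (G n) (Gx n) (Gy n) \<ge> 0" for n
  proof -
    have s: "sq_integrable (lborel_on ?K) (G n)" "sq_integrable (lborel_on ?K) (angular (Gx n) (Gy n))"
      using L LA by (auto simp: L2_tendsto_def)
    define \<Phi> where "\<Phi> z = \<rho> (norm z) * ((norm (angular (Gx n) (Gy n) z))\<^sup>2 + Im (cnj (G n z) * angular (Gx n) (Gy n) z))" for z
    note c1 = c2_onD[OF a(3)[of n]]
    have out: "\<Phi> z = 0" if "z \<notin> ?K" for z using that rho(3)[of "norm z"] by (auto simp: \<Phi>_def)
    have cont: "continuous_on UNIV \<Phi>"
    proof -
      have 1: "continuous_on (V n) \<Phi>"
        unfolding \<Phi>_def angular_def using c1_on_continuous[OF c1] c1_onD(2,3)[OF c1]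
        by (intro continuous_intros continuous_on_compose2[OF rho(1)]) auto
      have 2: "continuous_on (- ?K) \<Phi>"
        by (rule continuous_on_eq[OF continuous_on_const[of _ 0]]) (simp add: out)
      have "continuous_on (V n \<union> - ?K) \<Phi>"
        by (rule continuous_on_open_Un[OF a(1) _ 1 2]) (simp add: cl open_Compl)
      moreover have "V n \<union> - ?K = UNIV" using a(2)[of n] by blast
      ultimately show ?thesis by simp
    qed
    have "(\<integral>z. \<Phi> z \<partial>lborel) \<ge> 0"
    proof (rule integral_nonneg_circles[OF cont, of b])
      show "\<Phi> z = 0" if "b < norm z" for z using that by (intro out) auto
      fix u :: complex
      show "0 \<le> integral {0..2 * pi} (\<lambda>t. \<Phi> (cis t * u))"
      proof (cases "u \<in> ?K")
        case False
        then have "\<Phi> (cis t * u) = 0" for t by (intro out) (auto simp: norm_mult)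
        then show ?thesis by simp
      next
        case True
        then have "cis t * u \<in> ?K" for t by (simp add: norm_mult)
        then have inK: "cis t * u \<in> V n" for t using a(2)[of n] by blast
        define A where "A t = angular (Gx n) (Gy n) (cis t * u)" for t
        have d: "((\<lambda>t. G n (cis t * u)) has_vector_derivative A t) (at t)" for t
        proof -
          have c': "(cis has_derivative (\<lambda>h. of_real h * (\<i> * cis t))) (at t)"
            using has_derivative_cis[OF has_derivative_ident, of t UNIV] by (simp add: scaleR_conv_of_real)
          have "((\<lambda>t. G n (cis t * u)) has_derivative (\<lambda>h. of_real (Re (of_real h * (\<i> * cis t) * u)) * Gx n (cis t * u) + of_real (Im (of_real h * (\<i> * cis t) * u)) * Gy n (cis t * u))) (at t)"
            by (rule has_derivative_compose[OF has_derivative_mult_left[OF c'] c1_onD(1)[OF c1 inK]])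
          then show ?thesis
            unfolding has_vector_derivative_def A_def angular_def
            by (rule has_derivative_eq_rhs) (simp add: fun_eq_iff algebra_simps scaleR_conv_of_real)
        qed
        have cA: "continuous_on UNIV A"
          unfolding A_def angular_def using inK
          by (intro continuous_intros continuous_on_compose2[OF c1_onD(2)[OF c1]] continuous_on_compose2[OF c1_onD(3)[OF c1]]) auto
        have "0 \<le> integral {0..2 * pi} (\<lambda>t. (norm (A t))\<^sup>2 + Im (cnj (G n (cis t * u)) * A t))"
          by (rule isoperimetric_circle[OF d cA]) (simp_all add: A_def cis_mult flip: cis_mult)
        moreover have "integral {0..2 * pi} (\<lambda>t. \<Phi> (cis t * u)) = \<rho> (norm u) * integral {0..2 * pi} (\<lambda>t. (norm (A t))\<^sup>2 + Im (cnj (G n (cis t * u)) * A t))"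
          by (simp add: \<Phi>_def A_def norm_mult)
        ultimately show ?thesis using rho(2) by simp
      qed
    qed
    also have "(\<integral>z. \<Phi> z \<partial>lborel) = (\<integral>z. \<Phi> z \<partial>lborel_on ?K)"
      by (rule integral_lborel_on(1)[OF cl out, symmetric])
    also have "\<dots> = I (G n) (Gx n) (Gy n)"
      unfolding I_eq[OF s] \<Phi>_def distrib_left
      using Bochner_Integration.integral_add[OF I_int(2)[OF s] I_int(1)[OF s]] by (simp only: add.commute)
    finally show ?thesis .
  qed
  have "I g gx gy \<ge> 0"
    by (rule LIMSEQ_le_const[OF lim]) (simp add: pos)
  moreover have "sq_integrable (lborel_on ?K) g" "sq_integrable (lborel_on ?K) (angular gx gy)"
    using L LA by (auto simp: L2_tendsto_def)
  ultimately show ?thesis using I_eq[of g gx gy] by simp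
qed

lemma c1_on_radial:
  fixes \<phi> \<phi>' :: "real \<Rightarrow> real"
  assumes d: "\<And>r. r > 0 \<Longrightarrow> (\<phi> has_real_derivative \<phi>' r) (at r)" and c: "continuous_on {0<..} \<phi>'"
    and a: "a > 0" and z: "\<And>r. r < a \<Longrightarrow> \<phi> r = 0"
  shows "c1_on UNIV (\<lambda>z. of_real (\<phi> (norm z))) (\<lambda>z. of_real (\<phi>' (norm z) / norm z * Re z)) (\<lambda>z. of_real (\<phi>' (norm z) / norm z * Im z))"
proof -
  have z': "\<phi>' r = 0" if "0 < r" "r < a" for r
  proof -
    have "((\<lambda>r. 0) has_real_derivative \<phi>' r) (at r)"
      by (rule has_field_derivative_transform_within_open[OF d[OF that(1)], of "{0<..<a}"]) (use that z in auto)
    then show ?thesis by (rule DERIV_unique[OF _ DERIV_const])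
  qed
  have 1: "c1_on (- {0}) (\<lambda>z. of_real (\<phi> (norm z))) (\<lambda>z. of_real (\<phi>' (norm z) / norm z * Re z)) (\<lambda>z. of_real (\<phi>' (norm z) / norm z * Im z))"
    unfolding c1_on_def
  proof (intro conjI ballI)
    fix z :: complex assume z: "z \<in> - {0}"
    have n: "(norm has_derivative (\<lambda>h. (Re z * Re h + Im z * Im h) / norm z)) (at z)"
      using has_derivative_norm[of z] z by (simp add: sgn_div_norm inner_complex_def field_simps fun_eq_iff)
    have "(\<phi> has_derivative (\<lambda>h. h * \<phi>' (norm z))) (at (norm z))"
      using d[of "norm z"] z by (simp add: has_field_derivative_def mult.commute[of _ "\<phi>' (norm z)"])
    from has_derivative_of_real[OF has_derivative_compose[OF n this]]
    show "((\<lambda>z. complex_of_real (\<phi> (norm z))) has_derivative (\<lambda>h. of_real (Re h) * of_real (\<phi>' (norm z) / norm z * Re z) + of_real (Im h) * of_real (\<phi>' (norm z) / norm z * Im z))) (at z)"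
      by (rule has_derivative_eq_rhs) (use z in \<open>simp add: fun_eq_iff field_simps\<close>)
  next
    have "continuous_on (- {0}) (\<lambda>z::complex. \<phi>' (norm z))"
      by (rule continuous_on_compose2[OF c]) (auto intro!: continuous_on_norm_id)
    then show "continuous_on (- {0}) (\<lambda>z. complex_of_real (\<phi>' (norm z) / norm z * Re z))"
      "continuous_on (- {0}) (\<lambda>z. complex_of_real (\<phi>' (norm z) / norm z * Im z))"
      by (auto intro!: continuous_on_of_real continuous_on_mult continuous_on_divide continuous_on_norm_id continuous_on_Re continuous_on_Im continuous_on_id)
  qed
  have 2: "c1_on (ball 0 a) (\<lambda>z. of_real (\<phi> (norm z))) (\<lambda>z. of_real (\<phi>' (norm z) / norm z * Re z)) (\<lambda>z. of_real (\<phi>' (norm z) / norm z * Im z))"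
  proof (rule c1_on_cong[OF c1_on_const[of _ 0]])
    fix w :: complex assume w: "w \<in> ball 0 a"
    then show "0 = complex_of_real (\<phi> (norm w))" using z by simp
    have "\<phi>' (norm w) / norm w = 0" using z'[of "norm w"] w by (cases "w = 0") auto
    then show "0 = complex_of_real (\<phi>' (norm w) / norm w * Re w)" "0 = complex_of_real (\<phi>' (norm w) / norm w * Im w)"
      by (simp_all only: mult_zero_left of_real_0)
  qed simp
  have "(- {0}) \<union> ball 0 a = (UNIV :: complex set)" using a by auto
  then show ?thesis using c1_on_Un[OF 1 2] by (simp add: open_Compl)
qed

section \<open>Radial cutoffs\<close>

text \<open>The quintic that rises from 0 to 1 on the unit interval with vanishing first and second derivatives at both ends,
  written without a case distinction.\<close>

definition smoothstep :: "real \<Rightarrow> real"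
  where "smoothstep x = max 0 x ^ 3 * (10 - 15 * x + 6 * x\<^sup>2) - max 0 (x - 1) ^ 3 * (6 * x\<^sup>2 + 3 * x + 1)"

definition smoothstep' :: "real \<Rightarrow> real"
  where "smoothstep' x = 30 * max 0 x ^ 2 * (1 - x)\<^sup>2 - 30 * max 0 (x - 1) ^ 2 * x\<^sup>2"

definition smoothstep'' :: "real \<Rightarrow> real"
  where "smoothstep'' x = 60 * max 0 x * (1 - x) * (1 - 2 * x) + 60 * max 0 (x - 1) * x * (1 - 2 * x)"

lemma smoothstep_eq:
  "x \<le> 0 \<Longrightarrow> smoothstep x = 0" "x \<ge> 1 \<Longrightarrow> smoothstep x = 1"
  "x \<le> 0 \<Longrightarrow> smoothstep' x = 0" "x \<ge> 1 \<Longrightarrow> smoothstep' x = 0"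
proof -
  show "x \<le> 0 \<Longrightarrow> smoothstep x = 0" "x \<le> 0 \<Longrightarrow> smoothstep' x = 0"
    by (auto simp: smoothstep_def smoothstep'_def max_def)
  show "x \<ge> 1 \<Longrightarrow> smoothstep x = 1"
    by (simp add: smoothstep_def max_def) algebra
  show "x \<ge> 1 \<Longrightarrow> smoothstep' x = 0"
    by (simp add: smoothstep'_def max_def) algebra
qed

lemma smoothstep_derivative: "(smoothstep has_real_derivative smoothstep' x) (at x)"
proof -
  have m: "((\<lambda>x. max 0 (x - c) ^ 3) has_real_derivative 3 * max 0 (x - c) ^ 2) (at x)" for c :: real
  proof -
    have "((\<lambda>x. x - c) has_real_derivative 1) (at x)" by (auto intro!: derivative_eq_intros)
    from DERIV_chain2[where f="\<lambda>t. max 0 t ^ 3", OF max_power_has_derivative this] show ?thesis by simp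
  qed
  have "(smoothstep has_real_derivative
     (3 * max 0 (x - 0) ^ 2 * (10 - 15 * x + 6 * x\<^sup>2) + max 0 (x - 0) ^ 3 * (12 * x - 15)
     - (3 * max 0 (x - 1) ^ 2 * (6 * x\<^sup>2 + 3 * x + 1) + max 0 (x - 1) ^ 3 * (12 * x + 3)))) (at x)"
    unfolding smoothstep_def[abs_def]
    by (rule derivative_eq_intros m[of 0, simplified] m[of 1] refl | simp)+
  also have "(3 * max 0 (x - 0) ^ 2 * (10 - 15 * x + 6 * x\<^sup>2) + max 0 (x - 0) ^ 3 * (12 * x - 15)
     - (3 * max 0 (x - 1) ^ 2 * (6 * x\<^sup>2 + 3 * x + 1) + max 0 (x - 1) ^ 3 * (12 * x + 3))) = smoothstep' x"
  proof -
    have "3 * max 0 x ^ 2 * (10 - 15 * x + 6 * x\<^sup>2) + max 0 x ^ 3 * (12 * x - 15) = 30 * max 0 x ^ 2 * (1 - x)\<^sup>2"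
      by (cases "x \<le> 0") (simp_all add: max_def, algebra)
    moreover have "3 * max 0 (x - 1) ^ 2 * (6 * x\<^sup>2 + 3 * x + 1) + max 0 (x - 1) ^ 3 * (12 * x + 3) = 30 * max 0 (x - 1) ^ 2 * x\<^sup>2"
      by (cases "x \<le> 1") (simp_all add: max_def, algebra)
    ultimately show ?thesis by (simp add: smoothstep'_def)
  qed
  finally show ?thesis .
qed

lemma smoothstep'_derivative: "(smoothstep' has_real_derivative smoothstep'' x) (at x)"
proof -
  have m: "((\<lambda>x. max 0 (x - c) ^ 2) has_real_derivative 2 * max 0 (x - c)) (at x)" for c :: real
  proof -
    have "((\<lambda>x. x - c) has_real_derivative 1) (at x)" by (auto intro!: derivative_eq_intros)
    from DERIV_chain2[where f="\<lambda>t. max 0 t ^ 2", OF max_power_has_derivative this] show ?thesis by simp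
  qed
  have "(smoothstep' has_real_derivative
     30 * (2 * max 0 (x - 0)) * (1 - x)\<^sup>2 + 30 * max 0 (x - 0) ^ 2 * (2 * (1 - x) * -1)
     - (30 * (2 * max 0 (x - 1)) * x\<^sup>2 + 30 * max 0 (x - 1) ^ 2 * (2 * x))) (at x)"
    unfolding smoothstep'_def[abs_def]
    by (rule derivative_eq_intros m[of 0, simplified] m[of 1] refl | simp)+
  also have "30 * (2 * max 0 (x - 0)) * (1 - x)\<^sup>2 + 30 * max 0 (x - 0) ^ 2 * (2 * (1 - x) * -1)
     - (30 * (2 * max 0 (x - 1)) * x\<^sup>2 + 30 * max 0 (x - 1) ^ 2 * (2 * x)) = smoothstep'' x"
  proof -
    have "30 * (2 * max 0 x) * (1 - x)\<^sup>2 + 30 * max 0 x ^ 2 * (2 * (1 - x) * -1) = 60 * max 0 x * (1 - x) * (1 - 2 * x)"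
      by (cases "x \<le> 0") (simp_all add: max_def, algebra)
    moreover have "30 * (2 * max 0 (x - 1)) * x\<^sup>2 + 30 * max 0 (x - 1) ^ 2 * (2 * x) = - (60 * max 0 (x - 1) * x * (1 - 2 * x))"
      by (cases "x \<le> 1") (simp_all add: max_def, algebra)
    ultimately show ?thesis by (simp add: smoothstep''_def)
  qed
  finally show ?thesis .
qed

lemma continuous_on_smoothstep: "continuous_on A smoothstep" "continuous_on A smoothstep'" "continuous_on A smoothstep''"
proof -
  show "continuous_on A smoothstep" "continuous_on A smoothstep'"
    using smoothstep_derivative smoothstep'_derivative by (meson DERIV_continuous_on has_field_derivative_at_within)+
  show "continuous_on A smoothstep''" unfolding smoothstep''_def[abs_def] by (intro continuous_intros)
qed

lemma smoothstep'_bounds: "0 \<le> smoothstep' x" "smoothstep' x \<le> 2"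
proof -
  have "0 \<le> smoothstep' x \<and> smoothstep' x \<le> 2"
  proof (cases "0 < x \<and> x < 1")
    case True
    have e: "smoothstep' x = 30 * (x * (1 - x))\<^sup>2" using True by (simp add: smoothstep'_def power_mult_distrib)
    have "x * (1 - x) \<le> 1 / 4" using zero_le_power2[of "2 * x - 1"] by (simp add: power2_eq_square algebra_simps)
    then have "(x * (1 - x))\<^sup>2 \<le> (1 / 4)\<^sup>2" using True by (intro power_mono) auto
    moreover have "(1 / 4 :: real)\<^sup>2 = 1 / 16" by (simp add: power2_eq_square)
    moreover have "0 \<le> (x * (1 - x))\<^sup>2" by simp
    ultimately show ?thesis unfolding e by linarith
  qed (use smoothstep_eq(3,4)[of x] in auto)
  then show "0 \<le> smoothstep' x" "smoothstep' x \<le> 2" by auto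
qed

lemma smoothstep_bounds: "0 \<le> smoothstep x" "smoothstep x \<le> 1"
proof -
  have mono: "smoothstep x \<le> smoothstep y" if "x \<le> y" for x y
    by (rule DERIV_nonneg_imp_nondecreasing[OF that]) (use smoothstep_derivative smoothstep'_bounds in blast)
  show "0 \<le> smoothstep x" using mono[of "min x 0" x] smoothstep_eq(1)[of "min x 0"] by simp
  show "smoothstep x \<le> 1" using mono[of x "max x 1"] smoothstep_eq(2)[of "max x 1"] by simp
qed

section \<open>Integrals over annuli\<close>

lemma lborel_on_restrict:
  fixes F :: "complex \<Rightarrow> 'b::{banach, second_countable_topology}"
  assumes "closed A" "closed B" "A \<subseteq> B" "\<And>z. z \<in> B - A \<Longrightarrow> F z = 0"
  shows "(\<integral>z. F z \<partial>lborel_on B) = (\<integral>z. F z \<partial>lborel_on A)"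
    "integrable (lborel_on B) F \<longleftrightarrow> integrable (lborel_on A) F"
proof -
  have "(\<lambda>z. indicator A z *\<^sub>R F z) = (\<lambda>z. indicator B z *\<^sub>R F z)"
    using assms(3,4) by (auto simp: fun_eq_iff indicator_def)
  then show "(\<integral>z. F z \<partial>lborel_on B) = (\<integral>z. F z \<partial>lborel_on A)"
    "integrable (lborel_on B) F \<longleftrightarrow> integrable (lborel_on A) F"
    using assms(1,2) by (simp_all add: integral_restrict_space integrable_restrict_space)
qed

lemma lborel_on_subset_mono:
  fixes F :: "complex \<Rightarrow> real"
  assumes "closed A" "closed B" "A \<subseteq> B" and i: "integrable (lborel_on B) F" and n: "AE z in lborel. z \<in> B \<longrightarrow> F z \<ge> 0"
  shows "integrable (lborel_on A) F" "(\<integral>z. F z \<partial>lborel_on A) \<le> (\<integral>z. F z \<partial>lborel_on B)"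
proof -
  have iB: "integrable lborel (\<lambda>z. indicator B z *\<^sub>R F z)" using i assms(2) by (simp add: integrable_restrict_space)
  have iA: "integrable lborel (\<lambda>z. indicator A z *\<^sub>R F z)"
  proof -
    have "integrable lborel (\<lambda>z. indicator A z *\<^sub>R (indicator B z *\<^sub>R F z))"
      using assms(1) by (intro integrable_mult_indicator iB) auto
    also have "(\<lambda>z. indicator A z *\<^sub>R (indicator B z *\<^sub>R F z)) = (\<lambda>z. indicator A z *\<^sub>R F z)"
      using assms(3) by (auto simp: fun_eq_iff indicator_def)
    finally show ?thesis .
  qed
  then show "integrable (lborel_on A) F" using assms(1) by (simp add: integrable_restrict_space)
  have "(\<integral>z. indicator A z *\<^sub>R F z \<partial>lborel) \<le> (\<integral>z. indicator B z *\<^sub>R F z \<partial>lborel)"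
  proof (rule integral_mono_AE[OF iA iB])
    show "AE z in lborel. indicator A z *\<^sub>R F z \<le> indicator B z *\<^sub>R F z"
      using n by eventually_elim (use assms(3) in \<open>auto simp: indicator_def\<close>)
  qed
  then show "(\<integral>z. F z \<partial>lborel_on A) \<le> (\<integral>z. F z \<partial>lborel_on B)"
    using assms(1,2) by (simp add: integral_restrict_space)
qed

lemma AE_lborel_on: "closed K \<Longrightarrow> (AE z in lborel. z \<in> K \<longrightarrow> P z) \<Longrightarrow> (AE z in lborel_on K. P z)"
  by (simp add: AE_restrict_space_iff)

lemma integrable_continuous_mult:
  fixes b F :: "complex \<Rightarrow> real"
  assumes K: "compact K" and b: "continuous_on K b" and F: "integrable (lborel_on K) F"
  shows "integrable (lborel_on K) (\<lambda>z. b z * F z)"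
proof -
  obtain C where C: "\<And>z. z \<in> K \<Longrightarrow> norm (complex_of_real (b z)) \<le> C"
    using continuous_bounded_on_compact[OF K continuous_on_of_real[OF b]] by blast
  have "(\<lambda>z. complex_of_real (b z)) \<in> borel_measurable (lborel_on K)"
    by (rule continuous_on_measurable_lborel_on[OF compact_imp_closed[OF K] continuous_on_of_real[OF b]])
  from measurable_compose[OF this borel_measurable_Re] have m: "b \<in> borel_measurable (lborel_on K)" by simp
  show ?thesis
  proof (rule Bochner_Integration.integrable_bound)
    show "integrable (lborel_on K) (\<lambda>z. C * F z)" using F by simp
    show "(\<lambda>z. b z * F z) \<in> borel_measurable (lborel_on K)" using m F by simp
    show "AE z in lborel_on K. norm (b z * F z) \<le> norm (C * F z)"
    proof (rule AE_I2)
      fix z assume "z \<in> space (lborel_on K)"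
      then have "\<bar>b z\<bar> \<le> C" using C[of z] by (simp add: space_restrict_space)
      then show "norm (b z * F z) \<le> norm (C * F z)" by (simp add: abs_mult mult_right_mono)
    qed
  qed
qed

lemma integrable_continuous_compact:
  fixes b :: "complex \<Rightarrow> real"
  assumes "compact K" "continuous_on K b"
  shows "integrable (lborel_on K) b"
proof -
  interpret finite_measure "lborel_on K" by (rule finite_measure_lborel_on[OF assms(1)])
  show ?thesis using integrable_continuous_mult[OF assms, of "\<lambda>_. 1"] by simp
qed

lemma continuous_on_norm_compose:
  fixes \<phi> :: "real \<Rightarrow> real"
  assumes "continuous_on {0<..} \<phi>" "0 < a"
  shows "continuous_on (annulus a b) (\<lambda>z. \<phi> (norm z))"
  by (rule continuous_on_compose2[OF assms(1)]) (use assms(2) in \<open>auto intro!: continuous_on_norm_id\<close>)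

lemma measure_annulus_le:
  assumes "a > 0" "b \<ge> 0"
  shows "measure (lborel_on (annulus a b)) (space (lborel_on (annulus a b))) \<le> 4 * b\<^sup>2"
proof -
  have "measure (lborel_on (annulus a b)) (space (lborel_on (annulus a b))) = measure lborel (annulus a b)"
    using compact_imp_closed[OF compact_annulus[of a b]] by (simp add: measure_restrict_space space_restrict_space)
  also have "\<dots> \<le> measure lborel (cbox (Complex (-b) (-b)) (Complex b b))"
  proof (rule measure_mono_fmeasurable)
    show "annulus a b \<subseteq> cbox (Complex (-b) (-b)) (Complex b b)"
    proof
      fix z :: complex assume "z \<in> annulus a b"
      then have "\<bar>Re z\<bar> \<le> b" "\<bar>Im z\<bar> \<le> b"
        using abs_Re_le_cmod[of z] abs_Im_le_cmod[of z] by simp_all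
      then show "z \<in> cbox (Complex (-b) (-b)) (Complex b b)" by (simp add: in_cbox_complex_iff abs_le_iff)
    qed
    show "annulus a b \<in> sets lborel" using compact_imp_closed[OF compact_annulus[of a b]] by simp
  qed simp
  also have "\<dots> = 4 * b\<^sup>2"
    using assms by (simp add: measure_lborel_cbox_eq Basis_complex_def inner_complex_def power2_eq_square)
  finally show ?thesis .
qed

text \<open>The mean value property on every circle.\<close>

lemma radial_holomorphic_integral:
  assumes H: "H holomorphic_on ball 0 1" and c\<rho>: "continuous_on UNIV \<rho>" and \<rho>0: "\<forall>r>b. \<rho> r = 0" and b: "b < 1"
  shows "(\<integral>z. of_real (\<rho> (norm z)) * H z \<partial>lborel) = H 0 * of_real (\<integral>z. \<rho> (norm (z::complex)) \<partial>lborel)"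
    "integrable lborel (\<lambda>z. of_real (\<rho> (norm z)) * H z)"
proof -
  have r: "continuous_on UNIV \<rho>" "\<And>r. b < r \<Longrightarrow> \<rho> r = 0" using c\<rho> \<rho>0 by auto
  have cr: "continuous_on UNIV (\<lambda>z::complex. complex_of_real (\<rho> (norm z)))"
    by (intro continuous_on_of_real continuous_on_compose2[OF r(1)] continuous_on_norm_id) auto
  have gen: "continuous_on UNIV (\<lambda>z. of_real (\<rho> (norm z)) * G z)" if "G holomorphic_on ball 0 1" for G
  proof -
    have 1: "continuous_on (ball 0 1) (\<lambda>z. of_real (\<rho> (norm z)) * G z)"
      using holomorphic_on_imp_continuous_on[OF that] continuous_on_subset[OF cr] by (intro continuous_on_mult) auto
    have 2: "continuous_on (- cball 0 b) (\<lambda>z. of_real (\<rho> (norm z)) * G z)"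
      by (rule continuous_on_eq[OF continuous_on_const[of _ 0]]) (simp add: r(2))
    have "ball 0 1 \<union> - cball (0::complex) b = UNIV" using b by auto
    then show ?thesis using continuous_on_open_Un[OF _ _ 1 2] by (simp add: open_Compl)
  qed
  show i: "integrable lborel (\<lambda>z. of_real (\<rho> (norm z)) * H z)"
    by (rule integrable_continuous_support[OF gen[OF H], of b]) (simp add: r(2))
  have i0: "integrable lborel (\<lambda>z::complex. complex_of_real (\<rho> (norm z)))"
    by (rule integrable_continuous_support[OF cr, of b]) (simp add: r(2))
  have h0: "(\<lambda>z. H z - H 0) holomorphic_on ball 0 1" by (intro holomorphic_intros H)
  have "(\<integral>z. of_real (\<rho> (norm z)) * (H z - H 0) \<partial>lborel) = 0"
  proof (rule integral_eq_0_circles[OF gen[OF h0], of b])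
    fix u :: complex
    show "integral {0..2 * pi} (\<lambda>t. of_real (\<rho> (norm (cis t * u))) * (H (cis t * u) - H 0)) = 0"
    proof (cases "norm u \<le> b")
      case True
      then have "norm u < 1" using b by simp
      from integral_circle_holomorphic[OF h0 this] show ?thesis by (simp add: norm_mult)
    next
      case False then show ?thesis using r(2)[of "norm u"] by (simp add: norm_mult)
    qed
  qed (simp add: r(2))
  then show "(\<integral>z. of_real (\<rho> (norm z)) * H z \<partial>lborel) = H 0 * of_real (\<integral>z. \<rho> (norm (z::complex)) \<partial>lborel)"
    using i i0 by (simp add: right_diff_distrib mult.commute)
qed

section \<open>Univalent functions with small dilatation near a pole\<close>

text \<open>The Jacobian is the difference of the squared absolute values of the derivatives \<open>(p - \<i> q) / 2\<close> with respect to
  \<open>z\<close> and \<open>(p + \<i> q) / 2\<close> with respect to its conjugate.\<close>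

lemma Jacobian_identity: "Im (cnj p * q) = ((norm (p - \<i> * q))\<^sup>2 - (norm (p + \<i> * q))\<^sup>2) / 4"
  unfolding cmod_power2 by (simp add: power2_eq_square algebra_simps)

text \<open>The angular derivative is \<open>\<i> (z a - cnj z b)\<close>, where \<open>a\<close> and \<open>b\<close> are the derivatives with respect to
  \<open>z\<close> and its conjugate.\<close>

lemma angular_bound:
  "norm (angular gx gy z) \<le> norm z * ((norm (gx z - \<i> * gy z) + norm (gx z + \<i> * gy z)) / 2)"
proof -
  have "2 * angular gx gy z = \<i> * (z * (gx z - \<i> * gy z) - cnj z * (gx z + \<i> * gy z))"
    unfolding angular_def by (simp add: complex_eq_iff algebra_simps)
  then have "norm (2 * angular gx gy z) = norm (\<i> * (z * (gx z - \<i> * gy z) - cnj z * (gx z + \<i> * gy z)))"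
    by (rule arg_cong)
  then have "norm (angular gx gy z) = 1 / 2 * norm (z * (gx z - \<i> * gy z) - cnj z * (gx z + \<i> * gy z))"
    unfolding norm_mult by simp
  also have "\<dots> \<le> 1 / 2 * (norm z * norm (gx z - \<i> * gy z) + norm z * norm (gx z + \<i> * gy z))"
    using norm_triangle_ineq4[of "z * (gx z - \<i> * gy z)" "cnj z * (gx z + \<i> * gy z)"] by (simp add: norm_mult)
  finally show ?thesis by (simp add: algebra_simps)
qed

lemma dilatation_bounds:
  fixes A B \<kappa> :: real
  assumes "0 \<le> A" "0 \<le> B" "B \<le> \<kappa> * A" "0 \<le> \<kappa>" "\<kappa> < 1"
  shows "0 \<le> (A\<^sup>2 - B\<^sup>2) / 4" "((A + B) / 2)\<^sup>2 \<le> (1 + \<kappa>) / (1 - \<kappa>) * ((A\<^sup>2 - B\<^sup>2) / 4)"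
    "(A / 2)\<^sup>2 \<le> ((A\<^sup>2 - B\<^sup>2) / 4) / (1 - \<kappa>\<^sup>2)"
proof -
  have "\<kappa> * A \<le> A" using assms by (simp add: mult_left_le_one_le)
  then have BA: "B \<le> A" using assms by linarith
  then show "0 \<le> (A\<^sup>2 - B\<^sup>2) / 4" using assms by (simp add: power_mono)
  have "(A + B) * (1 - \<kappa>) \<le> (1 + \<kappa>) * (A - B)" using assms by (simp add: algebra_simps)
  then have "(A + B) * ((A + B) * (1 - \<kappa>)) \<le> (A + B) * ((1 + \<kappa>) * (A - B))"
    using assms by (intro mult_left_mono) auto
  then show "((A + B) / 2)\<^sup>2 \<le> (1 + \<kappa>) / (1 - \<kappa>) * ((A\<^sup>2 - B\<^sup>2) / 4)"
    using assms by (simp add: divide_simps power2_eq_square algebra_simps)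
  have "B\<^sup>2 \<le> (\<kappa> * A)\<^sup>2" using assms by (intro power_mono)
  moreover have "\<kappa>\<^sup>2 < 1" using assms by (simp add: power_less_one_iff abs_square_less_1)
  ultimately show "(A / 2)\<^sup>2 \<le> ((A\<^sup>2 - B\<^sup>2) / 4) / (1 - \<kappa>\<^sup>2)"
    by (simp add: field_simps power_mult_distrib)
qed

text \<open>The reciprocal of a rescaled and normalised quasiconformal map. It has a simple pole at the origin. The global bound
  \<open>k\<close> for the dilatation makes the Jacobian nonnegative and lets the contribution of infinity disappear, the bound
  \<open>\<kappa>\<close> holds up to the radius \<open>T\<close>, and the bound \<open>L |z|^\<alpha>\<close> is the one that enters the final estimate
  linearly.\<close>

locale exterior_qc =
  fixes g gx gy kk :: "complex \<Rightarrow> complex" and c0 :: complex and k \<kappa> L T \<alpha> :: real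
  assumes approx: "\<And>a b. 0 < a \<Longrightarrow> smooth_approx (annulus a b) g gx gy"
    and decay: "(g \<longlongrightarrow> 0) at_infinity"
    and kk: "kk holomorphic_on ball 0 1"
    and g_inner: "\<And>z. 0 < norm z \<Longrightarrow> norm z < 1 \<Longrightarrow> g z = 1 / z + c0 + z * kk z"
    and gx_inner: "AE z in lborel. norm z < 1 \<longrightarrow> gx z = - 1 / z\<^sup>2 + (kk z + z * deriv kk z)"
    and gy_inner: "AE z in lborel. norm z < 1 \<longrightarrow> gy z = \<i> * (- 1 / z\<^sup>2 + (kk z + z * deriv kk z))"
    and k: "0 \<le> k" "k < 1" "AE z in lborel. norm (gx z + \<i> * gy z) \<le> k * norm (gx z - \<i> * gy z)"
    and \<kappa>: "0 \<le> \<kappa>" "\<kappa> < 1" "AE z in lborel. norm z < T \<longrightarrow> norm (gx z + \<i> * gy z) \<le> \<kappa> * norm (gx z - \<i> * gy z)"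
    and L: "0 \<le> L" "AE z in lborel. norm (gx z + \<i> * gy z) \<le> L * norm z powr \<alpha> * norm (gx z - \<i> * gy z)"
    and T: "1 \<le> T"
begin

text \<open>\<open>J\<close> is the Jacobian, \<open>E\<close> the squared norm of the derivative as a linear map, and \<open>B\<close> the density of
  twice the signed area enclosed by the images of circles.\<close>

definition J :: "complex \<Rightarrow> real" where "J z = Im (cnj (gx z) * gy z)"
definition E :: "complex \<Rightarrow> real" where "E z = ((norm (gx z - \<i> * gy z) + norm (gx z + \<i> * gy z)) / 2)\<^sup>2"
definition B :: "complex \<Rightarrow> real" where "B z = Im (cnj (g z) * angular gx gy z)"

lemma J_nonneg: "AE z in lborel. J z \<ge> 0"
  using k(3) by eventually_elim (unfold J_def Jacobian_identity, rule dilatation_bounds(1)[OF norm_ge_zero norm_ge_zero _ k(1,2)])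

lemma E_le_J: "AE z in lborel. E z \<le> (1 + k) / (1 - k) * J z"
  using k(3) by eventually_elim (unfold J_def E_def Jacobian_identity, rule dilatation_bounds(2)[OF norm_ge_zero norm_ge_zero _ k(1,2)])

lemma E_le_J_near: "AE z in lborel. norm z < T \<longrightarrow> E z \<le> (1 + \<kappa>) / (1 - \<kappa>) * J z"
  using \<kappa>(3)
proof eventually_elim
  case (elim z)
  then show ?case
    unfolding J_def E_def Jacobian_identity
    using dilatation_bounds(2)[OF norm_ge_zero norm_ge_zero _ \<kappa>(1,2), of "gx z + \<i> * gy z" "gx z - \<i> * gy z"]
    by blast
qed

lemma angular_sq_le: "(norm (angular gx gy z))\<^sup>2 \<le> (norm z)\<^sup>2 * E z"
  using power_mono[OF angular_bound norm_ge_zero, of gx gy z 2] by (simp only: E_def power_mult_distrib)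

lemma norm_angular_le: "norm (angular gx gy z) \<le> norm z * sqrt (E z)"
  using angular_bound[of gx gy z] by (simp add: E_def)

lemma sq:
  assumes "0 < a"
  shows "sq_integrable (lborel_on (annulus a b)) g" "sq_integrable (lborel_on (annulus a b)) gx"
    "sq_integrable (lborel_on (annulus a b)) gy" "sq_integrable (lborel_on (annulus a b)) (angular gx gy)"
proof -
  note s = smooth_approx_sq_integrable[OF approx[OF assms, of b]]
  show "sq_integrable (lborel_on (annulus a b)) gx" "sq_integrable (lborel_on (annulus a b)) gy" using s by auto
  show "sq_integrable (lborel_on (annulus a b)) g"
    by (rule sq_integrable_continuous_on[OF compact_annulus smooth_approx_continuous[OF approx[OF assms]]])
  show "sq_integrable (lborel_on (annulus a b)) (angular gx gy)"
    using L2_tendsto_angular[OF compact_annulus L2_tendsto_const[OF s(1)] L2_tendsto_const[OF s(2)]] by (simp add: L2_tendsto_def)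
qed

lemma integrables:
  assumes "0 < a"
  shows "integrable (lborel_on (annulus a b)) J" "integrable (lborel_on (annulus a b)) E"
    "integrable (lborel_on (annulus a b)) (\<lambda>z. (norm (angular gx gy z))\<^sup>2)" "integrable (lborel_on (annulus a b)) B"
proof -
  note s = sq[OF assms, of b]
  show "integrable (lborel_on (annulus a b)) J"
    using integrable_Im[OF sq_integrable_mult_integrable[OF sq_integrable_cnj[OF s(2)] s(3)]] by (simp add: J_def[abs_def])
  show "integrable (lborel_on (annulus a b)) B"
    using integrable_Im[OF sq_integrable_mult_integrable[OF sq_integrable_cnj[OF s(1)] s(4)]] by (simp add: B_def[abs_def])
  show "integrable (lborel_on (annulus a b)) (\<lambda>z. (norm (angular gx gy z))\<^sup>2)"
    using s(4) by (simp add: sq_integrable_def)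
  have 1: "sq_integrable (lborel_on (annulus a b)) (\<lambda>z. gx z - \<i> * gy z)" "sq_integrable (lborel_on (annulus a b)) (\<lambda>z. gx z + \<i> * gy z)"
    by (intro sq_integrable_diff sq_integrable_add sq_integrable_cmult s)+
  show "integrable (lborel_on (annulus a b)) E"
  proof (rule Bochner_Integration.integrable_bound)
    show "integrable (lborel_on (annulus a b)) (\<lambda>z. (norm (gx z - \<i> * gy z))\<^sup>2 + (norm (gx z + \<i> * gy z))\<^sup>2)"
      using 1 by (simp add: sq_integrable_def)
    show "E \<in> borel_measurable (lborel_on (annulus a b))"
      unfolding E_def[abs_def]
      by (intro borel_measurable_power borel_measurable_divide borel_measurable_add borel_measurable_const
          measurable_compose[OF 1(1)[THEN sq_integrable_measurable] borel_measurable_norm]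
          measurable_compose[OF 1(2)[THEN sq_integrable_measurable] borel_measurable_norm])
    show "AE z in lborel_on (annulus a b). norm (E z) \<le> norm ((norm (gx z - \<i> * gy z))\<^sup>2 + (norm (gx z + \<i> * gy z))\<^sup>2)"
    proof (rule AE_I2)
      fix z
      have "((u + v) / 2)\<^sup>2 \<le> u\<^sup>2 + v\<^sup>2" for u v :: real
      proof -
        have "0 \<le> (u - v)\<^sup>2" "0 \<le> u\<^sup>2" "0 \<le> v\<^sup>2" by simp_all
        then have "2 * u * v \<le> 3 * v\<^sup>2 + 3 * u\<^sup>2" unfolding power2_diff by linarith
        then show ?thesis unfolding power_divide power2_sum by simp
      qed
      then show "norm (E z) \<le> norm ((norm (gx z - \<i> * gy z))\<^sup>2 + (norm (gx z + \<i> * gy z))\<^sup>2)"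
        by (simp add: E_def)
    qed
  qed
qed

lemma integrable_radial:
  assumes "0 < a" "continuous_on {0<..} \<phi>"
  shows "integrable (lborel_on (annulus a b)) (\<lambda>z. \<phi> (norm z) * J z)" "integrable (lborel_on (annulus a b)) (\<lambda>z. \<phi> (norm z) * E z)"
    "integrable (lborel_on (annulus a b)) (\<lambda>z. \<phi> (norm z) * (norm (angular gx gy z))\<^sup>2)" "integrable (lborel_on (annulus a b)) (\<lambda>z. \<phi> (norm z) * B z)"
  using integrables[OF assms(1), of b]
  by (auto intro!: integrable_continuous_mult[OF compact_annulus] continuous_on_norm_compose[OF assms(2,1)])

text \<open>For a radial weight, Green's formula pairs the gradient of the weight with the angular derivative of \<open>g\<close>
  alone.\<close>

lemma radial_Green:
  assumes d: "\<And>r. r > 0 \<Longrightarrow> (\<phi> has_real_derivative \<phi>' r) (at r)" and c: "continuous_on {0<..} \<phi>'"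
    and a: "0 < a" and z: "\<And>r. r < a \<Longrightarrow> \<phi> r = 0" "\<And>r. r > b \<Longrightarrow> \<phi> r = 0"
  shows "(\<integral>z. \<phi> (norm z) * J z \<partial>lborel_on (annulus a b)) = - (1 / 2) * (\<integral>z. (\<phi>' (norm z) / norm z) * B z \<partial>lborel_on (annulus a b))"
proof -
  let ?K = "annulus a b"
  define w wx wy where "w = (\<lambda>z::complex. complex_of_real (\<phi> (norm z)))"
    and "wx = (\<lambda>z. complex_of_real (\<phi>' (norm z) / norm z * Re z))" and "wy = (\<lambda>z. complex_of_real (\<phi>' (norm z) / norm z * Im z))"
  have w: "c1_on UNIV w wx wy" unfolding w_def wx_def wy_def by (rule c1_on_radial[OF d c a z(1)])
  have supp: "w z = 0" if "z \<notin> ?K" for z using that z by (auto simp: w_def not_le)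
  have G: "(\<integral>z. w z * cnj (gx z) * gy z - w z * cnj (gy z) * gx z \<partial>lborel_on ?K) =
      - (\<integral>z. wx z * cnj (g z) * gy z - wy z * cnj (g z) * gx z \<partial>lborel_on ?K)"
    by (rule smooth_approx_Green[OF approx[OF a] compact_annulus w supp])
  note cc = continuous_on_subset[OF c1_on_continuous[OF w] subset_UNIV, of ?K] continuous_on_subset[OF c1_onD(2)[OF w] subset_UNIV, of ?K]
    continuous_on_subset[OF c1_onD(3)[OF w] subset_UNIV, of ?K]
  note s = sq[OF a, of b]
  have sm: "sq_integrable (lborel_on ?K) (\<lambda>z. q z * cnj (u z))" if "continuous_on ?K q" "sq_integrable (lborel_on ?K) u" for q u
    using L2_tendsto_continuous_mult[OF compact_annulus that(1) L2_tendsto_const[OF sq_integrable_cnj[OF that(2)]]] by (simp add: L2_tendsto_def)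
  have i1: "integrable (lborel_on ?K) (\<lambda>z. w z * cnj (gx z) * gy z - w z * cnj (gy z) * gx z)"
    by (intro Bochner_Integration.integrable_diff sq_integrable_mult_integrable sm cc s)
  have i2: "integrable (lborel_on ?K) (\<lambda>z. wx z * cnj (g z) * gy z - wy z * cnj (g z) * gx z)"
    by (intro Bochner_Integration.integrable_diff sq_integrable_mult_integrable sm cc s)
  have e1: "Im (w z * cnj (gx z) * gy z - w z * cnj (gy z) * gx z) = 2 * (\<phi> (norm z) * J z)" for z
    by (simp add: w_def J_def algebra_simps)
  have e2: "Im (wx z * cnj (g z) * gy z - wy z * cnj (g z) * gx z) = (\<phi>' (norm z) / norm z) * B z" for z
  proof -
    have "wx z * cnj (g z) * gy z - wy z * cnj (g z) * gx z = of_real (\<phi>' (norm z) / norm z) * (cnj (g z) * angular gx gy z)"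
      by (simp add: wx_def wy_def angular_def algebra_simps)
    then show ?thesis by (simp add: B_def del: of_real_divide)
  qed
  have "2 * (\<integral>z. \<phi> (norm z) * J z \<partial>lborel_on ?K) = Im (\<integral>z. w z * cnj (gx z) * gy z - w z * cnj (gy z) * gx z \<partial>lborel_on ?K)"
    unfolding integral_Im[OF i1, symmetric] e1 by simp
  also have "\<dots> = - Im (\<integral>z. wx z * cnj (g z) * gy z - wy z * cnj (g z) * gx z \<partial>lborel_on ?K)"
    using arg_cong[OF G, of Im] by simp
  also have "\<dots> = - (\<integral>z. (\<phi>' (norm z) / norm z) * B z \<partial>lborel_on ?K)"
    unfolding integral_Im[OF i2, symmetric] e2 by simp
  finally show ?thesis by simp
qed

end

section \<open>Area estimates\<close>

lemma at_infinity_small: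
  assumes "((g :: complex \<Rightarrow> complex) \<longlongrightarrow> 0) at_infinity" "\<delta> > 0"
  obtains R where "R > 0" "\<And>z. norm z \<ge> R \<Longrightarrow> norm (g z) \<le> \<delta>"
proof -
  have "eventually (\<lambda>z. dist (g z) 0 < \<delta>) at_infinity" using assms tendstoD by blast
  then obtain R where "\<And>z. norm z \<ge> R \<Longrightarrow> dist (g z) 0 < \<delta>" by (auto simp: eventually_at_infinity)
  then show ?thesis using that[of "max R 1"] by (force simp: less_imp_le)
qed

lemma continuous_on_zero_extend:
  fixes \<rho> :: "real \<Rightarrow> real"
  assumes "continuous_on {0<..} \<rho>" "0 < a" "\<And>r. r < a \<Longrightarrow> \<rho> r = 0"
  shows "continuous_on UNIV \<rho>"
proof -
  have 2: "continuous_on {..<a} \<rho>"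
    by (rule continuous_on_eq[OF continuous_on_const[of _ 0]]) (use assms(3) in auto)
  have "{0<..} \<union> {..<a} = (UNIV :: real set)" using assms(2) by auto
  then show ?thesis using continuous_on_open_Un[OF _ _ assms(1) 2] by simp
qed

text \<open>The derivative of the cutoff \<open>smoothstep (8 r - 1)\<close>, divided by \<open>r\<close>.\<close>

definition ramp :: "real \<Rightarrow> real" where "ramp r = 8 * smoothstep' (8 * r - 1) / r"

lemma ramp_eq_0: "r \<le> 1 / 8 \<Longrightarrow> ramp r = 0" "r \<ge> 1 / 4 \<Longrightarrow> ramp r = 0"
  by (auto simp: ramp_def smoothstep_eq)

lemma ramp_nonneg: "ramp r \<ge> 0"
  using smoothstep'_bounds(1)[of "8 * r - 1"] ramp_eq_0(1)[of r] by (cases "r \<le> 1 / 8") (auto simp: ramp_def)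

lemma continuous_ramp: "continuous_on {0<..} ramp" "continuous_on UNIV ramp"
  "continuous_on UNIV (\<lambda>r. ramp r / r\<^sup>2)"
proof -
  show 1: "continuous_on {0<..} ramp"
    unfolding ramp_def[abs_def] by (intro continuous_intros continuous_on_compose2[OF continuous_on_smoothstep(2)[of UNIV]]) auto
  show "continuous_on UNIV ramp" by (rule continuous_on_zero_extend[OF 1, of "1/8"]) (auto simp: ramp_eq_0)
  show "continuous_on UNIV (\<lambda>r. ramp r / r\<^sup>2)"
    by (rule continuous_on_zero_extend[of _ "1/8"]) (auto simp: ramp_eq_0 intro!: continuous_intros 1)
qed

lemma smoothstep_affine_derivative:
  "((\<lambda>r. smoothstep (m * r - c)) has_real_derivative m * smoothstep' (m * r - c)) (at r)"
proof -
  have "((\<lambda>r. m * r - c) has_real_derivative m) (at r)" by (auto intro!: derivative_eq_intros)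
  from DERIV_chain2[OF smoothstep_derivative this] show ?thesis by (simp add: mult.commute)
qed

text \<open>By Green's formula the integral is twice the area integral of \<open>|H'|^2\<close> with the weight
  \<open>1 - smoothstep (8 r - 1)\<close>.\<close>

lemma holomorphic_ramp_area:
  assumes H: "H holomorphic_on ball 0 1"
  shows "integrable lborel (\<lambda>z. ramp (norm z) * Re (z * deriv H z * cnj (H z)))"
    "(\<integral>z. ramp (norm z) * Re (z * deriv H z * cnj (H z)) \<partial>lborel) \<ge> 0"
proof -
  have hd: "deriv H holomorphic_on ball 0 1" using H holomorphic_deriv by blast
  have cc: "continuous_on (ball 0 1) H" "continuous_on (ball 0 1) (deriv H)"
    using H hd holomorphic_on_imp_continuous_on by auto
  have cr: "continuous_on UNIV (\<lambda>z::complex. complex_of_real (ramp (norm z)))"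
    by (intro continuous_on_of_real continuous_on_compose2[OF continuous_ramp(2)] continuous_on_norm_id) auto
  let ?F = "\<lambda>z. of_real (ramp (norm z)) * (z * deriv H z * cnj (H z))"
  have cF: "continuous_on UNIV ?F"
  proof -
    have 1: "continuous_on (ball 0 1) ?F" by (intro continuous_intros cc continuous_on_subset[OF cr]) auto
    have 2: "continuous_on (- cball 0 (1/4)) ?F"
      by (rule continuous_on_eq[OF continuous_on_const[of _ 0]]) (simp add: ramp_eq_0)
    have "ball 0 1 \<union> - cball (0::complex) (1/4) = UNIV" by auto
    then show ?thesis using continuous_on_open_Un[OF _ _ 1 2] by (simp add: open_Compl)
  qed
  have iF: "integrable lborel ?F"
    by (rule integrable_continuous_support[OF cF, of "1/4"]) (simp add: ramp_eq_0)
  have Re: "Re (?F z) = ramp (norm z) * Re (z * deriv H z * cnj (H z))" for z by simp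
  show "integrable lborel (\<lambda>z. ramp (norm z) * Re (z * deriv H z * cnj (H z)))"
    using integrable_Re[OF iF] by (simp only: Re)
  define w where "w = (\<lambda>z::complex. 1 + (- 1) * complex_of_real (smoothstep (8 * norm z - 1)))"
  have w: "c1_on UNIV w (\<lambda>z. 0 + (- 1) * of_real (8 * smoothstep' (8 * norm z - 1) / norm z * Re z))
      (\<lambda>z. 0 + (- 1) * of_real (8 * smoothstep' (8 * norm z - 1) / norm z * Im z))"
    unfolding w_def
  proof (intro c1_on_add c1_on_const c1_on_cmult)
    show "c1_on UNIV (\<lambda>z. complex_of_real (smoothstep (8 * norm z - 1))) (\<lambda>z. of_real (8 * smoothstep' (8 * norm z - 1) / norm z * Re z))
      (\<lambda>z. of_real (8 * smoothstep' (8 * norm z - 1) / norm z * Im z))"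
      by (rule c1_on_radial[where a="1/8"])
        (auto intro!: smoothstep_affine_derivative continuous_intros continuous_on_compose2[OF continuous_on_smoothstep(2)[of UNIV]] simp: smoothstep_eq)
  qed
  obtain Hxx Hxy Hyy where c2: "c1_on (ball 0 1) H (deriv H) (\<lambda>z. \<i> * deriv H z)" "c1_on (ball 0 1) (deriv H) Hxx Hxy"
     "c1_on (ball 0 1) (\<lambda>z. \<i> * deriv H z) Hxy Hyy"
    using c2_on_holomorphic[OF open_ball H] unfolding c2_on_def by blast
  have G: "(\<integral>z. w z * (cnj (deriv H z) * (\<i> * deriv H z) - cnj (\<i> * deriv H z) * deriv H z) \<partial>lborel) =
         - (\<integral>z. cnj (H z) * ((0 + (- 1) * of_real (8 * smoothstep' (8 * norm z - 1) / norm z * Re z)) * (\<i> * deriv H z)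
            - (0 + (- 1) * of_real (8 * smoothstep' (8 * norm z - 1) / norm z * Im z)) * deriv H z) \<partial>lborel)"
    by (rule green_identity[OF c2 w open_ball compact_cball[of 0 "1/4"]]) (auto simp: w_def smoothstep_eq)
  have e1: "w z * (cnj (deriv H z) * (\<i> * deriv H z) - cnj (\<i> * deriv H z) * deriv H z)
     = 2 * \<i> * of_real ((1 - smoothstep (8 * norm z - 1)) * (norm (deriv H z))\<^sup>2)" for z
    unfolding of_real_mult complex_norm_square by (simp add: w_def algebra_simps)
  have e2: "cnj (H z) * ((0 + (- 1) * of_real (8 * smoothstep' (8 * norm z - 1) / norm z * Re z)) * (\<i> * deriv H z)
            - (0 + (- 1) * of_real (8 * smoothstep' (8 * norm z - 1) / norm z * Im z)) * deriv H z) = - \<i> * ?F z" for z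
  proof -
    have zz: "z = of_real (Re z) + \<i> * of_real (Im z)" by (simp add: complex_eq_iff)
    have "- \<i> * ?F z = - \<i> * (of_real (ramp (norm z)) * ((of_real (Re z) + \<i> * of_real (Im z)) * deriv H z * cnj (H z)))"
      using zz by metis
    then show ?thesis by (simp add: ramp_def algebra_simps)
  qed
  have "2 * \<i> * of_real (\<integral>z. (1 - smoothstep (8 * norm z - 1)) * (norm (deriv H z))\<^sup>2 \<partial>lborel) = \<i> * (\<integral>z. ?F z \<partial>lborel)"
    using G unfolding e1 e2
    by (simp only: integral_mult_right_zero integral_complex_of_real mult_minus_left minus_minus Bochner_Integration.integral_minus)
  then have "(\<integral>z. ?F z \<partial>lborel) = of_real (2 * (\<integral>z. (1 - smoothstep (8 * norm z - 1)) * (norm (deriv H z))\<^sup>2 \<partial>lborel))"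
    by (simp add: complex_eq_iff)
  then have "Re (\<integral>z. ?F z \<partial>lborel) = 2 * (\<integral>z. (1 - smoothstep (8 * norm z - 1)) * (norm (deriv H z))\<^sup>2 \<partial>lborel)"
    by simp
  moreover have "(\<integral>z. (1 - smoothstep (8 * norm z - 1)) * (norm (deriv H z))\<^sup>2 \<partial>lborel) \<ge> 0"
    by (intro integral_nonneg_AE AE_I2 mult_nonneg_nonneg) (use smoothstep_bounds in auto)
  ultimately show "(\<integral>z. ramp (norm z) * Re (z * deriv H z * cnj (H z)) \<partial>lborel) \<ge> 0"
    unfolding integral_Re[OF iF, symmetric] Re by simp
qed

definition ramp_energy :: real
  where "ramp_energy = 1 / 2 * (\<integral>z. ramp (norm (z::complex)) / (norm z)\<^sup>2 \<partial>lborel)"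

lemma ramp_energy_nonneg: "ramp_energy \<ge> 0"
  unfolding ramp_energy_def by (intro mult_nonneg_nonneg integral_nonneg_AE AE_I2) (auto simp: ramp_nonneg)

text \<open>A continuously differentiable function that is comparable to \<open>r\<close> up to \<open>T\<close> and constant from there on, with
  logarithmic derivative at most \<open>1 / r\<close>. It turns \<open>r^\<alpha>\<close> into a bounded weight whose derivative lives
  where the dilatation is at most \<open>\<kappa>\<close>.\<close>

definition saturation :: "real \<Rightarrow> real \<Rightarrow> real"
  where "saturation T r = T * (1 - (max 0 (1 - r / T))\<^sup>2)"

lemma saturation_derivative:
  assumes "T > 0"
  shows "(saturation T has_real_derivative 2 * max 0 (1 - r / T)) (at r)"
proof -
  have 1: "((\<lambda>r. 1 - r / T) has_real_derivative - 1 / T) (at r)" using assms by (auto intro!: derivative_eq_intros)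
  have 2: "((\<lambda>t::real. max 0 t ^ 2) has_real_derivative 2 * max 0 (1 - r / T)) (at (1 - r / T))"
    using max_power_has_derivative[of 2 "1 - r / T"] by simp
  have "((\<lambda>r. (max 0 (1 - r / T))\<^sup>2) has_real_derivative 2 * max 0 (1 - r / T) * (- 1 / T)) (at r)"
    by (rule DERIV_chain2[OF 2 1])
  from DERIV_cmult[OF DERIV_diff[OF DERIV_const[of 1] this], of T] show ?thesis
    using assms unfolding saturation_def[abs_def] by simp
qed

lemma saturation_bounds:
  assumes "T > 0" "r > 0"
  shows "saturation T r > 0" "r \<le> T \<Longrightarrow> r \<le> saturation T r" "saturation T r \<le> 2 * r"
    "r \<ge> T \<Longrightarrow> saturation T r = T" "r * (2 * max 0 (1 - r / T)) \<le> saturation T r"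
proof -
  have below: "saturation T r = 2 * r - r * (r / T) \<and> 0 \<le> r * (r / T) \<and> r * (r / T) \<le> r
     \<and> r * (2 * max 0 (1 - r / T)) = 2 * r - 2 * (r * (r / T))" if "r \<le> T"
  proof -
    have "r / T \<le> 1" "0 \<le> r / T" using that assms by auto
    then have "r * (r / T) \<le> r * 1" using assms by (intro mult_left_mono) auto
    moreover have "max 0 (1 - r / T) = 1 - r / T" using \<open>r / T \<le> 1\<close> by simp
    ultimately show ?thesis using assms by (simp add: saturation_def power2_eq_square field_simps)
  qed
  have above: "saturation T r = T \<and> max 0 (1 - r / T) = 0" if "r \<ge> T"
    using that assms by (simp add: saturation_def max_def)
  show "r \<ge> T \<Longrightarrow> saturation T r = T" using above by blast
  show "r \<le> T \<Longrightarrow> r \<le> saturation T r" using below by linarith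
  show "saturation T r > 0" using below above assms by (cases "r \<le> T"; force)
  show "saturation T r \<le> 2 * r" using below above assms by (cases "r \<le> T"; force)
  show "r * (2 * max 0 (1 - r / T)) \<le> saturation T r"
  proof (cases "r \<le> T")
    case True then show ?thesis using below by linarith
  next
    case False
    then have "max 0 (1 - r / T) = 0" "saturation T r = T" using above by auto
    then show ?thesis using assms by simp
  qed
qed

lemma continuous_saturation: "T > 0 \<Longrightarrow> continuous_on A (saturation T)"
  using saturation_derivative by (meson DERIV_continuous_on has_field_derivative_at_within)

definition growth_weight :: "real \<Rightarrow> real \<Rightarrow> real \<Rightarrow> real"
  where "growth_weight T \<alpha> r = smoothstep (4 * r - 1) * saturation T r powr \<alpha>"

lemma growth_weight_nonneg: "growth_weight T \<alpha> r \<ge> 0"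
  by (simp add: growth_weight_def smoothstep_bounds)

lemma growth_weight_ge:
  assumes "0 \<le> \<alpha>" "1 / 2 \<le> r" "r \<le> T"
  shows "r powr \<alpha> \<le> growth_weight T \<alpha> r"
proof -
  have "r powr \<alpha> \<le> saturation T r powr \<alpha>"
    using saturation_bounds(2)[of T r] assms by (intro powr_mono2) auto
  then show ?thesis using assms by (simp add: growth_weight_def smoothstep_eq)
qed

lemma continuous_growth_weight:
  assumes "T > 0"
  shows "continuous_on {0<..} (growth_weight T \<alpha>)"
proof -
  have nz: "\<forall>r\<in>{0<..}. saturation T r \<noteq> 0" using saturation_bounds(1)[OF assms] by fastforce
  have "continuous_on {0<..} (\<lambda>r. smoothstep (4 * r - 1))"
    by (intro continuous_on_compose2[OF continuous_on_smoothstep(1)[of UNIV]] continuous_intros subset_UNIV)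
  then show ?thesis
    unfolding growth_weight_def[abs_def]
    by (intro continuous_on_mult continuous_on_powr[OF continuous_saturation[OF assms] continuous_on_const nz])
qed

context exterior_qc
begin

text \<open>Green's formula is applied to the weight cut off between \<open>R\<close> and \<open>2 R\<close>, where \<open>R\<close> is so
  large that \<open>|g| \<le> e\<close> beyond it. Using the square of the cutoff, the error is at most \<open>e K\<close> times the left hand side
  itself, where \<open>K\<close> is the maximal distortion, plus \<open>16 M e\<close>.\<close>

lemma exterior_inequality_aux:
  assumes d: "\<And>r. r > 0 \<Longrightarrow> (\<phi> has_real_derivative \<phi>' r) (at r)" and c: "continuous_on {0<..} \<phi>'"
    and a: "0 < a" and z: "\<And>r. r < a \<Longrightarrow> \<phi> r = 0" and pos: "\<And>r. \<phi> r \<ge> 0"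
    and const: "\<And>r. r \<ge> T0 \<Longrightarrow> \<phi> r = M" "\<And>r. r \<ge> T0 \<Longrightarrow> \<phi>' r = 0"
    and e: "e > 0" "e * ((1 + k) / (1 - k)) \<le> 1" and aT: "a \<le> T0"
  shows "(1 - e * ((1 + k) / (1 - k))) * (\<integral>z. \<phi> (norm z) * J z \<partial>lborel_on (annulus a R0))
     \<le> - (1 / 2) * (\<integral>z. (\<phi>' (norm z) / norm z) * B z \<partial>lborel_on (annulus a T0)) + 16 * M * e"
proof -
  let ?K' = "(1 + k) / (1 - k)"
  \<comment> \<open>beyond \<open>R1\<close> the function is so small that the outer cutoff costs at most a fraction \<open>e\<close>\<close>
  obtain R1 where R1: "R1 > 0" "\<And>z. norm z \<ge> R1 \<Longrightarrow> norm (g z) \<le> e"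
    using at_infinity_small[OF decay e(1)] by blast
  define R where "R = Max {R1, R0, T0, 1}"
  have R: "R \<ge> R1" "R \<ge> R0" "R \<ge> T0" "R \<ge> 1" by (auto simp: R_def)
  define \<eta> where "\<eta> r = 1 - smoothstep (r / R - 1)" for r
  define \<eta>' where "\<eta>' r = - (smoothstep' (r / R - 1) / R)" for r
  have \<eta>d: "(\<eta> has_real_derivative \<eta>' r) (at r)" for r
  proof -
    have "((\<lambda>r. r / R - 1) has_real_derivative 1 / R) (at r)"
      using R by (auto intro!: derivative_eq_intros)
    from DERIV_chain2[OF smoothstep_derivative this] show ?thesis
      unfolding \<eta>_def[abs_def] \<eta>'_def by (auto intro!: derivative_eq_intros)
  qed
  have \<eta>1: "\<eta> r = 1" "\<eta>' r = 0" if "r \<le> R" for r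
    using that R by (auto simp: \<eta>_def \<eta>'_def smoothstep_eq)
  have \<eta>0: "\<eta> r = 0" if "r > 2 * R" for r
    using that R by (simp add: \<eta>_def smoothstep_eq field_simps)
  have \<eta>b: "0 \<le> \<eta> r" "\<bar>\<eta>' r\<bar> \<le> 2 / R" for r
    using smoothstep_bounds[of "r / R - 1"] smoothstep'_bounds[of "r / R - 1"] R
    by (auto simp: \<eta>_def \<eta>'_def abs_div divide_right_mono)
  have \<eta>'c: "continuous_on A \<eta>'" for A
    unfolding \<eta>'_def using R by (intro continuous_intros continuous_on_compose2[OF continuous_on_smoothstep(2)[of UNIV]]) auto
  have \<eta>c: "continuous_on A \<eta>" for A
    using \<eta>d by (meson DERIV_continuous_on has_field_derivative_at_within)
  have \<phi>c: "continuous_on {0<..} \<phi>"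
    using d by (auto intro!: continuous_at_imp_continuous_on DERIV_isCont)
  let ?w = "\<lambda>r. \<phi> r * (\<eta> r)\<^sup>2"
  let ?w1 = "\<lambda>r. \<phi>' r * (\<eta> r)\<^sup>2" and ?w2 = "\<lambda>r. \<phi> r * (2 * \<eta> r * \<eta>' r)"
  let ?K = "annulus a (2 * R)"
  have wd: "(?w has_real_derivative ?w1 r + ?w2 r) (at r)" if "r > 0" for r
    by (rule derivative_eq_intros d[OF that] \<eta>d refl | simp)+
  have wc: "continuous_on {0<..} (\<lambda>r. ?w1 r + ?w2 r)"
    by (intro continuous_intros c \<eta>c \<eta>'c \<phi>c)
  have "(\<integral>z. ?w (norm z) * J z \<partial>lborel_on ?K) = - (1 / 2) * (\<integral>z. ((?w1 (norm z) + ?w2 (norm z)) / norm z) * B z \<partial>lborel_on ?K)"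
    by (rule radial_Green[OF wd wc a]) (use z \<eta>0 in auto)
  also have "(\<integral>z. ((?w1 (norm z) + ?w2 (norm z)) / norm z) * B z \<partial>lborel_on ?K) =
      (\<integral>z. (?w1 (norm z) / norm z) * B z \<partial>lborel_on ?K) + (\<integral>z. (?w2 (norm z) / norm z) * B z \<partial>lborel_on ?K)"
  proof -
    have "integrable (lborel_on ?K) (\<lambda>z. (?w1 (norm z) / norm z) * B z)" "integrable (lborel_on ?K) (\<lambda>z. (?w2 (norm z) / norm z) * B z)"
      by (rule integrable_radial(4)[OF a, of "\<lambda>r. ?w1 r / r"] integrable_radial(4)[OF a, of "\<lambda>r. ?w2 r / r"];
          intro continuous_intros c \<eta>c \<eta>'c \<phi>c; auto)+
    from Bochner_Integration.integral_add[OF this] show ?thesis by (simp only: add_divide_distrib distrib_right)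
  qed
  also have "(\<integral>z. (?w1 (norm z) / norm z) * B z \<partial>lborel_on ?K) = (\<integral>z. (\<phi>' (norm z) / norm z) * B z \<partial>lborel_on (annulus a T0))"
  proof -
    have eq: "?w1 r = \<phi>' r" for r using const(2)[of r] \<eta>1(1)[of r] R by (cases "r \<ge> T0") auto
    show ?thesis unfolding eq
    proof (rule lborel_on_restrict(1))
      show "annulus a T0 \<subseteq> ?K" using R by auto
    qed (use const(2) compact_imp_closed[OF compact_annulus] in auto)
  qed
  finally have X: "(\<integral>z. ?w (norm z) * J z \<partial>lborel_on ?K) = - (1 / 2) * (\<integral>z. (\<phi>' (norm z) / norm z) * B z \<partial>lborel_on (annulus a T0))
     - (\<integral>z. (\<phi> (norm z) * \<eta> (norm z) * \<eta>' (norm z) / norm z) * B z \<partial>lborel_on ?K)"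
  proof -
    have "(\<integral>z. (?w2 (norm z) / norm z) * B z \<partial>lborel_on ?K) = 2 * (\<integral>z. (\<phi> (norm z) * \<eta> (norm z) * \<eta>' (norm z) / norm z) * B z \<partial>lborel_on ?K)"
      by (simp flip: integral_mult_right_zero add: algebra_simps)
    moreover assume "(\<integral>z. ?w (norm z) * J z \<partial>lborel_on ?K) = - (1 / 2) * ((\<integral>z. (\<phi>' (norm z) / norm z) * B z \<partial>lborel_on (annulus a T0)) + (\<integral>z. (?w2 (norm z) / norm z) * B z \<partial>lborel_on ?K))"
    moreover have "C = 2 * D \<Longrightarrow> X = - (1 / 2) * (A + C) \<Longrightarrow> X = - (1 / 2) * A - D" for A C D X :: real by (simp add: field_simps)
    ultimately show ?thesis by blast
  qed
  have M: "M \<ge> 0" using pos[of T0] const(1)[of T0] by simp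
  have iw: "integrable (lborel_on ?K) (\<lambda>z. ?w (norm z) * J z)"
    by (rule integrable_radial(1)[OF a, of ?w]) (intro continuous_intros \<phi>c \<eta>c)
  have ib: "integrable (lborel_on ?K) (\<lambda>z. (\<phi> (norm z) * \<eta> (norm z) * \<eta>' (norm z) / norm z) * B z)"
    by (rule integrable_radial(4)[OF a, of "\<lambda>r. \<phi> r * \<eta> r * \<eta>' r / r"]) (intro continuous_intros \<phi>c \<eta>c \<eta>'c, auto)
  interpret fm: finite_measure "lborel_on ?K" by (rule finite_measure_lborel_on[OF compact_annulus])
  have "- (\<integral>z. (\<phi> (norm z) * \<eta> (norm z) * \<eta>' (norm z) / norm z) * B z \<partial>lborel_on ?K)
     = (\<integral>z. - ((\<phi> (norm z) * \<eta> (norm z) * \<eta>' (norm z) / norm z) * B z) \<partial>lborel_on ?K)" by simp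
  also have "\<dots> \<le> (\<integral>z. e * ?K' * (?w (norm z) * J z) + M * e / R\<^sup>2 \<partial>lborel_on ?K)"
  proof (rule integral_mono_AE)
    show "integrable (lborel_on ?K) (\<lambda>z. e * ?K' * (?w (norm z) * J z) + M * e / R\<^sup>2)" using iw by simp
    show "AE z in lborel_on ?K. - ((\<phi> (norm z) * \<eta> (norm z) * \<eta>' (norm z) / norm z) * B z) \<le> e * ?K' * (?w (norm z) * J z) + M * e / R\<^sup>2"
    proof (rule AE_lborel_on[OF compact_imp_closed[OF compact_annulus]])
      show "AE z in lborel. z \<in> ?K \<longrightarrow> - ((\<phi> (norm z) * \<eta> (norm z) * \<eta>' (norm z) / norm z) * B z) \<le> e * ?K' * (?w (norm z) * J z) + M * e / R\<^sup>2"
        using E_le_J J_nonneg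
      proof eventually_elim
        case (elim z)
        show ?case
        proof
          assume zK: "z \<in> ?K"
          have K0: "?K' \<ge> 0" using k by simp
          show "- ((\<phi> (norm z) * \<eta> (norm z) * \<eta>' (norm z) / norm z) * B z) \<le> e * ?K' * (?w (norm z) * J z) + M * e / R\<^sup>2"
          proof (cases "norm z \<le> R")
            case True
            have "0 \<le> e * ?K' * (?w (norm z) * J z)"
              using elim pos[of "norm z"] e(1) K0 by (intro mult_nonneg_nonneg) auto
            moreover have "0 \<le> M * e / R\<^sup>2" using e(1) M by (intro divide_nonneg_nonneg mult_nonneg_nonneg) auto
            moreover have "- ((\<phi> (norm z) * \<eta> (norm z) * \<eta>' (norm z) / norm z) * B z) = 0" using \<eta>1(2)[OF True] by simp
            ultimately show ?thesis by linarith
          next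
            case False
            have "a \<le> norm z" using zK by simp
            then have n: "norm z > 0" using a by linarith
            have \<phi>M: "\<phi> (norm z) = M" by (rule const(1)) (use False R(3) in linarith)
            have g: "norm (g z) \<le> e" by (rule R1(2)) (use False R(1) in linarith)
            have Bz: "\<bar>B z\<bar> \<le> e * (norm z * sqrt (E z))"
            proof -
              have "\<bar>B z\<bar> \<le> norm (cnj (g z) * angular gx gy z)" unfolding B_def by (rule abs_Im_le_cmod)
              also have "\<dots> \<le> e * (norm z * sqrt (E z))"
                unfolding norm_mult complex_mod_cnj by (rule mult_mono[OF g norm_angular_le]) (use e(1) in simp_all)
              finally show ?thesis .
            qed
            have E0: "E z \<ge> 0" by (simp add: E_def)
            have "- ((\<phi> (norm z) * \<eta> (norm z) * \<eta>' (norm z) / norm z) * B z) \<le> \<bar>(\<phi> (norm z) * \<eta> (norm z) * \<eta>' (norm z) / norm z) * B z\<bar>"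
              by linarith
            also have "\<dots> = M * \<eta> (norm z) * \<bar>\<eta>' (norm z)\<bar> / norm z * \<bar>B z\<bar>"
              using M \<eta>b(1)[of "norm z"] n by (simp add: \<phi>M abs_mult)
            also have "\<dots> \<le> M * \<eta> (norm z) * (2 / R) / norm z * (e * (norm z * sqrt (E z)))"
              by (rule mult_mono[OF divide_right_mono[OF mult_left_mono[OF \<eta>b(2)]] Bz])
                (use M \<eta>b(1)[of "norm z"] n R(4) in simp_all)
            also have "\<dots> = M * e * (2 * (\<eta> (norm z) * sqrt (E z)) * (1 / R))"
              using n by simp
            also have "\<dots> \<le> M * e * ((\<eta> (norm z) * sqrt (E z))\<^sup>2 + (1 / R)\<^sup>2)"
              using M e(1) sum_squares_bound[of "\<eta> (norm z) * sqrt (E z)" "1 / R"] by (intro mult_left_mono) auto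
            also have "\<dots> = e * (?w (norm z) * E z) + M * e / R\<^sup>2"
              using E0 by (simp add: \<phi>M power_mult_distrib power_divide algebra_simps)
            also have "e * (?w (norm z) * E z) \<le> e * (?w (norm z) * (?K' * J z))"
              by (intro mult_left_mono elim(1)) (use e(1) M in \<open>simp_all add: \<phi>M\<close>)
            finally show ?thesis by (simp add: algebra_simps)
          qed
        qed
      qed
    qed
  qed (use ib in simp)
  also have "\<dots> = e * ?K' * (\<integral>z. ?w (norm z) * J z \<partial>lborel_on ?K) + M * e / R\<^sup>2 * measure (lborel_on ?K) (space (lborel_on ?K))"
    using iw by simp
  also have "M * e / R\<^sup>2 * measure (lborel_on ?K) (space (lborel_on ?K)) \<le> M * e / R\<^sup>2 * (4 * (2 * R)\<^sup>2)"
    using M e(1) R a by (intro mult_left_mono measure_annulus_le) auto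
  also have "M * e / R\<^sup>2 * (4 * (2 * R)\<^sup>2) = 16 * M * e" using R by (simp add: power2_eq_square)
  finally have q: "- (\<integral>z. (\<phi> (norm z) * \<eta> (norm z) * \<eta>' (norm z) / norm z) * B z \<partial>lborel_on ?K)
     \<le> e * ?K' * (\<integral>z. ?w (norm z) * J z \<partial>lborel_on ?K) + 16 * M * e" by simp
  have main: "(1 - e * ?K') * (\<integral>z. ?w (norm z) * J z \<partial>lborel_on ?K) \<le> - (1 / 2) * (\<integral>z. (\<phi>' (norm z) / norm z) * B z \<partial>lborel_on (annulus a T0)) + 16 * M * e"
    using q X by (simp only: left_diff_distrib mult_1_left)
  have "(\<integral>z. \<phi> (norm z) * J z \<partial>lborel_on (annulus a R0)) = (\<integral>z. ?w (norm z) * J z \<partial>lborel_on (annulus a R0))"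
  proof (rule Bochner_Integration.integral_cong[OF refl])
    fix z assume "z \<in> space (lborel_on (annulus a R0))"
    then have "norm z \<le> R" using R(2) by (simp add: space_restrict_space)
    then show "\<phi> (norm z) * J z = ?w (norm z) * J z" by (simp only: \<eta>1(1) power_one mult_1_right)
  qed
  also have "\<dots> \<le> (\<integral>z. ?w (norm z) * J z \<partial>lborel_on ?K)"
  proof (rule lborel_on_subset_mono(2)[OF _ _ _ iw])
    show "annulus a R0 \<subseteq> ?K" using R by auto
    show "AE z in lborel. z \<in> ?K \<longrightarrow> 0 \<le> ?w (norm z) * J z"
      using J_nonneg by eventually_elim (intro impI mult_nonneg_nonneg pos zero_le_power2)
  qed (use compact_imp_closed[OF compact_annulus] in auto)
  finally have "(1 - e * ?K') * (\<integral>z. \<phi> (norm z) * J z \<partial>lborel_on (annulus a R0)) \<le> (1 - e * ?K') * (\<integral>z. ?w (norm z) * J z \<partial>lborel_on ?K)"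
    using e(2) by (intro mult_left_mono) auto
  with main show ?thesis by linarith
qed

text \<open>The image of the complement of a disk covers no more than the area inside the image curve: the contribution of the
  outer boundary disappears as \<open>g\<close> tends to zero.\<close>

lemma exterior_inequality:
  assumes d: "\<And>r. r > 0 \<Longrightarrow> (\<phi> has_real_derivative \<phi>' r) (at r)" and c: "continuous_on {0<..} \<phi>'"
    and a: "0 < a" and z: "\<And>r. r < a \<Longrightarrow> \<phi> r = 0" and pos: "\<And>r. \<phi> r \<ge> 0"
    and const: "\<And>r. r \<ge> T0 \<Longrightarrow> \<phi> r = M" "\<And>r. r \<ge> T0 \<Longrightarrow> \<phi>' r = 0" and aT: "a \<le> T0"
  shows "(\<integral>z. \<phi> (norm z) * J z \<partial>lborel_on (annulus a R0))
     \<le> - (1 / 2) * (\<integral>z. (\<phi>' (norm z) / norm z) * B z \<partial>lborel_on (annulus a T0))"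
proof -
  let ?K' = "(1 + k) / (1 - k)"
  define Y where "Y = (\<integral>z. \<phi> (norm z) * J z \<partial>lborel_on (annulus a R0))"
  define A where "A = - (1 / 2) * (\<integral>z. (\<phi>' (norm z) / norm z) * B z \<partial>lborel_on (annulus a T0))"
  have K0: "?K' > 0" using k by simp
  have "eventually (\<lambda>e::real. 0 < e \<and> e < 1 / ?K') (at_right 0)"
  proof -
    have "1 / ?K' > 0" using K0 by (simp only: zero_less_divide_1_iff)
    from eventually_at_right_real[OF this] show ?thesis by eventually_elim (simp only: greaterThanLessThan_iff)
  qed
  then have ev: "eventually (\<lambda>e. (1 - e * ?K') * Y \<le> A + 16 * M * e) (at_right 0)"
  proof eventually_elim
    case (elim e)
    have "e * K \<le> 1" if "0 < K" "e < 1 / K" for K :: real using that by (simp add: field_simps)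
    from this[OF K0] elim have "e * ?K' \<le> 1" by blast
    then show ?case unfolding Y_def A_def
      using exterior_inequality_aux[OF d c a z pos const _ _ aT, of e R0] elim by simp
  qed
  have "((\<lambda>e. (1 - e * ?K') * Y) \<longlongrightarrow> (1 - 0 * ?K') * Y) (at_right 0)" by (intro tendsto_intros)
  moreover have "((\<lambda>e. A + 16 * M * e) \<longlongrightarrow> A + 16 * M * 0) (at_right 0)" by (intro tendsto_intros)
  ultimately have "(1 - 0 * ?K') * Y \<le> A + 16 * M * 0"
    using tendsto_le[OF _ _ _ ev] by (metis trivial_limit_at_right_real)
  then show ?thesis by (simp add: Y_def A_def)
qed

text \<open>The area theorem, smoothed out. In the unit disk \<open>g = 1/z + H\<close> with \<open>H\<close> holomorphic; the pole contributes
  the constant, the mixed terms have mean zero on circles, and \<open>H\<close> contributes with the favourable sign.\<close>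

lemma base_energy:
  "(\<integral>z. smoothstep (8 * norm z - 1) * J z \<partial>lborel_on (annulus (1/8) R0)) \<le> ramp_energy"
proof -
  let ?K = "annulus (1/8) (1/4)"
  have "(\<integral>z. smoothstep (8 * norm z - 1) * J z \<partial>lborel_on (annulus (1/8) R0)) \<le>
      - (1 / 2) * (\<integral>z. (8 * smoothstep' (8 * norm z - 1) / norm z) * B z \<partial>lborel_on ?K)"
    by (rule exterior_inequality[where M=1])
      (auto intro!: smoothstep_affine_derivative continuous_intros continuous_on_compose2[OF continuous_on_smoothstep(2)[of UNIV]]
        simp: smoothstep_eq smoothstep_bounds)
  also have "\<dots> = - (1 / 2) * (\<integral>z. ramp (norm z) * B z \<partial>lborel_on ?K)" by (simp add: ramp_def)
  finally have le: "(\<integral>z. smoothstep (8 * norm z - 1) * J z \<partial>lborel_on (annulus (1/8) R0))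
      \<le> - (1 / 2) * (\<integral>z. ramp (norm z) * B z \<partial>lborel_on ?K)" .
  have "(\<integral>z. ramp (norm z) * B z \<partial>lborel_on ?K) \<ge> - 2 * ramp_energy"
  proof -
    define H where "H z = c0 + z * kk z" for z
    have H: "H holomorphic_on ball 0 1" unfolding H_def by (intro holomorphic_intros kk)
    have dH: "deriv H z = kk z + z * deriv kk z" if "norm z < 1" for z
    proof -
      have "(kk has_field_derivative deriv kk z) (at z)" using kk that by (auto intro!: holomorphic_derivI[of _ "ball 0 1"])
      then have "(H has_field_derivative kk z + z * deriv kk z) (at z)"
        unfolding H_def[abs_def] by (auto intro!: derivative_eq_intros)
      then show ?thesis by (rule DERIV_imp_deriv)
    qed
    define F where "F z = - (ramp (norm z) / (norm z)\<^sup>2) + Re (of_real (ramp (norm z) / (norm z)\<^sup>2) * (z\<^sup>2 * deriv H z))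
        - Re (of_real (ramp (norm z) / (norm z)\<^sup>2) * (z * H z)) + ramp (norm z) * Re (z * deriv H z * cnj (H z))" for z
    have BF: "AE z in lborel. z \<in> ?K \<longrightarrow> ramp (norm z) * B z = F z"
      using gx_inner gy_inner
    proof eventually_elim
      case (elim z)
      show ?case
      proof
        assume z: "z \<in> ?K"
        then have z1: "norm z < 1" "z \<noteq> 0" by auto
        define D where "D = deriv H z"
        have gx: "gx z = - 1 / z\<^sup>2 + D" and gy: "gy z = \<i> * gx z" using elim z1 dH by (auto simp: D_def)
        have gz: "g z = 1 / z + H z" using g_inner[of z] z1 by (simp add: H_def)
        have "angular gx gy z = \<i> * (z * gx z)"
          unfolding angular_def gy by (simp add: complex_eq_iff algebra_simps)
        also have "z * gx z = - 1 / z + z * D" using z1 by (simp add: gx field_simps power2_eq_square)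
        finally have ang: "angular gx gy z = \<i> * (- 1 / z + z * D)" .
        have mul: "Re (of_real (\<rho> / n) * P) = \<rho> * Re (of_real (1 / n) * P)" for \<rho> n :: real and P
          by simp
        have Im_eq: "Im (\<i> * (- of_real a + of_real a * P - of_real a * cnj Q + S)) = - a + Re (of_real a * P) - Re (of_real a * Q) + Re S" for a P Q S
          by simp
        have cz: "1 / z = cnj z / of_real ((norm z)\<^sup>2)" "1 / cnj z = z / of_real ((norm z)\<^sup>2)"
          unfolding complex_norm_square using z1 by auto
        have "cnj (g z) * angular gx gy z = \<i> * (- (1 / cnj z * (1 / z)) + 1 / cnj z * (z * D) - cnj (H z) * (1 / z) + z * D * cnj (H z))"
          unfolding gz ang by (simp add: algebra_simps)
        also have "1 / cnj z * (1 / z) = of_real (1 / (norm z)\<^sup>2)"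
          unfolding of_real_divide complex_norm_square by simp
        also have "1 / cnj z * (z * D) = of_real (1 / (norm z)\<^sup>2) * (z\<^sup>2 * D)"
          unfolding cz by (simp add: power2_eq_square)
        also have "cnj (H z) * (1 / z) = of_real (1 / (norm z)\<^sup>2) * cnj (z * H z)"
          unfolding cz by simp
        finally have "B z = - (1 / (norm z)\<^sup>2) + Re (of_real (1 / (norm z)\<^sup>2) * (z\<^sup>2 * D)) - Re (of_real (1 / (norm z)\<^sup>2) * (z * H z)) + Re (z * D * cnj (H z))"
          unfolding B_def by (simp only: Im_eq)
        then show "ramp (norm z) * B z = F z"
          unfolding F_def mul[of "ramp (norm z)" "(norm z)\<^sup>2"] D_def[symmetric]
          by (simp only: right_diff_distrib distrib_left mult_minus_right times_divide_eq_right mult_1_right)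
      qed
    qed
    have hol: "(\<lambda>z. z\<^sup>2 * deriv H z) holomorphic_on ball 0 1" "(\<lambda>z. z * H z) holomorphic_on ball 0 1"
      by (intro holomorphic_on_mult holomorphic_on_power holomorphic_on_ident holomorphic_deriv[OF H] open_ball H)+
    have r0: "\<forall>r>1/4. ramp r / r\<^sup>2 = 0" by (simp add: ramp_eq_0)
    have lt: "(1 / 4 :: real) < 1" by simp
    note h1 = radial_holomorphic_integral[OF hol(1) continuous_ramp(3) r0 lt]
      and h2 = radial_holomorphic_integral[OF hol(2) continuous_ramp(3) r0 lt]
      and h3 = holomorphic_ramp_area[OF H]
    have i0: "integrable lborel (\<lambda>z::complex. ramp (norm z) / (norm z)\<^sup>2)"
      by (rule integrable_continuous_support[of _ "1/4"])
        (auto simp: ramp_eq_0 intro!: continuous_on_compose2[OF continuous_ramp(3)] continuous_on_norm_id)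
    have F0: "F z = 0" if "z \<notin> ?K" for z
    proof -
      have "ramp (norm z) = 0" using that ramp_eq_0[of "norm z"] by (auto simp: not_le)
      then show ?thesis by (simp add: F_def)
    qed
    have iF: "integrable lborel F" unfolding F_def[abs_def]
      by (rule Bochner_Integration.integrable_add[OF Bochner_Integration.integrable_diff[OF Bochner_Integration.integrable_add[OF
            Bochner_Integration.integrable_minus[OF i0] integrable_Re[OF h1(2)]] integrable_Re[OF h2(2)]] h3(1)])
    have "(\<integral>z. ramp (norm z) * B z \<partial>lborel_on ?K) = (\<integral>z. F z \<partial>lborel_on ?K)"
    proof (rule integral_cong_AE)
      show "(\<lambda>z. ramp (norm z) * B z) \<in> borel_measurable (lborel_on ?K)"
        using integrable_radial(4)[OF _ continuous_ramp(1), of "1/8" "1/4"] by simp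
      show "F \<in> borel_measurable (lborel_on ?K)"
        using borel_measurable_integrable[OF iF] by (rule measurable_restrict_space1)
      show "AE z in lborel_on ?K. ramp (norm z) * B z = F z"
        by (rule AE_lborel_on[OF compact_imp_closed[OF compact_annulus] BF])
    qed
    also have "\<dots> = (\<integral>z. F z \<partial>lborel)"
      by (rule integral_lborel_on(1)[OF compact_imp_closed[OF compact_annulus] F0])
    also have "\<dots> = - (\<integral>z. ramp (norm (z::complex)) / (norm z)\<^sup>2 \<partial>lborel) + Re (\<integral>z. of_real (ramp (norm z) / (norm z)\<^sup>2) * (z\<^sup>2 * deriv H z) \<partial>lborel)
       - Re (\<integral>z. of_real (ramp (norm z) / (norm z)\<^sup>2) * (z * H z) \<partial>lborel) + (\<integral>z. ramp (norm z) * Re (z * deriv H z * cnj (H z)) \<partial>lborel)"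
      unfolding F_def[abs_def] integral_Re[OF h1(2), symmetric] integral_Re[OF h2(2), symmetric]
      using i0 integrable_Re[OF h1(2)] integrable_Re[OF h2(2)] h3(1)
      by (simp only: Bochner_Integration.integral_add Bochner_Integration.integral_diff Bochner_Integration.integral_minus
          Bochner_Integration.integrable_add Bochner_Integration.integrable_diff Bochner_Integration.integrable_minus)
    also have "\<dots> \<ge> - 2 * ramp_energy"
      using h1(1) h2(1) h3(2) by (simp add: ramp_energy_def)
    finally show ?thesis .
  qed
  with le show ?thesis by simp
qed

text \<open>With \<open>X\<close> for the weighted area, the isoperimetric inequality gives
  \<open>X \<le> 2 K ramp_energy + K (\<alpha>/2) X\<close>, where \<open>K = (1 + \<kappa>) / (1 - \<kappa>)\<close>. As \<open>X\<close> is finite, being an integral over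
  a bounded annulus, the last term can be absorbed. The resulting bound does not involve \<open>T\<close>.\<close>

lemma weighted_energy:
  assumes \<alpha>: "0 < \<alpha>" and th: "(1 + \<kappa>) / (1 - \<kappa>) * (\<alpha> / 2) = \<theta>" "\<theta> < 1"
  shows "(\<integral>z. growth_weight T \<alpha> (norm z) * J z \<partial>lborel_on (annulus (1/4) T)) \<le> 2 * ((1 + \<kappa>) / (1 - \<kappa>)) * ramp_energy / (1 - \<theta>)"
proof -
  have T0: "T > 0" using T by simp
  define Kq where "Kq = (1 + \<kappa>) / (1 - \<kappa>)"
  have Kq: "Kq > 0" using \<kappa> by (simp add: Kq_def)
  define M M' where "M r = saturation T r powr \<alpha>" and "M' r = \<alpha> * saturation T r powr (\<alpha> - 1) * (2 * max 0 (1 - r / T))" for r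
  define \<phi> \<phi>' where "\<phi> r = smoothstep (4 * r - 1) * M r" and "\<phi>' r = 4 * smoothstep' (4 * r - 1) * M r + smoothstep (4 * r - 1) * M' r" for r
  have Md: "(M has_real_derivative M' r) (at r)" if "r > 0" for r
    unfolding M_def[abs_def] M'_def
  proof -
    have "((\<lambda>x. x powr \<alpha>) has_real_derivative \<alpha> * saturation T r powr (\<alpha> - 1)) (at (saturation T r))"
      by (rule has_real_derivative_powr[OF saturation_bounds(1)[OF T0 that]])
    from DERIV_chain2[OF this saturation_derivative[OF T0]]
    show "((\<lambda>r. saturation T r powr \<alpha>) has_real_derivative \<alpha> * saturation T r powr (\<alpha> - 1) * (2 * max 0 (1 - r / T))) (at r)" .
  qed
  have \<phi>d: "(\<phi> has_real_derivative \<phi>' r) (at r)" if "r > 0" for r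
    unfolding \<phi>_def[abs_def] \<phi>'_def
    by (rule DERIV_cong[OF DERIV_mult[OF smoothstep_affine_derivative Md[OF that]]]) simp
  have cM: "continuous_on {0<..} M" "continuous_on {0<..} M'"
  proof -
    have cs: "continuous_on {0<..} (saturation T)" by (rule continuous_saturation[OF T0])
    have nz: "\<forall>r\<in>{0<..}. saturation T r \<noteq> 0" using saturation_bounds(1)[OF T0] by fastforce
    show "continuous_on {0<..} M"
      unfolding M_def[abs_def] by (rule continuous_on_powr[OF cs continuous_on_const nz])
    have "continuous_on {0<..} (\<lambda>r. 2 * max 0 (1 - r / T))" using T0 by (intro continuous_intros) auto
    then show "continuous_on {0<..} M'"
      unfolding M'_def[abs_def] by (intro continuous_on_mult[OF continuous_on_mult[OF continuous_on_const continuous_on_powr[OF cs continuous_on_const nz]]])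
  qed
  have c\<phi>: "continuous_on {0<..} \<phi>" "continuous_on {0<..} \<phi>'"
    unfolding \<phi>_def[abs_def] \<phi>'_def[abs_def]
    by (intro continuous_intros cM continuous_on_compose2[OF continuous_on_smoothstep(1)[of UNIV]]
        continuous_on_compose2[OF continuous_on_smoothstep(2)[of UNIV]] subset_UNIV)+
  have M0: "M r \<ge> 0" for r by (simp add: M_def)
  have M'0: "M' r \<ge> 0" for r using \<alpha> by (simp add: M'_def)
  have \<phi>0: "\<phi> r \<ge> 0" "\<phi>' r \<ge> 0" for r
    using smoothstep_bounds smoothstep'_bounds M0 M'0 by (auto simp: \<phi>_def \<phi>'_def)
  have lo: "\<phi> r = 0" "\<phi>' r = 0" if "r \<le> 1 / 4" for r
    using that by (auto simp: \<phi>_def \<phi>'_def smoothstep_eq)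
  have hi: "\<phi> r = T powr \<alpha>" "\<phi>' r = 0" if "r \<ge> T" for r
  proof -
    have r: "r > 0" "r \<ge> 1" using that T by auto
    have "max 0 (1 - r / T) = 0" using that T0 by simp
    then show "\<phi> r = T powr \<alpha>" "\<phi>' r = 0"
      using r saturation_bounds(4)[OF T0 r(1) that] by (auto simp: \<phi>_def \<phi>'_def M_def M'_def smoothstep_eq)
  qed
  \<comment> \<open>the logarithmic derivative of the saturation is at most \<open>1 / r\<close>, and the cutoff varies only where the one of \<open>base_energy\<close> equals 1\<close>
  have growth: "\<phi>' r * r \<le> 4 * smoothstep (8 * r - 1) + \<alpha> * \<phi> r" if r: "r > 0" for r
  proof -
    have "saturation T r powr (\<alpha> - 1) * (r * (2 * max 0 (1 - r / T))) \<le> saturation T r powr (\<alpha> - 1) * saturation T r"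
      by (rule mult_left_mono[OF saturation_bounds(5)[OF T0 r]]) simp
    also have "\<dots> = saturation T r powr \<alpha>"
      using saturation_bounds(1)[OF T0 r] by (simp add: powr_diff)
    finally have "\<alpha> * (saturation T r powr (\<alpha> - 1) * (r * (2 * max 0 (1 - r / T)))) \<le> \<alpha> * M r"
      unfolding M_def using \<alpha> by (intro mult_left_mono) auto
    then have rM': "M' r * r \<le> \<alpha> * M r" by (simp add: M'_def algebra_simps)
    have "smoothstep (4 * r - 1) * (M' r * r) \<le> smoothstep (4 * r - 1) * (\<alpha> * M r)"
      using smoothstep_bounds(1) by (rule mult_left_mono[OF rM'])
    moreover have "4 * smoothstep' (4 * r - 1) * M r * r \<le> 4 * smoothstep (8 * r - 1)"
    proof (cases "1 / 4 \<le> r \<and> r \<le> 1 / 2")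
      case True
      have "M r \<le> 1 powr \<alpha>"
        unfolding M_def using saturation_bounds(1,3)[OF T0 r] \<alpha> True by (intro powr_mono2) auto
      then have "smoothstep' (4 * r - 1) * M r * r \<le> 2 * 1 * (1 / 2)"
        using smoothstep'_bounds M0 True by (intro mult_mono) auto
      then show ?thesis using True by (simp add: smoothstep_eq)
    next
      case False
      then show ?thesis using smoothstep_bounds(1)[of "8 * r - 1"] by (auto simp: smoothstep_eq not_le)
    qed
    ultimately show ?thesis by (simp add: \<phi>'_def \<phi>_def algebra_simps)
  qed
  let ?K = "annulus (1/4) T"
  define X where "X = (\<integral>z. \<phi> (norm z) * J z \<partial>lborel_on ?K)"
  define \<rho> where "\<rho> r = \<phi>' r / r" for r
  have c\<rho>: "continuous_on {0<..} \<rho>" unfolding \<rho>_def[abs_def] by (intro continuous_intros c\<phi>) auto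
  have c\<rho>U: "continuous_on UNIV \<rho>" by (rule continuous_on_zero_extend[OF c\<rho>, of "1/4"]) (auto simp: \<rho>_def lo)
  have \<rho>0: "\<rho> r \<ge> 0" for r using \<phi>0(2)[of r] lo(2)[of r] by (cases "r \<le> 1 / 4") (auto simp: \<rho>_def)
  have i8: "integrable (lborel_on ?K) (\<lambda>z. smoothstep (8 * norm z - 1) * J z)"
    "integrable (lborel_on (annulus (1/8) T)) (\<lambda>z. smoothstep (8 * norm z - 1) * J z)"
    by (rule integrable_radial(1)[of _ "\<lambda>r. smoothstep (8 * r - 1)"];
      force intro!: continuous_intros continuous_on_compose2[OF continuous_on_smoothstep(1)[of UNIV]])+
  have i\<phi>: "integrable (lborel_on ?K) (\<lambda>z. \<phi> (norm z) * J z)" by (rule integrable_radial(1)[OF _ c\<phi>(1)]) simp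
  have clK: "closed (annulus x y)" for x y by (rule compact_imp_closed[OF compact_annulus])
  have e8: "(\<integral>z. smoothstep (8 * norm z - 1) * J z \<partial>lborel_on ?K) \<le> ramp_energy"
  proof (rule order_trans[OF lborel_on_subset_mono(2)[OF clK clK _ i8(2)] base_energy])
    show "?K \<subseteq> annulus (1/8) T" by auto
    show "AE z in lborel. z \<in> annulus (1/8) T \<longrightarrow> 0 \<le> smoothstep (8 * norm z - 1) * J z"
      using J_nonneg by eventually_elim (intro impI mult_nonneg_nonneg smoothstep_bounds)
  qed
  have "X \<le> - (1 / 2) * (\<integral>z. (\<phi>' (norm z) / norm z) * B z \<partial>lborel_on ?K)"
    unfolding X_def by (rule exterior_inequality[OF \<phi>d c\<phi>(2) _ _ \<phi>0(1) hi]) (use lo T in auto)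
  also have "\<dots> = 1 / 2 * (- (\<integral>z. \<rho> (norm z) * Im (cnj (g z) * angular gx gy z) \<partial>lborel_on ?K))"
    by (simp add: \<rho>_def B_def)
  also have "\<dots> \<le> 1 / 2 * (\<integral>z. \<rho> (norm z) * (norm (angular gx gy z))\<^sup>2 \<partial>lborel_on ?K)"
  proof (intro mult_left_mono smooth_approx_isoperimetric[OF approx c\<rho>U \<rho>0])
    show "\<rho> r = 0" if "r < 1 / 4 \<or> T < r" for r using that lo(2)[of r] hi(2)[of r] by (auto simp: \<rho>_def)
  qed auto
  finally have X1: "X \<le> 1 / 2 * (\<integral>z. \<rho> (norm z) * (norm (angular gx gy z))\<^sup>2 \<partial>lborel_on ?K)" .
  have "(\<integral>z. \<rho> (norm z) * (norm (angular gx gy z))\<^sup>2 \<partial>lborel_on ?K)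
     \<le> (\<integral>z. Kq * (4 * (smoothstep (8 * norm z - 1) * J z) + \<alpha> * (\<phi> (norm z) * J z)) \<partial>lborel_on ?K)"
  proof (rule integral_mono_AE)
    show "integrable (lborel_on ?K) (\<lambda>z. \<rho> (norm z) * (norm (angular gx gy z))\<^sup>2)"
      by (rule integrable_radial(3)[OF _ c\<rho>]) simp
    show "integrable (lborel_on ?K) (\<lambda>z. Kq * (4 * (smoothstep (8 * norm z - 1) * J z) + \<alpha> * (\<phi> (norm z) * J z)))"
      using i8(1) i\<phi> by simp
    have "AE z in lborel. z \<in> ?K \<longrightarrow> \<rho> (norm z) * (norm (angular gx gy z))\<^sup>2 \<le> Kq * (4 * (smoothstep (8 * norm z - 1) * J z) + \<alpha> * (\<phi> (norm z) * J z))"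
      using E_le_J_near J_nonneg
    proof eventually_elim
      case (elim z)
      show ?case
      proof
        assume z: "z \<in> ?K"
        then have n: "norm z > 0" by (auto simp: less_le_trans[of 0 "1/4"])
        have gr: "Kq * (\<phi>' (norm z) * norm z * J z) \<le> Kq * ((4 * smoothstep (8 * norm z - 1) + \<alpha> * \<phi> (norm z)) * J z)"
          by (intro mult_left_mono mult_right_mono growth n elim(2)) (use Kq in simp)
        show "\<rho> (norm z) * (norm (angular gx gy z))\<^sup>2 \<le> Kq * (4 * (smoothstep (8 * norm z - 1) * J z) + \<alpha> * (\<phi> (norm z) * J z))"
        proof (cases "norm z < T")
          case True
          have "\<rho> (norm z) * (norm (angular gx gy z))\<^sup>2 \<le> \<rho> (norm z) * ((norm z)\<^sup>2 * E z)"
            by (rule mult_left_mono[OF angular_sq_le \<rho>0])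
          also have "\<dots> \<le> \<rho> (norm z) * ((norm z)\<^sup>2 * (Kq * J z))"
            using elim(1) True by (intro mult_left_mono \<rho>0) (auto simp: Kq_def)
          also have "\<dots> = Kq * (\<phi>' (norm z) * norm z * J z)"
            using n by (simp add: \<rho>_def power2_eq_square)
          finally show ?thesis using gr by (simp add: algebra_simps)
        next
          case False
          then have "\<phi>' (norm z) = 0" by (intro hi(2)) simp
          then show ?thesis using gr by (simp add: \<rho>_def algebra_simps)
        qed
      qed
    qed
    then show "AE z in lborel_on ?K. \<rho> (norm z) * (norm (angular gx gy z))\<^sup>2 \<le> Kq * (4 * (smoothstep (8 * norm z - 1) * J z) + \<alpha> * (\<phi> (norm z) * J z))"
      by (rule AE_lborel_on[OF clK])
  qed
  also have "\<dots> = Kq * (4 * (\<integral>z. smoothstep (8 * norm z - 1) * J z \<partial>lborel_on ?K) + \<alpha> * X)"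
    using i8(1) i\<phi> by (simp add: X_def)
  also have "\<dots> \<le> Kq * (4 * ramp_energy + \<alpha> * X)" using e8 Kq by simp
  finally have le: "(\<integral>z. \<rho> (norm z) * (norm (angular gx gy z))\<^sup>2 \<partial>lborel_on ?K) \<le> Kq * (4 * ramp_energy + \<alpha> * X)" .
  have "X \<le> 2 * Kq * ramp_energy + \<theta> * X"
  proof -
    have "1 / 2 * (Kq * (4 * ramp_energy + \<alpha> * X)) = 2 * Kq * ramp_energy + Kq * (\<alpha> / 2) * X"
      by (simp add: algebra_simps)
    also have "Kq * (\<alpha> / 2) = \<theta>" using th(1) by (simp only: Kq_def)
    finally show ?thesis using le X1 by linarith
  qed
  then have "X * (1 - \<theta>) \<le> 2 * Kq * ramp_energy" by (simp add: algebra_simps)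
  then have X: "X \<le> 2 * Kq * ramp_energy / (1 - \<theta>)" using th(2) by (simp add: pos_le_divide_eq)
  then show ?thesis by (simp add: Kq_def X_def \<phi>_def M_def growth_weight_def)
qed

end

section \<open>The coefficient of the linear term\<close>

text \<open>The integral of \<open>\<xi>'(r) / r\<close> for the cutoff \<open>\<xi> r = smoothstep (4 r - 1)\<close>, a pure number
  that normalises averages over circles.\<close>

definition coefficient_mass :: real
  where "coefficient_mass = (\<integral>z. 4 * smoothstep' (4 * norm (z::complex) - 1) / norm z \<partial>lborel)"

definition power_mass :: "real \<Rightarrow> real"
  where "power_mass \<alpha> = (\<integral>z. 4 * smoothstep' (4 * norm (z::complex) - 1) * norm z powr (\<alpha> - 3) \<partial>lborel)"

lemma continuous_smoothstep_affine:
  "continuous_on A (\<lambda>r. smoothstep (m * r - c))" "continuous_on A (\<lambda>r. smoothstep' (m * r - c))" "continuous_on A (\<lambda>r. smoothstep'' (m * r - c))"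
  by (intro continuous_on_compose2[OF continuous_on_smoothstep(1)[of UNIV]] continuous_on_compose2[OF continuous_on_smoothstep(2)[of UNIV]]
      continuous_on_compose2[OF continuous_on_smoothstep(3)[of UNIV]] continuous_intros subset_UNIV)+

lemma continuous_radial_profile:
  assumes "continuous_on {0<..} h"
  shows "continuous_on UNIV (\<lambda>r. 4 * smoothstep' (4 * r - 1) * h r)"
  by (rule continuous_on_zero_extend[of _ "1/4"])
    (auto intro!: continuous_intros continuous_smoothstep_affine assms simp: smoothstep_eq)

lemma radial_profile_integrable:
  assumes "continuous_on {0<..} h"
  shows "integrable lborel (\<lambda>z::complex. 4 * smoothstep' (4 * norm z - 1) * h (norm z))"
  by (rule integrable_continuous_support[of _ "1/2"])
    (auto intro!: continuous_on_compose2[OF continuous_radial_profile[OF assms]] continuous_on_norm_id simp: smoothstep_eq)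

lemma power_mass_nonneg: "power_mass \<alpha> \<ge> 0"
  unfolding power_mass_def by (intro integral_nonneg_AE AE_I2 mult_nonneg_nonneg) (auto simp: smoothstep'_bounds)

lemma coefficient_mass_pos: "coefficient_mass > 0"
proof -
  have c: "continuous_on {0<..} (\<lambda>r. 1 / r :: real)" by (intro continuous_intros) auto
  have i: "integrable lborel (\<lambda>z::complex. 4 * smoothstep' (4 * norm z - 1) * (1 / norm z))"
    by (rule radial_profile_integrable[OF c])
  have nn: "0 \<le> 4 * smoothstep' (4 * norm z - 1) * (1 / norm z)" for z :: complex
    by (simp add: smoothstep'_bounds)
  have "coefficient_mass \<noteq> 0"
  proof
    assume "coefficient_mass = 0"
    then have "(\<integral>z. 4 * smoothstep' (4 * norm (z::complex) - 1) * (1 / norm z) \<partial>lborel) = 0" by (simp add: coefficient_mass_def)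
    then have "AE z in lborel. 4 * smoothstep' (4 * norm (z::complex) - 1) * (1 / norm z) = 0"
      using integral_nonneg_eq_0_iff_AE[OF i] nn by simp
    then have "AE z in lborel. z \<notin> ball (3/8 :: complex) (1/8)"
    proof eventually_elim
      case (elim z)
      have "z \<notin> ball (3/8 :: complex) (1/8)"
      proof
        assume "z \<in> ball (3/8 :: complex) (1/8)"
        then have "norm (3/8 - z) < 1/8" by (simp add: dist_norm)
        moreover have "norm (3/8 :: complex) = 3/8" by simp
        ultimately have n: "1/4 < norm z" "norm z < 1/2"
          using norm_triangle_ineq2[of "3/8" z] norm_triangle_ineq3[of "3/8" z] by (auto simp: norm_minus_commute)
        have "smoothstep' (4 * norm z - 1) = 30 * (4 * norm z - 1)\<^sup>2 * (1 - (4 * norm z - 1))\<^sup>2"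
          using n by (simp add: smoothstep'_def)
        then have "smoothstep' (4 * norm z - 1) \<noteq> 0" "norm z \<noteq> 0" using n by auto
        then show False using elim by simp
      qed
      then show ?case .
    qed
    then have "emeasure lborel (ball (3/8 :: complex) (1/8)) = 0"
      by (subst (asm) AE_iff_measurable[where N="ball (3/8) (1/8)"]) auto
    then have "\<not> (open (ball (3/8 :: complex) (1/8)) \<and> ball (3/8 :: complex) (1/8) \<noteq> {})"
      by (metis open_not_negligible negligible_iff_null_sets null_setsI null_sets_completionI sets_lborel borel_open)
    then show False by simp
  qed
  moreover have "coefficient_mass \<ge> 0"
    unfolding coefficient_mass_def by (intro integral_nonneg_AE AE_I2 divide_nonneg_nonneg mult_nonneg_nonneg) (auto simp: smoothstep'_bounds)
  ultimately show ?thesis by simp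
qed

text \<open>The field \<open>\<phi>(|z|) z\<close> has divergence \<open>|z| \<phi>' + 2 \<phi>\<close>, of integral zero. For a power
  \<open>|z|^(\<alpha> - 4)\<close> with cutoffs this expresses \<open>2 - \<alpha>\<close> times the integral by the derivative of the cutoffs, and the outer
  cutoff contributes with a favourable sign.\<close>

lemma radial_power_integral:
  assumes \<alpha>: "\<alpha> < 2" and T: "1 \<le> T"
  shows "(\<integral>z. smoothstep (4 * norm z - 1) * norm z powr (\<alpha> - 4) \<partial>lborel_on (annulus (1/4) T)) \<le> power_mass \<alpha> / (2 - \<alpha>)"
proof -
  have T0: "T > 0" using T by simp
  define \<xi> \<xi>' where "\<xi> r = smoothstep (4 * r - 1) * (1 - smoothstep (1 / T * r - 1))"
    and "\<xi>' r = 4 * smoothstep' (4 * r - 1) * (1 - smoothstep (1 / T * r - 1)) - smoothstep (4 * r - 1) * (1 / T * smoothstep' (1 / T * r - 1))" for r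
  define \<phi> \<phi>' where "\<phi> r = \<xi> r * r powr (\<alpha> - 4)" and "\<phi>' r = \<xi>' r * r powr (\<alpha> - 4) + \<xi> r * ((\<alpha> - 4) * r powr (\<alpha> - 5))" for r
  have \<xi>d: "(\<xi> has_real_derivative \<xi>' r) (at r)" for r
    unfolding \<xi>_def[abs_def] \<xi>'_def
    by (rule DERIV_cong[OF DERIV_mult[OF smoothstep_affine_derivative DERIV_diff[OF DERIV_const smoothstep_affine_derivative]]]) simp
  have \<phi>d: "(\<phi> has_real_derivative \<phi>' r) (at r)" if "r > 0" for r
  proof -
    have p: "((\<lambda>r. r powr (\<alpha> - 4)) has_real_derivative (\<alpha> - 4) * r powr (\<alpha> - 4 - 1)) (at r)"
      by (rule has_real_derivative_powr[OF that])
    show ?thesis unfolding \<phi>_def[abs_def] \<phi>'_def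
      by (rule DERIV_cong[OF DERIV_mult[OF \<xi>d p]]) (simp add: algebra_simps)
  qed
  have c\<xi>: "continuous_on A \<xi>" "continuous_on A \<xi>'" for A
    unfolding \<xi>_def[abs_def] \<xi>'_def[abs_def] by (intro continuous_intros continuous_smoothstep_affine)+
  have cp: "continuous_on {0<..} (\<lambda>r::real. r powr p)" for p by (intro continuous_intros) auto
  have c\<phi>: "continuous_on {0<..} \<phi>'"
    unfolding \<phi>'_def[abs_def] by (intro continuous_intros c\<xi> cp)
  have z: "\<phi> r = 0" if "r < 1 / 4" for r using that by (simp add: \<phi>_def \<xi>_def smoothstep_eq)
  have zz: "\<phi> r = 0" if "r > 2 * T" for r using that T0 by (simp add: \<phi>_def \<xi>_def smoothstep_eq field_simps)
  have \<xi>b: "0 \<le> \<xi> r" "\<xi>' r \<le> 4 * smoothstep' (4 * r - 1)" for r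
  proof -
    show "0 \<le> \<xi> r" unfolding \<xi>_def using smoothstep_bounds by (simp add: mult_nonneg_nonneg)
    have "4 * smoothstep' (4 * r - 1) * (1 - smoothstep (1 / T * r - 1)) \<le> 4 * smoothstep' (4 * r - 1) * 1"
      using smoothstep'_bounds(1) smoothstep_bounds(1) by (intro mult_left_mono) auto
    moreover have "0 \<le> smoothstep (4 * r - 1) * (1 / T * smoothstep' (1 / T * r - 1))"
      using smoothstep'_bounds(1) smoothstep_bounds(1) T0 by (intro mult_nonneg_nonneg) auto
    ultimately show "\<xi>' r \<le> 4 * smoothstep' (4 * r - 1)" unfolding \<xi>'_def by linarith
  qed
  define w wx wy where "w = (\<lambda>z::complex. complex_of_real (\<phi> (norm z)))"
    and "wx = (\<lambda>z::complex. complex_of_real (\<phi>' (norm z) / norm z * Re z))" and "wy = (\<lambda>z::complex. complex_of_real (\<phi>' (norm z) / norm z * Im z))"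
  have w: "c1_on UNIV w wx wy" unfolding w_def wx_def wy_def by (rule c1_on_radial[where a="1/4", OF \<phi>d c\<phi> _ z]) auto
  note X = c1_on_mult[OF w c1_on_Re] and Y = c1_on_mult[OF w c1_on_Im]
  have w0: "w z = 0" if "norm z > 2 * T" for z using that zz by (simp add: w_def)
  have sX: "w z * of_real (Re z) = 0" "w z * of_real (Im z) = 0" if "norm z > 2 * T" for z using w0[OF that] by simp_all
  have iX: "(\<integral>z. wx z * of_real (Re z) + w z * 1 \<partial>lborel) = 0" "integrable lborel (\<lambda>z. wx z * of_real (Re z) + w z * 1)"
    by (rule integral_partial_x_eq_0[OF X], erule sX(1)) (rule c1_on_support_integrable(1)[OF X], erule sX(1))
  have iY: "(\<integral>z. wy z * of_real (Im z) + w z * 1 \<partial>lborel) = 0" "integrable lborel (\<lambda>z. wy z * of_real (Im z) + w z * 1)"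
    by (rule integral_partial_y_eq_0[OF Y], erule sX(2)) (rule c1_on_support_integrable(2)[OF Y], erule sX(2))
  have "(\<integral>z. (wx z * of_real (Re z) + w z * 1) + (wy z * of_real (Im z) + w z * 1) \<partial>lborel) = 0"
    unfolding Bochner_Integration.integral_add[OF iX(2) iY(2)] iX(1) iY(1) by simp
  moreover have eq: "Re ((wx z * of_real (Re z) + w z * 1) + (wy z * of_real (Im z) + w z * 1)) = \<xi>' (norm z) * norm z powr (\<alpha> - 3) - (2 - \<alpha>) * \<phi> (norm z)" for z
  proof (cases "z = 0")
    case True then show ?thesis by (simp add: w_def z \<xi>'_def smoothstep_eq)
  next
    case False
    then have n: "norm z > 0" by simp
    have "Re ((wx z * of_real (Re z) + w z * 1) + (wy z * of_real (Im z) + w z * 1)) = \<phi>' (norm z) / norm z * ((Re z)\<^sup>2 + (Im z)\<^sup>2) + 2 * \<phi> (norm z)"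
      by (simp add: wx_def wy_def w_def power2_eq_square algebra_simps)
    also have "(Re z)\<^sup>2 + (Im z)\<^sup>2 = norm z * norm z" by (simp add: cmod_power2 flip: power2_eq_square)
    also have "\<phi>' (norm z) / norm z * (norm z * norm z) = \<phi>' (norm z) * norm z" using n by simp
    also have "\<phi>' (norm z) * norm z = \<xi>' (norm z) * (norm z powr (\<alpha> - 4) * norm z) + (\<alpha> - 4) * (\<xi> (norm z) * (norm z powr (\<alpha> - 5) * norm z))"
      by (simp add: \<phi>'_def algebra_simps)
    also have "norm z powr (\<alpha> - 4) * norm z = norm z powr (\<alpha> - 3)"
      using n powr_mult_base[of "norm z" "\<alpha> - 4"] by (simp add: mult.commute)
    also have "norm z powr (\<alpha> - 5) * norm z = norm z powr (\<alpha> - 4)"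
      using n powr_mult_base[of "norm z" "\<alpha> - 5"] by (simp add: mult.commute)
    finally show ?thesis by (simp add: \<phi>_def algebra_simps)
  qed
  moreover have i: "integrable lborel (\<lambda>z. (wx z * of_real (Re z) + w z * 1) + (wy z * of_real (Im z) + w z * 1))"
    by (rule Bochner_Integration.integrable_add[OF iX(2) iY(2)])
  ultimately have "(\<integral>z. \<xi>' (norm z) * norm z powr (\<alpha> - 3) - (2 - \<alpha>) * \<phi> (norm (z::complex)) \<partial>lborel) = 0"
    using integral_Re[OF i] by simp
  moreover have i\<phi>: "integrable lborel (\<lambda>z::complex. \<phi> (norm z))"
  proof -
    have "integrable lborel w" by (rule integrable_continuous_support[OF c1_on_continuous[OF w], of "2 * T"]) (use w0 in auto)
    from integrable_Re[OF this] show ?thesis by (simp add: w_def)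
  qed
  moreover have i\<xi>: "integrable lborel (\<lambda>z::complex. \<xi>' (norm z) * norm z powr (\<alpha> - 3))"
  proof -
    have "integrable lborel (\<lambda>z::complex. (\<xi>' (norm z) * norm z powr (\<alpha> - 3) - (2 - \<alpha>) * \<phi> (norm z)) + (2 - \<alpha>) * \<phi> (norm z))"
      using integrable_Re[OF i] i\<phi> unfolding eq by (intro Bochner_Integration.integrable_add integrable_mult_right) auto
    then show ?thesis by simp
  qed
  ultimately have "(2 - \<alpha>) * (\<integral>z. \<phi> (norm (z::complex)) \<partial>lborel) = (\<integral>z. \<xi>' (norm z) * norm (z::complex) powr (\<alpha> - 3) \<partial>lborel)"
    by simp
  also have "\<dots> \<le> power_mass \<alpha>"
    unfolding power_mass_def
    by (intro integral_mono i\<xi> radial_profile_integrable[OF cp] mult_right_mono \<xi>b) auto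
  finally have main: "(\<integral>z. \<phi> (norm (z::complex)) \<partial>lborel) \<le> power_mass \<alpha> / (2 - \<alpha>)"
    using \<alpha> by (simp add: pos_le_divide_eq mult.commute)
  let ?K = "annulus (1/4) T"
  have clK: "closed ?K" by (rule compact_imp_closed[OF compact_annulus])
  have "(\<integral>z. smoothstep (4 * norm z - 1) * norm z powr (\<alpha> - 4) \<partial>lborel_on ?K) = (\<integral>z. indicator ?K z *\<^sub>R \<phi> (norm z) \<partial>lborel)"
  proof -
    have "(\<integral>z. smoothstep (4 * norm z - 1) * norm z powr (\<alpha> - 4) \<partial>lborel_on ?K) = (\<integral>z. \<phi> (norm z) \<partial>lborel_on ?K)"
    proof (rule Bochner_Integration.integral_cong[OF refl])
      fix z assume "z \<in> space (lborel_on ?K)"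
      then have "1 / T * norm z - 1 \<le> 0" using T0 by (simp add: space_restrict_space)
      then show "smoothstep (4 * norm z - 1) * norm z powr (\<alpha> - 4) = \<phi> (norm z)" by (simp add: \<phi>_def \<xi>_def smoothstep_eq)
    qed
    then show ?thesis using clK by (simp add: integral_restrict_space)
  qed
  also have "\<dots> \<le> (\<integral>z. \<phi> (norm (z::complex)) \<partial>lborel)"
    using clK i\<phi> \<xi>b(1) by (intro integral_mono integrable_mult_indicator) (auto simp: indicator_def \<phi>_def)
  finally show ?thesis using main by simp
qed

lemma conj_moment_eq_0:
  assumes "continuous_on {0<..} h" "n \<ge> 1"
  shows "(\<integral>z. of_real (4 * smoothstep' (4 * norm z - 1) * h (norm z)) * cnj (z ^ n) \<partial>lborel) = 0"
    "integrable lborel (\<lambda>z. of_real (4 * smoothstep' (4 * norm z - 1) * h (norm z)) * cnj (z ^ n))"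
proof -
  have z: "\<forall>r>1/2. 4 * smoothstep' (4 * r - 1) * h r = 0" by (simp add: smoothstep_eq)
  have lt: "(1/2::real) < 1" by simp
  have hol: "(\<lambda>z. z ^ n) holomorphic_on ball (0::complex) 1" by (intro holomorphic_intros)
  note R = radial_holomorphic_integral[OF hol continuous_radial_profile[OF assms(1)] z lt]
  have e: "of_real (4 * smoothstep' (4 * norm z - 1) * h (norm z)) * cnj (z ^ n) = cnj (of_real (4 * smoothstep' (4 * norm z - 1) * h (norm z)) * z ^ n)" for z
    by simp
  show "(\<integral>z. of_real (4 * smoothstep' (4 * norm z - 1) * h (norm z)) * cnj (z ^ n) \<partial>lborel) = 0"
    unfolding e Bochner_Integration.integral_bounded_linear[OF bounded_linear_cnj R(2)] R(1) using assms(2) by simp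
  show "integrable lborel (\<lambda>z. of_real (4 * smoothstep' (4 * norm z - 1) * h (norm z)) * cnj (z ^ n))"
    unfolding e by (rule integrable_bounded_linear[OF bounded_linear_cnj R(2)])
qed

context exterior_qc
begin

text \<open>Averaged over circles, \<open>g z / z\<close> retains only the term \<open>kk 0\<close> of
  \<open>1/z^2 + c0/z + kk z\<close>.\<close>

lemma coefficient_extraction:
  "(\<integral>z. of_real (4 * smoothstep' (4 * norm z - 1) / norm z) / z * g z \<partial>lborel) = kk 0 * of_real coefficient_mass"
proof -
  let ?P = "\<lambda>n z. of_real (4 * smoothstep' (4 * norm z - 1) * (1 / norm z ^ n)) :: complex"
  have c: "continuous_on {0<..} (\<lambda>r. 1 / r ^ n :: real)" for n by (intro continuous_intros) auto
  have z: "\<forall>r>1/2. 4 * smoothstep' (4 * r - 1) * (1 / r ^ 1) = 0" by (simp add: smoothstep_eq)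
  have lt: "(1/2::real) < 1" by simp
  note R = radial_holomorphic_integral[OF kk continuous_radial_profile[OF c[of 1]] z lt]
  note M2 = conj_moment_eq_0[OF c[of 5], of 2] and M1 = conj_moment_eq_0[OF c[of 3], of 1]
  have e: "of_real (4 * smoothstep' (4 * norm z - 1) / norm z) / z * g z
    = ?P 5 z * cnj (z ^ 2) + c0 * (?P 3 z * cnj (z ^ 1)) + ?P 1 z * kk z" for z
  proof (cases "1/4 < norm z \<and> norm z < 1/2")
    case False
    then have "smoothstep' (4 * norm z - 1) = 0" by (auto simp: smoothstep_eq not_less)
    then show ?thesis by simp
  next
    case True
    then have "0 < norm z" "norm z < 1" by linarith+
    then have nz: "z \<noteq> 0" and g: "g z = 1 / z + c0 + z * kk z" by (simp, rule g_inner)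
    define n where "n = complex_of_real (norm z)"
    have n: "n \<noteq> 0" "n * n = z * cnj z" using nz complex_norm_square[of z] by (auto simp: n_def power2_eq_square)
    have c1: "1 / z = cnj z / (n * n)" using n nz by (simp add: field_simps)
    have c2: "1 / z * (1 / z) = cnj z * cnj z / (n * n * (n * n))" unfolding c1 by simp
    define s where "s = complex_of_real (4 * smoothstep' (4 * norm z - 1))"
    have "of_real (4 * smoothstep' (4 * norm z - 1) / norm z) / z * g z = s / n * (1 / z * (1 / z)) + c0 * (s / n * (1 / z)) + s / n * kk z"
      unfolding g using nz by (simp add: s_def n_def field_simps)
    also have "\<dots> = s / n * (cnj z * cnj z / (n * n * (n * n))) + c0 * (s / n * (cnj z / (n * n))) + s / n * kk z"
      unfolding c2 unfolding c1 by simp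
    also have "\<dots> = ?P 5 z * cnj (z ^ 2) + c0 * (?P 3 z * cnj (z ^ 1)) + ?P 1 z * kk z"
      by (simp add: s_def n_def power2_eq_square power_numeral_reduce algebra_simps)
    finally show ?thesis .
  qed
  have "(\<integral>z. of_real (4 * smoothstep' (4 * norm z - 1) / norm z) / z * g z \<partial>lborel) = 0 + c0 * 0 + (\<integral>z. ?P 1 z * kk z \<partial>lborel)"
  proof -
    have iM1: "integrable lborel (\<lambda>z. c0 * (?P 3 z * cnj (z ^ 1)))" by (rule integrable_mult_right[OF M1(2)]) simp
    have "(\<integral>z. ?P 5 z * cnj (z ^ 2) + c0 * (?P 3 z * cnj (z ^ 1)) + ?P 1 z * kk z \<partial>lborel)
      = (\<integral>z. ?P 5 z * cnj (z ^ 2) \<partial>lborel) + (\<integral>z. c0 * (?P 3 z * cnj (z ^ 1)) \<partial>lborel) + (\<integral>z. ?P 1 z * kk z \<partial>lborel)"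
      using Bochner_Integration.integral_add[OF Bochner_Integration.integrable_add[OF M2(2) iM1] R(2)] Bochner_Integration.integral_add[OF M2(2) iM1] by simp
    moreover have "(\<integral>z. ?P 5 z * cnj (z ^ 2) \<partial>lborel) = 0" by (rule M2(1)) simp
    moreover have "(\<integral>z. c0 * (?P 3 z * cnj (z ^ 1)) \<partial>lborel) = c0 * 0"
      unfolding integral_mult_right_zero using M1(1) by simp
    ultimately show ?thesis unfolding e by simp
  qed
  also have "\<dots> = kk 0 * of_real coefficient_mass"
    unfolding coefficient_mass_def using R(1) by simp
  finally show ?thesis .
qed

text \<open>Integration by parts of \<open>\<xi> z^(-2)\<close> against \<open>gx + \<i> gy\<close> produces the circle averages that
  extract \<open>kk 0\<close> near the inner cutoff, and an average of \<open>g / z\<close> near the outer one. A second integration by parts along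
  circles exchanges \<open>g\<close> in the latter for its angular derivative, which the weighted area controls.\<close>

lemma coefficient_identity:
  defines "\<xi> \<equiv> \<lambda>r. smoothstep (4 * r - 1) * (1 - smoothstep (2 / T * r - 1))"
    and "\<rho> \<equiv> \<lambda>r. 2 / T * smoothstep' (2 / T * r - 1) / r"
  shows "kk 0 * of_real coefficient_mass =
    - \<i> * (\<integral>z. of_real (\<rho> (norm z)) / z * angular gx gy z \<partial>lborel_on (annulus (1/4) T))
    - (\<integral>z. of_real (\<xi> (norm z)) / z\<^sup>2 * (gx z + \<i> * gy z) \<partial>lborel_on (annulus (1/4) T))"
    "integrable (lborel_on (annulus (1/4) T)) (\<lambda>z. of_real (\<rho> (norm z)) / z * angular gx gy z)"
    "integrable (lborel_on (annulus (1/4) T)) (\<lambda>z. of_real (\<xi> (norm z)) / z\<^sup>2 * (gx z + \<i> * gy z))"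
proof -
  let ?K = "annulus (1/4) T"
  have T0: "T > 0" using T by simp
  have clK: "closed ?K" by (rule compact_imp_closed[OF compact_annulus])
  have cpK: "compact ?K" by (rule compact_annulus)
  have q0: "(1/4::real) > 0" by simp
  have KV: "?K \<subseteq> - {0}" by auto
  have oV: "open (- {0::complex})" by (simp add: open_Compl)
  note ap = approx[OF q0, of T] and s = sq[OF q0, of T]
  define \<xi>' where "\<xi>' r = 4 * smoothstep' (4 * r - 1) - 2 / T * smoothstep' (2 / T * r - 1)" for r
  define \<rho>' where "\<rho>' r = (2 / T * (2 / T * smoothstep'' (2 / T * r - 1)) * r - 2 / T * smoothstep' (2 / T * r - 1)) / (r * r)" for r
  have \<xi>d: "(\<xi> has_real_derivative \<xi>' r) (at r)" for r
  proof -
    have "(\<xi> has_real_derivative 4 * smoothstep' (4 * r - 1) * (1 - smoothstep (2 / T * r - 1)) + smoothstep (4 * r - 1) * (0 - 2 / T * smoothstep' (2 / T * r - 1))) (at r)"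
      unfolding \<xi>_def
      by (rule DERIV_cong[OF DERIV_mult[OF smoothstep_affine_derivative DERIV_diff[OF DERIV_const smoothstep_affine_derivative]]]) simp
    also have "4 * smoothstep' (4 * r - 1) * (1 - smoothstep (2 / T * r - 1)) + smoothstep (4 * r - 1) * (0 - 2 / T * smoothstep' (2 / T * r - 1)) = \<xi>' r"
    proof (cases "r \<le> 1/2")
      case True
      then have "2 * r \<le> T" using T by linarith
      then have "2 / T * r - 1 \<le> 0" using T0 by (simp add: field_simps)
      then show ?thesis by (simp add: \<xi>'_def smoothstep_eq)
    next
      case False then show ?thesis by (simp add: \<xi>'_def smoothstep_eq)
    qed
    finally show ?thesis .
  qed
  have sd: "((\<lambda>r. smoothstep' (2 / T * r - 1)) has_real_derivative 2 / T * smoothstep'' (2 / T * r - 1)) (at r)" for r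
  proof -
    have "((\<lambda>r. 2 / T * r - 1) has_real_derivative 2 / T) (at r)" using T0 by (auto intro!: derivative_eq_intros)
    from DERIV_chain2[OF smoothstep'_derivative this] show ?thesis by (simp add: mult.commute)
  qed
  have \<rho>d: "(\<rho> has_real_derivative \<rho>' r) (at r)" if "r > 0" for r
    unfolding \<rho>_def \<rho>'_def
    by (rule DERIV_cong[OF DERIV_divide[OF DERIV_cmult[OF sd] DERIV_ident]]) (use that in simp_all)
  have c: "continuous_on {0<..} \<xi>'" "continuous_on {0<..} \<rho>'"
    unfolding \<xi>'_def[abs_def] \<rho>'_def[abs_def]
    by (intro continuous_intros continuous_smoothstep_affine; auto)+
  have z: "\<xi> r = 0" "\<rho> r = 0" if "r < 1/4" for r
  proof -
    have "2 * r \<le> T" using that T by linarith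
    then have "2 / T * r - 1 \<le> 0" using T0 by (simp add: field_simps)
    then show "\<xi> r = 0" "\<rho> r = 0" using that by (simp_all add: \<xi>_def \<rho>_def smoothstep_eq)
  qed
  have zz: "\<xi> r = 0" "\<rho> r = 0" if "r > T" for r
  proof -
    have "2 / T * r - 1 \<ge> 1" using that T0 by (simp add: field_simps)
    then show "\<xi> r = 0" "\<rho> r = 0" by (simp_all add: \<xi>_def \<rho>_def smoothstep_eq)
  qed
  define u ux uy where "u = (\<lambda>z::complex. complex_of_real (\<xi> (norm z)))"
    and "ux = (\<lambda>z::complex. complex_of_real (\<xi>' (norm z) / norm z * Re z))" and "uy = (\<lambda>z::complex. complex_of_real (\<xi>' (norm z) / norm z * Im z))"
  define v vx vy where "v = (\<lambda>z::complex. complex_of_real (\<rho> (norm z)))"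
    and "vx = (\<lambda>z::complex. complex_of_real (\<rho>' (norm z) / norm z * Re z))" and "vy = (\<lambda>z::complex. complex_of_real (\<rho>' (norm z) / norm z * Im z))"
  have u: "c1_on UNIV u ux uy" unfolding u_def ux_def uy_def by (rule c1_on_radial[where a="1/4", OF \<xi>d c(1) q0 z(1)])
  have v: "c1_on UNIV v vx vy" unfolding v_def vx_def vy_def by (rule c1_on_radial[where a="1/4", OF \<rho>d c(2) q0 z(2)])
  have u0: "u z = 0" and v0: "v z = 0" if "z \<notin> ?K" for z
    using that z zz by (auto simp: u_def v_def not_le)
  have A1: "c1_on (- {0}) (\<lambda>z::complex. inverse z) (\<lambda>z. - 1 / z\<^sup>2) (\<lambda>z. - \<i> / z\<^sup>2)"
    by (rule c1_on_inverse[OF c1_on_ident]) auto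
  have A2: "c1_on (- {0}) (\<lambda>z::complex. inverse z * inverse z) (\<lambda>z. - 2 / z ^ 3) (\<lambda>z. - 2 * \<i> / z ^ 3)"
    by (rule c1_on_cong[OF c1_on_mult[OF A1 A1]]) (auto simp: field_simps power2_eq_square power3_eq_cube)
  have \<psi>: "c1_on UNIV (\<lambda>z. u z * (inverse z * inverse z)) (\<lambda>z. ux z * (inverse z * inverse z) + u z * (- 2 / z ^ 3))
      (\<lambda>z. uy z * (inverse z * inverse z) + u z * (- 2 * \<i> / z ^ 3))"
    by (rule c1_on_mult_cutoff[OF A2 u oV clK KV]) (erule u0)
  have \<theta>: "c1_on UNIV (\<lambda>z. v z * inverse z) (\<lambda>z. vx z * inverse z + v z * (- 1 / z\<^sup>2)) (\<lambda>z. vy z * inverse z + v z * (- \<i> / z\<^sup>2))"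
    by (rule c1_on_mult_cutoff[OF A1 v oV clK KV]) (erule v0)
  have \<psi>0: "u z * (inverse z * inverse z) = 0" and \<theta>0: "v z * inverse z = 0" if "z \<notin> ?K" for z
    using u0[OF that] v0[OF that] by simp_all
  have si: "integrable (lborel_on ?K) (\<lambda>z. q z * h z)" if "continuous_on UNIV q" "sq_integrable (lborel_on ?K) h" for q h
    by (rule sq_integrable_mult_integrable[OF sq_integrable_continuous_on[OF cpK continuous_on_subset[OF that(1)]] that(2)]) simp
  note cont\<psi> = c1_on_continuous[OF \<psi>] c1_onD(2,3)[OF \<psi>]
  note cont\<theta> = c1_on_continuous[OF \<theta>] c1_onD(2,3)[OF \<theta>]
  have pa: "(\<integral>z. u z * (inverse z * inverse z) * gx z \<partial>lborel_on ?K) = - (\<integral>z. (ux z * (inverse z * inverse z) + u z * (- 2 / z ^ 3)) * g z \<partial>lborel_on ?K)"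
    "(\<integral>z. u z * (inverse z * inverse z) * gy z \<partial>lborel_on ?K) = - (\<integral>z. (uy z * (inverse z * inverse z) + u z * (- 2 * \<i> / z ^ 3)) * g z \<partial>lborel_on ?K)"
  proof -
    note P = smooth_approx_partials[OF ap cpK \<psi>]
    show "(\<integral>z. u z * (inverse z * inverse z) * gx z \<partial>lborel_on ?K) = - (\<integral>z. (ux z * (inverse z * inverse z) + u z * (- 2 / z ^ 3)) * g z \<partial>lborel_on ?K)"
      by (rule P(1)) (rule \<psi>0)
    show "(\<integral>z. u z * (inverse z * inverse z) * gy z \<partial>lborel_on ?K) = - (\<integral>z. (uy z * (inverse z * inverse z) + u z * (- 2 * \<i> / z ^ 3)) * g z \<partial>lborel_on ?K)"
      by (rule P(2)) (rule \<psi>0)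
  qed
  have I1: "(\<integral>z. u z * (inverse z * inverse z) * (gx z + \<i> * gy z) \<partial>lborel_on ?K)
      = - (\<integral>z. ((ux z * (inverse z * inverse z) + u z * (- 2 / z ^ 3)) + \<i> * (uy z * (inverse z * inverse z) + u z * (- 2 * \<i> / z ^ 3))) * g z \<partial>lborel_on ?K)"
  proof -
    have "(\<integral>z. u z * (inverse z * inverse z) * (gx z + \<i> * gy z) \<partial>lborel_on ?K)
       = (\<integral>z. u z * (inverse z * inverse z) * gx z + \<i> * (u z * (inverse z * inverse z) * gy z) \<partial>lborel_on ?K)"
      by (simp add: algebra_simps)
    also have "\<dots> = (\<integral>z. u z * (inverse z * inverse z) * gx z \<partial>lborel_on ?K) + \<i> * (\<integral>z. u z * (inverse z * inverse z) * gy z \<partial>lborel_on ?K)"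
      using si[OF cont\<psi>(1) s(2)] si[OF cont\<psi>(1) s(3)] by simp
    also have "\<dots> = - ((\<integral>z. (ux z * (inverse z * inverse z) + u z * (- 2 / z ^ 3)) * g z \<partial>lborel_on ?K)
        + \<i> * (\<integral>z. (uy z * (inverse z * inverse z) + u z * (- 2 * \<i> / z ^ 3)) * g z \<partial>lborel_on ?K))"
      unfolding pa by (simp add: algebra_simps)
    also have "\<dots> = - (\<integral>z. (ux z * (inverse z * inverse z) + u z * (- 2 / z ^ 3)) * g z + \<i> * ((uy z * (inverse z * inverse z) + u z * (- 2 * \<i> / z ^ 3)) * g z) \<partial>lborel_on ?K)"
      using si[OF cont\<psi>(2) s(1)] si[OF cont\<psi>(3) s(1)] by simp
    finally show ?thesis by (simp add: algebra_simps)
  qed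
  have K1: "((ux z * (inverse z * inverse z) + u z * (- 2 / z ^ 3)) + \<i> * (uy z * (inverse z * inverse z) + u z * (- 2 * \<i> / z ^ 3)))
      = of_real (\<xi>' (norm z) / norm z) / z" if "z \<in> ?K" for z
  proof -
    have nz: "z \<noteq> 0" using that by auto
    have "ux z + \<i> * uy z = of_real (\<xi>' (norm z) / norm z) * z"
      by (simp add: ux_def uy_def complex_eq_iff)
    moreover have "((ux z * (inverse z * inverse z) + u z * (- 2 / z ^ 3)) + \<i> * (uy z * (inverse z * inverse z) + u z * (- 2 * \<i> / z ^ 3)))
      = (ux z + \<i> * uy z) * (inverse z * inverse z)"
      by (simp add: algebra_simps)
    ultimately have e: "((ux z * (inverse z * inverse z) + u z * (- 2 / z ^ 3)) + \<i> * (uy z * (inverse z * inverse z) + u z * (- 2 * \<i> / z ^ 3)))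
      = of_real (\<xi>' (norm z) / norm z) * (z * inverse z) * inverse z" by (simp only: mult.assoc)
    have "z * inverse z = 1" using nz by simp
    then show ?thesis unfolding e by (simp add: divide_inverse)
  qed
  note Yp = c1_on_mult[OF c1_on_Re \<theta>] and Xp = c1_on_mult[OF c1_on_Im \<theta>]
  have r0: "of_real (Re z) * (v z * inverse z) = 0" "of_real (Im z) * (v z * inverse z) = 0" if "z \<notin> ?K" for z
    using \<theta>0[OF that] by simp_all
  have pY: "(\<integral>z. of_real (Re z) * (v z * inverse z) * gy z \<partial>lborel_on ?K) =
      - (\<integral>z. (0 * (v z * inverse z) + of_real (Re z) * (vy z * inverse z + v z * (- \<i> / z\<^sup>2))) * g z \<partial>lborel_on ?K)"
    by (rule smooth_approx_partials(2)[OF ap cpK Yp], erule r0(1))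
  have pX: "(\<integral>z. of_real (Im z) * (v z * inverse z) * gx z \<partial>lborel_on ?K) =
      - (\<integral>z. (0 * (v z * inverse z) + of_real (Im z) * (vx z * inverse z + v z * (- 1 / z\<^sup>2))) * g z \<partial>lborel_on ?K)"
    by (rule smooth_approx_partials(1)[OF ap cpK Xp], erule r0(2))
  note cY = c1_on_continuous[OF Yp] c1_onD(3)[OF Yp] and cX = c1_on_continuous[OF Xp] c1_onD(2)[OF Xp]
  have I2: "(\<integral>z. v z * inverse z * angular gx gy z \<partial>lborel_on ?K) = \<i> * (\<integral>z. v z * inverse z * g z \<partial>lborel_on ?K)"
  proof -
    have "(\<integral>z. v z * inverse z * angular gx gy z \<partial>lborel_on ?K)
      = (\<integral>z. of_real (Re z) * (v z * inverse z) * gy z - of_real (Im z) * (v z * inverse z) * gx z \<partial>lborel_on ?K)"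
      by (simp add: angular_def algebra_simps)
    also have "\<dots> = (\<integral>z. of_real (Re z) * (v z * inverse z) * gy z \<partial>lborel_on ?K) - (\<integral>z. of_real (Im z) * (v z * inverse z) * gx z \<partial>lborel_on ?K)"
      by (rule Bochner_Integration.integral_diff[OF si[OF cY(1) s(3)] si[OF cX(1) s(2)]])
    also have "\<dots> = (\<integral>z. (0 * (v z * inverse z) + of_real (Im z) * (vx z * inverse z + v z * (- 1 / z\<^sup>2))) * g z \<partial>lborel_on ?K)
       - (\<integral>z. (0 * (v z * inverse z) + of_real (Re z) * (vy z * inverse z + v z * (- \<i> / z\<^sup>2))) * g z \<partial>lborel_on ?K)"
      unfolding pY pX by simp
    also have "\<dots> = (\<integral>z. (0 * (v z * inverse z) + of_real (Im z) * (vx z * inverse z + v z * (- 1 / z\<^sup>2))) * g z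
       - (0 * (v z * inverse z) + of_real (Re z) * (vy z * inverse z + v z * (- \<i> / z\<^sup>2))) * g z \<partial>lborel_on ?K)"
      by (rule Bochner_Integration.integral_diff[symmetric, OF si[OF cX(2) s(1)] si[OF cY(2) s(1)]])
    also have "\<dots> = (\<integral>z. \<i> * (v z * inverse z * g z) \<partial>lborel_on ?K)"
    proof (rule Bochner_Integration.integral_cong[OF refl])
      fix z assume "z \<in> space (lborel_on ?K)"
      then have nz: "z \<noteq> 0" by (auto simp: space_restrict_space)
      have "of_real (Im z) * (vx z * inverse z + v z * (- 1 / z\<^sup>2)) - of_real (Re z) * (vy z * inverse z + v z * (- \<i> / z\<^sup>2))
        = v z * (\<i> * (of_real (Re z) + \<i> * of_real (Im z))) / z\<^sup>2"
        by (simp add: vx_def vy_def algebra_simps diff_divide_distrib add_divide_distrib)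
      also have "of_real (Re z) + \<i> * of_real (Im z) = z" by (simp add: complex_eq_iff)
      also have "v z * (\<i> * z) / z\<^sup>2 = \<i> * (v z * inverse z)" using nz by (simp add: power2_eq_square field_simps)
      finally have k: "of_real (Im z) * (vx z * inverse z + v z * (- 1 / z\<^sup>2)) - of_real (Re z) * (vy z * inverse z + v z * (- \<i> / z\<^sup>2)) = \<i> * (v z * inverse z)" .
      show "(0 * (v z * inverse z) + of_real (Im z) * (vx z * inverse z + v z * (- 1 / z\<^sup>2))) * g z
       - (0 * (v z * inverse z) + of_real (Re z) * (vy z * inverse z + v z * (- \<i> / z\<^sup>2))) * g z = \<i> * (v z * inverse z * g z)"
        using arg_cong[OF k, of "\<lambda>t. t * g z"] by (simp only: left_diff_distrib mult_zero_left add_0_left mult.assoc)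
    qed
    also have "\<dots> = \<i> * (\<integral>z. v z * inverse z * g z \<partial>lborel_on ?K)" by simp
    finally show ?thesis .
  qed
  have D: "(\<integral>z. of_real (\<xi>' (norm z) / norm z) / z * g z \<partial>lborel_on ?K) =
     (\<integral>z. of_real (4 * smoothstep' (4 * norm z - 1) / norm z) / z * g z \<partial>lborel_on ?K) - (\<integral>z. v z * inverse z * g z \<partial>lborel_on ?K)"
  proof -
    have cc: "continuous_on ?K (\<lambda>z::complex. complex_of_real (4 * smoothstep' (4 * norm z - 1) / norm z) / z)"
      by (intro continuous_intros continuous_on_compose2[OF continuous_smoothstep_affine(2)[of UNIV]]) auto
    have i1: "integrable (lborel_on ?K) (\<lambda>z. of_real (4 * smoothstep' (4 * norm z - 1) / norm z) / z * g z)"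
      by (rule sq_integrable_mult_integrable[OF sq_integrable_continuous_on[OF cpK cc] s(1)])
    have eq: "of_real (\<xi>' (norm z) / norm z) / z * g z = of_real (4 * smoothstep' (4 * norm z - 1) / norm z) / z * g z - v z * inverse z * g z" for z
      by (simp add: \<xi>'_def v_def \<rho>_def divide_inverse algebra_simps)
    show ?thesis unfolding eq by (rule Bochner_Integration.integral_diff[OF i1 si[OF cont\<theta>(1) s(1)]])
  qed
  have E: "(\<integral>z. of_real (4 * smoothstep' (4 * norm z - 1) / norm z) / z * g z \<partial>lborel_on ?K) = kk 0 * of_real coefficient_mass"
  proof -
    have "of_real (4 * smoothstep' (4 * norm z - 1) / norm z) / z * g z = 0" if "z \<notin> ?K" for z
    proof -
      have "4 * norm z - 1 \<le> 0 \<or> 4 * norm z - 1 \<ge> 1" using that T by auto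
      then have "smoothstep' (4 * norm z - 1) = 0" by (auto simp: smoothstep_eq)
      then show ?thesis by simp
    qed
    from integral_lborel_on(1)[OF clK this] show ?thesis using coefficient_extraction by simp
  qed
  have "(\<integral>z. u z * (inverse z * inverse z) * (gx z + \<i> * gy z) \<partial>lborel_on ?K) = - (\<integral>z. of_real (\<xi>' (norm z) / norm z) / z * g z \<partial>lborel_on ?K)"
    unfolding I1 using K1 by (intro arg_cong[of _ _ uminus] Bochner_Integration.integral_cong) (auto simp: space_restrict_space)
  then have "kk 0 * of_real coefficient_mass = (\<integral>z. v z * inverse z * g z \<partial>lborel_on ?K) - (\<integral>z. u z * (inverse z * inverse z) * (gx z + \<i> * gy z) \<partial>lborel_on ?K)"
    unfolding D E by simp
  also have "(\<integral>z. v z * inverse z * g z \<partial>lborel_on ?K) = - \<i> * (\<integral>z. v z * inverse z * angular gx gy z \<partial>lborel_on ?K)"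
    unfolding I2 by (simp flip: mult.assoc)
  finally show "kk 0 * of_real coefficient_mass =
    - \<i> * (\<integral>z. of_real (\<rho> (norm z)) / z * angular gx gy z \<partial>lborel_on ?K)
    - (\<integral>z. of_real (\<xi> (norm z)) / z\<^sup>2 * (gx z + \<i> * gy z) \<partial>lborel_on ?K)"
    by (simp only: u_def v_def divide_inverse power2_eq_square inverse_mult_distrib)
  show "integrable (lborel_on ?K) (\<lambda>z. of_real (\<rho> (norm z)) / z * angular gx gy z)"
    using si[OF cont\<theta>(1) s(4)] by (simp only: v_def divide_inverse)
  show "integrable (lborel_on ?K) (\<lambda>z. of_real (\<xi> (norm z)) / z\<^sup>2 * (gx z + \<i> * gy z))"
    using si[OF cont\<psi>(1) sq_integrable_add[OF s(2) sq_integrable_cmult[OF s(3)]]]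
    by (simp only: u_def divide_inverse power2_eq_square inverse_mult_distrib)
qed

text \<open>On the outer cutoff, of size \<open>1/T^2\<close> at radius about \<open>T\<close>, the inequality
  \<open>8 x y \<le> 4 x^2 + 4 y^2\<close> leaves \<open>T^(-\<alpha>)\<close> times the weighted area and a term of order \<open>T^(-2)\<close>.
  In the other integral it is used in the form \<open>r^(-2) A \<le> r^(-4) + (A/2)^2\<close>.\<close>

lemma coefficient_bound:
  assumes \<alpha>: "0 < \<alpha>" "\<alpha> < 2" and th: "(1 + \<kappa>) / (1 - \<kappa>) * (\<alpha> / 2) = \<theta>" "\<theta> < 1"
    and C: "C = 2 * ((1 + \<kappa>) / (1 - \<kappa>)) * ramp_energy / (1 - \<theta>)"
  shows "norm (kk 0) * coefficient_mass \<le> (16 * ((1 + \<kappa>) / (1 - \<kappa>)) * C + 16) * T powr (- \<alpha>)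
    + L * (power_mass \<alpha> / (2 - \<alpha>) + C / (1 - \<kappa>\<^sup>2))"
proof -
  let ?K = "annulus (1/4) T"
  have T0: "T > 0" using T by simp
  have q0: "(1/4::real) > 0" by simp
  have clK: "closed ?K" by (rule compact_imp_closed[OF compact_annulus])
  define Kq where "Kq = (1 + \<kappa>) / (1 - \<kappa>)"
  have Kq: "Kq > 0" using \<kappa> by (simp add: Kq_def)
  have \<kappa>2: "\<kappa>\<^sup>2 < 1" using \<kappa> by (simp add: power_less_one_iff abs_square_less_1)
  define \<xi> where "\<xi> = (\<lambda>r. smoothstep (4 * r - 1) * (1 - smoothstep (2 / T * r - 1)))"
  define \<rho> where "\<rho> = (\<lambda>r. 2 / T * smoothstep' (2 / T * r - 1) / r)"
  have id: "kk 0 * of_real coefficient_mass =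
    - \<i> * (\<integral>z. of_real (\<rho> (norm z)) / z * angular gx gy z \<partial>lborel_on ?K)
    - (\<integral>z. of_real (\<xi> (norm z)) / z\<^sup>2 * (gx z + \<i> * gy z) \<partial>lborel_on ?K)"
    "integrable (lborel_on ?K) (\<lambda>z. of_real (\<rho> (norm z)) / z * angular gx gy z)"
    "integrable (lborel_on ?K) (\<lambda>z. of_real (\<xi> (norm z)) / z\<^sup>2 * (gx z + \<i> * gy z))"
    unfolding \<xi>_def \<rho>_def by (rule coefficient_identity)+
  define w where "w = (\<lambda>z. growth_weight T \<alpha> (norm z) * J z)"
  have iw: "integrable (lborel_on ?K) w"
    unfolding w_def by (rule integrable_radial(1)[OF q0 continuous_growth_weight[OF T0]])
  have W: "(\<integral>z. w z \<partial>lborel_on ?K) \<le> C"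
    unfolding w_def C by (rule weighted_energy[OF \<alpha>(1) th])
  interpret fm: finite_measure "lborel_on ?K" by (rule finite_measure_lborel_on[OF compact_annulus])
  have ms: "measure (lborel_on ?K) (space (lborel_on ?K)) \<le> 4 * T\<^sup>2"
    by (rule measure_annulus_le) (use T0 in auto)
  have pointwise1: "AE z in lborel. z \<in> ?K \<longrightarrow> norm (of_real (\<rho> (norm z)) / z * angular gx gy z) \<le> 16 * Kq * T powr (- \<alpha>) * w z + 4 / T ^ 4"
    using E_le_J_near J_nonneg
  proof eventually_elim
    case (elim z)
    show ?case
    proof
      assume zK: "z \<in> ?K"
      define r where "r = norm z"
      have r: "1/4 \<le> r" "r \<le> T" using zK by (auto simp: r_def)
      have w0: "0 \<le> w z" unfolding w_def using growth_weight_nonneg elim(2) by (rule mult_nonneg_nonneg)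
      have rhs0: "0 \<le> 16 * Kq * T powr (- \<alpha>) * w z + 4 / T ^ 4" using Kq T0 w0 by (intro add_nonneg_nonneg mult_nonneg_nonneg divide_nonneg_nonneg) auto
      show "norm (of_real (\<rho> (norm z)) / z * angular gx gy z) \<le> 16 * Kq * T powr (- \<alpha>) * w z + 4 / T ^ 4"
      proof (cases "T / 2 < r \<and> r < T")
        case False
        then have "2 / T * r - 1 \<le> 0 \<or> 2 / T * r - 1 \<ge> 1" using T0 r by (auto simp: field_simps)
        then have "\<rho> r = 0" by (auto simp: \<rho>_def smoothstep_eq)
        then show ?thesis using rhs0 by (simp add: r_def)
      next
        case True
        have \<rho>: "0 \<le> \<rho> r" "\<rho> r \<le> 8 / T\<^sup>2"
        proof -
          show "0 \<le> \<rho> r" unfolding \<rho>_def using T0 r smoothstep'_bounds(1) by (intro divide_nonneg_nonneg mult_nonneg_nonneg) auto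
          have "\<rho> r \<le> 2 / T * 2 / (T / 2)"
            unfolding \<rho>_def using T0 True smoothstep'_bounds by (intro frac_le mult_left_mono) auto
          then show "\<rho> r \<le> 8 / T\<^sup>2" by (simp add: power2_eq_square)
        qed
        have E0: "E z \<ge> 0" by (simp add: E_def)
        have "norm (of_real (\<rho> (norm z)) / z * angular gx gy z) = \<rho> r / r * norm (angular gx gy z)"
          using \<rho>(1) by (simp add: norm_mult norm_divide r_def)
        also have "\<dots> \<le> \<rho> r / r * (r * sqrt (E z))"
          unfolding r_def using \<rho>(1) norm_angular_le by (intro mult_left_mono) (auto simp: r_def)
        also have "\<dots> = \<rho> r * sqrt (E z)" using r by simp
        also have "\<dots> \<le> 8 / T\<^sup>2 * sqrt (E z)" using \<rho> E0 by (intro mult_right_mono) auto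
        also have "\<dots> \<le> 4 * E z + 4 / T ^ 4"
        proof -
          have "0 \<le> 4 * (sqrt (E z) - 1 / T\<^sup>2)\<^sup>2" by simp
          also have "\<dots> = 4 * E z + 4 / T ^ 4 - 8 / T\<^sup>2 * sqrt (E z)"
            using E0 by (simp add: power2_diff power_divide algebra_simps)
          finally show ?thesis by simp
        qed
        also have "4 * E z \<le> 16 * Kq * T powr (- \<alpha>) * w z"
        proof -
          have "T powr \<alpha> \<le> (2 * r) powr \<alpha>" using True \<alpha> T0 by (intro powr_mono2) auto
          also have "\<dots> = 2 powr \<alpha> * r powr \<alpha>" using r by (simp add: powr_mult)
          also have "\<dots> \<le> 4 * growth_weight T \<alpha> r"
          proof -
            have "(2::real) powr \<alpha> \<le> 2 powr 2" using \<alpha> by (intro powr_mono) auto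
            then have "(2::real) powr \<alpha> \<le> 4" by simp
            moreover have "r powr \<alpha> \<le> growth_weight T \<alpha> r" by (rule growth_weight_ge) (use \<alpha> r True T in auto)
            ultimately show ?thesis by (intro mult_mono) auto
          qed
          finally have "T powr (- \<alpha>) * T powr \<alpha> \<le> T powr (- \<alpha>) * (4 * growth_weight T \<alpha> r)" by (intro mult_left_mono) auto
          moreover have "T powr (- \<alpha>) * T powr \<alpha> = 1" using T0 by (simp flip: powr_add)
          ultimately have "1 \<le> 4 * T powr (- \<alpha>) * growth_weight T \<alpha> r" by simp
          then have "1 * J z \<le> 4 * T powr (- \<alpha>) * growth_weight T \<alpha> r * J z" using elim(2) by (rule mult_right_mono)
          then have "J z \<le> 4 * T powr (- \<alpha>) * w z" by (simp add: w_def r_def mult.assoc)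
          then have "Kq * J z \<le> Kq * (4 * T powr (- \<alpha>) * w z)" using Kq by (intro mult_left_mono) auto
          moreover have "Kq * (4 * T powr (- \<alpha>) * w z) = (16 * Kq * T powr (- \<alpha>) * w z) / 4" by simp
          moreover have "E z \<le> Kq * J z" using elim(1) True by (simp add: Kq_def r_def)
          ultimately show ?thesis by linarith
        qed
        finally show ?thesis by simp
      qed
    qed
  qed
  have I1: "norm (\<integral>z. of_real (\<rho> (norm z)) / z * angular gx gy z \<partial>lborel_on ?K) \<le> (16 * Kq * C + 16) * T powr (- \<alpha>)"
  proof -
    have "norm (\<integral>z. of_real (\<rho> (norm z)) / z * angular gx gy z \<partial>lborel_on ?K) \<le> (\<integral>z. 16 * Kq * T powr (- \<alpha>) * w z + 4 / T ^ 4 \<partial>lborel_on ?K)"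
      by (rule order_trans[OF integral_norm_bound integral_mono_AE[OF integrable_norm[OF id(2)] _ AE_lborel_on[OF clK pointwise1]]])
        (intro Bochner_Integration.integrable_add integrable_mult_right iw fm.integrable_const)
    also have "\<dots> = 16 * Kq * T powr (- \<alpha>) * (\<integral>z. w z \<partial>lborel_on ?K) + measure (lborel_on ?K) (space (lborel_on ?K)) * (4 / T ^ 4)"
      using Bochner_Integration.integral_add[OF integrable_mult_right[OF iw] fm.integrable_const[of "4 / T ^ 4"], of "16 * Kq * T powr (- \<alpha>)"] by simp
    also have "\<dots> \<le> 16 * Kq * T powr (- \<alpha>) * C + 16 * T powr (- \<alpha>)"
    proof (rule add_mono)
      show "16 * Kq * T powr (- \<alpha>) * (\<integral>z. w z \<partial>lborel_on ?K) \<le> 16 * Kq * T powr (- \<alpha>) * C"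
        using W Kq by (intro mult_left_mono) auto
      have "measure (lborel_on ?K) (space (lborel_on ?K)) * (4 / T ^ 4) \<le> 4 * T\<^sup>2 * (4 / T ^ 4)"
        using ms by (rule mult_right_mono) simp
      also have "\<dots> = 16 * T powr (- 2)" using T0 by (simp add: powr_minus powr_numeral divide_simps power_numeral_reduce)
      also have "\<dots> \<le> 16 * T powr (- \<alpha>)" using T \<alpha> by (intro mult_left_mono powr_mono) auto
      finally show "measure (lborel_on ?K) (space (lborel_on ?K)) * (4 / T ^ 4) \<le> 16 * T powr (- \<alpha>)" .
    qed
    finally show ?thesis by (simp add: algebra_simps)
  qed
  define h where "h = (\<lambda>z::complex. smoothstep (4 * norm z - 1) * norm z powr (\<alpha> - 4))"
  have ih: "integrable (lborel_on ?K) h"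
    unfolding h_def by (rule integrable_continuous_compact[OF compact_annulus])
      (auto intro!: continuous_intros continuous_on_compose2[OF continuous_smoothstep_affine(1)[of UNIV]])
  have H: "(\<integral>z. h z \<partial>lborel_on ?K) \<le> power_mass \<alpha> / (2 - \<alpha>)"
    unfolding h_def by (rule radial_power_integral[OF \<alpha>(2) T])
  have pointwise2: "AE z in lborel. z \<in> ?K \<longrightarrow> norm (of_real (\<xi> (norm z)) / z\<^sup>2 * (gx z + \<i> * gy z)) \<le> L * (h z + w z / (1 - \<kappa>\<^sup>2))"
    using gx_inner gy_inner \<kappa>(3) L(2) J_nonneg
  proof eventually_elim
    case (elim z)
    show ?case
    proof
      assume zK: "z \<in> ?K"
      define r where "r = norm z"
      have r: "1/4 \<le> r" "r \<le> T" using zK by (auto simp: r_def)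
      have w0: "0 \<le> w z" unfolding w_def using growth_weight_nonneg elim(5) by (rule mult_nonneg_nonneg)
      have h0: "0 \<le> h z" unfolding h_def using smoothstep_bounds(1) by (intro mult_nonneg_nonneg) auto
      have rhs0: "0 \<le> L * (h z + w z / (1 - \<kappa>\<^sup>2))" using L(1) w0 h0 \<kappa>2 by (intro mult_nonneg_nonneg add_nonneg_nonneg divide_nonneg_nonneg) auto
      show "norm (of_real (\<xi> (norm z)) / z\<^sup>2 * (gx z + \<i> * gy z)) \<le> L * (h z + w z / (1 - \<kappa>\<^sup>2))"
      proof (cases "1 \<le> r \<and> r < T")
        case False
        have "of_real (\<xi> (norm z)) / z\<^sup>2 * (gx z + \<i> * gy z) = 0"
        proof (cases "r < 1")
          case True
          then have "gx z = - 1 / z\<^sup>2 + (kk z + z * deriv kk z)" "gy z = \<i> * (- 1 / z\<^sup>2 + (kk z + z * deriv kk z))"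
            using elim by (auto simp: r_def)
          then have "gx z + \<i> * gy z = 0" by (simp flip: mult.assoc)
          then show ?thesis by simp
        next
          case False
          then have "r = T" using \<open>\<not> (1 \<le> r \<and> r < T)\<close> r by simp
          then have "2 / T * r - 1 = 1" using T0 by simp
          then have "\<xi> r = 0" by (simp add: \<xi>_def smoothstep_eq)
          then show ?thesis by (simp add: r_def)
        qed
        then show ?thesis using rhs0 by (simp only: norm_zero)
      next
        case True
        define A where "A = norm (gx z - \<i> * gy z)"
        have \<xi>1: "0 \<le> \<xi> r" "\<xi> r \<le> 1" unfolding \<xi>_def using smoothstep_bounds by (auto intro!: mult_nonneg_nonneg mult_le_one)
        have "norm (of_real (\<xi> (norm z)) / z\<^sup>2 * (gx z + \<i> * gy z)) = \<xi> r / r\<^sup>2 * norm (gx z + \<i> * gy z)"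
          using \<xi>1 by (simp add: norm_mult norm_divide norm_power r_def)
        also have "\<dots> \<le> 1 / r\<^sup>2 * (L * r powr \<alpha> * A)"
          using elim(4) \<xi>1 L(1) by (intro mult_mono divide_right_mono) (auto simp: A_def r_def)
        also have "\<dots> = L * (r powr \<alpha> * (2 * (1 / r\<^sup>2) * (A / 2)))" by simp
        also have "\<dots> \<le> L * (r powr \<alpha> * (1 / r ^ 4 + (A / 2)\<^sup>2))"
        proof -
          have "0 \<le> (1 / r\<^sup>2 - A / 2)\<^sup>2" by simp
          also have "\<dots> = 1 / r ^ 4 + (A / 2)\<^sup>2 - 2 * (1 / r\<^sup>2) * (A / 2)" by (simp add: power2_diff power_one_over flip: power_mult)
          finally have "2 * (1 / r\<^sup>2) * (A / 2) \<le> 1 / r ^ 4 + (A / 2)\<^sup>2" by simp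
          then show ?thesis using L(1) by (intro mult_left_mono) auto
        qed
        also have "\<dots> \<le> L * (h z + w z / (1 - \<kappa>\<^sup>2))"
        proof (intro mult_left_mono L(1))
          have "smoothstep (4 * r - 1) = 1" using True by (simp add: smoothstep_eq)
          moreover have "r powr \<alpha> * (1 / r ^ 4) = r powr (\<alpha> - 4)" using r by (simp add: powr_diff powr_numeral)
          ultimately have hh: "r powr \<alpha> * (1 / r ^ 4) = h z" by (simp add: h_def r_def)
          have "(A / 2)\<^sup>2 \<le> J z / (1 - \<kappa>\<^sup>2)"
            unfolding J_def Jacobian_identity A_def
            by (rule dilatation_bounds(3)[OF norm_ge_zero norm_ge_zero _ \<kappa>(1,2)]) (use elim(3) True in \<open>simp add: r_def\<close>)
          moreover have "r powr \<alpha> \<le> growth_weight T \<alpha> r" by (rule growth_weight_ge) (use \<alpha> True in auto)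
          ultimately have "r powr \<alpha> * (A / 2)\<^sup>2 \<le> growth_weight T \<alpha> r * (J z / (1 - \<kappa>\<^sup>2))"
            by (intro mult_mono growth_weight_nonneg) auto
          then show "r powr \<alpha> * (1 / r ^ 4 + (A / 2)\<^sup>2) \<le> h z + w z / (1 - \<kappa>\<^sup>2)"
            unfolding distrib_left hh by (simp add: w_def r_def)
        qed
        finally show ?thesis .
      qed
    qed
  qed
  have I2: "norm (\<integral>z. of_real (\<xi> (norm z)) / z\<^sup>2 * (gx z + \<i> * gy z) \<partial>lborel_on ?K) \<le> L * (power_mass \<alpha> / (2 - \<alpha>) + C / (1 - \<kappa>\<^sup>2))"
  proof -
    have iwd: "integrable (lborel_on ?K) (\<lambda>z. w z / (1 - \<kappa>\<^sup>2))" by (rule integrable_divide_zero) (rule iw)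
    have "norm (\<integral>z. of_real (\<xi> (norm z)) / z\<^sup>2 * (gx z + \<i> * gy z) \<partial>lborel_on ?K) \<le> (\<integral>z. L * (h z + w z / (1 - \<kappa>\<^sup>2)) \<partial>lborel_on ?K)"
      by (rule order_trans[OF integral_norm_bound integral_mono_AE[OF integrable_norm[OF id(3)] _ AE_lborel_on[OF clK pointwise2]]])
        (intro Bochner_Integration.integrable_add integrable_mult_right ih iwd)
    also have "\<dots> = L * ((\<integral>z. h z \<partial>lborel_on ?K) + (\<integral>z. w z \<partial>lborel_on ?K) / (1 - \<kappa>\<^sup>2))"
      using Bochner_Integration.integral_add[OF ih iwd] by simp
    also have "\<dots> \<le> L * (power_mass \<alpha> / (2 - \<alpha>) + C / (1 - \<kappa>\<^sup>2))"
      using H W L(1) \<kappa>2 by (intro mult_left_mono add_mono divide_right_mono) auto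
    finally show ?thesis .
  qed
  have "norm (kk 0) * coefficient_mass = norm (kk 0 * of_real coefficient_mass)"
    using coefficient_mass_pos by (simp add: norm_mult)
  also have "\<dots> \<le> norm (- \<i> * (\<integral>z. of_real (\<rho> (norm z)) / z * angular gx gy z \<partial>lborel_on ?K))
      + norm (\<integral>z. of_real (\<xi> (norm z)) / z\<^sup>2 * (gx z + \<i> * gy z) \<partial>lborel_on ?K)"
    unfolding id(1) by (rule norm_triangle_ineq4)
  also have "norm (- \<i> * (\<integral>z. of_real (\<rho> (norm z)) / z * angular gx gy z \<partial>lborel_on ?K))
      = norm (\<integral>z. of_real (\<rho> (norm z)) / z * angular gx gy z \<partial>lborel_on ?K)" unfolding norm_mult by simp
  finally show ?thesis using I1 I2 unfolding Kq_def by linarith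
qed

end

section \<open>Weak gradients and Weyl's lemma\<close>

text \<open>Weak differentiability, tested only against mollifiers: mollification turns \<open>f\<close> into a smooth function with the
  gradient that is obtained by mollifying \<open>p\<close> and \<open>q\<close>.\<close>

definition weak_gradient :: "(complex \<Rightarrow> complex) \<Rightarrow> (complex \<Rightarrow> complex) \<Rightarrow> (complex \<Rightarrow> complex) \<Rightarrow> bool"
  where "weak_gradient f p q \<longleftrightarrow> continuous_on UNIV f \<and> locally_sq_integrable p \<and> locally_sq_integrable q \<and>
    (\<forall>e>0. \<forall>z. convolve (mollifier_x e) f z = mollify e p z \<and> convolve (mollifier_y e) f z = mollify e q z)"

lemma weak_gradient_mollify:
  assumes w: "weak_gradient f p q" and e: "e > 0"
  shows "c2_on UNIV (mollify e f) (mollify e p) (mollify e q)"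
proof -
  have cf: "continuous_on UNIV f" and eq: "convolve (mollifier_x e) f = mollify e p" "convolve (mollifier_y e) f = mollify e q"
    using w e by (auto simp: weak_gradient_def)
  obtain kxx kxy kyy where k: "c1_on UNIV (mollifier_x e) kxx kxy" "c1_on UNIV (mollifier_y e) kxy kyy"
    by (rule c2_mollifier[of e])
  have z: "mollifier e z = 0" if "norm z > e" for z using mollifier_eq_0[of e z] e that by simp
  have o: "open (- cball (0::complex) e)" by (simp add: open_Compl)
  have zx: "mollifier_x e z = 0" "mollifier_y e z = 0" if "norm z > e" for z
    by (rule c1_on_vanish[OF c1_mollifier o subset_UNIV]; use z that in simp)+
  have 1: "c1_on UNIV (mollify e f) (convolve (mollifier_x e) f) (convolve (mollifier_y e) f)"
    by (rule c1_convolve[OF c1_mollifier _ cf]) (erule z)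
  have 2: "c1_on UNIV (convolve (mollifier_x e) f) (convolve kxx f) (convolve kxy f)"
    by (rule c1_convolve[OF k(1) _ cf]) (erule zx)
  have 3: "c1_on UNIV (convolve (mollifier_y e) f) (convolve kxy f) (convolve kyy f)"
    by (rule c1_convolve[OF k(2) _ cf]) (erule zx)
  show ?thesis unfolding c2_on_def using 1 2 3 unfolding eq by blast
qed

text \<open>A subsequence converges almost everywhere to the limit in mean square.\<close>

lemma L2_tendsto_AE_limit_unique:
  assumes L: "L2_tendsto M U u" and lim: "\<And>x. x \<in> space M \<Longrightarrow> P x \<Longrightarrow> (\<lambda>n. U n x) \<longlonglongrightarrow> v x"
  shows "AE x in M. P x \<longrightarrow> u x = v x"
proof -
  have s: "sq_integrable M (\<lambda>x. U n x - u x)" for n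
    using L by (auto simp: L2_tendsto_def intro: sq_integrable_diff)
  have i: "integrable M (\<lambda>x. (norm (U n x - u x))\<^sup>2)" for n
    using s[of n] by (simp add: sq_integrable_def)
  have "(\<lambda>n. \<integral>x. norm ((norm (U n x - u x))\<^sup>2) \<partial>M) \<longlonglongrightarrow> 0" using L by (simp add: L2_tendsto_def)
  from tendsto_L1_AE_subseq[OF i this] obtain r :: "nat \<Rightarrow> nat" where r: "strict_mono r" "AE x in M. (\<lambda>n. (norm (U (r n) x - u x))\<^sup>2) \<longlonglongrightarrow> 0" by blast
  have "AE x in M. x \<in> space M" by (rule AE_space)
  with r(2) show ?thesis
  proof eventually_elim
    case (elim x)
    show ?case
    proof
      assume "P x"
      have "(\<lambda>n. norm (U (r n) x - u x)) \<longlonglongrightarrow> 0"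
        using tendsto_real_sqrt[OF elim(1)] by simp
      then have "(\<lambda>n. U (r n) x) \<longlonglongrightarrow> u x" by (simp add: LIM_zero_iff tendsto_norm_zero_iff)
      moreover have "(\<lambda>n. U (r n) x) \<longlonglongrightarrow> v x"
        using LIMSEQ_subseq_LIMSEQ[OF lim[OF elim(2) \<open>P x\<close>] r(1)] by (simp add: o_def)
      ultimately show "u x = v x" by (rule LIMSEQ_unique)
    qed
  qed
qed

text \<open>Where the Cauchy-Riemann equation holds in the weak sense, the mollifications are holomorphic, and their locally
  uniform limit \<open>f\<close> is holomorphic with the limit of the derivatives. Comparison of this limit with the one in mean square
  identifies \<open>p\<close> and \<open>q\<close>.\<close>

lemma Weyl_holomorphic:
  assumes w: "weak_gradient f p q" and CR: "AE z in lborel. norm z < 1 \<longrightarrow> p z + \<i> * q z = 0"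
  shows "f holomorphic_on ball 0 1" "AE z in lborel. norm z < 1 \<longrightarrow> p z = deriv f z \<and> q z = \<i> * deriv f z"
proof -
  have lp: "locally_sq_integrable p" and lq: "locally_sq_integrable q" and cf: "continuous_on UNIV f"
    using w by (auto simp: weak_gradient_def)
  let ?e = "\<lambda>n. 1 / real (Suc n)"
  have CRn: "mollify e q z = \<i> * mollify e p z" if "e > 0" "norm z < 1 - e" for e z
  proof -
    have "mollify e p z + \<i> * mollify e q z = (\<integral>v. mollifier e (z - v) * p v + \<i> * (mollifier e (z - v) * q v) \<partial>lborel)"
      unfolding convolve_def using mollify_integrable[OF lp that(1), of z] mollify_integrable[OF lq that(1), of z] by simp
    also have "\<dots> = (\<integral>v. 0 \<partial>(lborel :: complex measure))"
    proof (rule Bochner_Integration.integral_cong_AE)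
      show "AE v in lborel. mollifier e (z - v) * p v + \<i> * (mollifier e (z - v) * q v) = 0"
        using CR
      proof eventually_elim
        case (elim v)
        show ?case
        proof (cases "norm (z - v) < e")
          case True
          then have "norm v < 1" using that norm_triangle_ineq2[of v z] by (simp add: norm_minus_commute)
          then have "p v + \<i> * q v = 0" using elim by simp
          then have "mollifier e (z - v) * (p v + \<i> * q v) = 0" by simp
          then show ?thesis by (simp add: algebra_simps)
        next
          case False
          then have "mollifier e (z - v) = 0" using mollifier_eq_0[of e "z - v"] that by simp
          then show ?thesis by simp
        qed
      qed
    qed (use mollify_integrable[OF lp that(1), of z] mollify_integrable[OF lq that(1), of z] in auto)
    finally have "mollify e p z + \<i> * mollify e q z = 0" by simp
    then have "\<i> * (mollify e p z + \<i> * mollify e q z) = 0" by simp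
    then show ?thesis by (simp add: algebra_simps flip: mult.assoc)
  qed
  have der: "(mollify e f has_field_derivative mollify e p z) (at z)" if "e > 0" "norm z < 1 - e" for e z
  proof -
    have "(mollify e f has_derivative (\<lambda>h. of_real (Re h) * mollify e p z + of_real (Im h) * mollify e q z)) (at z)"
      by (rule c1_onD(1)[OF c2_onD[OF weak_gradient_mollify[OF w that(1)]]]) simp
    moreover have "(\<lambda>h. of_real (Re h) * mollify e p z + of_real (Im h) * mollify e q z) = (*) (mollify e p z)"
      unfolding CRn[OF that] by (rule ext) (simp add: complex_eq_iff algebra_simps)
    ultimately show ?thesis by (simp add: has_field_derivative_def)
  qed
  have loc: "(f has_field_derivative deriv f z) (at z) \<and> (\<lambda>n. mollify (?e n) p z) \<longlonglongrightarrow> deriv f z" if z: "norm z < 1" for z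
  proof -
    obtain s where s: "norm z < s" "s < 1" using dense[OF z] by blast
    obtain N where N: "?e N < 1 - s" using nat_approx_posE[of "1 - s"] s by auto
    have eN: "?e (n + N) \<le> ?e N" for n by (simp add: frac_le)
    have o: "open (ball (0::complex) s)" by simp
    have d: "(mollify (?e (n + N)) f has_field_derivative mollify (?e (n + N)) p x) (at x)" if "x \<in> ball 0 s" for n x
      by (rule der) (use that eN[of n] N in auto)
    have U: "uniform_limit (cball 0 1) (\<lambda>n. mollify (?e (n + N)) f) f sequentially"
    proof (rule uniform_limitI)
      fix r :: real assume "r > 0"
      from uniform_limitD[OF mollify_uniform_limit[OF cf] this, of 1] obtain M where
        M: "\<And>n z. n \<ge> M \<Longrightarrow> z \<in> cball 0 1 \<Longrightarrow> dist (mollify (?e n) f z) (f z) < r"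
        unfolding eventually_sequentially by blast
      show "\<forall>\<^sub>F n in sequentially. \<forall>z\<in>cball 0 1. dist (mollify (?e (n + N)) f z) (f z) < r"
      proof (intro eventually_sequentiallyI[of M] ballI)
        fix n z assume "M \<le> n" "z \<in> cball (0::complex) 1"
        then show "dist (mollify (?e (n + N)) f z) (f z) < r" by (intro M) simp_all
      qed
    qed
    have ex: "\<exists>d>0. cball x d \<subseteq> ball 0 s \<and> uniform_limit (cball x d) (\<lambda>n. mollify (?e (n + N)) f) f sequentially" if "x \<in> ball 0 s" for x
    proof -
      have "\<exists>d>0. cball x d \<subseteq> ball 0 s" using o that open_contains_cball by blast
      then obtain d where d: "d > 0" "cball x d \<subseteq> ball 0 s" by blast
      have "cball x d \<subseteq> cball 0 1" using d(2) s(2) by (auto dest!: subsetD)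
      then have "uniform_limit (cball x d) (\<lambda>n. mollify (?e (n + N)) f) f sequentially" by (rule uniform_limit_on_subset[OF U])
      with d show ?thesis by (intro exI[of _ d] conjI)
    qed
    have "\<exists>g'. \<forall>x\<in>ball 0 s. (f has_field_derivative g' x) (at x) \<and> (\<lambda>n. mollify (?e (n + N)) p x) \<longlonglongrightarrow> g' x"
      by (rule has_complex_derivative_uniform_sequence[OF o]) (erule d, erule ex)
    then obtain g' where g': "\<forall>x\<in>ball 0 s. (f has_field_derivative g' x) (at x) \<and> (\<lambda>n. mollify (?e (n + N)) p x) \<longlonglongrightarrow> g' x"
      by (rule exE)
    have zs: "z \<in> ball 0 s" using s by simp
    note gz = bspec[OF g' zs]
    have "deriv f z = g' z" by (rule DERIV_imp_deriv) (rule conjunct1[OF gz])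
    then show ?thesis using gz LIMSEQ_offset[of "\<lambda>n. mollify (?e n) p z" N] by (simp only:)
  qed
  show "f holomorphic_on ball 0 1"
    by (rule holomorphic_onI) (use loc in \<open>auto simp: field_differentiable_def intro: has_field_derivative_at_within\<close>)
  have K: "closed (cball (0::complex) 1)" by simp
  have "AE z in lborel_on (cball 0 1). norm z < 1 \<longrightarrow> p z = deriv f z"
    by (rule L2_tendsto_AE_limit_unique[OF mollify_L2_tendsto[OF lp]]) (use loc in auto)
  then have "AE z in lborel. norm z < 1 \<longrightarrow> p z = deriv f z"
    by (subst (asm) AE_restrict_space_iff) (auto elim!: eventually_mono)
  with CR show "AE z in lborel. norm z < 1 \<longrightarrow> p z = deriv f z \<and> q z = \<i> * deriv f z"
  proof eventually_elim
    case (elim z)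
    show ?case
    proof
      assume n: "norm z < 1"
      then have "\<i> * (p z + \<i> * q z) = 0" using elim by simp
      then have "q z = \<i> * p z" by (simp add: algebra_simps flip: mult.assoc)
      then show "p z = deriv f z \<and> q z = \<i> * deriv f z" using elim n by simp
    qed
  qed
qed

section \<open>Affine changes of variable\<close>

lemma AE_lborel_affine:
  assumes d: "d > 0" and P: "AE z in lborel. P (z::complex)"
  shows "AE u in lborel. P (w + of_real d * u)"
proof -
  have "AE z in density (distr lborel borel (\<lambda>x. w + d *\<^sub>R x)) (\<lambda>_. \<bar>d\<bar>^DIM(complex)). P z"
    using P d by (subst (asm) lborel_affine[of d w]) auto
  then have "AE z in distr lborel borel (\<lambda>x. w + d *\<^sub>R x). P z"
    using d by (simp add: AE_density)
  then show ?thesis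
    using AE_distrD[of "\<lambda>x. w + d *\<^sub>R x" lborel borel P] by (simp add: scaleR_conv_of_real)
qed

lemma integral_affine_cball_le:
  fixes F :: "complex \<Rightarrow> real"
  assumes d: "d > 0" and F: "integrable (lborel_on (cball 0 S)) F" and nn: "\<And>z. F z \<ge> 0" and S: "norm w + d * R \<le> S"
  shows "integrable (lborel_on (cball 0 R)) (\<lambda>u. F (w + of_real d * u))"
    "(\<integral>u. F (w + of_real d * u) \<partial>lborel_on (cball 0 R)) \<le> (\<integral>z. F z \<partial>lborel_on (cball 0 S)) / d\<^sup>2"
proof -
  define H where "H = (\<lambda>z. indicator (cball 0 S) z *\<^sub>R F z)"
  have iH: "integrable lborel H" and eH: "(\<integral>z. H z \<partial>lborel) = (\<integral>z. F z \<partial>lborel_on (cball 0 S))"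
    using F by (simp_all add: H_def integrable_restrict_space integral_restrict_space)
  have mH[measurable]: "H \<in> borel_measurable borel" using borel_measurable_integrable[OF iH] by simp
  have dens: "(lborel :: complex measure) = density (distr lborel borel (\<lambda>x. w + d *\<^sub>R x)) (\<lambda>_. ennreal (d\<^sup>2))"
    using lborel_affine[of d w] d by (simp add: ennreal_power)
  have iH': "integrable (density (distr lborel borel (\<lambda>x. w + d *\<^sub>R x)) (\<lambda>_. ennreal (d\<^sup>2))) H"
    using iH by (simp only: flip: dens)
  have "integrable (distr lborel borel (\<lambda>x. w + d *\<^sub>R x)) (\<lambda>x. d\<^sup>2 *\<^sub>R H x)"
    using iH' by (subst (asm) integrable_density) auto
  then have i1: "integrable lborel (\<lambda>x. d\<^sup>2 *\<^sub>R H (w + d *\<^sub>R x))"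
    by (subst (asm) integrable_distr_eq) auto
  then have i2: "integrable lborel (\<lambda>u. H (w + of_real d * u))"
    using d by (simp add: scaleR_conv_of_real)
  have "(\<integral>z. H z \<partial>lborel) = (\<integral>z. H z \<partial>density (distr lborel borel (\<lambda>x. w + d *\<^sub>R x)) (\<lambda>_. ennreal (d\<^sup>2)))"
    by (simp only: flip: dens)
  also have "\<dots> = (\<integral>x. d\<^sup>2 *\<^sub>R H (w + d *\<^sub>R x) \<partial>lborel)"
    by (subst integral_density) (auto simp: integral_distr)
  finally have e2: "(\<integral>u. H (w + of_real d * u) \<partial>lborel) = (\<integral>z. F z \<partial>lborel_on (cball 0 S)) / d\<^sup>2"
    using d eH by (simp add: scaleR_conv_of_real field_simps)
  have in_S: "w + of_real d * u \<in> cball 0 S" if "u \<in> cball 0 R" for u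
  proof -
    have "norm (w + of_real d * u) \<le> norm w + d * norm u" using d norm_triangle_ineq[of w "of_real d * u"] by (simp add: norm_mult)
    also have "\<dots> \<le> norm w + d * R" using that d by simp
    finally show ?thesis using S by simp
  qed
  have FH: "indicator (cball 0 R) u *\<^sub>R F (w + of_real d * u) = indicator (cball 0 R) u *\<^sub>R H (w + of_real d * u)" for u
    using in_S[of u] by (simp add: H_def indicator_def)
  have i3: "integrable lborel (\<lambda>u. indicator (cball 0 R) u *\<^sub>R H (w + of_real d * u))"
    by (rule integrable_mult_indicator[OF _ i2]) simp
  then show "integrable (lborel_on (cball 0 R)) (\<lambda>u. F (w + of_real d * u))"
    by (subst integrable_restrict_space) (simp, simp only: FH)
  have "(\<integral>u. F (w + of_real d * u) \<partial>lborel_on (cball 0 R)) = (\<integral>u. indicator (cball 0 R) u *\<^sub>R H (w + of_real d * u) \<partial>lborel)"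
    by (subst integral_restrict_space) (simp, simp only: FH)
  also have "\<dots> \<le> (\<integral>u. H (w + of_real d * u) \<partial>lborel)"
    using nn by (intro integral_mono i3 i2) (auto simp: indicator_def H_def)
  finally show "(\<integral>u. F (w + of_real d * u) \<partial>lborel_on (cball 0 R)) \<le> (\<integral>z. F z \<partial>lborel_on (cball 0 S)) / d\<^sup>2"
    by (simp add: e2)
qed

lemma L2_tendsto_affine:
  assumes d: "d > 0" and L: "L2_tendsto (lborel_on (cball 0 (norm w + d * R))) U u"
  shows "L2_tendsto (lborel_on (cball 0 R)) (\<lambda>n v. c * U n (w + of_real d * v)) (\<lambda>v. c * u (w + of_real d * v))"
proof -
  let ?S = "norm w + d * R"
  have in_S: "w + of_real d * u \<in> cball 0 ?S" if "u \<in> cball 0 R" for u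
  proof -
    have "norm (w + of_real d * u) \<le> norm w + d * norm u" using d norm_triangle_ineq[of w "of_real d * u"] by (simp add: norm_mult)
    also have "\<dots> \<le> norm w + d * R" using that d by simp
    finally show ?thesis by simp
  qed
  have aff: "(\<lambda>v. w + of_real d * v) \<in> lborel_on (cball 0 R) \<rightarrow>\<^sub>M lborel_on (cball 0 ?S)"
    by (intro measurable_restrict_space3) (use in_S in auto)
  have sq: "sq_integrable (lborel_on (cball 0 R)) (\<lambda>v. h (w + of_real d * v))"
    and le: "(\<integral>v. (norm (h (w + of_real d * v)))\<^sup>2 \<partial>lborel_on (cball 0 R)) \<le> (\<integral>z. (norm (h z))\<^sup>2 \<partial>lborel_on (cball 0 ?S)) / d\<^sup>2"
    if "sq_integrable (lborel_on (cball 0 ?S)) h" for h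
  proof -
    have m: "h \<in> borel_measurable (lborel_on (cball 0 ?S))" and i: "integrable (lborel_on (cball 0 ?S)) (\<lambda>z. (norm (h z))\<^sup>2)"
      using that by (auto simp: sq_integrable_def)
    show "sq_integrable (lborel_on (cball 0 R)) (\<lambda>v. h (w + of_real d * v))"
      unfolding sq_integrable_def using measurable_compose[OF aff m] integral_affine_cball_le(1)[OF d i] by simp
    show "(\<integral>v. (norm (h (w + of_real d * v)))\<^sup>2 \<partial>lborel_on (cball 0 R)) \<le> (\<integral>z. (norm (h z))\<^sup>2 \<partial>lborel_on (cball 0 ?S)) / d\<^sup>2"
      by (rule integral_affine_cball_le(2)[OF d i]) simp_all
  qed
  have s: "sq_integrable (lborel_on (cball 0 ?S)) u" "\<And>n. sq_integrable (lborel_on (cball 0 ?S)) (U n)"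
    and lim: "(\<lambda>n. \<integral>z. (norm (U n z - u z))\<^sup>2 \<partial>lborel_on (cball 0 ?S)) \<longlonglongrightarrow> 0"
    using L by (auto simp: L2_tendsto_def)
  have "L2_tendsto (lborel_on (cball 0 R)) (\<lambda>n v. U n (w + of_real d * v)) (\<lambda>v. u (w + of_real d * v))"
    unfolding L2_tendsto_def
  proof (intro conjI allI sq s)
    have LIM: "(\<lambda>n. (\<integral>z. (norm (U n z - u z))\<^sup>2 \<partial>lborel_on (cball 0 ?S)) / d\<^sup>2) \<longlonglongrightarrow> 0"
      using tendsto_divide[OF lim tendsto_const[of "d\<^sup>2"]] d by simp
    show "(\<lambda>n. \<integral>v. (norm (U n (w + of_real d * v) - u (w + of_real d * v)))\<^sup>2 \<partial>lborel_on (cball 0 R)) \<longlonglongrightarrow> 0"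
      by (rule tendsto_sandwich[OF always_eventually always_eventually tendsto_const LIM])
        (use le[OF sq_integrable_diff[OF s(2) s(1)]] in auto)
  qed
  then show ?thesis by (rule L2_tendsto_bounded_mult[where C="norm c"]) auto
qed

lemma c1_on_affine:
  assumes G: "c1_on UNIV G Gx Gy"
  shows "c1_on UNIV (\<lambda>u. G (w + of_real d * u)) (\<lambda>u. of_real d * Gx (w + of_real d * u)) (\<lambda>u. of_real d * Gy (w + of_real d * u))"
  unfolding c1_on_def
proof (intro conjI ballI)
  fix u :: complex
  have 1: "((\<lambda>u. w + of_real d * u) has_derivative (\<lambda>h. of_real d * h)) (at u)" by (auto intro!: derivative_eq_intros)
  have 2: "(G has_derivative (\<lambda>h. of_real (Re h) * Gx (w + of_real d * u) + of_real (Im h) * Gy (w + of_real d * u))) (at (w + of_real d * u))"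
    by (rule c1_onD(1)[OF G]) simp
  show "((\<lambda>u. G (w + of_real d * u)) has_derivative (\<lambda>h. of_real (Re h) * (of_real d * Gx (w + of_real d * u)) + of_real (Im h) * (of_real d * Gy (w + of_real d * u)))) (at u)"
    using has_derivative_compose[OF 1 2] by (simp add: algebra_simps)
qed (auto intro!: continuous_intros continuous_on_compose2[OF c1_onD(2)[OF G]] continuous_on_compose2[OF c1_onD(3)[OF G]])

lemma smooth_approx_affine:
  assumes w: "weak_gradient f p q" and d: "d > 0"
  shows "smooth_approx (cball 0 R) (\<lambda>u. c * (f (w + of_real d * u) - f w))
    (\<lambda>u. c * of_real d * p (w + of_real d * u)) (\<lambda>u. c * of_real d * q (w + of_real d * u))"
proof -
  let ?e = "\<lambda>n. 1 / real (Suc n)" and ?S = "norm w + d * R"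
  have lp: "locally_sq_integrable p" and lq: "locally_sq_integrable q" and cf: "continuous_on UNIV f"
    using w by (auto simp: weak_gradient_def)
  have "c2_on UNIV (\<lambda>u. c * (mollify (?e n) f (w + of_real d * u) + (- f w)))
     (\<lambda>u. c * of_real d * mollify (?e n) p (w + of_real d * u)) (\<lambda>u. c * of_real d * mollify (?e n) q (w + of_real d * u))" for n
  proof -
    have "?e n > 0" by simp
    from weak_gradient_mollify[OF w this] obtain A B C where m: "c1_on UNIV (mollify (?e n) f) (mollify (?e n) p) (mollify (?e n) q)"
      "c1_on UNIV (mollify (?e n) p) A B" "c1_on UNIV (mollify (?e n) q) B C" unfolding c2_on_def by blast
    have 1: "c1_on UNIV (\<lambda>u. c * (mollify (?e n) f (w + of_real d * u) + (- f w)))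
     (\<lambda>u. c * of_real d * mollify (?e n) p (w + of_real d * u)) (\<lambda>u. c * of_real d * mollify (?e n) q (w + of_real d * u))"
      by (rule c1_on_cong[OF c1_on_cmult[OF c1_on_add[OF c1_on_affine[OF m(1), of w d] c1_on_const]]]) auto
    show ?thesis unfolding c2_on_def
      using 1 c1_on_cmult[OF c1_on_affine[OF m(2), of w d], of "c * of_real d"] c1_on_cmult[OF c1_on_affine[OF m(3), of w d], of "c * of_real d"] by blast
  qed
  moreover have "uniform_limit (cball 0 R) (\<lambda>n u. c * (mollify (?e n) f (w + of_real d * u) + (- f w))) (\<lambda>u. c * (f (w + of_real d * u) - f w)) sequentially"
  proof -
    have "uniform_limit (cball 0 R) (\<lambda>n u. mollify (?e n) f (w + of_real d * u)) (\<lambda>u. f (w + of_real d * u)) sequentially"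
    proof (rule uniform_limitI)
      fix r :: real assume "r > 0"
      from uniform_limitD[OF mollify_uniform_limit[OF cf] this, of ?S]
      show "\<forall>\<^sub>F n in sequentially. \<forall>u\<in>cball 0 R. dist (mollify (?e n) f (w + of_real d * u)) (f (w + of_real d * u)) < r"
      proof eventually_elim
        case (elim n)
        show ?case
        proof
          fix u :: complex assume u: "u \<in> cball 0 R"
          have "norm (w + of_real d * u) \<le> norm w + d * norm u" using d norm_triangle_ineq[of w "of_real d * u"] by (simp add: norm_mult)
          also have "\<dots> \<le> norm w + d * R" using u d by simp
          finally show "dist (mollify (?e n) f (w + of_real d * u)) (f (w + of_real d * u)) < r" using elim by simp
        qed
      qed
    qed
    then have "uniform_limit (cball 0 R) (\<lambda>n u. c * (mollify (?e n) f (w + of_real d * u) + (- f w))) (\<lambda>u. c * (f (w + of_real d * u) + (- f w))) sequentially"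
      by (intro bounded_linear.uniform_limit[OF bounded_linear_mult_right] uniform_limit_add uniform_limit_const)
    then show ?thesis by simp
  qed
  moreover have "L2_tendsto (lborel_on (cball 0 R)) (\<lambda>n u. c * of_real d * mollify (?e n) p (w + of_real d * u)) (\<lambda>u. c * of_real d * p (w + of_real d * u))"
    "L2_tendsto (lborel_on (cball 0 R)) (\<lambda>n u. c * of_real d * mollify (?e n) q (w + of_real d * u)) (\<lambda>u. c * of_real d * q (w + of_real d * u))"
    by (rule L2_tendsto_affine[OF d mollify_L2_tendsto[OF lp]], rule L2_tendsto_affine[OF d mollify_L2_tendsto[OF lq]])
  ultimately show ?thesis unfolding smooth_approx_def by (intro exI[of _ "\<lambda>_. UNIV"] exI conjI allI) auto
qed

section \<open>The Schwarzian derivative and the normalised map\<close>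

text \<open>With \<open>m = z / f\<close>, the identity \<open>f m = z\<close> is differentiated two and three times at the origin. The
  first four derivatives of \<open>f\<close> there become polynomials in those of \<open>m\<close>, and the Schwarzian derivative comes out as
  \<open>- 3\<close> times the second derivative of \<open>m\<close>, which is \<open>2 kk 0\<close>.\<close>

lemma Schwarzian_of_inverse:
  fixes f :: "complex \<Rightarrow> complex"
  assumes f: "f holomorphic_on ball 0 1" and f0: "f 0 = 0" "deriv f 0 = 1"
    and nz: "\<And>z. norm z < 1 \<Longrightarrow> z \<noteq> 0 \<Longrightarrow> f z \<noteq> 0"
  obtains c0 kk where "kk holomorphic_on ball 0 1"
    "\<And>z. 0 < norm z \<Longrightarrow> norm z < 1 \<Longrightarrow> inverse (f z) = 1 / z + c0 + z * kk z"
    "(deriv ^^ 3) f 0 - 3 / 2 * ((deriv ^^ 2) f 0)\<^sup>2 = - 6 * kk 0"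
proof -
  have B: "open (ball (0::complex) 1)" "(0::complex) \<in> ball 0 1" "(0::complex) \<in> interior (ball 0 1)" by auto
  have pole: "(\<lambda>z. if z = 0 then deriv h 0 else (h z - h 0) / (z - 0)) holomorphic_on ball 0 1" if "h holomorphic_on ball 0 1" for h :: "complex \<Rightarrow> complex"
    using pole_lemma[OF that B(3)] .
  define e where "e = (\<lambda>z. if z = 0 then deriv f 0 else (f z - f 0) / (z - 0))"
  have e: "e holomorphic_on ball 0 1" unfolding e_def by (rule pole[OF f])
  have enz: "\<And>z. z \<in> ball 0 1 \<Longrightarrow> e z \<noteq> 0" using nz f0 by (auto simp: e_def)
  define m where "m = (\<lambda>z. inverse (e z))"
  have m: "m holomorphic_on ball 0 1" unfolding m_def by (rule holomorphic_on_inverse[OF e enz])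
  have m0: "m 0 = 1" by (simp add: m_def e_def f0)
  define q where "q = (\<lambda>z. if z = 0 then deriv m 0 else (m z - m 0) / (z - 0))"
  have q: "q holomorphic_on ball 0 1" unfolding q_def by (rule pole[OF m])
  define kk where "kk = (\<lambda>z. if z = 0 then deriv q 0 else (q z - q 0) / (z - 0))"
  have kk: "kk holomorphic_on ball 0 1" unfolding kk_def by (rule pole[OF q])
  have qe: "m z = 1 + z * q z" for z by (simp add: q_def m0)
  have ke: "q z = q 0 + z * kk z" for z by (simp add: kk_def)
  have inv: "inverse (f z) = 1 / z + q 0 + z * kk z" if "0 < norm z" "norm z < 1" for z
  proof -
    have z: "z \<noteq> 0" using that by auto
    have "inverse (f z) = m z / z" using z by (simp add: m_def e_def f0 inverse_eq_divide)
    also have "\<dots> = 1 / z + q z" using z by (simp add: qe field_simps)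
    finally show ?thesis using ke[of z] by simp
  qed
  have fm: "f z * m z = z" if "z \<in> ball 0 1" for z
    using enz[OF that] nz[of z] that f0 by (auto simp: m_def e_def)
  have D: "(\<Sum>i = 0..n. of_nat (n choose i) * (deriv ^^ i) f 0 * (deriv ^^ (n - i)) m 0) = (deriv ^^ n) (\<lambda>z. z) 0" for n
    unfolding higher_deriv_mult[OF f m B(1,2), symmetric]
    by (rule higher_deriv_transform_within_open[OF _ _ B(1,2)]) (use f m fm in \<open>auto intro!: holomorphic_intros\<close>)
  have M: "(deriv ^^ n) m 0 = (deriv ^^ n) (\<lambda>z. 1 + z * q z) 0" for n
    by (rule higher_deriv_transform_within_open[OF _ _ B(1,2)]) (use m q qe in \<open>auto intro!: holomorphic_intros\<close>)
  have M2: "(deriv ^^ 2) m 0 = 2 * kk 0"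
  proof -
    have hq: "(\<lambda>z. z * q z) holomorphic_on ball 0 1" by (intro holomorphic_intros q)
    have "(deriv ^^ 2) m 0 = (deriv ^^ 2) (\<lambda>z. 1 + z * q z) 0" by (rule M)
    also have "\<dots> = (deriv ^^ 2) (\<lambda>z. 1) 0 + (deriv ^^ 2) (\<lambda>z. z * q z) 0"
      by (rule higher_deriv_add[OF _ hq B(1,2)]) simp
    also have "(deriv ^^ 2) (\<lambda>z. z * q z) 0 = (\<Sum>i = 0..2. of_nat (2 choose i) * (deriv ^^ i) (\<lambda>z. z) 0 * (deriv ^^ (2 - i)) q 0)"
      by (rule higher_deriv_mult[OF _ q B(1,2)]) (simp add: holomorphic_on_ident)
    also have "\<dots> = 2 * deriv q 0" by (simp add: numeral_2_eq_2)
    finally show ?thesis by (simp add: kk_def numeral_2_eq_2)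
  qed
  have s: "{0..2} = {0, 1, 2::nat}" "{0..3} = {0, 1, 2, 3::nat}" by auto
  have ch: "(3::nat) choose 2 = 3" "(3::nat) choose 1 = 3" "(2::nat) choose 1 = 2" by (simp_all add: numeral_eq_Suc)
  have d2: "2 * deriv m 0 + (deriv ^^ 2) f 0 = 0"
    using D[of 2] unfolding s by (simp add: f0 m0 ch numeral_2_eq_2)
  have d3: "3 * (deriv ^^ 2) m 0 + 3 * (deriv ^^ 2) f 0 * deriv m 0 + (deriv ^^ 3) f 0 = 0"
  proof -
    have "(deriv ^^ 3) (\<lambda>z::complex. z) 0 = 0" by (simp add: numeral_3_eq_3)
    moreover have "(\<Sum>i = 0..3. of_nat (3 choose i) * (deriv ^^ i) f 0 * (deriv ^^ (3 - i)) m 0)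
      = 3 * (deriv ^^ 2) m 0 + 3 * (deriv ^^ 2) f 0 * deriv m 0 + (deriv ^^ 3) f 0"
      unfolding s using ch by (simp add: f0 m0)
    ultimately show ?thesis using D[of 3] by simp
  qed
  have combine: "X - 3 / 2 * A\<^sup>2 = - 3 * Y" if "2 * a + A = 0" "3 * Y + 3 * A * a + X = 0" for a A X Y :: complex
  proof -
    have A: "A = - (2 * a)" using that(1) by (rule minus_unique[symmetric])
    have X: "X = - (3 * Y + 3 * A * a)" using that(2) by (rule minus_unique[symmetric])
    show ?thesis unfolding X unfolding A by (simp add: power2_eq_square algebra_simps)
  qed
  have "(deriv ^^ 3) f 0 - 3 / 2 * ((deriv ^^ 2) f 0)\<^sup>2 = - 6 * kk 0"
    unfolding combine[OF d2 d3] M2 by simp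
  from that[OF kk inv this] show ?thesis .
qed

text \<open>Chosen such that \<open>(1 + \<kappa>) / (1 - \<kappa>) \<cdot> \<alpha> / 2\<close> is the midpoint \<open>(2 + \<alpha>) / 4\<close> between
  \<open>\<alpha> / 2\<close> and 1.\<close>

definition small_dilatation :: "real \<Rightarrow> real"
  where "small_dilatation \<alpha> = (2 - \<alpha>) / (2 + 3 * \<alpha>)"

text \<open>The bound of \<open>weighted_energy\<close> for \<open>\<kappa> = small_dilatation \<alpha>\<close>.\<close>

definition energy_constant :: "real \<Rightarrow> real"
  where "energy_constant \<alpha> = 2 * ((2 + \<alpha>) / (2 * \<alpha>)) * ramp_energy / (1 - (2 + \<alpha>) / 4)"

definition schwarzian_constant :: "real \<Rightarrow> real"
  where "schwarzian_constant \<alpha> = 6 / coefficient_mass *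
    ((16 * ((2 + \<alpha>) / (2 * \<alpha>)) * energy_constant \<alpha> + 16) / small_dilatation \<alpha>
      + power_mass \<alpha> / (2 - \<alpha>) + energy_constant \<alpha> / (1 - (small_dilatation \<alpha>)\<^sup>2))"

lemma small_dilatation:
  assumes "0 < \<alpha>" "\<alpha> < 2"
  shows "0 < small_dilatation \<alpha>" "small_dilatation \<alpha> < 1"
    "(1 + small_dilatation \<alpha>) / (1 - small_dilatation \<alpha>) = (2 + \<alpha>) / (2 * \<alpha>)"
    "(small_dilatation \<alpha>)\<^sup>2 < 1"
proof -
  show s: "0 < small_dilatation \<alpha>" "small_dilatation \<alpha> < 1" using assms by (simp_all add: small_dilatation_def)
  have e: "1 + small_dilatation \<alpha> = (4 + 2 * \<alpha>) / (2 + 3 * \<alpha>)" "1 - small_dilatation \<alpha> = (4 * \<alpha>) / (2 + 3 * \<alpha>)"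
    using assms by (simp_all add: small_dilatation_def field_simps)
  show "(1 + small_dilatation \<alpha>) / (1 - small_dilatation \<alpha>) = (2 + \<alpha>) / (2 * \<alpha>)"
  proof -
    have "x / y / (z / y) = x / z" if "y \<noteq> 0" for x y z :: real using that by simp
    then have "(1 + small_dilatation \<alpha>) / (1 - small_dilatation \<alpha>) = (4 + 2 * \<alpha>) / (4 * \<alpha>)"
      unfolding e using assms by (metis add_pos_pos mult_pos_pos order_less_irrefl zero_less_numeral)
    also have "\<dots> = (2 + \<alpha>) / (2 * \<alpha>)" using assms by (simp add: field_simps)
    finally show ?thesis .
  qed
  show "(small_dilatation \<alpha>)\<^sup>2 < 1" using s by (simp add: power_less_one_iff abs_square_less_1)
qed

lemma energy_constant_nonneg:
  assumes "0 < \<alpha>" "\<alpha> < 2"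
  shows "energy_constant \<alpha> \<ge> 0"
  unfolding energy_constant_def using assms ramp_energy_nonneg by (intro divide_nonneg_nonneg mult_nonneg_nonneg) auto

lemma schwarzian_constant_pos:
  assumes "0 < \<alpha>" "\<alpha> < 2"
  shows "schwarzian_constant \<alpha> > 0"
proof -
  note s = small_dilatation[OF assms] and e = energy_constant_nonneg[OF assms]
  have "(16 * ((2 + \<alpha>) / (2 * \<alpha>)) * energy_constant \<alpha> + 16) / small_dilatation \<alpha> > 0"
    using assms s e by (intro divide_pos_pos add_nonneg_pos mult_nonneg_nonneg) auto
  moreover have "power_mass \<alpha> / (2 - \<alpha>) \<ge> 0" using assms power_mass_nonneg by simp
  moreover have "energy_constant \<alpha> / (1 - (small_dilatation \<alpha>)\<^sup>2) \<ge> 0" using e s by simp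
  ultimately show ?thesis unfolding schwarzian_constant_def using coefficient_mass_pos by (intro mult_pos_pos) auto
qed

text \<open>The strict positivity of \<open>M\<close> makes the radius \<open>T\<close> with \<open>L T^\<alpha> = \<kappa>\<close> available. If that
  radius is less than one, \<open>T = 1\<close> will do, since the dilatation vanishes in the unit disk.\<close>

lemma weak_gradient_schwarzian_bound:
  fixes f p q :: "complex \<Rightarrow> complex"
  assumes \<alpha>: "0 < \<alpha>" "\<alpha> < 2"
    and w: "weak_gradient f p q" and inj: "inj f" and inf: "filterlim f at_infinity at_infinity"
    and k: "0 \<le> k" "k < 1" "AE z in lborel. norm (p z + \<i> * q z) \<le> k * norm (p z - \<i> * q z)"
    and M: "0 < M" "AE z in lborel. norm (p z + \<i> * q z) \<le> M * max 0 (norm z - 1) powr \<alpha> * norm (p z - \<i> * q z)"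
    and \<zeta>: "norm \<zeta> < 1"
  shows "(1 - norm \<zeta>) powr (2 - \<alpha>) * norm (deriv (\<lambda>z. deriv (deriv f) z / deriv f z) \<zeta> - (deriv (deriv f) \<zeta> / deriv f \<zeta>)\<^sup>2 / 2)
    \<le> schwarzian_constant \<alpha> * M"
proof -
  have CR: "AE z in lborel. norm z < 1 \<longrightarrow> p z + \<i> * q z = 0"
    using M(2) by eventually_elim auto
  note hol = Weyl_holomorphic(1)[OF w CR] and grad = Weyl_holomorphic(2)[OF w CR]
  have B: "open (ball (0::complex) 1)" "\<zeta> \<in> ball 0 1" "(0::complex) \<in> ball 0 1" using \<zeta> by auto
  define f1 f2 f3 where "f1 = deriv f \<zeta>" and "f2 = deriv (deriv f) \<zeta>" and "f3 = deriv (deriv (deriv f)) \<zeta>"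
  have f1: "f1 \<noteq> 0" unfolding f1_def
    by (rule holomorphic_injective_imp_regular[OF hol B(1) inj_on_subset[OF inj subset_UNIV] B(2)])
  define d where "d = 1 - norm \<zeta>"
  have d: "d > 0" using \<zeta> by (simp add: d_def)
  define c where "c = 1 / (of_real d * f1)"
  have c: "c \<noteq> 0" "c * of_real d * f1 = 1" using d f1 by (simp_all add: c_def)
  define F where "F = (\<lambda>u. c * (f (\<zeta> + of_real d * u) - f \<zeta>))"
  define P Q where "P = (\<lambda>u. c * of_real d * p (\<zeta> + of_real d * u))" and "Q = (\<lambda>u. c * of_real d * q (\<zeta> + of_real d * u))"
  have nd: "norm (\<zeta> + of_real d * u) \<le> norm \<zeta> + d * norm u" for u
    using norm_triangle_ineq[of \<zeta> "of_real d * u"] d by (simp add: norm_mult)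
  have in1: "norm (\<zeta> + of_real d * u) < 1" if "norm u < 1" for u
  proof -
    have "d * norm u < d * 1" using that d by (intro mult_strict_left_mono) auto
    then show ?thesis using nd[of u] by (simp add: d_def)
  qed
  define h where "h = (\<lambda>u. f (of_real d * u + \<zeta>))"
  have h: "h holomorphic_on ball 0 1"
  proof -
    have "(f \<circ> (\<lambda>u. of_real d * u + \<zeta>)) holomorphic_on ball 0 1"
      by (rule holomorphic_on_compose_gen[OF _ hol]) (use in1 in \<open>auto intro!: holomorphic_intros simp: add.commute\<close>)
    then show ?thesis by (simp add: h_def o_def)
  qed
  have Fh: "F = (\<lambda>u. c * (h u - f \<zeta>))" by (simp add: F_def h_def add.commute)
  have Fhol: "F holomorphic_on ball 0 1" unfolding Fh by (intro holomorphic_intros h)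
  have Fder: "(deriv ^^ n) F 0 = c * (of_real d ^ n * (deriv ^^ n) f \<zeta>)" if "n > 0" for n
  proof -
    have "(deriv ^^ n) F 0 = c * (deriv ^^ n) (\<lambda>u. h u - f \<zeta>) 0"
      unfolding Fh by (rule higher_deriv_cmult[OF _ B(3,1)]) (intro holomorphic_intros h)
    also have "(deriv ^^ n) (\<lambda>u. h u - f \<zeta>) 0 = (deriv ^^ n) h 0 - (deriv ^^ n) (\<lambda>u. f \<zeta>) 0"
      by (rule higher_deriv_diff[OF h _ B(1,3)]) simp
    also have "(deriv ^^ n) (\<lambda>u. f \<zeta>) (0::complex) = 0" using that by (simp add: higher_deriv_const)
    also have "(deriv ^^ n) h 0 = of_real d ^ n * (deriv ^^ n) f (of_real d * 0 + \<zeta>)"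
      unfolding h_def by (rule higher_deriv_compose_linear'[OF hol B(1) B(1) B(3)]) (use in1 in \<open>simp add: add.commute\<close>)
    finally show ?thesis by simp
  qed
  have F0: "F 0 = 0" by (simp add: F_def)
  have F1: "deriv F 0 = 1" using Fder[of 1] c(2) by (simp add: f1_def mult.assoc)
  have Fnz: "F u \<noteq> 0" if "u \<noteq> 0" for u
  proof
    assume "F u = 0"
    then have "f (\<zeta> + of_real d * u) = f \<zeta>" using c by (simp add: F_def)
    then have "\<zeta> + of_real d * u = \<zeta>" by (rule injD[OF inj])
    then show False using d that by simp
  qed
  have Fnz': "\<And>z. norm z < 1 \<Longrightarrow> z \<noteq> 0 \<Longrightarrow> F z \<noteq> 0" using Fnz by blast
  obtain c0 kk where kk: "kk holomorphic_on ball 0 1"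
    and Finv: "\<And>z. 0 < norm z \<Longrightarrow> norm z < 1 \<Longrightarrow> inverse (F z) = 1 / z + c0 + z * kk z"
    and FS: "(deriv ^^ 3) F 0 - 3 / 2 * ((deriv ^^ 2) F 0)\<^sup>2 = - 6 * kk 0"
    by (rule Schwarzian_of_inverse[OF Fhol F0 F1 Fnz'], assumption, assumption, rule that)
  define S where "S = deriv (\<lambda>z. deriv (deriv f) z / deriv f z) \<zeta> - (deriv (deriv f) \<zeta> / deriv f \<zeta>)\<^sup>2 / 2"
  \<comment> \<open>the Schwarzian derivative is invariant under postcomposition with affine maps and scales with \<open>d^2\<close>\<close>
  have dS: "- 6 * kk 0 = of_real (d\<^sup>2) * S"
  proof -
    have hol1: "deriv f holomorphic_on ball 0 1" by (rule holomorphic_deriv[OF hol B(1)])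
    have hol2: "deriv (deriv f) holomorphic_on ball 0 1" by (rule holomorphic_deriv[OF hol1 B(1)])
    have "deriv (\<lambda>z. deriv (deriv f) z / deriv f z) \<zeta> = (f3 * f1 - f2 * f2) / (f1 * f1)"
      unfolding f1_def f2_def f3_def
      by (rule DERIV_imp_deriv, rule DERIV_divide[OF holomorphic_derivI[OF hol2 B(1,2)] holomorphic_derivI[OF hol1 B(1,2)]])
        (use f1 in \<open>simp add: f1_def\<close>)
    then have 1: "S = (f3 * f1 - f2 * f2) / (f1 * f1) - (f2 / f1)\<^sup>2 / 2" by (simp add: S_def f1_def f2_def)
    have 2: "(deriv ^^ 3) F 0 = of_real (d\<^sup>2) * (f3 / f1)"
      using Fder[of 3] d f1 by (simp add: c_def f3_def numeral_3_eq_3 power2_eq_square field_simps)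
    have 3: "(deriv ^^ 2) F 0 = of_real d * (f2 / f1)"
      using Fder[of 2] d f1 by (simp add: c_def f2_def numeral_2_eq_2 field_simps)
    show ?thesis unfolding FS[symmetric] 1 2 3 using f1 by (simp add: power2_eq_square field_simps)
  qed
  define g gx gy where "g = (\<lambda>u. inverse (F u))" and "gx = (\<lambda>u. - P u / (F u)\<^sup>2)" and "gy = (\<lambda>u. - Q u / (F u)\<^sup>2)"
  define m where "m = (\<lambda>u. norm (c * of_real d) / norm ((F u)\<^sup>2))"
  have m0: "m u \<ge> 0" for u by (simp add: m_def)
  have gplus: "norm (gx u + \<i> * gy u) = m u * norm (p (\<zeta> + of_real d * u) + \<i> * q (\<zeta> + of_real d * u))" for u
  proof -
    have "gx u + \<i> * gy u = - (c * of_real d / (F u)\<^sup>2 * (p (\<zeta> + of_real d * u) + \<i> * q (\<zeta> + of_real d * u)))"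
      by (simp add: gx_def gy_def P_def Q_def add_divide_distrib algebra_simps)
    then show ?thesis unfolding m_def by (simp only: norm_minus_cancel norm_mult norm_divide)
  qed
  have gminus: "norm (gx u - \<i> * gy u) = m u * norm (p (\<zeta> + of_real d * u) - \<i> * q (\<zeta> + of_real d * u))" for u
  proof -
    have "gx u - \<i> * gy u = - (c * of_real d / (F u)\<^sup>2 * (p (\<zeta> + of_real d * u) - \<i> * q (\<zeta> + of_real d * u)))"
      by (simp add: gx_def gy_def P_def Q_def diff_divide_distrib algebra_simps)
    then show ?thesis unfolding m_def by (simp only: norm_minus_cancel norm_mult norm_divide)
  qed
  have scale: "norm (gx u + \<i> * gy u) \<le> b * norm (gx u - \<i> * gy u)"
    if "norm (p (\<zeta> + of_real d * u) + \<i> * q (\<zeta> + of_real d * u)) \<le> b * norm (p (\<zeta> + of_real d * u) - \<i> * q (\<zeta> + of_real d * u))" for u b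
    unfolding gplus gminus using mult_left_mono[OF that m0[of u]] by (simp only: mult.left_commute)
  define \<kappa> where "\<kappa> = small_dilatation \<alpha>"
  note sd = small_dilatation[OF \<alpha>, folded \<kappa>_def]
  define L where "L = M * d powr \<alpha>"
  have L: "L > 0" using M(1) d by (simp add: L_def)
  \<comment> \<open>the radius at which the bound \<open>L |u|^\<alpha>\<close> for the dilatation reaches \<open>\<kappa>\<close>\<close>
  define T where "T = max 1 ((\<kappa> / L) powr (1 / \<alpha>))"
  have T1: "T \<ge> 1" by (simp add: T_def)
  have TL: "T powr (- \<alpha>) \<le> L / \<kappa>"
  proof -
    have "T powr (- \<alpha>) \<le> ((\<kappa> / L) powr (1 / \<alpha>)) powr (- \<alpha>)"
      using sd L \<alpha> by (intro powr_mono2') (auto simp: T_def)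
    also have "\<dots> = (\<kappa> / L) powr (- 1)" using \<alpha> by (simp add: powr_powr)
    also have "\<dots> = L / \<kappa>" using sd L by (simp add: powr_minus)
    finally show ?thesis .
  qed
  have inner: "AE u in lborel. norm u < 1 \<longrightarrow> P u = c * of_real d * deriv f (\<zeta> + of_real d * u) \<and> Q u = \<i> * (c * of_real d * deriv f (\<zeta> + of_real d * u))"
    using AE_lborel_affine[OF d grad, of \<zeta>] by eventually_elim (use in1 in \<open>auto simp: P_def Q_def\<close>)
  have Lp: "AE u in lborel. norm (gx u + \<i> * gy u) \<le> M * max 0 (norm (\<zeta> + of_real d * u) - 1) powr \<alpha> * norm (gx u - \<i> * gy u)"
    using AE_lborel_affine[OF d M(2), of \<zeta>] by eventually_elim (rule scale)
  have deriv_inv: "- (c * of_real d * deriv f (\<zeta> + of_real d * u)) / (F u)\<^sup>2 = - 1 / u\<^sup>2 + (kk u + u * deriv kk u)"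
    if u: "u \<noteq> 0" "norm u < 1" for u
  proof (rule DERIV_unique)
    have fd: "(f has_field_derivative deriv f (\<zeta> + of_real d * u)) (at (\<zeta> + of_real d * u))"
      by (rule holomorphic_derivI[OF hol B(1)]) (use in1[OF u(2)] in simp)
    have ad: "((\<lambda>u. \<zeta> + of_real d * u) has_field_derivative of_real d) (at u)" by (auto intro!: derivative_eq_intros)
    have Fd: "(F has_field_derivative c * of_real d * deriv f (\<zeta> + of_real d * u)) (at u)"
      unfolding F_def by (rule DERIV_cong[OF DERIV_cmult[OF DERIV_diff[OF DERIV_chain2[OF fd ad] DERIV_const]]]) simp
    show "((\<lambda>u. inverse (F u)) has_field_derivative - (c * of_real d * deriv f (\<zeta> + of_real d * u)) / (F u)\<^sup>2) (at u)"
      by (rule DERIV_cong[OF DERIV_inverse_fun[OF Fd Fnz[OF u(1)]]]) (simp add: power2_eq_square divide_inverse)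
    have kd: "(kk has_field_derivative deriv kk u) (at u)" by (rule holomorphic_derivI[OF kk B(1)]) (use u in simp)
    have rd: "((\<lambda>u. 1 / u + c0 + u * kk u) has_field_derivative - 1 / u\<^sup>2 + (kk u + u * deriv kk u)) (at u)"
      using u by (auto intro!: derivative_eq_intros kd simp: power2_eq_square)
    have o: "open (ball 0 1 - {0::complex})" by (intro open_Diff) auto
    show "((\<lambda>u. inverse (F u)) has_field_derivative - 1 / u\<^sup>2 + (kk u + u * deriv kk u)) (at u)"
      by (rule has_field_derivative_transform_within_open[OF rd o]) (use u Finv in auto)
  qed
  have approx: "smooth_approx (annulus a b) g gx gy" if a: "0 < a" for a b
  proof -
    have 1: "smooth_approx (cball 0 b) F P Q" unfolding F_def P_def Q_def by (rule smooth_approx_affine[OF w d])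
    have 2: "annulus a b \<subseteq> cball 0 b" by auto
    have 3: "smooth_approx (annulus a b) F P Q"
      by (rule smooth_approx_subset[OF 1 closed_cball 2 compact_imp_closed[OF compact_annulus]])
    have 4: "F z \<noteq> 0" if "z \<in> annulus a b" for z
    proof (rule Fnz)
      show "z \<noteq> 0" using that a by auto
    qed
    show ?thesis unfolding g_def gx_def gy_def
      by (rule smooth_approx_inverse[OF 3 compact_annulus]) (erule 4)
  qed
  have decay: "(g \<longlongrightarrow> 0) at_infinity"
  proof -
    have dn: "complex_of_real d \<noteq> 0" using d by simp
    have fl: "filterlim (\<lambda>u. of_real d * u) at_infinity (at_infinity :: complex filter)"
      by (rule tendsto_mult_filterlim_at_infinity[OF tendsto_const dn filterlim_ident])
    have fl2: "filterlim (\<lambda>u. \<zeta> + of_real d * u) at_infinity at_infinity"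
      by (rule tendsto_add_filterlim_at_infinity[OF tendsto_const fl])
    have fl3: "filterlim (\<lambda>u. - f \<zeta> + f (\<zeta> + of_real d * u)) at_infinity at_infinity"
      by (rule tendsto_add_filterlim_at_infinity[OF tendsto_const filterlim_compose[OF inf fl2]])
    have "filterlim (\<lambda>u. c * (- f \<zeta> + f (\<zeta> + of_real d * u))) at_infinity at_infinity"
      by (rule tendsto_mult_filterlim_at_infinity[OF tendsto_const c(1) fl3])
    then have "filterlim F at_infinity at_infinity" by (simp add: F_def)
    from filterlim_compose[OF tendsto_inverse_0 this] show ?thesis by (simp add: g_def)
  qed
  interpret exterior_qc g gx gy kk c0 k \<kappa> L T \<alpha>
  proof
    show "smooth_approx (annulus a b) g gx gy" if "0 < a" for a b by (rule approx[OF that])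
    show "(g \<longlongrightarrow> 0) at_infinity" by (rule decay)
    show "kk holomorphic_on ball 0 1" by (rule kk)
    show "g z = 1 / z + c0 + z * kk z" if "0 < norm z" "norm z < 1" for z
      unfolding g_def by (rule Finv[OF that])
    show "AE z in lborel. norm z < 1 \<longrightarrow> gx z = - 1 / z\<^sup>2 + (kk z + z * deriv kk z)"
      using inner AE_lborel_singleton[of 0]
    proof eventually_elim
      case (elim z)
      then show ?case using deriv_inv[of z] by (auto simp: gx_def)
    qed
    show "AE z in lborel. norm z < 1 \<longrightarrow> gy z = \<i> * (- 1 / z\<^sup>2 + (kk z + z * deriv kk z))"
      using inner AE_lborel_singleton[of 0]
    proof eventually_elim
      case (elim z)
      show ?case
      proof
        assume z: "norm z < 1"
        have "gy z = \<i> * (- (c * of_real d * deriv f (\<zeta> + of_real d * z)) / (F z)\<^sup>2)"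
          using elim z by (simp add: gy_def)
        then show "gy z = \<i> * (- 1 / z\<^sup>2 + (kk z + z * deriv kk z))" unfolding deriv_inv[OF elim(2) z] .
      qed
    qed
    show "0 \<le> k" "k < 1" "0 \<le> \<kappa>" "\<kappa> < 1" "0 \<le> L" "1 \<le> T" using k sd L T1 by auto
    show "AE z in lborel. norm (gx z + \<i> * gy z) \<le> k * norm (gx z - \<i> * gy z)"
      using AE_lborel_affine[OF d k(3), of \<zeta>] by eventually_elim (rule scale)
    show "AE z in lborel. norm z < T \<longrightarrow> norm (gx z + \<i> * gy z) \<le> \<kappa> * norm (gx z - \<i> * gy z)"
      using Lp
    proof eventually_elim
      case (elim z)
      show ?case
      proof
        assume zT: "norm z < T"
        have "M * max 0 (norm (\<zeta> + of_real d * z) - 1) powr \<alpha> \<le> \<kappa>"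
        proof (cases "norm z < 1")
          case True then show ?thesis using in1[OF True] sd by simp
        next
          case False
          have "max 0 (norm (\<zeta> + of_real d * z) - 1) \<le> d * norm z" using nd[of z] d \<zeta> by simp
          then have "M * max 0 (norm (\<zeta> + of_real d * z) - 1) powr \<alpha> \<le> M * (d * norm z) powr \<alpha>"
            using M(1) \<alpha> by (intro mult_left_mono powr_mono2) auto
          also have "\<dots> = L * norm z powr \<alpha>" using d by (simp add: L_def powr_mult)
          also have "\<dots> \<le> L * ((\<kappa> / L) powr (1 / \<alpha>)) powr \<alpha>"
            using False zT L \<alpha> by (intro mult_left_mono powr_mono2) (auto simp: T_def)
          also have "\<dots> = \<kappa>" using \<alpha> L sd by (simp add: powr_powr)
          finally show ?thesis .
        qed
        then show "norm (gx z + \<i> * gy z) \<le> \<kappa> * norm (gx z - \<i> * gy z)"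
          using elim mult_right_mono[OF _ norm_ge_zero] by (meson order_trans)
      qed
    qed
    show "AE z in lborel. norm (gx z + \<i> * gy z) \<le> L * norm z powr \<alpha> * norm (gx z - \<i> * gy z)"
      using Lp
    proof eventually_elim
      case (elim z)
      have "max 0 (norm (\<zeta> + of_real d * z) - 1) \<le> d * norm z" using nd[of z] d \<zeta> by simp
      then have "M * max 0 (norm (\<zeta> + of_real d * z) - 1) powr \<alpha> \<le> M * (d * norm z) powr \<alpha>"
        using M(1) \<alpha> by (intro mult_left_mono powr_mono2) auto
      also have "\<dots> = L * norm z powr \<alpha>" using d by (simp add: L_def powr_mult)
      finally show ?case using elim mult_right_mono[OF _ norm_ge_zero] by (meson order_trans)
    qed
  qed
  let ?K = "(2 + \<alpha>) / (2 * \<alpha>)" and ?C = "energy_constant \<alpha>"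
  let ?D = "(16 * ?K * ?C + 16) / \<kappa> + power_mass \<alpha> / (2 - \<alpha>) + ?C / (1 - \<kappa>\<^sup>2)"
  have th: "(1 + \<kappa>) / (1 - \<kappa>) * (\<alpha> / 2) = (2 + \<alpha>) / 4" "(2 + \<alpha>) / 4 < 1"
    using \<alpha> unfolding sd(3) by (simp_all add: field_simps)
  have Ceq: "?C = 2 * ((1 + \<kappa>) / (1 - \<kappa>)) * ramp_energy / (1 - (2 + \<alpha>) / 4)"
    unfolding sd(3) energy_constant_def ..
  have "norm (kk 0) * coefficient_mass \<le> (16 * ?K * ?C + 16) * T powr (- \<alpha>) + L * (power_mass \<alpha> / (2 - \<alpha>) + ?C / (1 - \<kappa>\<^sup>2))"
    using coefficient_bound[OF \<alpha> th Ceq] unfolding sd(3) .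
  also have "\<dots> \<le> (16 * ?K * ?C + 16) * (L / \<kappa>) + L * (power_mass \<alpha> / (2 - \<alpha>) + ?C / (1 - \<kappa>\<^sup>2))"
    using TL energy_constant_nonneg[OF \<alpha>] \<alpha> by (intro add_right_mono mult_left_mono add_nonneg_nonneg mult_nonneg_nonneg) auto
  also have "\<dots> = L * ?D"
  proof -
    have "X * (L / \<kappa>) + L * (a + b) = L * (X / \<kappa> + a + b)" for X a b by (simp add: distrib_left)
    then show ?thesis .
  qed
  finally have kk0: "norm (kk 0) \<le> L * ?D / coefficient_mass" using coefficient_mass_pos by (simp add: pos_le_divide_eq)
  have "d\<^sup>2 * norm S = 6 * norm (kk 0)"
    using arg_cong[OF dS, of norm] d by (simp add: norm_mult norm_power)
  also have "\<dots> \<le> 6 * (L * ?D / coefficient_mass)" using kk0 by simp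
  also have "\<dots> = schwarzian_constant \<alpha> * M * d powr \<alpha>"
    by (simp add: schwarzian_constant_def \<kappa>_def L_def)
  finally have "d powr (- \<alpha>) * (d\<^sup>2 * norm S) \<le> d powr (- \<alpha>) * (schwarzian_constant \<alpha> * M * d powr \<alpha>)"
    by (rule mult_left_mono) simp
  moreover have "d powr (- \<alpha>) * d\<^sup>2 = d powr (2 - \<alpha>)" using d powr_add[of d "- \<alpha>" 2] by (simp add: powr_numeral)
  moreover have "d powr (- \<alpha>) * d powr \<alpha> = 1" using d by (simp flip: powr_add)
  ultimately have "d powr (2 - \<alpha>) * norm S \<le> schwarzian_constant \<alpha> * M"
    by (simp add: mult.assoc[symmetric]) (simp add: mult.commute mult.left_commute)
  then show ?thesis unfolding S_def d_def .
qed

section \<open>From the Riemann sphere to the plane\<close>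

text \<open>Neighbourhoods of infinity in the Alexandroff compactification are the complements of compact sets.\<close>

lemma homeomorphism_fixing_infinity:
  assumes F: "homeomorphic_map riemann_sphere riemann_sphere F" and "F None = None"
  shows "finite_domain F = UNIV" "inj (finite_part F)" "continuous_on UNIV (finite_part F)"
    "filterlim (finite_part F) at_infinity at_infinity"
proof -
  have top: "topspace riemann_sphere = UNIV"
    by (simp add: riemann_sphere_def UNIV_option_conv)
  have inj: "inj F" using homeomorphic_imp_injective_map[OF F] by (simp add: top)
  have fin: "F (Some z) \<noteq> None" for z
  proof
    assume "F (Some z) = None"
    then have "F (Some z) = F None" using assms(2) by simp
    then show False using injD[OF inj] by blast
  qed
  show "finite_domain F = UNIV" using fin by (simp add: finite_domain_def)
  have Fs: "F (Some z) = Some (finite_part F z)" for z using fin[of z] by (simp add: finite_part_def)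
  show "inj (finite_part F)"
  proof (rule injI)
    fix x y assume "finite_part F x = finite_part F y"
    then have "F (Some x) = F (Some y)" by (simp add: Fs)
    then have "Some x = Some y" by (rule injD[OF inj])
    then show "x = y" by simp
  qed
  have pre: "openin riemann_sphere {x. F x \<in> V}" if "openin riemann_sphere V" for V
    using openin_continuous_map_preimage[OF homeomorphic_imp_continuous_map[OF F] that] by (simp add: top)
  show "continuous_on UNIV (finite_part F)"
  proof (rule continuous_on_open_vimage[THEN iffD2, OF open_UNIV], intro allI impI)
    fix U :: "complex set" assume "open U"
    then have "openin riemann_sphere (Some ` U)" by (simp add: riemann_sphere_def)
    from pre[OF this] have "openin riemann_sphere {x. F x \<in> Some ` U}" .
    moreover have "{x. F x \<in> Some ` U} = Some ` (finite_part F -` U)"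
    proof (rule set_eqI)
      fix x show "x \<in> {x. F x \<in> Some ` U} \<longleftrightarrow> x \<in> Some ` (finite_part F -` U)"
        by (cases x) (auto simp: Fs assms(2))
    qed
    ultimately show "open (finite_part F -` U \<inter> UNIV)" by (simp add: riemann_sphere_def)
  qed
  show "filterlim (finite_part F) at_infinity at_infinity"
  proof (subst filterlim_at_infinity[OF order_refl], intro allI impI)
    fix r :: real assume "r > 0"
    let ?V = "insert None (Some ` (UNIV - cball 0 r)) :: complex option set"
    have "openin riemann_sphere ?V"
      unfolding riemann_sphere_def openin_Alexandroff_compactification by (intro disjI2 exI[of _ "cball 0 r"]) simp
    from pre[OF this] have "openin riemann_sphere {x. F x \<in> ?V}" .
    moreover have "None \<in> {x. F x \<in> ?V}" using assms(2) by simp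
    ultimately obtain C where C: "compact C" "{x. F x \<in> ?V} = insert None (Some ` (UNIV - C))"
      unfolding riemann_sphere_def openin_Alexandroff_compactification by auto
    obtain b where b: "\<And>z. z \<in> C \<Longrightarrow> norm z \<le> b" using compact_imp_bounded[OF C(1)] by (auto simp: bounded_iff)
    show "eventually (\<lambda>z. r \<le> norm (finite_part F z)) at_infinity"
      unfolding eventually_at_infinity
    proof (intro exI[of _ "b + 1"] allI impI)
      fix z :: complex assume "b + 1 \<le> norm z"
      then have "z \<notin> C" using b[of z] by auto
      then have "Some z \<in> {x. F x \<in> ?V}" unfolding C(2) by simp
      then show "r \<le> norm (finite_part F z)" by (auto simp: Fs)
    qed
  qed
qed

text \<open>Every function measurable for the completed Lebesgue measure agrees almost everywhere with a Borel function.\<close>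

lemma borel_representative:
  assumes "locally_square_integrable UNIV p"
  obtains p' where "locally_sq_integrable p'" "AE z in lborel. p z = p' z"
proof -
  have m: "p \<in> borel_measurable lebesgue" and i: "\<And>K. compact K \<Longrightarrow> integrable (lebesgue_on K) (\<lambda>z. (norm (p z))\<^sup>2)"
    using assms by (auto simp: locally_square_integrable_def lebesgue_on_UNIV_eq)
  have mr: "(\<lambda>z. Re (p z)) \<in> borel_measurable lebesgue" "(\<lambda>z. Im (p z)) \<in> borel_measurable lebesgue"
    using m by (auto intro: measurable_compose[OF _ borel_measurable_Re] measurable_compose[OF _ borel_measurable_Im])
  obtain a where a: "a \<in> borel_measurable lborel" "AE z in lborel. Re (p z) = a z"
    using completion_ex_borel_measurable_real[OF mr(1)] by blast
  obtain b where b: "b \<in> borel_measurable lborel" "AE z in lborel. Im (p z) = b z"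
    using completion_ex_borel_measurable_real[OF mr(2)] by blast
  define p' where "p' = (\<lambda>z. Complex (a z) (b z))"
  have ae: "AE z in lborel. p z = p' z"
    using a(2) b(2) by eventually_elim (simp add: p'_def complex_eq_iff)
  have mp[measurable]: "p' \<in> borel_measurable borel"
    unfolding p'_def using a(1) b(1) by (simp add: borel_measurable_complex_iff)
  have sq: "sq_integrable (lborel_on (cball 0 R)) p'" for R
  proof -
    have "integrable lebesgue (\<lambda>z. indicator (cball 0 R) z *\<^sub>R (norm (p z))\<^sup>2)"
      using i[of "cball 0 R"] by (simp add: integrable_restrict_space)
    moreover have "AE z in lebesgue. indicator (cball 0 R) z *\<^sub>R (norm (p z))\<^sup>2 = indicator (cball 0 R) z *\<^sub>R (norm (p' z))\<^sup>2"
      unfolding AE_completion_iff using ae by eventually_elim simp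
    moreover have mI: "(\<lambda>z. indicator (cball 0 R) z *\<^sub>R (norm (p' z))\<^sup>2) \<in> borel_measurable lborel"
      by (intro borel_measurable_scaleR borel_measurable_indicator borel_measurable_power borel_measurable_norm) (use mp in simp_all)
    ultimately have "integrable lebesgue (\<lambda>z. indicator (cball 0 R) z *\<^sub>R (norm (p' z))\<^sup>2)"
      using integrable_cong_AE_imp measurable_completion by blast
    then have "integrable lborel (\<lambda>z. indicator (cball 0 R) z *\<^sub>R (norm (p' z))\<^sup>2)"
      by (subst (asm) integrable_completion[OF mI])
    then have "integrable (lborel_on (cball 0 R)) (\<lambda>z. (norm (p' z))\<^sup>2)" by (simp add: integrable_restrict_space)
    moreover have "p' \<in> borel_measurable (lborel_on (cball 0 R))" using mp by (simp add: measurable_restrict_space1)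
    ultimately show ?thesis by (simp add: sq_integrable_def)
  qed
  show ?thesis by (rule that[OF _ ae]) (simp add: locally_sq_integrable_def mp sq)
qed

lemma mollifier_test_function:
  fixes z v :: complex
  assumes "e > 0"
  defines "\<phi> \<equiv> \<lambda>v. Re (mollifier e (z - v))"
  shows "\<phi> \<in> test_functions UNIV"
    "frechet_derivative \<phi> (at v) 1 = - Re (mollifier_x e (z - v))" "frechet_derivative \<phi> (at v) \<i> = - Re (mollifier_y e (z - v))"
proof -
  have D: "(\<phi> has_derivative (\<lambda>h. - (Re h * Re (mollifier_x e (z - v)) + Im h * Re (mollifier_y e (z - v))))) (at v)" for v
  proof -
    have 1: "((\<lambda>v. z - v) has_derivative (\<lambda>h. - h)) (at v)" by (auto intro!: derivative_eq_intros)
    have 2: "(mollifier e has_derivative (\<lambda>h. of_real (Re h) * mollifier_x e (z - v) + of_real (Im h) * mollifier_y e (z - v))) (at (z - v))"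
      by (rule c1_onD(1)[OF c1_mollifier]) simp
    show ?thesis
      using bounded_linear.has_derivative[OF bounded_linear_Re has_derivative_compose[OF 1 2]] by (simp add: \<phi>_def algebra_simps)
  qed
  have fd: "frechet_derivative \<phi> (at v) = (\<lambda>h. - (Re h * Re (mollifier_x e (z - v)) + Im h * Re (mollifier_y e (z - v))))" for v
    by (rule frechet_derivative_at[OF D, symmetric])
  show "frechet_derivative \<phi> (at v) 1 = - Re (mollifier_x e (z - v))" "frechet_derivative \<phi> (at v) \<i> = - Re (mollifier_y e (z - v))"
    by (simp_all add: fd)
  have c: "continuous_on UNIV (\<lambda>v. mollifier_x e (z - v))" "continuous_on UNIV (\<lambda>v. mollifier_y e (z - v))"
    by (auto intro!: continuous_on_compose2[OF c1_onD(2)[OF c1_mollifier]] continuous_on_compose2[OF c1_onD(3)[OF c1_mollifier]] continuous_intros)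
  have sub: "{v. \<phi> v \<noteq> 0} \<subseteq> cball z e"
  proof
    fix v assume "v \<in> {v. \<phi> v \<noteq> 0}"
    then have "mollifier e (z - v) \<noteq> 0" by (auto simp: \<phi>_def)
    then have "norm (z - v) < e" using mollifier_eq_0[of e "z - v"] assms(1) by fastforce
    then show "v \<in> cball z e" by (simp add: dist_norm)
  qed
  have "compact (closure {v. \<phi> v \<noteq> 0})"
    using bounded_subset[OF bounded_cball sub] by simp
  moreover have "continuous_on UNIV (\<lambda>v. frechet_derivative \<phi> (at v) h)" for h
    unfolding fd by (intro continuous_intros c)
  ultimately show "\<phi> \<in> test_functions UNIV"
    using D by (auto simp: test_functions_def differentiable_def)
qed

text \<open>The test function is the mollifier as a function of the second argument of the convolution; this accounts for the
  sign.\<close>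

lemma weak_derivative_convolve:
  assumes w: "weak_derivative UNIV h f p" and m: "p \<in> borel_measurable lebesgue" and f: "continuous_on UNIV f"
    and p': "p' \<in> borel_measurable borel" "AE z in lborel. p z = p' z" and e: "e > 0"
    and k: "\<And>v. frechet_derivative (\<lambda>v. Re (mollifier e (z - v))) (at v) h = - Re (k (z - v))" "\<And>v. of_real (Re (k v)) = k v"
    and ck: "continuous_on UNIV k"
  shows "convolve k f z = mollify e p' z"
proof -
  have "(LINT v|lebesgue. - Re (k (z - v)) *\<^sub>R f v) = - (LINT v|lebesgue. Re (mollifier e (z - v)) *\<^sub>R p v)"
    using w mollifier_test_function(1)[OF e, of z] unfolding weak_derivative_def k(1)[symmetric] lebesgue_on_UNIV_eq by blast
  moreover have "(LINT v|lebesgue. - Re (k (z - v)) *\<^sub>R f v) = - convolve k f z"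
  proof -
    have cf: "continuous_on UNIV (\<lambda>v. - Re (k (z - v)) *\<^sub>R f v)"
      by (intro continuous_intros f continuous_on_compose2[OF ck]) auto
    have "(\<lambda>v. - Re (k (z - v)) *\<^sub>R f v) \<in> borel_measurable lborel"
      by (subst measurable_cong_sets[OF sets_lborel refl]) (rule borel_measurable_continuous_onI[OF cf])
    from integral_completion[OF this] have "(LINT v|lebesgue. - Re (k (z - v)) *\<^sub>R f v) = (LINT v|lborel. - (k (z - v) * f v))"
      using k(2) by (simp add: scaleR_conv_of_real)
    then show ?thesis by (simp add: convolve_def)
  qed
  moreover have "(LINT v|lebesgue. Re (mollifier e (z - v)) *\<^sub>R p v) = mollify e p' z"
  proof -
    have cm: "continuous_on UNIV (\<lambda>v. Re (mollifier e (z - v)))"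
      by (intro continuous_intros continuous_on_compose2[OF continuous_mollifier]) auto
    have rm: "(\<lambda>v. Re (mollifier e (z - v))) \<in> borel_measurable borel" by (rule borel_measurable_continuous_onI[OF cm])
    have rm': "(\<lambda>v. Re (mollifier e (z - v))) \<in> borel_measurable lebesgue" by (rule measurable_completion) (use rm in simp)
    have mp: "(\<lambda>v. Re (mollifier e (z - v)) *\<^sub>R p' v) \<in> borel_measurable lborel" using rm p'(1) by simp
    have "(LINT v|lebesgue. Re (mollifier e (z - v)) *\<^sub>R p v) = (LINT v|lebesgue. Re (mollifier e (z - v)) *\<^sub>R p' v)"
    proof (rule Bochner_Integration.integral_cong_AE)
      show "(\<lambda>v. Re (mollifier e (z - v)) *\<^sub>R p v) \<in> borel_measurable lebesgue" by (rule borel_measurable_scaleR[OF rm' m])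
      show "(\<lambda>v. Re (mollifier e (z - v)) *\<^sub>R p' v) \<in> borel_measurable lebesgue" by (rule measurable_completion[OF mp])
      show "AE v in lebesgue. Re (mollifier e (z - v)) *\<^sub>R p v = Re (mollifier e (z - v)) *\<^sub>R p' v"
        unfolding AE_completion_iff using p'(2) by eventually_elim simp
    qed
    also have "\<dots> = (LINT v|lborel. Re (mollifier e (z - v)) *\<^sub>R p' v)" by (rule integral_completion[OF mp])
    also have "\<dots> = mollify e p' z" by (simp add: convolve_def mollifier_def scaleR_conv_of_real)
    finally show ?thesis .
  qed
  ultimately show ?thesis by simp
qed

lemma beltrami_bound:
  assumes \<nu>: "\<nu> \<in> beltrami_on UNIV"
  obtains k where "0 \<le> k" "k < 1" "AE z in lborel. norm (\<nu> z) \<le> k"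
proof -
  have "esssup lebesgue (\<lambda>z. ereal (norm (\<nu> z))) < 1"
    using \<nu> by (simp add: beltrami_on_def lebesgue_on_UNIV_eq)
  then obtain k1 where k1: "esssup lebesgue (\<lambda>z. ereal (norm (\<nu> z))) < ereal k1" "ereal k1 < 1"
    using ereal_dense2 by blast
  have "AE z in lebesgue. ereal (norm (\<nu> z)) \<le> esssup lebesgue (\<lambda>z. ereal (norm (\<nu> z)))"
    by (rule esssup_AE)
  then have "AE z in lebesgue. norm (\<nu> z) \<le> max 0 k1"
  proof eventually_elim
    case (elim z)
    then have "ereal (norm (\<nu> z)) < ereal k1" using k1(1) by (rule order_le_less_trans)
    then show ?case by simp
  qed
  then show ?thesis using that[of "max 0 k1"] k1(2) by (simp add: AE_completion_iff)
qed

lemma weighted_norm_bound: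
  assumes "weighted_norm \<alpha> \<mu> \<le> ereal M"
  shows "AE z in lborel. norm (extend_by_zero \<mu> z) \<le> M * max 0 (norm z - 1) powr \<alpha>"
proof -
  have o: "open exterior_disk" unfolding exterior_disk_def by (intro open_Collect_less continuous_intros)
  have "AE z in lebesgue_on exterior_disk. ereal (max ((norm z - 1) powr (- \<alpha>)) 1 * norm (\<mu> z)) \<le> weighted_norm \<alpha> \<mu>"
    unfolding weighted_norm_def by (rule esssup_AE)
  then have "AE z in lebesgue. z \<in> exterior_disk \<longrightarrow> ereal (max ((norm z - 1) powr (- \<alpha>)) 1 * norm (\<mu> z)) \<le> weighted_norm \<alpha> \<mu>"
    using o by (subst (asm) AE_restrict_space_iff) auto
  then have "AE z in lborel. z \<in> exterior_disk \<longrightarrow> ereal (max ((norm z - 1) powr (- \<alpha>)) 1 * norm (\<mu> z)) \<le> weighted_norm \<alpha> \<mu>"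
    by (simp only: AE_completion_iff)
  then show ?thesis
  proof eventually_elim
    case (elim z)
    show ?case
    proof (cases "z \<in> exterior_disk")
      case False then show ?thesis by (simp add: extend_by_zero_def exterior_disk_def)
    next
      case True
      then have n: "norm z - 1 > 0" by (simp add: exterior_disk_def)
      have "ereal (max ((norm z - 1) powr (- \<alpha>)) 1 * norm (\<mu> z)) \<le> ereal M" using elim True assms order_trans by blast
      then have "max ((norm z - 1) powr (- \<alpha>)) 1 * norm (\<mu> z) \<le> M" by simp
      moreover have "(norm z - 1) powr (- \<alpha>) * norm (\<mu> z) \<le> max ((norm z - 1) powr (- \<alpha>)) 1 * norm (\<mu> z)"
        by (intro mult_right_mono) auto
      ultimately have "(norm z - 1) powr (- \<alpha>) * norm (\<mu> z) \<le> M" by linarith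
      then have "(norm z - 1) powr \<alpha> * ((norm z - 1) powr (- \<alpha>) * norm (\<mu> z)) \<le> (norm z - 1) powr \<alpha> * M"
        by (rule mult_left_mono) simp
      moreover have "(norm z - 1) powr \<alpha> * (norm z - 1) powr (- \<alpha>) = 1" using n by (simp flip: powr_add)
      ultimately have "norm (\<mu> z) \<le> (norm z - 1) powr \<alpha> * M" by (simp flip: mult.assoc)
      then show ?thesis using n True by (simp add: extend_by_zero_def mult.commute)
    qed
  qed
qed

text \<open>The exterior disk contains an open set, on which a negative essential bound for a nonnegative function is
  impossible.\<close>

lemma weighted_norm_nonneg: "weighted_norm \<alpha> \<mu> \<ge> 0"
proof (rule ccontr)
  assume "\<not> weighted_norm \<alpha> \<mu> \<ge> 0"
  then have neg: "weighted_norm \<alpha> \<mu> < ereal 0" by (simp only: not_le zero_ereal_def)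
  then obtain M where M: "weighted_norm \<alpha> \<mu> < ereal M" "ereal M < ereal 0" using ereal_dense2 by blast
  have "AE z in lborel. norm (extend_by_zero \<mu> z) \<le> M * max 0 (norm z - 1) powr \<alpha>"
    by (rule weighted_norm_bound) (use M in simp)
  then have "AE z in lborel. z \<notin> ball (2 :: complex) 1"
  proof eventually_elim
    case (elim z)
    have "z \<notin> ball (2 :: complex) 1"
    proof
      assume "z \<in> ball (2 :: complex) 1"
      then have "norm (2 - z) < 1" by (simp add: dist_norm)
      then have "norm z > 1" using norm_triangle_ineq2[of 2 z] by simp
      then have "max 0 (norm z - 1) powr \<alpha> > 0" by simp
      then have "M * max 0 (norm z - 1) powr \<alpha> < 0" using M(2) by (simp add: mult_neg_pos)
      then show False using elim norm_ge_zero[of "extend_by_zero \<mu> z"] by linarith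
    qed
    then show ?case .
  qed
  then have "emeasure lborel (ball (2 :: complex) 1) = 0"
    by (subst (asm) AE_iff_measurable[where N="ball 2 1"]) auto
  then have "\<not> (open (ball (2 :: complex) 1) \<and> ball (2 :: complex) 1 \<noteq> {})"
    by (metis open_not_negligible negligible_iff_null_sets null_setsI null_sets_completionI sets_lborel borel_open)
  then show False by simp
qed

text \<open>Any real number above the weighted norm serves as \<open>M\<close>; the weighted norm itself may be zero and is reached by
  a limit.\<close>

lemma schwarzian_weighted_bound:
  assumes \<alpha>: "0 < \<alpha>" "\<alpha> < 2" and F: "normalized_qc_extension \<mu> F" and M: "0 < M" "weighted_norm \<alpha> \<mu> \<le> ereal M"
    and \<zeta>: "norm \<zeta> < 1"
  shows "(1 - norm \<zeta>) powr (2 - \<alpha>) * norm (schwarzian (finite_part F) \<zeta>) \<le> schwarzian_constant \<alpha> * M"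
proof -
  define f where "f = finite_part F"
  have qc: "quasiconformal_with_dilatation (extend_by_zero \<mu>) F" and FN: "F None = None"
    using F by (auto simp: normalized_qc_extension_def)
  have hm: "homeomorphic_map riemann_sphere riemann_sphere F" and \<nu>: "extend_by_zero \<mu> \<in> beltrami_on UNIV"
    using qc by (auto simp: quasiconformal_with_dilatation_def)
  note hf = homeomorphism_fixing_infinity[OF hm FN, folded f_def]
  obtain p q where p: "locally_square_integrable UNIV p" and q: "locally_square_integrable UNIV q"
    and wp: "weak_derivative UNIV 1 f p" and wq: "weak_derivative UNIV \<i> f q"
    and beltrami: "AE z in lebesgue_on UNIV. (p z + \<i> * q z) / 2 = extend_by_zero \<mu> z * ((p z - \<i> * q z) / 2)"
    using qc unfolding quasiconformal_with_dilatation_def hf(1) f_def[symmetric] by blast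
  have mp: "p \<in> borel_measurable lebesgue" "q \<in> borel_measurable lebesgue"
    using p q by (auto simp: locally_square_integrable_def lebesgue_on_UNIV_eq)
  obtain p' where p': "locally_sq_integrable p'" "AE z in lborel. p z = p' z" by (rule borel_representative[OF p])
  obtain q' where q': "locally_sq_integrable q'" "AE z in lborel. q z = q' z" by (rule borel_representative[OF q])
  have bm: "p' \<in> borel_measurable borel" "q' \<in> borel_measurable borel" using p' q' by (auto simp: locally_sq_integrable_def)
  have "convolve (mollifier_x e) f z = mollify e p' z" if "e > 0" for e z
    by (rule weak_derivative_convolve[OF wp mp(1) hf(3) bm(1) p'(2) that mollifier_test_function(2)[OF that] _ c1_onD(2)[OF c1_mollifier]])
      (simp add: mollifier_x_def)
  moreover have "convolve (mollifier_y e) f z = mollify e q' z" if "e > 0" for e z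
    by (rule weak_derivative_convolve[OF wq mp(2) hf(3) bm(2) q'(2) that mollifier_test_function(3)[OF that] _ c1_onD(3)[OF c1_mollifier]])
      (simp add: mollifier_y_def)
  ultimately have w: "weak_gradient f p' q'" using hf(3) p'(1) q'(1) unfolding weak_gradient_def by blast
  have B: "AE z in lborel. norm (p' z + \<i> * q' z) = norm (extend_by_zero \<mu> z) * norm (p' z - \<i> * q' z)"
    using beltrami[unfolded lebesgue_on_UNIV_eq AE_completion_iff] p'(2) q'(2)
  proof eventually_elim
    case (elim z)
    have half: "a = n * b" if "a / 2 = n * (b / 2)" for a b n :: complex using that by simp
    have "p' z + \<i> * q' z = extend_by_zero \<mu> z * (p' z - \<i> * q' z)" by (rule half) (use elim in \<open>simp only:\<close>)
    then show ?case by (simp only: norm_mult)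
  qed
  obtain k where k: "0 \<le> k" "k < 1" "AE z in lborel. norm (extend_by_zero \<mu> z) \<le> k"
    by (rule beltrami_bound[OF \<nu>])
  have B1: "AE z in lborel. norm (p' z + \<i> * q' z) \<le> k * norm (p' z - \<i> * q' z)"
    using B k(3) by eventually_elim (simp add: mult_right_mono)
  have B2: "AE z in lborel. norm (p' z + \<i> * q' z) \<le> M * max 0 (norm z - 1) powr \<alpha> * norm (p' z - \<i> * q' z)"
    using B weighted_norm_bound[OF M(2)] by eventually_elim (simp add: mult_right_mono)
  show ?thesis
    using weak_gradient_schwarzian_bound[OF \<alpha> w hf(2,4) k(1,2) B1 M(1) B2 \<zeta>]
    by (simp add: schwarzian_def pre_schwarzian_def[abs_def] f_def)
qed

theorem theorem7p1:
  fixes \<alpha> :: real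
  assumes "0 < \<alpha>" and "\<alpha> < 2"
  shows "\<exists>C>0. \<forall>(\<mu> :: complex \<Rightarrow> complex) (F :: complex option \<Rightarrow> complex option).
           \<mu> \<in> beltrami_on exterior_disk \<longrightarrow>
           weighted_norm \<alpha> \<mu> < \<infinity> \<longrightarrow>
           normalized_qc_extension \<mu> F \<longrightarrow>
           (\<forall>\<zeta>\<in>ball 0 1.
              ereal ((1 - norm \<zeta>) powr (2 - \<alpha>) * norm (schwarzian (finite_part F) \<zeta>))
                \<le> ereal C * weighted_norm \<alpha> \<mu>)"
proof (intro exI[of _ "schwarzian_constant \<alpha>"] conjI allI impI ballI)
  show C: "schwarzian_constant \<alpha> > 0" by (rule schwarzian_constant_pos[OF assms])
  fix \<mu> F and \<zeta> :: complex
  assume fin: "weighted_norm \<alpha> \<mu> < \<infinity>" and F: "normalized_qc_extension \<mu> F" and \<zeta>: "\<zeta> \<in> ball 0 1"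
  obtain w where w: "weighted_norm \<alpha> \<mu> = ereal w" "w \<ge> 0"
    using fin weighted_norm_nonneg[of \<alpha> \<mu>] by (cases "weighted_norm \<alpha> \<mu>") auto
  let ?X = "(1 - norm \<zeta>) powr (2 - \<alpha>) * norm (schwarzian (finite_part F) \<zeta>)"
  have "?X \<le> schwarzian_constant \<alpha> * w"
  proof (rule field_le_epsilon)
    fix e :: real assume e: "e > 0"
    have "?X \<le> schwarzian_constant \<alpha> * (w + e / schwarzian_constant \<alpha>)"
      by (rule schwarzian_weighted_bound[OF assms F]) (use w e C \<zeta> in \<open>auto intro: add_nonneg_pos\<close>)
    also have "\<dots> = schwarzian_constant \<alpha> * w + e" using C by (simp add: distrib_left)
    finally show "?X \<le> schwarzian_constant \<alpha> * w + e" .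
  qed
  then show "ereal ?X \<le> ereal (schwarzian_constant \<alpha>) * weighted_norm \<alpha> \<mu>" by (simp add: w(1))
qed

end
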